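(* Let $G$ be a group which decomposes as the fundamental group of a finite graph of groups where all vertex groups are finitely generated and virtually abelian. If $G$ has (VRC) then $G$ admits a proper and cocompact action by isometries on a complete CAT($0$) space.
   Context: A subgroup $H$ of a group $G$ is a virtual retract of $G$ if there is a finite index subgroup $K$ of $G$ such that $H \subseteq K$ and there is a homomorphism $\rho: K \to H$ whose restriction to $H$ is the identity map. A group has property (VRC) if every cyclic subgroup is a virtual retract. A group $G$ acts on a metric space $(X,\mathrm{d})$ properly if for each $x \in X$ there exists $r > 0$ such that the set $\{g \in G \mid \mathrm{d}(g.x,x) \le r\}$ is finite. A CAT($0$) space is a geodesic metric space in which all geodesic triangles satisfy the CAT($0$) inequality. Graphs are in the sense of Serre: a graph $\Gamma$ has a vertex set $V\Gamma$, an edge set $E\Gamma$, an inversion map $e \mapsto \overline{e}$ on $E\Gamma$ with $\overline{e} \ne e$ and $\overline{\overline{e}} = e$, and incidence maps $\alpha,\omega: E\Gamma \to V\Gamma$ with $\omega(\overline{e}) = \alpha(e)$. An orientation is a decomposition $E\Gamma = E\Gamma^+ \sqcup E\Gamma^-$ with $E\Gamma^- = \{\overline{e} \mid e \in E\Gamma^+\}$. A finite graph of groups $(\mathcal{G},\Gamma)$ consists of a non-empty finite connected graph $\Gamma$, vertex groups $G_v$ ($v \in V\Gamma$), edge groups $G_e$ ($e \in E\Gamma$) with $G_e = G_{\overline{e}}$, and monomorphisms $\alpha_e: G_e \to G_{\alpha(e)}$ ($e \in E\Gamma$); put $\omega_e := \alpha_{\overline{e}}: G_e \to G_{\omega(e)}$.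 Given a maximal tree $T$ in $\Gamma$ and an orientation, its fundamental group is the group generated by all $G_v$, $v \in V\Gamma$, and free letters $t_e$, $e \in E\Gamma^+$, subject to the relations of the vertex groups, $t_e\, \omega_e(a)\, t_e^{-1} = \alpha_e(a)$ for all $e \in E\Gamma^+$, $a \in G_e$, and $t_f = 1$ for all $f \in ET \cap E\Gamma^+$; up to isomorphism it does not depend on the choices. *)

theory Defs
  imports
    "HOL-Algebra.Elementary_Groups"
    "HOL-Algebra.Group_Action"
    "HOL-Analysis.Analysis"
    "Graph_Theory.Bidirected_Digraph"
    "Graph_Theory.Digraph_Component"
begin

section \<open>Finiteness conditions and virtual retracts\<close>

definition finite_index :: "('a, 'm) monoid_scheme \<Rightarrow> 'a set \<Rightarrow> bool" where
  "finite_index G K \<longleftrightarrow> subgroup K G \<and> finite (rcosets\<^bsub>G\<^esub> K)"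

definition finitely_generated_group :: "('a, 'm) monoid_scheme \<Rightarrow> bool" where
  "finitely_generated_group G \<longleftrightarrow>
     (\<exists>S. finite S \<and> S \<subseteq> carrier G \<and> generate G S = carrier G)"

definition virtually_abelian :: "('a, 'm) monoid_scheme \<Rightarrow> bool" where
  "virtually_abelian G \<longleftrightarrow> (\<exists>A. finite_index G A \<and> comm_group (G\<lparr>carrier := A\<rparr>))"

definition virtual_retract :: "('a, 'm) monoid_scheme \<Rightarrow> 'a set \<Rightarrow> bool" where
  "virtual_retract G H \<longleftrightarrow> subgroup H G \<and>
     (\<exists>K. finite_index G K \<and> H \<subseteq> K \<and>
        (\<exists>\<rho> \<in> hom (G\<lparr>carrier := K\<rparr>) (G\<lparr>carrier := H\<rparr>). \<forall>h\<in>H. \<rho> h = h))"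

definition property_VRC :: "('a, 'm) monoid_scheme \<Rightarrow> bool" where
  "property_VRC G \<longleftrightarrow>
     (\<forall>H. subgroup H G \<and> cyclic_group (G\<lparr>carrier := H\<rparr>) \<longrightarrow> virtual_retract G H)"


section \<open>Groups given by generators and relators\<close>

text \<open>
  A letter \<open>(x, True)\<close> stands for the generator \<open>x\<close> and \<open>(x, False)\<close> for its inverse.
\<close>

type_synonym 'x word = "('x \<times> bool) list"

definition words :: "'x set \<Rightarrow> 'x word set" where
  "words X = lists (X \<times> UNIV)"

inductive pres_eq :: "'x set \<Rightarrow> 'x word set \<Rightarrow> 'x word \<Rightarrow> 'x word \<Rightarrow> bool"
  for X :: "'x set" and R :: "'x word set" where
  refl: "w \<in> words X \<Longrightarrow> pres_eq X R w w"
| sym: "pres_eq X R u v \<Longrightarrow> pres_eq X R v u"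
| trans: "pres_eq X R u v \<Longrightarrow> pres_eq X R v w \<Longrightarrow> pres_eq X R u w"
| cancel: "\<lbrakk>u \<in> words X; v \<in> words X; x \<in> X\<rbrakk> \<Longrightarrow>
    pres_eq X R (u @ [(x, b), (x, \<not> b)] @ v) (u @ v)"
| relator: "\<lbrakk>u \<in> words X; v \<in> words X; r \<in> R; r \<in> words X\<rbrakk> \<Longrightarrow>
    pres_eq X R (u @ r @ v) (u @ v)"

definition presented_group :: "'x set \<Rightarrow> 'x word set \<Rightarrow> 'x word set monoid" where
  "presented_group X R =
     \<lparr>carrier = words X // {(u, v). pres_eq X R u v},
      monoid.mult = (\<lambda>A B. {w. \<exists>u\<in>A. \<exists>v\<in>B. pres_eq X R (u @ v) w}),
      monoid.one = {w. pres_eq X R [] w}\<rparr>"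

lemma words_simps [simp]:
  "[] \<in> words X"
  "(x, b) # w \<in> words X \<longleftrightarrow> x \<in> X \<and> w \<in> words X"
  "u @ v \<in> words X \<longleftrightarrow> u \<in> words X \<and> v \<in> words X"
  by (auto simp: words_def)

lemma pres_eq_words: "pres_eq X R u v \<Longrightarrow> u \<in> words X \<and> v \<in> words X"
  by (induction rule: pres_eq.induct) auto

lemma pres_eq_context:
  assumes "pres_eq X R u v" "p \<in> words X" "q \<in> words X"
  shows "pres_eq X R (p @ u @ q) (p @ v @ q)"
  using assms
proof (induction rule: pres_eq.induct)
  case (cancel u v x b)
  then show ?case
    using pres_eq.cancel[of "p @ u" X "v @ q" x R b] by simp
next
  case (relator u v r)
  then show ?case
    using pres_eq.relator[of "p @ u" X "v @ q" r R] by simp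
qed (auto intro: pres_eq.intros)

lemma pres_eq_append:
  assumes "pres_eq X R u u'" "pres_eq X R v v'"
  shows "pres_eq X R (u @ v) (u' @ v')"
proof -
  have "pres_eq X R (u @ v) (u' @ v)"
    using pres_eq_context[OF assms(1), of "[]" v] pres_eq_words[OF assms(2)] by simp
  moreover have "pres_eq X R (u' @ v) (u' @ v')"
    using pres_eq_context[OF assms(2), of u' "[]"] pres_eq_words[OF assms(1)] by simp
  ultimately show ?thesis by (rule pres_eq.trans)
qed

lemma presented_group_carrier:
  "A \<in> carrier (presented_group X R) \<longleftrightarrow> (\<exists>w\<in>words X. A = {u. pres_eq X R w u})"
  by (auto simp: presented_group_def quotient_def)

lemma presented_group_mult:
  assumes "u \<in> words X" "v \<in> words X"
  shows "{w. pres_eq X R u w} \<otimes>\<^bsub>presented_group X R\<^esub> {w. pres_eq X R v w}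
       = {w. pres_eq X R (u @ v) w}"
  using assms
  by (auto simp: presented_group_def intro: pres_eq.intros pres_eq_append)

lemma presented_group_one: "\<one>\<^bsub>presented_group X R\<^esub> = {w. pres_eq X R [] w}"
  by (simp add: presented_group_def)

lemma pres_eq_inverse:
  "w \<in> words X \<Longrightarrow> \<exists>w'\<in>words X. pres_eq X R (w' @ w) []"
proof (induction w)
  case Nil
  then show ?case by (intro bexI[of _ "[]"]) (auto intro: pres_eq.refl)
next
  case (Cons a w)
  obtain x b where a: "a = (x, b)" by (cases a)
  from Cons a obtain w' where w': "w' \<in> words X" "pres_eq X R (w' @ w) []" by auto
  have "pres_eq X R (w' @ [(x, \<not> b), (x, \<not> \<not> b)] @ w) (w' @ w)"
    using Cons.prems a w' by (intro pres_eq.cancel) auto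
  then have "pres_eq X R ((w' @ [(x, \<not> b)]) @ a # w) []"
    using w' a by (auto intro: pres_eq.trans)
  then show ?case
    using w' Cons.prems a by (intro bexI[of _ "w' @ [(x, \<not> b)]"]) auto
qed

lemma group_presented_group: "group (presented_group X R)"
proof (rule groupI)
  let ?P = "presented_group X R"
  fix A assume "A \<in> carrier ?P"
  then obtain u where u: "u \<in> words X" "A = {w. pres_eq X R u w}"
    by (auto simp: presented_group_carrier)
  show "\<one>\<^bsub>?P\<^esub> \<otimes>\<^bsub>?P\<^esub> A = A"
    using u presented_group_mult[of "[]" X u R] by (simp add: presented_group_one)
  obtain u' where u': "u' \<in> words X" "pres_eq X R (u' @ u) []"
    using pres_eq_inverse u by blast
  then have "{w. pres_eq X R (u' @ u) w} = {w. pres_eq X R [] w}"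
    by (blast intro: pres_eq.sym pres_eq.trans)
  then show "\<exists>B\<in>carrier ?P. B \<otimes>\<^bsub>?P\<^esub> A = \<one>\<^bsub>?P\<^esub>"
    using u u' by (auto simp: presented_group_carrier presented_group_one presented_group_mult
        intro!: bexI[of _ "{w. pres_eq X R u' w}"])
next
  show "\<one>\<^bsub>presented_group X R\<^esub> \<in> carrier (presented_group X R)"
    using words_simps(1) by (auto simp only: presented_group_carrier presented_group_one)
next
  fix A B assume "A \<in> carrier (presented_group X R)" "B \<in> carrier (presented_group X R)"
  then obtain u v where "u \<in> words X" "A = {w. pres_eq X R u w}"
    "v \<in> words X" "B = {w. pres_eq X R v w}"
    by (auto simp: presented_group_carrier)
  then show "A \<otimes>\<^bsub>presented_group X R\<^esub> B \<in> carrier (presented_group X R)"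
    by (auto simp: presented_group_mult presented_group_carrier intro!: bexI[of _ "u @ v"])
next
  fix A B C assume "A \<in> carrier (presented_group X R)" "B \<in> carrier (presented_group X R)"
    "C \<in> carrier (presented_group X R)"
  then show "A \<otimes>\<^bsub>presented_group X R\<^esub> B \<otimes>\<^bsub>presented_group X R\<^esub> C =
      A \<otimes>\<^bsub>presented_group X R\<^esub> (B \<otimes>\<^bsub>presented_group X R\<^esub> C)"
    by (auto simp: presented_group_carrier presented_group_mult)
qed


section \<open>Graphs of groups\<close>

text \<open>
  A graph in the sense of Serre is a \<^locale>\<open>bidirected_digraph\<close>: the arc reversal is a fixed point
  free involution on the set of arcs (extended by the identity outside that set), and
  \<open>\<alpha>\<close>, \<open>\<omega>\<close> are \<^const>\<open>tail\<close>, \<^const>\<open>head\<close>.  The constants \<open>tree\<close> and \<open>forest\<close> of that library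
  are not usable here, because for them \<open>e\<close> followed by its reverse is a cycle.  A circuit must
  not backtrack; loops and pairs of parallel edges do form circuits.  A graph that is connected
  in the sense of \<^const>\<open>Digraph_Component.connected\<close> has at least one vertex.
\<close>

definition circuit :: "('v, 'e) pre_digraph \<Rightarrow> ('e \<Rightarrow> 'e) \<Rightarrow> 'e list \<Rightarrow> bool" where
  "circuit \<Gamma> erev p \<longleftrightarrow> pre_digraph.cycle \<Gamma> p \<and>
     (\<forall>i. Suc i < length p \<longrightarrow> p ! Suc i \<noteq> erev (p ! i))"

definition serre_tree :: "('e \<Rightarrow> 'e) \<Rightarrow> ('v, 'e) pre_digraph \<Rightarrow> bool" where
  "serre_tree erev T \<longleftrightarrow> (\<forall>e\<in>arcs T. erev e \<in> arcs T) \<and>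
     Digraph_Component.connected T \<and> (\<nexists>p. circuit T erev p)"

definition maximal_tree ::
    "('v, 'e) pre_digraph \<Rightarrow> ('e \<Rightarrow> 'e) \<Rightarrow> ('v, 'e) pre_digraph \<Rightarrow> bool" where
  "maximal_tree \<Gamma> erev T \<longleftrightarrow> pre_digraph.max_subgraph \<Gamma> (serre_tree erev) T"

definition orientation :: "('v, 'e) pre_digraph \<Rightarrow> ('e \<Rightarrow> 'e) \<Rightarrow> 'e set \<Rightarrow> bool" where
  "orientation \<Gamma> erev Ep \<longleftrightarrow> Ep \<union> erev ` Ep = arcs \<Gamma> \<and> Ep \<inter> erev ` Ep = {}"

text \<open>
  All vertex groups live in one type \<open>'c\<close> and all edge groups in one type \<open>'d\<close>; their carriers
  are unrelated to each other.
\<close>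

locale finite_graph_of_groups =
  bidirected_digraph \<Gamma> erev + fin_digraph \<Gamma>
  for \<Gamma> :: "('v, 'e) pre_digraph" and erev :: "'e \<Rightarrow> 'e" +
  fixes Gv :: "'v \<Rightarrow> 'c monoid"
    and Ge :: "'e \<Rightarrow> 'd monoid"
    and \<alpha> :: "'e \<Rightarrow> 'd \<Rightarrow> 'c"
  assumes connected_graph: "Digraph_Component.connected \<Gamma>"
    and vertex_group: "v \<in> verts \<Gamma> \<Longrightarrow> group (Gv v)"
    and edge_group: "e \<in> arcs \<Gamma> \<Longrightarrow> group (Ge e)"
    and edge_group_rev: "e \<in> arcs \<Gamma> \<Longrightarrow> Ge (erev e) = Ge e"
    and edge_mono: "e \<in> arcs \<Gamma> \<Longrightarrow> \<alpha> e \<in> mon (Ge e) (Gv (tail \<Gamma> e))"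

datatype ('v, 'c, 'e) gog_gen = VGen 'v 'c | EGen 'e

definition gog_generators ::
    "('v, 'e) pre_digraph \<Rightarrow> ('v \<Rightarrow> 'c monoid) \<Rightarrow> 'e set \<Rightarrow> ('v, 'c, 'e) gog_gen set" where
  "gog_generators \<Gamma> Gv Ep =
     {VGen v g | v g. v \<in> verts \<Gamma> \<and> g \<in> carrier (Gv v)} \<union> {EGen e | e. e \<in> Ep}"

text \<open>
  The three families of relators are \<open>g h (g h)\<^sup>-\<^sup>1\<close> inside each vertex group (the multiplication
  table), \<open>t\<^sub>e \<omega>\<^sub>e(a) t\<^sub>e\<^sup>-\<^sup>1 \<alpha>\<^sub>e(a)\<^sup>-\<^sup>1\<close> with \<open>\<omega>\<^sub>e\<close> the monomorphism of the reversed edge, and \<open>t\<^sub>f\<close>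
  for \<open>f\<close> in the tree.
\<close>

definition gog_relators ::
    "('v, 'e) pre_digraph \<Rightarrow> ('e \<Rightarrow> 'e) \<Rightarrow> ('v \<Rightarrow> 'c monoid) \<Rightarrow> ('e \<Rightarrow> 'd monoid) \<Rightarrow>
     ('e \<Rightarrow> 'd \<Rightarrow> 'c) \<Rightarrow> ('v, 'e) pre_digraph \<Rightarrow> 'e set \<Rightarrow> ('v, 'c, 'e) gog_gen word set" where
  "gog_relators \<Gamma> erev Gv Ge \<alpha> T Ep =
     {[(VGen v g, True), (VGen v h, True), (VGen v (g \<otimes>\<^bsub>Gv v\<^esub> h), False)] | v g h.
        v \<in> verts \<Gamma> \<and> g \<in> carrier (Gv v) \<and> h \<in> carrier (Gv v)} \<union>
     {[(EGen e, True), (VGen (head \<Gamma> e) (\<alpha> (erev e) a), True), (EGen e, False),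
       (VGen (tail \<Gamma> e) (\<alpha> e a), False)] | e a. e \<in> Ep \<and> a \<in> carrier (Ge e)} \<union>
     {[(EGen f, True)] | f. f \<in> arcs T \<inter> Ep}"

definition fundamental_group ::
    "('v, 'e) pre_digraph \<Rightarrow> ('e \<Rightarrow> 'e) \<Rightarrow> ('v \<Rightarrow> 'c monoid) \<Rightarrow> ('e \<Rightarrow> 'd monoid) \<Rightarrow>
     ('e \<Rightarrow> 'd \<Rightarrow> 'c) \<Rightarrow> ('v, 'e) pre_digraph \<Rightarrow> 'e set \<Rightarrow>
     ('v, 'c, 'e) gog_gen word set monoid" where
  "fundamental_group \<Gamma> erev Gv Ge \<alpha> T Ep =
     presented_group (gog_generators \<Gamma> Gv Ep) (gog_relators \<Gamma> erev Gv Ge \<alpha> T Ep)"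


section \<open>CAT(0) spaces\<close>

definition geodesic_path :: "'x metric \<Rightarrow> (real \<Rightarrow> 'x) \<Rightarrow> 'x \<Rightarrow> 'x \<Rightarrow> bool" where
  "geodesic_path X c x y \<longleftrightarrow>
     c ` {0..mdist X x y} \<subseteq> mspace X \<and> c 0 = x \<and> c (mdist X x y) = y \<and>
     (\<forall>s\<in>{0..mdist X x y}. \<forall>t\<in>{0..mdist X x y}. mdist X (c s) (c t) = \<bar>s - t\<bar>)"

definition geodesic_segment :: "'x metric \<Rightarrow> 'x \<Rightarrow> 'x \<Rightarrow> 'x set \<Rightarrow> bool" where
  "geodesic_segment X x y S \<longleftrightarrow> (\<exists>c. geodesic_path X c x y \<and> S = c ` {0..mdist X x y})"

definition geodesic_space :: "'x metric \<Rightarrow> bool" where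
  "geodesic_space X \<longleftrightarrow> (\<forall>x\<in>mspace X. \<forall>y\<in>mspace X. \<exists>c. geodesic_path X c x y)"

text \<open>
  \<open>x'\<close>, a point of the comparison side \<open>[p', q']\<close>, is a comparison point for \<open>x\<close>, a point of the
  geodesic segment \<open>S\<close> from \<open>p\<close> to \<open>q\<close>.
\<close>

definition comparison_on_side ::
    "'x metric \<Rightarrow> 'x \<Rightarrow> 'x set \<Rightarrow> real^2 \<Rightarrow> real^2 \<Rightarrow> 'x \<Rightarrow> real^2 \<Rightarrow> bool" where
  "comparison_on_side X p S p' q' x x' \<longleftrightarrow>
     x \<in> S \<and> x' \<in> closed_segment p' q' \<and> dist p' x' = mdist X p x"

definition comparison_point ::
    "'x metric \<Rightarrow> 'x \<times> 'x \<times> 'x \<Rightarrow> 'x set \<times> 'x set \<times> 'x set \<Rightarrow>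
     (real^2) \<times> (real^2) \<times> (real^2) \<Rightarrow> 'x \<Rightarrow> real^2 \<Rightarrow> bool" where
  "comparison_point X = (\<lambda>(p, q, r) (A, B, C) (p', q', r') x x'.
     comparison_on_side X p A p' q' x x' \<or>
     comparison_on_side X q B q' r' x x' \<or>
     comparison_on_side X r C r' p' x x')"

definition CAT0_inequality ::
    "'x metric \<Rightarrow> 'x \<times> 'x \<times> 'x \<Rightarrow> 'x set \<times> 'x set \<times> 'x set \<Rightarrow> bool" where
  "CAT0_inequality X = (\<lambda>(p, q, r) (A, B, C).
     \<forall>p' q' r'. dist p' q' = mdist X p q \<and> dist q' r' = mdist X q r \<and> dist r' p' = mdist X r p \<longrightarrow>
       (\<forall>x y x' y'.
          comparison_point X (p, q, r) (A, B, C) (p', q', r') x x' \<and>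
          comparison_point X (p, q, r) (A, B, C) (p', q', r') y y' \<longrightarrow>
          mdist X x y \<le> dist x' y'))"

text \<open>
  CAT(0) spaces are required to be non-empty: every group would act properly and cocompactly on
  the empty space.
\<close>

definition CAT0_space :: "'x metric \<Rightarrow> bool" where
  "CAT0_space X \<longleftrightarrow> mspace X \<noteq> {} \<and> geodesic_space X \<and>
     (\<forall>p\<in>mspace X. \<forall>q\<in>mspace X. \<forall>r\<in>mspace X. \<forall>A B C.
        geodesic_segment X p q A \<and> geodesic_segment X q r B \<and> geodesic_segment X r p C \<longrightarrow>
        CAT0_inequality X (p, q, r) (A, B, C))"


section \<open>Actions on metric spaces\<close>

definition isometric_action ::
    "('a, 'm) monoid_scheme \<Rightarrow> 'x metric \<Rightarrow> ('a \<Rightarrow> 'x \<Rightarrow> 'x) \<Rightarrow> bool" where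
  "isometric_action G X \<phi> \<longleftrightarrow> group_action G (mspace X) \<phi> \<and>
     (\<forall>g\<in>carrier G. \<forall>x\<in>mspace X. \<forall>y\<in>mspace X. mdist X (\<phi> g x) (\<phi> g y) = mdist X x y)"

definition proper_action ::
    "('a, 'm) monoid_scheme \<Rightarrow> 'x metric \<Rightarrow> ('a \<Rightarrow> 'x \<Rightarrow> 'x) \<Rightarrow> bool" where
  "proper_action G X \<phi> \<longleftrightarrow>
     (\<forall>x\<in>mspace X. \<exists>r>0. finite {g \<in> carrier G. mdist X (\<phi> g x) x \<le> r})"

definition cocompact_action ::
    "('a, 'm) monoid_scheme \<Rightarrow> 'x metric \<Rightarrow> ('a \<Rightarrow> 'x \<Rightarrow> 'x) \<Rightarrow> bool" where
  "cocompact_action G X \<phi> \<longleftrightarrow>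
     (\<exists>K. compactin (mtopology_of X) K \<and> mspace X = (\<Union>g\<in>carrier G. \<phi> g ` K))"

text \<open>
  When the existence of a space with a cocompact isometric action of a countable group \<open>G\<close> (in
  particular a finitely generated one) is asserted, its underlying set may be sought inside the
  type of real sequences without loss of generality: a space with a cocompact
  isometric \<open>G\<close>-action is then a countable union of compact sets, hence separable, hence has at
  most the cardinality of the continuum and can be transported to a subset of this type.
\<close>

end

theory Submission
  imports Defs "HOL-Algebra.Multiplicative_Group"
begin

text \<open>
  By (VRC), characters defined on finite-index subgroups of \<open>G\<close> detect every vertex group up to a finite
  kernel. Inducing them up to \<open>G\<close> gives an action by integer translations and coordinate permutations on a
  finite-dimensional space; adjoining one coordinate for every coset of a vertex or edge group gives an
  affine isometric action on a space of finitely supported functions, in which an edge of the Bass-Serre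
  tree moves only its own coordinate. Closed convex hulls of the orbits of the vertex groups and of the
  edge groups are flat pieces glued in the pattern of the tree: a strip over an edge meets its two vertex
  pieces in the extreme slices of its own coordinate. The length metric on the union is CAT(0), because the
  distance from a point across successive pieces is an iterated infimal convolution of norms, and infimal
  convolution with the norm preserves the CAT(0) inequality for the squared distance.
\<close>

section \<open>Two-convex functions\<close>

text \<open>The obstacle is the gluing. Flat metrics chosen separately on adjacent vertex groups
  would have to agree on the edge group between them, up to conjugation by the stable letter. (VRC)
  removes the choice: a retraction onto an infinite cyclic subgroup is defined on a finite-index
  subgroup of \<open>G\<close> itself, so the induced coordinates carry one isometric action of the
  whole of \<open>G\<close>, and every piece takes its metric from the same inner product. Such
  coordinates detect vertex groups only, up to finite kernels; the coset coordinates record which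
  piece a point lies in. All base positions and all translation vectors are integral. Hence a group
  element that moves a point very little cannot change its coset coordinates, and properness reduces
  to a single vertex group. The union of the pieces is not convex, which forces the length metric.
  The inner product space has infinitely many coordinates and is incomplete, so limits and
  minimisers come from compactness of bounded parts of single pieces, and completeness comes from
  the gap between distinct vertex pieces.\<close>

definition two_convex_on :: "'w::real_inner set \<Rightarrow> ('w \<Rightarrow> real) \<Rightarrow> bool" where
  "two_convex_on S F \<longleftrightarrow> (\<forall>x\<in>S. \<forall>y\<in>S. \<forall>s. 0 \<le> s \<and> s \<le> 1 \<longrightarrow>
     (F ((1 - s) *\<^sub>R x + s *\<^sub>R y))\<^sup>2 \<le> (1 - s) * (F x)\<^sup>2 + s * (F y)\<^sup>2 - s * (1 - s) * (norm (x - y))\<^sup>2)"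

text \<open>Stewart's theorem for the cevian from \<open>r\<close>. It is the Euclidean equality
  case against which every later distance function is compared.\<close>

lemma norm_combination_sq:
  fixes x y r :: "'w::real_inner"
  shows "(norm (r - ((1 - s) *\<^sub>R x + s *\<^sub>R y)))\<^sup>2
    = (1 - s) * (norm (r - x))\<^sup>2 + s * (norm (r - y))\<^sup>2 - s * (1 - s) * (norm (x - y))\<^sup>2"
  unfolding power2_norm_eq_inner
  by (simp add: inner_simps inner_commute algebra_simps)

text \<open>Equality holds here. For a distance function F, \<open>two_convex_on\<close> is the CN
  inequality of Bruhat and Tits, taken at every ratio and not only at midpoints.\<close>

lemma two_convex_on_norm: "two_convex_on S (\<lambda>x. norm (r - x))"
  unfolding two_convex_on_def norm_combination_sq by simp

text \<open>The right side minus the first square is a quadratic form of rank one in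
  \<open>w0\<close>, \<open>w1\<close>, \<open>u\<close>, so completing the square leaves a single
  nonnegative term. \<open>M\<close> and \<open>N\<close> come from
  \<open>infimal_step_core\<close>, where \<open>M / N\<close> is the weight of the last leg of a
  path.\<close>

lemma rank_one_identity:
  fixes w0 w1 u :: "'w::real_inner" and p q s :: real
  defines "M \<equiv> s * q + (1 - s) * p - p * q"
    and "N \<equiv> 1 - (1 - s) * q - s * p"
  assumes "p > 0" "q > 0" "M > 0" "N > 0"
  shows "N / M * (norm ((1 - s) *\<^sub>R w0 + s *\<^sub>R w1 + (s * (1 - s) * (p - q) / N) *\<^sub>R u))\<^sup>2
     + s * (1 - s) * p * q / M * (norm (u - ((1 - q) / q) *\<^sub>R w1 + ((1 - p) / p) *\<^sub>R w0))\<^sup>2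
    = s * (1 - s) / N * (norm u)\<^sup>2 + (1 - s) / p * (norm w0)\<^sup>2 + s / q * (norm w1)\<^sup>2
      - s * (1 - s) * (norm (u + w1 - w0))\<^sup>2"
proof -
  have nz: "M \<noteq> 0" "N \<noteq> 0" "p \<noteq> 0" "q \<noteq> 0" using assms by auto
  \<comment> \<open>\<open>c1\<close> to \<open>c6\<close> are the coefficient comparisons for the
    inner products w0.w0, w1.w1, w0.w1, u.u, w0.u and w1.u, in this order.\<close>
  have c1: "N / M * (1 - s)\<^sup>2 + s * (1 - s) * p * q / M * ((1 - p) / p)\<^sup>2 = (1 - s) / p - s * (1 - s)"
  proof -
    have "(N * (1 - s)\<^sup>2) * p + s * (1 - s) * q * (1 - p)\<^sup>2 = ((1 - s) - s * (1 - s) * p) * M"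
      unfolding M_def N_def by (simp add: algebra_simps power2_eq_square)
    then have "((N * (1 - s)\<^sup>2) * p + s * (1 - s) * q * (1 - p)\<^sup>2) / (M * p)
        = ((1 - s) - s * (1 - s) * p) * M / (M * p)" by simp
    moreover have "N / M * (1 - s)\<^sup>2 + s * (1 - s) * p * q / M * ((1 - p) / p)\<^sup>2
        = ((N * (1 - s)\<^sup>2) * p + s * (1 - s) * q * (1 - p)\<^sup>2) / (M * p)"
      using nz by (simp add: add_divide_distrib power2_eq_square)
    moreover have "((1 - s) - s * (1 - s) * p) * M / (M * p) = (1 - s) / p - s * (1 - s)"
      using nz by (simp add: diff_divide_distrib)
    ultimately show ?thesis by simp
  qed
  have c2: "N / M * s\<^sup>2 + s * (1 - s) * p * q / M * ((1 - q) / q)\<^sup>2 = s / q - s * (1 - s)"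
  proof -
    have "(N * s\<^sup>2) * q + s * (1 - s) * p * (1 - q)\<^sup>2 = (s - s * (1 - s) * q) * M"
      unfolding M_def N_def by (simp add: algebra_simps power2_eq_square)
    then have "((N * s\<^sup>2) * q + s * (1 - s) * p * (1 - q)\<^sup>2) / (M * q)
        = (s - s * (1 - s) * q) * M / (M * q)" by simp
    moreover have "N / M * s\<^sup>2 + s * (1 - s) * p * q / M * ((1 - q) / q)\<^sup>2
        = ((N * s\<^sup>2) * q + s * (1 - s) * p * (1 - q)\<^sup>2) / (M * q)"
      using nz by (simp add: add_divide_distrib power2_eq_square)
    moreover have "(s - s * (1 - s) * q) * M / (M * q) = s / q - s * (1 - s)"
      using nz by (simp add: diff_divide_distrib)
    ultimately show ?thesis by simp
  qed
  have c3: "N / M * ((1 - s) * s) - s * (1 - s) * p * q / M * (((1 - q) / q) * ((1 - p) / p)) = s * (1 - s)"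
  proof -
    have "N * ((1 - s) * s) - s * (1 - s) * ((1 - q) * (1 - p)) = s * (1 - s) * M"
      unfolding M_def N_def by (simp add: algebra_simps power2_eq_square)
    then have "(N * ((1 - s) * s) - s * (1 - s) * ((1 - q) * (1 - p))) / M = (s * (1 - s) * M) / M" by (rule arg_cong)
    moreover have "N / M * ((1 - s) * s) - s * (1 - s) * p * q / M * (((1 - q) / q) * ((1 - p) / p)) = (N * ((1 - s) * s) - s * (1 - s) * ((1 - q) * (1 - p))) / M"
    proof -
      have "s * (1 - s) * p * q / M * (((1 - q) / q) * ((1 - p) / p))
          = s * (1 - s) / M * ((q * ((1 - q) / q)) * (p * ((1 - p) / p)))" by (simp only: divide_inverse mult_ac)
      also have "\<dots> = s * (1 - s) / M * ((1 - q) * (1 - p))" using nz by simp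
      finally show ?thesis by (simp add: diff_divide_distrib)
    qed
    ultimately show ?thesis using nz by (simp add: diff_divide_distrib)
  qed
  have c4: "N / M * (s * (1 - s) * (p - q) / N)\<^sup>2 + s * (1 - s) * p * q / M = s * (1 - s) / N - s * (1 - s)"
  proof -
    have "(s * (1 - s) * (p - q))\<^sup>2 + s * (1 - s) * p * q * N = (s * (1 - s) - s * (1 - s) * N) * M"
      unfolding M_def N_def by (simp add: algebra_simps power2_eq_square)
    then have "((s * (1 - s) * (p - q))\<^sup>2 + s * (1 - s) * p * q * N) / (M * N) = ((s * (1 - s) - s * (1 - s) * N) * M) / (M * N)" by (rule arg_cong)
    moreover have "N / M * (s * (1 - s) * (p - q) / N)\<^sup>2 + s * (1 - s) * p * q / M = ((s * (1 - s) * (p - q))\<^sup>2 + s * (1 - s) * p * q * N) / (M * N)"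
      using nz by (simp add: diff_divide_distrib add_divide_distrib power2_eq_square)
    ultimately show ?thesis using nz by (simp add: diff_divide_distrib)
  qed
  have c5: "N / M * ((1 - s) * (s * (1 - s) * (p - q) / N)) + s * (1 - s) * p * q / M * ((1 - p) / p) = s * (1 - s)"
  proof -
    have "(1 - s) * (s * (1 - s) * (p - q)) + s * (1 - s) * q * (1 - p) = s * (1 - s) * M"
      unfolding M_def N_def by (simp add: algebra_simps power2_eq_square)
    then have "((1 - s) * (s * (1 - s) * (p - q)) + s * (1 - s) * q * (1 - p)) / M = (s * (1 - s) * M) / M" by (rule arg_cong)
    moreover have "N / M * ((1 - s) * (s * (1 - s) * (p - q) / N)) + s * (1 - s) * p * q / M * ((1 - p) / p) = ((1 - s) * (s * (1 - s) * (p - q)) + s * (1 - s) * q * (1 - p)) / M"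
    proof -
      have "s * (1 - s) * p * q / M * ((1 - p) / p)
          = s * (1 - s) * q / M * (p * ((1 - p) / p))" by (simp only: divide_inverse mult_ac)
      also have "\<dots> = s * (1 - s) * q / M * (1 - p)" using nz by simp
      finally show ?thesis using nz by (simp add: diff_divide_distrib add_divide_distrib)
    qed
    ultimately show ?thesis using nz by (simp add: diff_divide_distrib)
  qed
  have c6: "N / M * (s * (s * (1 - s) * (p - q) / N)) - s * (1 - s) * p * q / M * ((1 - q) / q) = - (s * (1 - s))"
  proof -
    have "s * (s * (1 - s) * (p - q)) - s * (1 - s) * p * (1 - q) = - (s * (1 - s) * M)"
      unfolding M_def N_def by (simp add: algebra_simps power2_eq_square)
    then have "(s * (s * (1 - s) * (p - q)) - s * (1 - s) * p * (1 - q)) / M = (- (s * (1 - s) * M)) / M" by (rule arg_cong)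
    moreover have "N / M * (s * (s * (1 - s) * (p - q) / N)) - s * (1 - s) * p * q / M * ((1 - q) / q) = (s * (s * (1 - s) * (p - q)) - s * (1 - s) * p * (1 - q)) / M"
    proof -
      have "s * (1 - s) * p * q / M * ((1 - q) / q)
          = s * (1 - s) * p / M * (q * ((1 - q) / q))" by (simp only: divide_inverse mult_ac)
      also have "\<dots> = s * (1 - s) * p / M * (1 - q)" using nz by simp
      finally show ?thesis using nz by (simp add: diff_divide_distrib add_divide_distrib)
    qed
    ultimately show ?thesis using nz by (simp add: diff_divide_distrib)
  qed
  have e1: "(norm (a *\<^sub>R w0 + b *\<^sub>R w1 + c *\<^sub>R u))\<^sup>2 = a\<^sup>2 * inner w0 w0 + b\<^sup>2 * inner w1 w1 + c\<^sup>2 * inner u u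
     + 2 * (a * b) * inner w0 w1 + 2 * (a * c) * inner w0 u + 2 * (b * c) * inner w1 u" for a b c
    unfolding power2_norm_eq_inner by (simp add: inner_simps inner_commute algebra_simps power2_eq_square)
  have e2: "u - ((1 - q) / q) *\<^sub>R w1 + ((1 - p) / p) *\<^sub>R w0
     = ((1 - p) / p) *\<^sub>R w0 + (- ((1 - q) / q)) *\<^sub>R w1 + 1 *\<^sub>R u" by (simp add: algebra_simps)
  have e3: "u + w1 - w0 = (-1) *\<^sub>R w0 + 1 *\<^sub>R w1 + 1 *\<^sub>R u" by (simp add: algebra_simps)
  have e4: "(norm w)\<^sup>2 = inner w w" for w :: 'w by (rule power2_norm_eq_inner)
  \<comment> \<open>With the quotients abbreviated, what remains is linear in the six inner
    products.\<close>
  define k where "k = s * (1 - s) * p * q / M"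
  define h where "h = N / M"
  define x where "x = (1 - p) / p"
  define y where "y = (1 - q) / q"
  define z where "z = s * (1 - s) * (p - q) / N"
  define n where "n = s * (1 - s) / N"
  define f where "f = (1 - s) / p"
  define g where "g = s / q"
  note folds = k_def[symmetric] h_def[symmetric] x_def[symmetric] y_def[symmetric] z_def[symmetric]
    n_def[symmetric] f_def[symmetric] g_def[symmetric]
  note C = c1[unfolded folds] c2[unfolded folds] c3[unfolded folds] c4[unfolded folds] c5[unfolded folds] c6[unfolded folds]
  show ?thesis
  proof -
    have "h * ((1 - s)\<^sup>2 * inner w0 w0 + s\<^sup>2 * inner w1 w1 + z\<^sup>2 * inner u u + 2 * ((1 - s) * s) * inner w0 w1
        + 2 * ((1 - s) * z) * inner w0 u + 2 * (s * z) * inner w1 u)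
      + k * (x\<^sup>2 * inner w0 w0 + (- y)\<^sup>2 * inner w1 w1 + 1\<^sup>2 * inner u u + 2 * (x * (- y)) * inner w0 w1
        + 2 * (x * 1) * inner w0 u + 2 * (- y * 1) * inner w1 u)
      = (h * (1 - s)\<^sup>2 + k * x\<^sup>2) * inner w0 w0 + (h * s\<^sup>2 + k * y\<^sup>2) * inner w1 w1
        + 2 * (h * ((1 - s) * s) - k * (y * x)) * inner w0 w1 + (h * z\<^sup>2 + k) * inner u u
        + 2 * (h * ((1 - s) * z) + k * x) * inner w0 u + 2 * (h * (s * z) - k * y) * inner w1 u"
      by (simp only: power2_minus one_power2) (simp only: ring_distribs mult_1_right mult_1_left mult_minus_left mult_minus_right diff_conv_add_uminus add_ac mult_ac)
    also have "\<dots> = n * inner u u + f * inner w0 w0 + g * inner w1 w1 -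
        s * (1 - s) * ((- 1)\<^sup>2 * inner w0 w0 + 1\<^sup>2 * inner w1 w1 + 1\<^sup>2 * inner u u
          + 2 * (- 1 * 1) * inner w0 w1 + 2 * (- 1 * 1) * inner w0 u + 2 * (1 * 1) * inner w1 u)"
      unfolding C by (simp add: algebra_simps)
    finally show ?thesis unfolding e2 e3 unfolding folds unfolding e1 unfolding e4 by (simp only: mult_ac)
  qed
qed

text \<open>Picture a Euclidean triangle with apex r whose base ends have distances
  \<open>la0 + mu0\<close> and \<open>la1 + mu1\<close> from r, with points marked on the two sides
  at distances \<open>la0\<close> and \<open>la1\<close>. The cevian to the base point of ratio
  \<open>s\<close> crosses the chord between the marked points at ratio \<open>\<sigma>\<close>;
  this is the origin of its formula. In the application \<open>u\<close> runs along the gate and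
  \<open>w0\<close>, \<open>w1\<close> are the legs beyond it.\<close>

lemma infimal_step_core:
  fixes w0 w1 u :: "'w::real_inner"
  assumes s: "0 < s" "s < 1" and pos: "la0 > 0" "la1 > 0" "mu0 > 0" "mu1 > 0" and "\<phi> \<ge> 0"
    and \<sigma>: "\<sigma> = s * (la1 + mu1) * la0 / ((1 - s) * (la0 + mu0) * la1 + s * (la1 + mu1) * la0)"
    and \<phi>: "\<phi>\<^sup>2 \<le> (1 - \<sigma>) * la0\<^sup>2 + \<sigma> * la1\<^sup>2 - \<sigma> * (1 - \<sigma>) * (norm u)\<^sup>2"
    and w: "norm w0 \<le> mu0" "norm w1 \<le> mu1"
  shows "(\<phi> + norm ((1 - s) *\<^sub>R w0 + s *\<^sub>R w1 + (s - \<sigma>) *\<^sub>R u))\<^sup>2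
     \<le> (1 - s) * (la0 + mu0)\<^sup>2 + s * (la1 + mu1)\<^sup>2 - s * (1 - s) * (norm (u + w1 - w0))\<^sup>2"
proof -
  define f0 where "f0 = la0 + mu0"
  define f1 where "f1 = la1 + mu1"
  have fp: "f0 > 0" "f1 > 0" using pos by (auto simp: f0_def f1_def)
  \<comment> \<open>The fractions of the two sides that lie beyond the gate.\<close>
  define p where "p = mu0 / f0"
  define q where "q = mu1 / f1"
  have pq: "0 < p" "p < 1" "0 < q" "q < 1" using pos fp by (auto simp: p_def q_def f0_def f1_def)
  have l0: "la0 = (1 - p) * f0" and m0: "mu0 = p * f0" using fp by (auto simp: p_def f0_def field_simps)
  have l1: "la1 = (1 - q) * f1" and m1: "mu1 = q * f1" using fp by (auto simp: q_def f1_def field_simps)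
  define M where "M = s * q + (1 - s) * p - p * q"
  define N where "N = 1 - (1 - s) * q - s * p"
  have Np: "N > 0"
  proof -
    have "N = (1 - s) * (1 - q) + s * (1 - p)" by (simp add: N_def algebra_simps)
    then show ?thesis using s pq by (simp add: add_pos_pos)
  qed
  have Mp: "M > 0"
  proof -
    have "M = s * q * (1 - p) + (1 - s) * p * (1 - q)" by (simp add: M_def algebra_simps)
    then show ?thesis using s pq by (simp add: add_pos_pos)
  qed
  \<comment> \<open>In the comparison triangle this is the fraction of the cevian between the apex
    and the chord.\<close>
  define \<tau> where "\<tau> = (1 - p) * (1 - q) / N"
  have NM: "N - (1 - p) * (1 - q) = M" by (simp add: N_def M_def algebra_simps)
  have \<tau>: "0 < \<tau>" "\<tau> < 1" using pq Np Mp NM by (auto simp: \<tau>_def)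
  have omt: "1 - \<tau> = M / N" using NM Np by (simp add: \<tau>_def field_simps)
  have sig: "\<sigma> = s * (1 - p) / N"
  proof -
    have "\<sigma> = s * f1 * la0 / ((1 - s) * f0 * la1 + s * f1 * la0)"
      unfolding \<sigma> f0_def f1_def ..
    also have "\<dots> = s * f1 * ((1 - p) * f0) / ((1 - s) * f0 * ((1 - q) * f1) + s * f1 * ((1 - p) * f0))"
      by (simp only: l0 l1)
    also have "\<dots> = (f0 * f1) * (s * (1 - p)) / ((f0 * f1) * N)"
      by (simp add: N_def algebra_simps)
    finally show ?thesis using fp by simp
  qed
  have oms: "1 - \<sigma> = (1 - s) * (1 - q) / N"
    using Np unfolding sig by (simp add: N_def field_simps)
  have ssig: "s - \<sigma> = s * (1 - s) * (p - q) / N"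
  proof -
    have "s * N - s * (1 - p) = s * (1 - s) * (p - q)" unfolding N_def by (simp add: algebra_simps)
    then show ?thesis using Np unfolding sig by (simp add: field_simps)
  qed
  define v where "v = (1 - s) *\<^sub>R w0 + s *\<^sub>R w1 + (s - \<sigma>) *\<^sub>R u"
  \<comment> \<open>Cauchy-Schwarz with weights \<tau> and 1 - \<tau>; in the comparison triangle it
    would be an equality, so nothing is lost in the flat case.\<close>
  have split: "(a + b)\<^sup>2 \<le> a\<^sup>2 / \<tau> + b\<^sup>2 / (1 - \<tau>)" for a b :: real
  proof -
    have "a\<^sup>2 / \<tau> + b\<^sup>2 / (1 - \<tau>) - (a + b)\<^sup>2 = ((1 - \<tau>) * a - \<tau> * b)\<^sup>2 / (\<tau> * (1 - \<tau>))"
      using \<tau> by (simp add: field_simps power2_eq_square)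
    also have "\<dots> \<ge> 0" using \<tau> by simp
    finally show ?thesis by simp
  qed
  have A: "\<phi>\<^sup>2 / \<tau> \<le> (1 - s) * (la0 * f0) + s * (la1 * f1) - s * (1 - s) / N * (norm u)\<^sup>2"
  proof -
    have lin: "(a * x + b * y - c * z) / t = a / t * x + b / t * y - c / t * z" for a b c x y z t :: real
      by (simp add: diff_divide_distrib add_divide_distrib)
    have "\<phi>\<^sup>2 / \<tau> \<le> ((1 - \<sigma>) * la0\<^sup>2 + \<sigma> * la1\<^sup>2 - \<sigma> * (1 - \<sigma>) * (norm u)\<^sup>2) / \<tau>"
      using \<phi> \<tau> by (simp add: divide_right_mono)
    also have "\<dots> = (1 - \<sigma>) / \<tau> * la0\<^sup>2 + \<sigma> / \<tau> * la1\<^sup>2 - \<sigma> * (1 - \<sigma>) / \<tau> * (norm u)\<^sup>2"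
      by (rule lin)
    also have "(1 - \<sigma>) / \<tau> = (1 - s) / (1 - p)" unfolding oms \<tau>_def using pq Np by simp
    also have "\<sigma> / \<tau> = s / (1 - q)" unfolding sig \<tau>_def using pq Np by simp
    also have "\<sigma> * (1 - \<sigma>) / \<tau> = s * (1 - s) / N" unfolding oms unfolding sig \<tau>_def using pq Np by simp
    also have "(1 - s) / (1 - p) * la0\<^sup>2 = (1 - s) * (la0 * f0)"
      using pq by (simp add: l0 power2_eq_square)
    also have "s / (1 - q) * la1\<^sup>2 = s * (la1 * f1)"
      using pq by (simp add: l1 power2_eq_square)
    finally show ?thesis .
  qed
  \<comment> \<open>The positive multiple of the square of \<open>norm u\<close> is exactly what
    \<open>A\<close> subtracts, so it cancels in the sum.\<close>
  have B: "(norm v)\<^sup>2 / (1 - \<tau>) \<le> s * (1 - s) / N * (norm u)\<^sup>2 + (1 - s) * (mu0 * f0) + s * (mu1 * f1)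
      - s * (1 - s) * (norm (u + w1 - w0))\<^sup>2"
  proof -
    have "(norm v)\<^sup>2 / (1 - \<tau>) = N / M * (norm v)\<^sup>2" unfolding omt by simp
    also have "\<dots> \<le> N / M * (norm v)\<^sup>2
        + s * (1 - s) * p * q / M * (norm (u - ((1 - q) / q) *\<^sub>R w1 + ((1 - p) / p) *\<^sub>R w0))\<^sup>2"
      using s pq Mp by simp
    also have "\<dots> = s * (1 - s) / N * (norm u)\<^sup>2 + (1 - s) / p * (norm w0)\<^sup>2 + s / q * (norm w1)\<^sup>2
      - s * (1 - s) * (norm (u + w1 - w0))\<^sup>2"
      unfolding v_def ssig M_def N_def
      by (rule rank_one_identity) (use pq Mp Np in \<open>auto simp: M_def N_def\<close>)
    also have "\<dots> \<le> s * (1 - s) / N * (norm u)\<^sup>2 + (1 - s) / p * mu0\<^sup>2 + s / q * mu1\<^sup>2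
      - s * (1 - s) * (norm (u + w1 - w0))\<^sup>2"
      using w s pq Np by (intro diff_mono add_mono mult_left_mono power_mono) auto
    also have "(1 - s) / p * mu0\<^sup>2 = (1 - s) * (mu0 * f0)" using pq by (simp add: m0 power2_eq_square)
    also have "s / q * mu1\<^sup>2 = s * (mu1 * f1)" using pq by (simp add: m1 power2_eq_square)
    finally show ?thesis .
  qed
  have "(\<phi> + norm v)\<^sup>2 \<le> \<phi>\<^sup>2 / \<tau> + (norm v)\<^sup>2 / (1 - \<tau>)" by (rule split)
  also have "\<dots> \<le> (1 - s) * (la0 * f0) + s * (la1 * f1) + (1 - s) * (mu0 * f0) + s * (mu1 * f1)
      - s * (1 - s) * (norm (u + w1 - w0))\<^sup>2" using A B by simp
  also have "\<dots> = (1 - s) * f0\<^sup>2 + s * f1\<^sup>2 - s * (1 - s) * (norm (u + w1 - w0))\<^sup>2"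
    by (simp add: f0_def f1_def power2_eq_square algebra_simps)
  finally show ?thesis unfolding v_def f0_def f1_def .
qed

text \<open>While z moves from z0 to z1 at ratio \<open>s\<close>, the point of the gate slides
  between near-minimisers at the different ratio \<open>\<sigma>\<close> of
  \<open>infimal_step_core\<close>. \<open>upper\<close> and \<open>approx\<close> together express
  that \<open>f z\<close> is the infimum of \<open>F c + norm (c - z)\<close>, which need not be
  attained.\<close>

lemma two_convex_on_infimal_convolution:
  fixes A E :: "'w::real_inner set"
  assumes F: "two_convex_on A F" "\<And>c. c \<in> A \<Longrightarrow> 0 \<le> F c" and A: "convex A" and E: "convex E"
    and upper: "\<And>z c. z \<in> E \<Longrightarrow> c \<in> A \<Longrightarrow> f z \<le> F c + norm (c - z)"
    and approx: "\<And>z e. z \<in> E \<Longrightarrow> e > 0 \<Longrightarrow> \<exists>c\<in>A. F c + norm (c - z) < f z + e"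
    and f0: "\<And>z. z \<in> E \<Longrightarrow> 0 \<le> f z"
  shows "two_convex_on E f"
  unfolding two_convex_on_def
proof (intro ballI allI impI)
  fix z0 z1 s assume z: "z0 \<in> E" "z1 \<in> E" and s': "0 \<le> s \<and> s \<le> (1::real)"
  let ?z = "(1 - s) *\<^sub>R z0 + s *\<^sub>R z1"
  show "(f ?z)\<^sup>2 \<le> (1 - s) * (f z0)\<^sup>2 + s * (f z1)\<^sup>2 - s * (1 - s) * (norm (z0 - z1))\<^sup>2"
  proof (cases "s = 0 \<or> s = 1")
    case True then show ?thesis by auto
  next
    case False
    then have s: "0 < s" "s < 1" using s' by auto
    have zE: "?z \<in> E" using convexD_alt[OF E z] s by simp
    \<comment> \<open>Of the three errors \<open>e\<close>, one comes from the near-minimiser and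
      two from the padding below.\<close>
    define R where "R e = (1 - s) * (f z0 + 3 * e)\<^sup>2 + s * (f z1 + 3 * e)\<^sup>2 - s * (1 - s) * (norm (z0 - z1))\<^sup>2" for e
    have "(f ?z)\<^sup>2 \<le> R e" if e: "e > 0" for e
    proof -
      obtain a0 where a0: "a0 \<in> A" "F a0 + norm (a0 - z0) < f z0 + e" using approx[OF z(1) e] by blast
      obtain a1 where a1: "a1 \<in> A" "F a1 + norm (a1 - z1) < f z1 + e" using approx[OF z(2) e] by blast
      \<comment> \<open>Padding by \<open>e\<close> makes all four lengths positive, so that
        \<sigma> is defined also when a leg degenerates to a point.\<close>
      define la0 where "la0 = F a0 + e"
      define la1 where "la1 = F a1 + e"
      define mu0 where "mu0 = norm (a0 - z0) + e"
      define mu1 where "mu1 = norm (a1 - z1) + e"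
      have pos: "la0 > 0" "la1 > 0" "mu0 > 0" "mu1 > 0"
        using e F(2)[OF a0(1)] F(2)[OF a1(1)] by (auto simp: la0_def la1_def mu0_def mu1_def add_nonneg_pos)
      define \<sigma> where "\<sigma> = s * (la1 + mu1) * la0 / ((1 - s) * (la0 + mu0) * la1 + s * (la1 + mu1) * la0)"
      have \<sigma>: "0 \<le> \<sigma>" "\<sigma> \<le> 1" using pos s by (auto simp: \<sigma>_def divide_simps add_pos_pos)
      define a where "a = (1 - \<sigma>) *\<^sub>R a0 + \<sigma> *\<^sub>R a1"
      have aA: "a \<in> A" unfolding a_def using convexD_alt[OF A a0(1) a1(1)] \<sigma> by simp
      have "(F a)\<^sup>2 \<le> (1 - \<sigma>) * (F a0)\<^sup>2 + \<sigma> * (F a1)\<^sup>2 - \<sigma> * (1 - \<sigma>) * (norm (a0 - a1))\<^sup>2"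
        using F(1) a0(1) a1(1) \<sigma> unfolding two_convex_on_def a_def by blast
      also have "\<dots> \<le> (1 - \<sigma>) * la0\<^sup>2 + \<sigma> * la1\<^sup>2 - \<sigma> * (1 - \<sigma>) * (norm (a1 - a0))\<^sup>2"
        using \<sigma> e F(2)[OF a0(1)] F(2)[OF a1(1)]
        by (intro diff_mono add_mono mult_left_mono power_mono) (auto simp: la0_def la1_def norm_minus_commute)
      finally have Fa: "(F a)\<^sup>2 \<le> (1 - \<sigma>) * la0\<^sup>2 + \<sigma> * la1\<^sup>2 - \<sigma> * (1 - \<sigma>) * (norm (a1 - a0))\<^sup>2" .
      have core: "(F a + norm ((1 - s) *\<^sub>R (z0 - a0) + s *\<^sub>R (z1 - a1) + (s - \<sigma>) *\<^sub>R (a1 - a0)))\<^sup>2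
        \<le> (1 - s) * (la0 + mu0)\<^sup>2 + s * (la1 + mu1)\<^sup>2 - s * (1 - s) * (norm ((a1 - a0) + (z1 - a1) - (z0 - a0)))\<^sup>2"
        by (rule infimal_step_core[OF s pos F(2)[OF aA] \<sigma>_def Fa])
           (use e in \<open>auto simp: mu0_def mu1_def norm_minus_commute\<close>)
      have eq: "(1 - s) *\<^sub>R (z0 - a0) + s *\<^sub>R (z1 - a1) + (s - \<sigma>) *\<^sub>R (a1 - a0) = ?z - a"
        by (simp add: a_def algebra_simps)
      have eq2: "(a1 - a0) + (z1 - a1) - (z0 - a0) = z1 - z0" by simp
      have "f ?z \<le> F a + norm (?z - a)" using upper[OF zE aA] by (simp add: norm_minus_commute)
      then have "(f ?z)\<^sup>2 \<le> (F a + norm (?z - a))\<^sup>2" using f0[OF zE] by (intro power_mono) auto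
      also have "\<dots> \<le> (1 - s) * (la0 + mu0)\<^sup>2 + s * (la1 + mu1)\<^sup>2 - s * (1 - s) * (norm (z0 - z1))\<^sup>2"
        using core unfolding eq eq2 by (simp add: norm_minus_commute)
      also have "\<dots> \<le> R e"
      proof -
        have "(la0 + mu0)\<^sup>2 \<le> (f z0 + 3 * e)\<^sup>2" "(la1 + mu1)\<^sup>2 \<le> (f z1 + 3 * e)\<^sup>2"
          using pos a0(2) a1(2) by (auto intro!: power_mono simp: la0_def la1_def mu0_def mu1_def)
        then show ?thesis unfolding R_def using s by (intro diff_mono add_mono mult_left_mono) auto
      qed
      finally show ?thesis .
    qed
    then have ev: "\<forall>\<^sub>F e in at_right 0. (f ?z)\<^sup>2 \<le> R e"
      by (auto simp: eventually_at_right_less eventually_mono[OF eventually_at_right_less])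
    have "(R \<longlongrightarrow> R 0) (at_right 0)" unfolding R_def by (intro tendsto_intros)
    from tendsto_lowerbound[OF this ev] have "(f ?z)\<^sup>2 \<le> R 0" by simp
    then show ?thesis by (simp add: R_def)
  qed
qed


section \<open>Trees of convex pieces\<close>

inductive piecewise_path :: "'w::real_normed_vector set set \<Rightarrow> 'w \<Rightarrow> 'w \<Rightarrow> real \<Rightarrow> bool"
  for \<P> :: "'w set set" where
  refl: "x \<in> \<Union>\<P> \<Longrightarrow> piecewise_path \<P> x x 0"
| step: "P \<in> \<P> \<Longrightarrow> x \<in> P \<Longrightarrow> y \<in> P \<Longrightarrow> piecewise_path \<P> y z l \<Longrightarrow> piecewise_path \<P> x z (norm (x - y) + l)"

lemma piecewise_path_ge: "piecewise_path \<P> x y l \<Longrightarrow> norm (x - y) \<le> l"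
proof (induction rule: piecewise_path.induct)
  case (step P x y z l)
  then show ?case using norm_triangle_ineq[of "x - y" "y - z"] by simp
qed auto

lemma piecewise_path_trans:
  "piecewise_path \<P> x y l \<Longrightarrow> piecewise_path \<P> y z m \<Longrightarrow> piecewise_path \<P> x z (l + m)"
proof (induction rule: piecewise_path.induct)
  case (step P x y y' l)
  then have "piecewise_path \<P> x z (norm (x - y) + (l + m))" by (auto intro: piecewise_path.step)
  then show ?case by (simp add: add_ac)
qed auto

lemma piecewise_path_single: "P \<in> \<P> \<Longrightarrow> x \<in> P \<Longrightarrow> y \<in> P \<Longrightarrow> piecewise_path \<P> x y (norm (x - y))"
  using piecewise_path.step[of P \<P> x y y 0] piecewise_path.refl[of y \<P>] by auto

lemma piecewise_path_sym: "piecewise_path \<P> x y l \<Longrightarrow> piecewise_path \<P> y x l"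
proof (induction rule: piecewise_path.induct)
  case (step P x y z l)
  then have "piecewise_path \<P> z x (l + norm (y - x))"
    by (auto intro: piecewise_path_trans piecewise_path_single)
  then show ?case by (simp add: add_ac norm_minus_commute)
qed (rule piecewise_path.refl)

text \<open>Each step stays inside one piece. The first step taken in a piece of \<open>B\<close>
  starts in both unions; if there is none, the end point itself has stayed in the union of
  \<open>A\<close>.\<close>

lemma piecewise_path_cross:
  assumes "piecewise_path (A \<union> B) x z l" "x \<in> \<Union>A" "z \<in> \<Union>B"
  shows "\<exists>c\<in>\<Union>A \<inter> \<Union>B. \<exists>l1 l2. piecewise_path (A \<union> B) x c l1 \<and> piecewise_path (A \<union> B) c z l2 \<and> l = l1 + l2"
  using assms
proof (induction rule: piecewise_path.induct)
  case (refl x)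
  then have "piecewise_path (A \<union> B) x x 0" by (intro piecewise_path.refl) auto
  moreover have "(0::real) = 0 + 0" by simp
  ultimately show ?case using refl by blast
next
  case (step P x y z l)
  note full = piecewise_path.step[OF step.hyps]
  show ?case
  proof (cases "P \<in> B")
    case True
    then have "x \<in> \<Union>A \<inter> \<Union>B" using step by auto
    moreover have "piecewise_path (A \<union> B) x x 0" using step by (auto intro: piecewise_path.refl)
    moreover have "norm (x - y) + l = 0 + (norm (x - y) + l)" by simp
    ultimately show ?thesis using full by blast
  next
    case False
    then have "y \<in> \<Union>A" using step by auto
    from step.IH[OF this step.prems(2)] obtain c l1 l2 where c: "c \<in> \<Union>A \<inter> \<Union>B"
      "piecewise_path (A \<union> B) y c l1" "piecewise_path (A \<union> B) c z l2" "l = l1 + l2" by blast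
    have "piecewise_path (A \<union> B) x c (norm (x - y) + l1)" by (rule piecewise_path.step[OF step.hyps(1-3) c(2)])
    moreover have "norm (x - y) + l = (norm (x - y) + l1) + l2" using c by simp
    ultimately show ?thesis using c by blast
  qed
qed

text \<open>The length metric of the union, measured on polygonal chains whose sides each lie in one
  piece.\<close>

definition chain_dist :: "'w::real_normed_vector set set \<Rightarrow> 'w \<Rightarrow> 'w \<Rightarrow> real" where
  "chain_dist \<P> x y = Inf {l. piecewise_path \<P> x y l}"

text \<open>
  In a gallery the last piece is separated from all earlier ones by a wall whose gate is its
  intersection with the preceding piece.
\<close>

inductive gallery :: "'w set set \<Rightarrow> 'w set list \<Rightarrow> bool" for \<P> :: "'w set set" where
  single: "P \<in> \<P> \<Longrightarrow> gallery \<P> [P]"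
| snoc: "gallery \<P> (Ps @ [Q]) \<Longrightarrow> \<P> = A \<union> B \<Longrightarrow> set (Ps @ [Q]) \<subseteq> A \<Longrightarrow> P \<in> B \<Longrightarrow>
    \<Union>A \<inter> \<Union>B \<subseteq> Q \<inter> P \<Longrightarrow> Q \<inter> P \<noteq> {} \<Longrightarrow> gallery \<P> (Ps @ [Q, P])"

text \<open>The wall condition speaks only of the earlier pieces, so it gets weaker when the first
  one is forgotten. Suffixes are needed to restart the geodesic construction at an interior
  piece.\<close>

lemma gallery_tl: "gallery \<P> Ps \<Longrightarrow> length Ps > 1 \<Longrightarrow> gallery \<P> (tl Ps)"
proof (induction rule: gallery.induct)
  case (snoc Ps Q A B P)
  show ?case
  proof (cases Ps)
    case Nil
    then show ?thesis using snoc by (auto intro: gallery.single)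
  next
    case (Cons a list)
    have "gallery \<P> (list @ [Q])" using snoc Cons by simp
    then have "gallery \<P> (list @ [Q, P])"
      by (rule gallery.snoc) (use snoc Cons in auto)
    then show ?thesis using Cons by simp
  qed
qed auto

lemma gallery_drop: "gallery \<P> Ps \<Longrightarrow> i < length Ps \<Longrightarrow> gallery \<P> (drop i Ps)"
proof (induction i)
  case (Suc i)
  then have "gallery \<P> (tl (drop i Ps))" by (intro gallery_tl) auto
  then show ?case by (simp add: drop_Suc tl_drop)
qed simp

text \<open>Compactness is demanded only of bounded parts of single pieces, because the ambient
  space of the application is infinite-dimensional and incomplete.\<close>

locale tree_of_pieces =
  fixes \<P> :: "'w::real_inner set set"
  assumes convex_piece: "P \<in> \<P> \<Longrightarrow> convex P"
    and compact_piece: "P \<in> \<P> \<Longrightarrow> compact (P \<inter> cball x r)"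
    and nonempty: "\<P> \<noteq> {}" "{} \<notin> \<P>"
    and galleries: "P \<in> \<P> \<Longrightarrow> Q \<in> \<P> \<Longrightarrow> \<exists>Ps. gallery \<P> Ps \<and> hd Ps = P \<and> last Ps = Q"
begin

abbreviation X :: "'w set" where "X \<equiv> \<Union>\<P>"

abbreviation d :: "'w \<Rightarrow> 'w \<Rightarrow> real" where "d \<equiv> chain_dist \<P>"

lemma gallery_path:
  "gallery \<P> Ps \<Longrightarrow> x \<in> hd Ps \<Longrightarrow> y \<in> last Ps \<Longrightarrow> \<exists>l. piecewise_path \<P> x y l"
proof (induction arbitrary: y rule: gallery.induct)
  case (single P)
  then show ?case using piecewise_path_single[of P \<P> x y] by auto
next
  case (snoc Ps Q A B P)
  then obtain c where c: "c \<in> Q" "c \<in> P" by auto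
  have "\<exists>l. piecewise_path \<P> x c l" using snoc c by (cases Ps) auto
  moreover have "piecewise_path \<P> c y (norm (c - y))"
    using snoc c by (intro piecewise_path_single[of P]) auto
  ultimately show ?case using piecewise_path_trans by blast
qed

lemma path_exists:
  assumes "x \<in> X" "y \<in> X" shows "\<exists>l. piecewise_path \<P> x y l"
proof -
  obtain P Q where "P \<in> \<P>" "x \<in> P" "Q \<in> \<P>" "y \<in> Q" using assms by auto
  then show ?thesis using galleries[of P Q] gallery_path by blast
qed

lemma bdd_below_paths: "bdd_below {l. piecewise_path \<P> x y l}"
  by (rule bdd_belowI[of _ "norm (x - y)"]) (simp add: piecewise_path_ge)

lemma d_le: "piecewise_path \<P> x y l \<Longrightarrow> d x y \<le> l"
  unfolding chain_dist_def by (rule cInf_lower[OF _ bdd_below_paths]) simp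

lemma d_ge: "x \<in> X \<Longrightarrow> y \<in> X \<Longrightarrow> (\<And>l. piecewise_path \<P> x y l \<Longrightarrow> b \<le> l) \<Longrightarrow> b \<le> d x y"
  unfolding chain_dist_def using path_exists[of x y] by (intro cInf_greatest) (blast, simp)

lemma d_approx:
  assumes "x \<in> X" "y \<in> X" "e > 0" obtains l where "piecewise_path \<P> x y l" "l < d x y + e"
proof -
  have "\<not> (\<forall>l. piecewise_path \<P> x y l \<longrightarrow> d x y + e \<le> l)" using d_ge[of x y "d x y + e"] assms by auto
  then show ?thesis using that by force
qed

lemma norm_le_d: "x \<in> X \<Longrightarrow> y \<in> X \<Longrightarrow> norm (x - y) \<le> d x y"
  by (rule d_ge) (auto dest: piecewise_path_ge)

lemma d_piece: "P \<in> \<P> \<Longrightarrow> x \<in> P \<Longrightarrow> y \<in> P \<Longrightarrow> d x y = norm (x - y)"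
  using d_le[OF piecewise_path_single] norm_le_d[of x y] by (force intro: antisym)

lemma d_nonneg: "x \<in> X \<Longrightarrow> y \<in> X \<Longrightarrow> 0 \<le> d x y"
  using norm_le_d norm_ge_zero order_trans by blast

lemma d_commute: "d x y = d y x"
proof -
  have "piecewise_path \<P> x y = piecewise_path \<P> y x" using piecewise_path_sym by blast
  then show ?thesis by (simp add: chain_dist_def)
qed

lemma d_triangle:
  assumes "x \<in> X" "y \<in> X" "z \<in> X" shows "d x z \<le> d x y + d y z"
proof (rule field_le_epsilon)
  fix e :: real assume e: "e > 0"
  obtain l where l: "piecewise_path \<P> x y l" "l < d x y + e / 2" using d_approx[OF assms(1,2), of "e/2"] e by auto
  obtain m where m: "piecewise_path \<P> y z m" "m < d y z + e / 2" using d_approx[OF assms(2,3), of "e/2"] e by auto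
  show "d x z \<le> d x y + d y z + e" using d_le[OF piecewise_path_trans[OF l(1) m(1)]] l m by simp
qed

text \<open>Off the union the infimum in \<open>chain_dist\<close> runs over an empty set, whereas
  \<open>Metric_space\<close> wants nonnegativity and symmetry at all points; hence the extension by
  0.\<close>

lemma Metric_space_d: "Metric_space X (\<lambda>x y. if x \<in> X \<and> y \<in> X then d x y else 0)"
proof
  fix x y show "0 \<le> (if x \<in> X \<and> y \<in> X then d x y else 0)" using d_nonneg by auto
  show "(if x \<in> X \<and> y \<in> X then d x y else 0) = (if y \<in> X \<and> x \<in> X then d y x else 0)"
    using d_commute by auto
  assume xy: "x \<in> X" "y \<in> X"
  show "(if x \<in> X \<and> y \<in> X then d x y else 0) = 0 \<longleftrightarrow> x = y"
  proof
    assume "(if x \<in> X \<and> y \<in> X then d x y else 0) = 0"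
    then show "x = y" using xy norm_le_d[OF xy] by simp
  next
    assume "x = y"
    then show "(if x \<in> X \<and> y \<in> X then d x y else 0) = 0" using xy d_piece[of _ x x] by auto
  qed
next
  fix x y z assume "x \<in> X" "y \<in> X" "z \<in> X"
  then show "(if x \<in> X \<and> z \<in> X then d x z else 0)
    \<le> (if x \<in> X \<and> y \<in> X then d x y else 0) + (if y \<in> X \<and> z \<in> X then d y z else 0)"
    using d_triangle by auto
qed

text \<open>A nearly optimal chain is cut where it crosses the wall.\<close>

lemma d_cross:
  assumes W: "\<P> = A \<union> B" "\<Union>A \<inter> \<Union>B \<subseteq> G" "x \<in> \<Union>A" "y \<in> \<Union>B" and e: "e > 0"
  shows "\<exists>c\<in>G. c \<in> \<Union>A \<inter> \<Union>B \<and> d x c + d c y < d x y + e"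
proof -
  obtain l where l: "piecewise_path \<P> x y l" "l < d x y + e" using d_approx[of x y e] W e by auto
  obtain c l1 l2 where c: "c \<in> \<Union>A \<inter> \<Union>B" "piecewise_path \<P> x c l1" "piecewise_path \<P> c y l2" "l = l1 + l2"
    using piecewise_path_cross[of A B x y l] l W by auto
  have "d x c + d c y \<le> l" using d_le[OF c(2)] d_le[OF c(3)] c(4) by simp
  then have "d x c + d c y < d x y + e" using l by simp
  then show ?thesis using c(1) W(2) by blast
qed

text \<open>Seen from \<open>r\<close>, the last piece lies behind its wall: every chain from
  \<open>r\<close> to it passes the gate, and from there the last leg is straight. So the distance
  on the last piece is the infimal convolution of the norm with the distance on the gate, and
  two-convexity propagates piece by piece.\<close>

lemma two_convex_gallery:
  assumes "gallery \<P> Ps" "r \<in> hd Ps" shows "two_convex_on (last Ps) (d r)"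
  using assms
proof (induction rule: gallery.induct)
  case (single P)
  have "d r x = norm (r - x)" if "x \<in> P" for x using single that by (auto intro: d_piece)
  then show ?case using two_convex_on_norm[of P r] convex_piece[OF single(1)]
    by (auto simp: two_convex_on_def convexD_alt)
next
  case (snoc Ps Q A B P)
  have r: "r \<in> hd (Ps @ [Q])" using snoc by (cases Ps) auto
  have rA: "r \<in> \<Union>A" using r snoc(3) by (cases Ps) auto
  have QP: "Q \<in> \<P>" "P \<in> \<P>" using snoc by auto
  have IH: "two_convex_on Q (d r)" using snoc.IH[OF r] by simp
  have rX: "r \<in> X" using rA snoc(2) by auto
  have "two_convex_on P (d r)"
  proof (rule two_convex_on_infimal_convolution[of "Q \<inter> P" "d r"])
    show "two_convex_on (Q \<inter> P) (d r)" using IH by (auto simp: two_convex_on_def)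
    show "convex (Q \<inter> P)" "convex P" using convex_piece QP by (auto intro: convex_Int)
    show "0 \<le> d r c" if "c \<in> Q \<inter> P" for c using that QP rX by (intro d_nonneg) auto
    show "0 \<le> d r c" if "c \<in> P" for c using that QP rX by (intro d_nonneg) auto
    show "d r z \<le> d r c + norm (c - z)" if "z \<in> P" "c \<in> Q \<inter> P" for z c
      using d_triangle[of r c z] d_piece[of P c z] that QP rX by auto
    show "\<exists>c\<in>Q \<inter> P. d r c + norm (c - z) < d r z + e" if zP: "z \<in> P" and e0: "e > 0" for z e
    proof -
      obtain c where "c \<in> Q \<inter> P" "d r c + d c z < d r z + e"
        using d_cross[OF snoc(2,5) rA _ e0, of z] zP snoc(4) by auto
      then show ?thesis using d_piece[of P c z] QP zP by auto
    qed
  qed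
  then show ?case by simp
qed

lemma two_convex_piece: "r \<in> X \<Longrightarrow> P \<in> \<P> \<Longrightarrow> two_convex_on P (d r)"
  using galleries two_convex_gallery by blast

end

section \<open>Gluing convex functions on adjacent intervals\<close>

lemma convex_on_eq:
  assumes "convex_on S f" "\<forall>x\<in>S. g x = f x" shows "convex_on S g"
proof (rule convex_onI)
  show "convex S" using assms by (simp add: convex_on_def)
  fix t x y assume t: "0 < t" "t < (1::real)" and xy: "x \<in> S" "y \<in> S"
  have "(1 - t) *\<^sub>R x + t *\<^sub>R y \<in> S" using convexD_alt[OF \<open>convex S\<close> xy, of t] t by simp
  then show "g ((1 - t) *\<^sub>R x + t *\<^sub>R y) \<le> (1 - t) * g x + t * g y"
    using convex_onD[OF assms(1), of t x y] t xy assms(2) by simp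
qed

text \<open>Convexity across b is a first-order condition: the outward slopes \<open>A\<close> and
  \<open>B\<close> must have nonnegative sum. The error in \<open>mid\<close> is of second order, so
  it disappears after division by \<open>e\<close>.\<close>

lemma convex_on_join:
  fixes \<phi> :: "real \<Rightarrow> real"
  assumes left: "convex_on {a..b} \<phi>" and right: "convex_on {b..c} \<phi>" and ord: "a \<le> b" "b \<le> c"
    and mid: "\<And>e. 0 < e \<Longrightarrow> e < b - a \<Longrightarrow> e < c - b \<Longrightarrow> \<phi> b \<le> (\<phi> (b - e) + \<phi> (b + e)) / 2 + e\<^sup>2"
  shows "convex_on {a..c} \<phi>"
proof (rule convex_on_linorderI)
  fix t x y :: real
  assume t: "0 < t" "t < 1" and x: "x \<in> {a..c}" and y: "y \<in> {a..c}" and xy: "x < y"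
  let ?z = "(1 - t) *\<^sub>R x + t *\<^sub>R y"
  have three: "(v - u) * \<phi> w \<le> (v - w) * \<phi> u + (w - u) * \<phi> v"
    if "convex_on S \<phi>" "u \<in> S" "v \<in> S" "u \<le> w" "w \<le> v" "u < v" for S u v w
  proof -
    define s where "s = (w - u) / (v - u)"
    have s: "0 \<le> s" "s \<le> 1" using that by (auto simp: s_def)
    have w: "w = (1 - s) *\<^sub>R u + s *\<^sub>R v"
    proof -
      have "s * (v - u) = w - u" using that by (simp add: s_def)
      then show ?thesis by (simp add: algebra_simps)
    qed
    have "\<phi> w \<le> (1 - s) * \<phi> u + s * \<phi> v" unfolding w using convex_onD[OF that(1) s] that by auto
    then have "(v - u) * \<phi> w \<le> (v - u) * ((1 - s) * \<phi> u + s * \<phi> v)" using that by simp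
    also have "\<dots> = ((v - u) - s * (v - u)) * \<phi> u + (s * (v - u)) * \<phi> v" by (simp add: algebra_simps)
    also have "s * (v - u) = w - u" using that by (simp add: s_def)
    finally show ?thesis by (simp add: algebra_simps)
  qed
  have zxy: "x \<le> ?z" "?z \<le> y"
  proof -
    have "0 \<le> t * (y - x)" "0 \<le> (1 - t) * (y - x)" using t xy by auto
    then show "x \<le> ?z" "?z \<le> y" by (auto simp: algebra_simps)
  qed
  consider "y \<le> b" | "b \<le> x" | "x < b" "b < y" by linarith
  then show "\<phi> ?z \<le> (1 - t) * \<phi> x + t * \<phi> y"
  proof cases
    case 1
    then show ?thesis using convex_onD[OF left, of t x y] t x y xy by auto
  next
    case 2
    then show ?thesis using convex_onD[OF right, of t x y] t x y xy by auto
  next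
    case 3
    define A where "A = (\<phi> x - \<phi> b) / (b - x)"
    define B where "B = (\<phi> y - \<phi> b) / (y - b)"
    have AB: "- 2 * e \<le> A + B" if e: "0 < e" "e < b - x" "e < y - b" for e
    proof -
      have 1: "(b - x) * \<phi> (b - e) \<le> e * \<phi> x + (b - e - x) * \<phi> b"
        using three[OF left, of x b "b - e"] x ord e 3 by simp
      have 2: "(y - b) * \<phi> (b + e) \<le> (y - (b + e)) * \<phi> b + e * \<phi> y"
        using three[OF right, of b y "b + e"] y ord e 3 by simp
      have 1: "\<phi> (b - e) \<le> \<phi> b + e * A" using 1 3 by (simp add: A_def field_simps)
      have 2: "\<phi> (b + e) \<le> \<phi> b + e * B" using 2 3 by (simp add: B_def field_simps)
      have "\<phi> b \<le> (\<phi> (b - e) + \<phi> (b + e)) / 2 + e\<^sup>2" using mid[of e] e x y by auto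
      then have "0 \<le> e * (A + B) + e * (2 * e)" using 1 2 by (simp add: field_simps power2_eq_square)
      then have "0 \<le> e * (A + B + 2 * e)" by (simp add: algebra_simps)
      then show ?thesis using e by (simp add: zero_le_mult_iff)
    qed
    have "0 \<le> A + B"
    proof (rule ccontr)
      assume n: "\<not> 0 \<le> A + B"
      \<comment> \<open>At most a quarter of the supposed defect: then \<open>- 2 * e\<close> is
        still larger than \<open>A + B\<close>, against \<open>AB\<close>.\<close>
      define e where "e = min (min ((b - x) / 2) ((y - b) / 2)) (- (A + B) / 4)"
      have "0 < e" "e < b - x" "e < y - b" "e \<le> - (A + B) / 4" using 3 n by (auto simp: e_def min_def)
      from AB[OF this(1-3)] this(4) n show False by simp
    qed
    then have "0 \<le> (b - x) * (y - b) * (A + B)" using 3 by simp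
    also have "\<dots> = (y - b) * ((b - x) * A) + (b - x) * ((y - b) * B)" by (simp add: algebra_simps)
    also have "(b - x) * A = \<phi> x - \<phi> b" using 3 by (simp add: A_def)
    also have "(y - b) * B = \<phi> y - \<phi> b" using 3 by (simp add: B_def)
    finally have b: "(y - x) * \<phi> b \<le> (y - b) * \<phi> x + (b - x) * \<phi> y" by (simp add: algebra_simps)
    have "(y - x) * \<phi> ?z \<le> (y - ?z) * \<phi> x + (?z - x) * \<phi> y"
    proof (cases "?z \<le> b")
      case True
      have "(b - x) * \<phi> ?z \<le> (b - ?z) * \<phi> x + (?z - x) * \<phi> b"
        using three[OF left, of x b ?z] x ord True zxy 3 by simp
      then have "(y - x) * ((b - x) * \<phi> ?z) \<le> (y - x) * ((b - ?z) * \<phi> x + (?z - x) * \<phi> b)"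
        using xy by (intro mult_left_mono) auto
      also have "\<dots> = (y - x) * (b - ?z) * \<phi> x + (?z - x) * ((y - x) * \<phi> b)"
        by (simp only: ring_distribs mult_ac)
      also have "\<dots> \<le> (y - x) * (b - ?z) * \<phi> x + (?z - x) * ((y - b) * \<phi> x + (b - x) * \<phi> y)"
        using b zxy by (intro add_left_mono mult_left_mono) auto
      also have "\<dots> = (b - x) * ((y - ?z) * \<phi> x + (?z - x) * \<phi> y)"
        by (simp add: algebra_simps)
      finally have "(b - x) * ((y - x) * \<phi> ?z) \<le> (b - x) * ((y - ?z) * \<phi> x + (?z - x) * \<phi> y)"
        by (simp only: mult_ac)
      then show ?thesis using 3 by (simp only: mult_le_cancel_left_pos diff_gt_0_iff_gt)
    next
      case False
      have "(y - b) * \<phi> ?z \<le> (y - ?z) * \<phi> b + (?z - b) * \<phi> y"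
        using three[OF right, of b y ?z] y ord False zxy 3 by simp
      then have "(y - x) * ((y - b) * \<phi> ?z) \<le> (y - x) * ((y - ?z) * \<phi> b + (?z - b) * \<phi> y)"
        using xy by (intro mult_left_mono) auto
      also have "\<dots> = (y - ?z) * ((y - x) * \<phi> b) + (y - x) * (?z - b) * \<phi> y"
        by (simp only: ring_distribs mult_ac)
      also have "\<dots> \<le> (y - ?z) * ((y - b) * \<phi> x + (b - x) * \<phi> y) + (y - x) * (?z - b) * \<phi> y"
        using b zxy by (intro add_right_mono mult_left_mono) auto
      also have "\<dots> = (y - b) * ((y - ?z) * \<phi> x + (?z - x) * \<phi> y)"
        by (simp add: algebra_simps)
      finally have "(y - b) * ((y - x) * \<phi> ?z) \<le> (y - b) * ((y - ?z) * \<phi> x + (?z - x) * \<phi> y)"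
        by (simp only: mult_ac)
      then show ?thesis using 3 by (simp only: mult_le_cancel_left_pos diff_gt_0_iff_gt)
    qed
    then have "(y - x) * \<phi> ?z \<le> (y - x) * ((1 - t) * \<phi> x + t * \<phi> y)"
      by (simp add: algebra_simps)
    then show ?thesis using xy by simp
  qed
qed simp

section \<open>Geodesics through galleries\<close>

context tree_of_pieces
begin

text \<open>Subtracting the square of t turns the CN inequality at all ratios into ordinary
  convexity in one variable, which can be verified on subintervals and glued.\<close>

definition convex_geodesic :: "'w \<Rightarrow> 'w \<Rightarrow> (real \<Rightarrow> 'w) \<Rightarrow> bool" where
  "convex_geodesic x y \<gamma> \<longleftrightarrow> \<gamma> 0 = x \<and> \<gamma> (d x y) = y \<and> (\<forall>t\<in>{0..d x y}. \<gamma> t \<in> X) \<and>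
     (\<forall>s\<in>{0..d x y}. \<forall>t\<in>{0..d x y}. d (\<gamma> s) (\<gamma> t) = \<bar>s - t\<bar>) \<and>
     (\<forall>r\<in>X. convex_on {0..d x y} (\<lambda>t. (d r (\<gamma> t))\<^sup>2 - t\<^sup>2))"

lemma convex_geodesic_midpoint:
  assumes g: "convex_geodesic x y \<gamma>" and xy: "x \<in> X" "y \<in> X"
  shows "\<exists>m\<in>X. \<forall>r\<in>X. (d r m)\<^sup>2 \<le> ((d r x)\<^sup>2 + (d r y)\<^sup>2) / 2 - (d x y)\<^sup>2 / 4"
proof (intro bexI ballI)
  let ?L = "d x y"
  have L: "0 \<le> ?L" using d_nonneg xy by auto
  show "\<gamma> (?L / 2) \<in> X" using g L unfolding convex_geodesic_def by auto
  fix r assume r: "r \<in> X"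
  have "convex_on {0..?L} (\<lambda>t. (d r (\<gamma> t))\<^sup>2 - t\<^sup>2)" using g r unfolding convex_geodesic_def by auto
  from convex_onD[OF this, of "1/2" 0 ?L] L
  have "(d r (\<gamma> (?L / 2)))\<^sup>2 - (?L / 2)\<^sup>2 \<le> (1 / 2) * (d r (\<gamma> 0))\<^sup>2 + (1 / 2) * ((d r (\<gamma> ?L))\<^sup>2 - ?L\<^sup>2)"
    by (simp add: field_simps)
  moreover have "\<gamma> 0 = x" "\<gamma> ?L = y" using g unfolding convex_geodesic_def by auto
  ultimately show "(d r (\<gamma> (?L / 2)))\<^sup>2 \<le> ((d r x)\<^sup>2 + (d r y)\<^sup>2) / 2 - ?L\<^sup>2 / 4"
    by (simp add: field_simps power2_eq_square)
qed

text \<open>The triangle inequality bounds the difference of the two distances by \<open>l\<close>,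
  and this turns the quadratic bound into a linear one.\<close>

lemma midpoint_linear:
  assumes "r \<in> X" "x \<in> X" "y \<in> X" "m \<in> X" and m: "(d r m)\<^sup>2 \<le> ((d r x)\<^sup>2 + (d r y)\<^sup>2) / 2 - l\<^sup>2 / 4"
    and l: "l = d x y"
  shows "d r m \<le> (d r x + d r y) / 2"
proof -
  have "\<bar>d r x - d r y\<bar> \<le> l"
    using d_triangle[of r x y] d_triangle[of r y x] d_commute[of x y] assms by auto
  then have "\<bar>d r x - d r y\<bar>\<^sup>2 \<le> l\<^sup>2" by (intro power_mono) auto
  then have "(d r m)\<^sup>2 \<le> ((d r x + d r y) / 2)\<^sup>2" using m by (simp add: power2_eq_square field_simps)
  moreover have "0 \<le> (d r x + d r y) / 2" using d_nonneg assms by auto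
  ultimately show ?thesis by (rule power2_le_imp_le)
qed

lemma segment_convex:
  assumes P: "P \<in> \<P>" and \<gamma>: "\<And>t. t \<in> {a..b} \<Longrightarrow> \<gamma> t \<in> P" and r: "r \<in> X"
    and aff: "\<And>s t u. \<gamma> ((1 - u) *\<^sub>R s + u *\<^sub>R t) = (1 - u) *\<^sub>R \<gamma> s + u *\<^sub>R \<gamma> t"
    and dist: "\<And>s t. norm (\<gamma> s - \<gamma> t) = \<bar>s - t\<bar>"
  shows "convex_on {a..b} (\<lambda>t. (d r (\<gamma> t))\<^sup>2 - t\<^sup>2)"
proof (rule convex_onI)
  fix u s t :: real assume u: "0 < u" "u < 1" and st: "s \<in> {a..b}" "t \<in> {a..b}"
  have "(d r ((1 - u) *\<^sub>R \<gamma> s + u *\<^sub>R \<gamma> t))\<^sup>2 \<le> (1 - u) * (d r (\<gamma> s))\<^sup>2 + u * (d r (\<gamma> t))\<^sup>2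
      - u * (1 - u) * (norm (\<gamma> s - \<gamma> t))\<^sup>2"
    using two_convex_piece[OF r P] u st \<gamma> unfolding two_convex_on_def by auto
  then show "(d r (\<gamma> ((1 - u) *\<^sub>R s + u *\<^sub>R t)))\<^sup>2 - ((1 - u) *\<^sub>R s + u *\<^sub>R t)\<^sup>2
      \<le> (1 - u) * ((d r (\<gamma> s))\<^sup>2 - s\<^sup>2) + u * ((d r (\<gamma> t))\<^sup>2 - t\<^sup>2)"
    unfolding aff dist power2_abs by (simp add: power2_eq_square algebra_simps)
qed simp

text \<open>The convexity condition at the point \<open>a\<close> where a geodesic passes a gate.
  Minimality of \<open>a\<close> on the gate is used through its first variation,
  \<open>star\<close>: the angles at \<open>a\<close> towards any gate point add up to at least a
  straight angle. Then \<open>a\<close> is at least as close to the far midpoints as in a Euclidean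
  triangle with corners z1, z2, c, in which \<open>a\<close> would be the midpoint of the side z1
  z2.\<close>

lemma joint_convex:
  assumes W: "\<P> = A \<union> B" "\<Union>A \<inter> \<Union>B \<subseteq> Q \<inter> P" "Q \<in> A" "P \<in> B"
    and z: "z1 \<in> \<Union>A" "z2 \<in> P" "a \<in> Q \<inter> P" and e: "d z1 a = e" "norm (a - z2) = e"
    and min: "\<And>b. b \<in> Q \<inter> P \<Longrightarrow> 2 * e \<le> d z1 b + norm (b - z2)"
    and geo: "\<And>c. c \<in> Q \<inter> P \<Longrightarrow> \<exists>\<gamma>. convex_geodesic z1 c \<gamma>"
    and r: "r \<in> X"
  shows "d r a \<le> (d r z1 + d r z2) / 2"
proof -
  have QP: "Q \<in> \<P>" "P \<in> \<P>" using W by auto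
  have inX: "z1 \<in> X" "z2 \<in> X" "a \<in> X" using z QP W(1) by auto
  have tc: "two_convex_on (Q \<inter> P) (d z1)" using two_convex_piece[OF inX(1) QP(2)] by (auto simp: two_convex_on_def)
  \<comment> \<open>Compare \<open>a\<close> with the point \<open>b\<close> a little further
    towards \<open>c\<close>: two-convexity of both squared distances against minimality at
    \<open>a\<close>, divided by \<delta>, in the limit \<delta> to 0.\<close>
  have star: "2 * e\<^sup>2 + 2 * (norm (a - c))\<^sup>2 \<le> (d z1 c)\<^sup>2 + (norm (c - z2))\<^sup>2" if c: "c \<in> Q \<inter> P" for c
  proof -
    define D where "D = (norm (a - c))\<^sup>2"
    define K where "K = (d z1 c)\<^sup>2 + (norm (c - z2))\<^sup>2 - 2 * e\<^sup>2"
    have "2 * (1 - \<delta>) * D \<le> K" if \<delta>: "0 < \<delta>" "\<delta> < 1" for \<delta>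
    proof -
      define b where "b = (1 - \<delta>) *\<^sub>R a + \<delta> *\<^sub>R c"
      have bG: "b \<in> Q \<inter> P" unfolding b_def
        by (rule convexD_alt[OF convex_Int[OF convex_piece[OF QP(1)] convex_piece[OF QP(2)]] z(3) c]) (use \<delta> in auto)
      have 1: "(d z1 b)\<^sup>2 \<le> (1 - \<delta>) * e\<^sup>2 + \<delta> * (d z1 c)\<^sup>2 - \<delta> * (1 - \<delta>) * D"
        using tc z(3) c \<delta> unfolding two_convex_on_def b_def D_def e(1)[symmetric] by auto
      have 2: "(norm (b - z2))\<^sup>2 = (1 - \<delta>) * e\<^sup>2 + \<delta> * (norm (c - z2))\<^sup>2 - \<delta> * (1 - \<delta>) * D"
        using norm_combination_sq[of z2 \<delta> a c] unfolding b_def D_def e(2)[symmetric]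
        by (simp add: norm_minus_commute)
      have e0: "0 \<le> e" using e(2) norm_ge_zero[of "a - z2"] by simp
      have "(2 * e)\<^sup>2 \<le> (d z1 b + norm (b - z2))\<^sup>2" using min[OF bG] e0 by (intro power_mono) auto
      also have "\<dots> \<le> 2 * ((d z1 b)\<^sup>2 + (norm (b - z2))\<^sup>2)"
        using sum_squares_bound[of "d z1 b" "norm (b - z2)"] by (simp add: power2_eq_square algebra_simps)
      finally have "4 * e\<^sup>2 \<le> 2 * ((d z1 b)\<^sup>2 + (norm (b - z2))\<^sup>2)" by (simp add: power2_eq_square)
      then have "2 * e\<^sup>2 \<le> 2 * (1 - \<delta>) * e\<^sup>2 + \<delta> * ((d z1 c)\<^sup>2 + (norm (c - z2))\<^sup>2) - 2 * (\<delta> * (1 - \<delta>) * D)"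
        using 1 2 by (simp add: algebra_simps)
      then have "\<delta> * (2 * (1 - \<delta>) * D) \<le> \<delta> * K" by (simp add: K_def algebra_simps)
      then show ?thesis using \<delta> by simp
    qed
    then have ev: "\<forall>\<^sub>F \<delta> in at_right 0. 2 * (1 - \<delta>) * D \<le> K"
      unfolding eventually_at_right_field by (intro exI[of _ 1]) simp
    have "((\<lambda>\<delta>. 2 * (1 - \<delta>) * D) \<longlongrightarrow> 2 * (1 - 0) * D) (at_right 0)" by (intro tendsto_intros)
    from tendsto_upperbound[OF this ev] show ?thesis by (simp add: K_def D_def)
  qed
  show ?thesis
  proof (rule field_le_epsilon)
    fix \<eta> :: real assume \<eta>: "\<eta> > 0"
    show "d r a \<le> (d r z1 + d r z2) / 2 + \<eta>"
    proof (cases "r \<in> \<Union>A")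
      case True
      \<comment> \<open>A nearly optimal chain from \<open>r\<close> to z2 passes the gate at
        \<open>c\<close>. The midpoint m of z1 and \<open>c\<close> has distance at most half of
        \<open>norm (c - z2)\<close> from \<open>a\<close>, as for a midline of a triangle.\<close>
      obtain c where c: "c \<in> Q \<inter> P" and c': "d r c + d c z2 < d r z2 + \<eta>"
        using d_cross[OF W(1,2) True _ \<eta>, of z2] z W(4) by auto
      have cX: "c \<in> X" using c QP by auto
      have cz: "d c z2 = norm (c - z2)" using d_piece[OF QP(2)] c z by auto
      obtain \<gamma> where "convex_geodesic z1 c \<gamma>" using geo[OF c] by blast
      from convex_geodesic_midpoint[OF this inX(1) cX] obtain m where m: "m \<in> X"
        "\<And>r. r \<in> X \<Longrightarrow> (d r m)\<^sup>2 \<le> ((d r z1)\<^sup>2 + (d r c)\<^sup>2) / 2 - (d z1 c)\<^sup>2 / 4" by blast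
      have rm: "d r m \<le> (d r z1 + d r c) / 2"
        by (rule midpoint_linear[OF r inX(1) cX m(1) m(2)[OF r] HOL.refl])
      have "(d a m)\<^sup>2 \<le> (e\<^sup>2 + (norm (a - c))\<^sup>2) / 2 - (d z1 c)\<^sup>2 / 4"
        using m(2)[OF inX(3)] e(1) d_commute[of a z1] d_piece[OF QP(2), of a c] z c by auto
      also have "\<dots> \<le> (norm (c - z2) / 2)\<^sup>2" using star[OF c] by (simp add: power_divide field_simps)
      finally have "d a m \<le> norm (c - z2) / 2" by (rule power2_le_imp_le) simp
      then have "d r a \<le> (d r z1 + d r c) / 2 + norm (c - z2) / 2"
        using d_triangle[OF r m(1) inX(3)] rm d_commute[of a m] by linarith
      then show ?thesis using c' cz \<eta> by (simp add: field_simps)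
    next
      case False
      then have rB: "r \<in> \<Union>B" using r W(1) by auto
      \<comment> \<open>The mirror case: the chain from z1 to \<open>r\<close> passes the gate, and
        the midpoint of \<open>c\<close> and z2 is the affine one inside the flat piece
        \<open>P\<close>.\<close>
      obtain c where c: "c \<in> Q \<inter> P" and c': "d z1 c + d c r < d z1 r + \<eta>"
        using d_cross[OF W(1,2) z(1) rB \<eta>] by auto
      have cX: "c \<in> X" using c QP by auto
      define m where "m = (1 - 1/2) *\<^sub>R c + (1/2) *\<^sub>R z2"
      have mP: "m \<in> P" unfolding m_def
        using convexD_alt[OF convex_piece[OF QP(2)], of c z2 "1/2"] c z by simp
      then have mX: "m \<in> X" using QP by auto
      have cz: "d c z2 = norm (c - z2)" using d_piece[OF QP(2)] c z by auto
      have "(d r m)\<^sup>2 \<le> (1 - 1/2) * (d r c)\<^sup>2 + 1/2 * (d r z2)\<^sup>2 - 1/2 * (1 - 1/2) * (norm (c - z2))\<^sup>2"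
        using two_convex_piece[OF r QP(2)] c z(2) unfolding two_convex_on_def m_def
        by (elim ballE[of _ _ c] ballE[of _ _ z2] allE[of _ "1/2"]) simp_all
      then have "(d r m)\<^sup>2 \<le> ((d r c)\<^sup>2 + (d r z2)\<^sup>2) / 2 - (norm (c - z2))\<^sup>2 / 4" by (simp add: field_simps)
      from midpoint_linear[OF r cX inX(2) mX this cz[symmetric]]
      have rm: "d r m \<le> (d r c + d r z2) / 2" .
      have "(norm (a - m))\<^sup>2 = (1 - 1/2) * (norm (a - c))\<^sup>2 + (1/2) * e\<^sup>2 - (1/2) * (1 - 1/2) * (norm (c - z2))\<^sup>2"
        unfolding m_def norm_combination_sq e(2) ..
      also have "\<dots> \<le> (d z1 c / 2)\<^sup>2" using star[OF c] by (simp add: power_divide field_simps)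
      finally have "norm (a - m) \<le> d z1 c / 2"
        by (rule power2_le_imp_le) (use d_nonneg inX cX in auto)
      moreover have "d m a = norm (a - m)" using d_piece[OF QP(2), of m a] mP z by (auto simp: norm_minus_commute)
      ultimately have "d r a \<le> (d r c + d r z2) / 2 + d z1 c / 2"
        using d_triangle[OF r mX inX(3)] rm by linarith
      then show ?thesis using c' \<eta> d_commute[of c r] d_commute[of z1 r] by (simp add: field_simps)
    qed
  qed
qed

text \<open>Go to the gate point that minimises the total length, then straight on through the last
  piece. Recording that the geodesic stays in the union of the gallery keeps each of its points in a
  piece from which a shorter gallery to the gate is available; \<open>joint_convex\<close> needs
  geodesics from such points.\<close>

lemma geodesic_in_gallery:
  assumes "gallery \<P> Ps" "length Ps = n" "x \<in> hd Ps" "y \<in> last Ps"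
  shows "\<exists>\<gamma>. convex_geodesic x y \<gamma> \<and> (\<forall>t\<in>{0..d x y}. \<gamma> t \<in> \<Union>(set Ps))"
  using assms
proof (induction n arbitrary: Ps x y rule: less_induct)
  case (less n)
  have segment: "\<exists>\<gamma>. convex_geodesic x y \<gamma> \<and> (\<forall>t\<in>{0..d x y}. \<gamma> t \<in> P)"
    if P: "P \<in> \<P>" "x \<in> P" "y \<in> P" for P x y
  proof (cases "x = y")
    case True
    then have "d x y = 0" using d_piece[OF P] by simp
    moreover have "convex_on {0..0} f" for f :: "real \<Rightarrow> real"
      by (rule convex_onI) (auto simp: algebra_simps)
    ultimately have "convex_geodesic x y (\<lambda>_. x)" using P True by (auto simp: convex_geodesic_def)
    then show ?thesis using P by blast
  next
    case False
    define L where "L = norm (x - y)"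
    have L: "0 < L" "d x y = L" using False d_piece[OF P] by (auto simp: L_def)
    define \<gamma> where "\<gamma> t = x + (t / L) *\<^sub>R (y - x)" for t
    have inP: "\<gamma> t \<in> P" if "t \<in> {0..L}" for t
    proof -
      have "(1 - t / L) *\<^sub>R x + (t / L) *\<^sub>R y \<in> P"
        using that L by (intro convexD_alt[OF convex_piece[OF P(1)] P(2,3)]) auto
      moreover have "(1 - t / L) *\<^sub>R x + (t / L) *\<^sub>R y = \<gamma> t" by (simp add: \<gamma>_def algebra_simps)
      ultimately show ?thesis by simp
    qed
    have dist: "norm (\<gamma> s - \<gamma> t) = \<bar>s - t\<bar>" for s t
    proof -
      have "\<gamma> s - \<gamma> t = ((s - t) / L) *\<^sub>R (y - x)" by (simp add: \<gamma>_def diff_divide_distrib scaleR_diff_left)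
      then show ?thesis using L by (simp add: L_def norm_minus_commute)
    qed
    have aff: "\<gamma> ((1 - u) *\<^sub>R s + u *\<^sub>R t) = (1 - u) *\<^sub>R \<gamma> s + u *\<^sub>R \<gamma> t" for s t u
      by (simp add: \<gamma>_def scaleR_add_right scaleR_add_left scaleR_diff_left add_divide_distrib diff_divide_distrib)
    have "convex_on {0..L} (\<lambda>t. (d r (\<gamma> t))\<^sup>2 - t\<^sup>2)" if "r \<in> X" for r
      by (rule segment_convex[OF P(1) inP that aff dist])
    moreover have "\<gamma> 0 = x" "\<gamma> L = y" using L by (auto simp: \<gamma>_def)
    moreover have "d (\<gamma> s) (\<gamma> t) = \<bar>s - t\<bar>" if "s \<in> {0..L}" "t \<in> {0..L}" for s t
      using d_piece[OF P(1) inP[OF that(1)] inP[OF that(2)]] dist by simp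
    moreover have "\<gamma> t \<in> X" if "t \<in> {0..L}" for t using inP[OF that] P(1) by auto
    ultimately have "convex_geodesic x y \<gamma>" unfolding convex_geodesic_def L(2) by blast
    then show ?thesis using inP L(2) by auto
  qed
  show ?case
    using less.prems(1)
  proof (cases rule: gallery.cases)
    case (single P)
    then show ?thesis using segment[of P x y] less.prems by auto
  next
    case (snoc Ps' Q A B P)
    have QP: "Q \<in> \<P>" "P \<in> \<P>" using snoc by auto
    define G where "G = Q \<inter> P"
    have xPs: "x \<in> hd (Ps' @ [Q])" using less.prems(3) snoc(1) by (cases Ps') auto
    have xA: "x \<in> \<Union>A" using xPs snoc(4) by (cases Ps') auto
    have yP: "y \<in> P" using less.prems(4) snoc(1) by simp
    have inX: "x \<in> X" "y \<in> X" using xA yP QP snoc(3) by auto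
    have sub: "\<Union>(set (Ps' @ [Q])) \<subseteq> \<Union>A" using snoc(4) by blast
    obtain c0 where c0: "c0 \<in> G" using snoc(7) G_def by auto
    \<comment> \<open>Gate points farther than \<open>R\<close> from \<open>y\<close> already cost
      more than \<open>c0\<close>, so minimising over a compact part of the gate suffices.\<close>
    define R where "R = d x c0 + norm (c0 - y)"
    have GX: "G \<subseteq> X" using QP by (auto simp: G_def)
    have cG: "compact (G \<inter> cball y R)"
    proof -
      have "G \<inter> cball y R = (Q \<inter> cball y R) \<inter> (P \<inter> cball y R)" by (auto simp: G_def)
      then show ?thesis using compact_Int[OF compact_piece[OF QP(1)] compact_piece[OF QP(2)]] by metis
    qed
    have c0R: "c0 \<in> G \<inter> cball y R"
      using c0 d_nonneg[OF inX(1), of c0] GX by (auto simp: R_def dist_norm norm_minus_commute)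
    have "continuous_on (G \<inter> cball y R) (\<lambda>c. d x c + norm (c - y))"
    proof (intro continuous_intros)
      have "1-lipschitz_on (G \<inter> cball y R) (d x)"
      proof (rule lipschitz_onI)
        fix c c' assume "c \<in> G \<inter> cball y R" "c' \<in> G \<inter> cball y R"
        then have c: "c \<in> Q" "c' \<in> Q" "c \<in> X" "c' \<in> X" using GX by (auto simp: G_def)
        have "d c c' = norm (c - c')" by (rule d_piece[OF QP(1) c(1,2)])
        then show "dist (d x c) (d x c') \<le> 1 * dist c c'"
          using d_triangle[OF inX(1) c(3,4)] d_triangle[OF inX(1) c(4,3)] d_commute[of c c']
          by (simp add: dist_norm)
      qed simp
      then show "continuous_on (G \<inter> cball y R) (d x)" by (rule lipschitz_on_continuous_on)
    qed
    from continuous_attains_inf[OF cG _ this] c0R obtain a where a: "a \<in> G"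
      "\<And>c. c \<in> G \<inter> cball y R \<Longrightarrow> d x a + norm (a - y) \<le> d x c + norm (c - y)" by blast
    have min: "d x a + norm (a - y) \<le> d x c + norm (c - y)" if c: "c \<in> G" for c
    proof (cases "c \<in> cball y R")
      case True then show ?thesis using a(2) c by blast
    next
      case False
      then have "R < norm (c - y)" by (simp add: dist_norm norm_minus_commute)
      moreover have "d x a + norm (a - y) \<le> R" using a(2)[OF c0R] by (simp add: R_def)
      moreover have "c \<in> X" using c GX by blast
      then have "0 \<le> d x c" by (rule d_nonneg[OF inX(1)])
      ultimately show ?thesis by simp
    qed
    define L1 where "L1 = d x a"
    define L2 where "L2 = norm (a - y)"
    have aX: "a \<in> X" using a GX by auto
    have L: "0 \<le> L1" "0 \<le> L2" using d_nonneg[OF inX(1) aX] by (auto simp: L1_def L2_def)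
    have da: "d a y = L2" using d_piece[OF QP(2)] a(1) yP by (auto simp: L2_def G_def)
    have dxy: "d x y = L1 + L2"
    proof (rule antisym)
      show "d x y \<le> L1 + L2" using d_triangle[OF inX(1) aX inX(2)] da by (simp add: L1_def)
      show "L1 + L2 \<le> d x y"
      proof (rule field_le_epsilon)
        fix e :: real assume "e > 0"
        from d_cross[OF snoc(3,6) xA _ this, of y] yP snoc(5) obtain c
          where "c \<in> Q \<inter> P" "d x c + d c y < d x y + e" by auto
        then show "L1 + L2 \<le> d x y + e"
          using min[of c] d_piece[OF QP(2), of c y] yP by (auto simp: G_def L1_def L2_def)
      qed
    qed
    \<comment> \<open>The suffix that begins at the piece of \<open>z\<close> is again a gallery and
      lacks the last piece, so it is shorter.\<close>
    have IH: "\<exists>\<gamma>. convex_geodesic z c \<gamma> \<and> (\<forall>t\<in>{0..d z c}. \<gamma> t \<in> \<Union>(set (Ps' @ [Q])))"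
      if zc: "z \<in> \<Union>(set (Ps' @ [Q]))" "c \<in> Q" for z c
    proof -
      obtain i where i: "i < length (Ps' @ [Q])" "z \<in> (Ps' @ [Q]) ! i" using zc(1) by (metis UnionE in_set_conv_nth)
      let ?D = "drop i (Ps' @ [Q])"
      have 1: "length ?D < n" using less.prems(2) snoc(1) by simp
      have 2: "gallery \<P> ?D" by (rule gallery_drop[OF snoc(2) i(1)])
      have 3: "z \<in> hd ?D" using i hd_drop_conv_nth by metis
      have 4: "c \<in> last ?D" using i zc by (simp add: last_drop)
      from less.IH[OF 1 2 HOL.refl 3 4] obtain \<gamma> where g: "convex_geodesic z c \<gamma>"
        "\<forall>t\<in>{0..d z c}. \<gamma> t \<in> \<Union>(set ?D)" by blast
      have "\<Union>(set ?D) \<subseteq> \<Union>(set (Ps' @ [Q]))" using set_drop_subset[of i "Ps' @ [Q]"] by blast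
      with g show ?thesis by blast
    qed
    have xU: "x \<in> \<Union>(set (Ps' @ [Q]))" using xPs by (cases Ps') auto
    obtain \<gamma>1 where g1: "convex_geodesic x a \<gamma>1" and g1U: "\<And>t. t \<in> {0..L1} \<Longrightarrow> \<gamma>1 t \<in> \<Union>(set (Ps' @ [Q]))"
      using IH[OF xU, of a] a(1) unfolding G_def L1_def by blast
    have g1A: "\<gamma>1 t \<in> \<Union>A" if "t \<in> {0..L1}" for t using g1U[OF that] sub by blast
    have g1X: "\<gamma>1 t \<in> X" if "t \<in> {0..L1}" for t using g1A[OF that] snoc(3) by auto
    have g1': "\<gamma>1 0 = x" "\<gamma>1 L1 = a" "\<And>s t. s \<in> {0..L1} \<Longrightarrow> t \<in> {0..L1} \<Longrightarrow> d (\<gamma>1 s) (\<gamma>1 t) = \<bar>s - t\<bar>"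
      "\<And>r. r \<in> X \<Longrightarrow> convex_on {0..L1} (\<lambda>t. (d r (\<gamma>1 t))\<^sup>2 - t\<^sup>2)"
      using g1 unfolding convex_geodesic_def L1_def[symmetric] by blast+
    show ?thesis
    proof (cases "L2 = 0")
      case True
      then have "a = y" by (simp add: L2_def)
      have "\<Union>(set (Ps' @ [Q])) \<subseteq> \<Union>(set Ps)" using snoc(1) by auto
      then have "\<forall>t\<in>{0..d x y}. \<gamma>1 t \<in> \<Union>(set Ps)" using g1U \<open>a = y\<close> L1_def by blast
      then show ?thesis using g1 \<open>a = y\<close> by blast
    next
      case False
      then have L2: "L2 > 0" using L by simp
      define \<gamma>2 where "\<gamma>2 t = a + ((t - L1) / L2) *\<^sub>R (y - a)" for t
      define \<gamma> where "\<gamma> t = (if t \<le> L1 then \<gamma>1 t else \<gamma>2 t)" for t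
      have g2a: "\<gamma>2 L1 = a" "\<gamma>2 (L1 + L2) = y" using L2 by (auto simp: \<gamma>2_def)
      have gL: "\<gamma> t = \<gamma>1 t" if "t \<le> L1" for t using that by (simp add: \<gamma>_def)
      have gR: "\<gamma> t = \<gamma>2 t" if "L1 \<le> t" for t using that g2a g1' by (auto simp: \<gamma>_def)
      have inP: "\<gamma>2 t \<in> P" if "t \<in> {L1..L1 + L2}" for t
      proof -
        have "(1 - (t - L1) / L2) *\<^sub>R a + ((t - L1) / L2) *\<^sub>R y \<in> P"
          using that L2 a(1) yP by (intro convexD_alt[OF convex_piece[OF QP(2)]]) (auto simp: G_def)
        moreover have "(1 - (t - L1) / L2) *\<^sub>R a + ((t - L1) / L2) *\<^sub>R y = \<gamma>2 t"
          by (simp add: \<gamma>2_def scaleR_diff_left scaleR_diff_right)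
        ultimately show ?thesis by simp
      qed
      have dist: "norm (\<gamma>2 s - \<gamma>2 t) = \<bar>s - t\<bar>" for s t
      proof -
        have "\<gamma>2 s - \<gamma>2 t = ((s - t) / L2) *\<^sub>R (y - a)"
          by (simp add: \<gamma>2_def diff_divide_distrib scaleR_diff_left)
        then show ?thesis using L2 by (simp add: L2_def norm_minus_commute)
      qed
      have aff: "\<gamma>2 ((1 - u) *\<^sub>R s + u *\<^sub>R t) = (1 - u) *\<^sub>R \<gamma>2 s + u *\<^sub>R \<gamma>2 t" for s t u
      proof -
        have "((1 - u) *\<^sub>R s + u *\<^sub>R t - L1) / L2 = (1 - u) * ((s - L1) / L2) + u * ((t - L1) / L2)"
          using L2 by (simp add: field_simps)
        then have "\<gamma>2 ((1 - u) *\<^sub>R s + u *\<^sub>R t)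
            = a + ((1 - u) * ((s - L1) / L2) + u * ((t - L1) / L2)) *\<^sub>R (y - a)" by (simp only: \<gamma>2_def)
        also have "\<dots> = (1 - u) *\<^sub>R \<gamma>2 s + u *\<^sub>R \<gamma>2 t"
          unfolding \<gamma>2_def scaleR_add_left scaleR_add_right scaleR_scaleR[symmetric]
          by (simp add: scaleR_diff_left)
        finally show ?thesis .
      qed
      have gX: "\<gamma> t \<in> X" if "t \<in> {0..L1 + L2}" for t
        using g1X[of t] inP[of t] QP that by (cases "t \<le> L1") (auto simp: \<gamma>_def)
      have lo: "d (\<gamma> s) (\<gamma> t) \<le> \<bar>s - t\<bar>" if st: "s \<in> {0..L1 + L2}" "t \<in> {0..L1 + L2}" "s \<le> t" for s t
      proof -
        consider "t \<le> L1" | "L1 \<le> s" | "s \<le> L1" "L1 \<le> t" by linarith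
        then show ?thesis
        proof cases
          case 1 then show ?thesis using g1'(3)[of s t] gL[of s] gL[of t] st by auto
        next
          case 2 then show ?thesis using d_piece[OF QP(2) inP inP, of s t] dist[of s t] gR[of s] gR[of t] st by auto
        next
          case 3
          have "d (\<gamma> s) a = L1 - s" using g1'(2) g1'(3)[of s L1] gL[of s] 3 st L by auto
          moreover have "d a (\<gamma> t) = t - L1"
            using d_piece[OF QP(2) inP inP, of L1 t] dist[of L1 t] g2a gR[of t] 3 st L by auto
          ultimately show ?thesis using d_triangle[OF gX[OF st(1)] aX gX[OF st(2)]] by simp
        qed
      qed
      have ends: "\<gamma> 0 = x" "\<gamma> (L1 + L2) = y" using gL[of 0] gR[of "L1 + L2"] g1' g2a L by auto
      \<comment> \<open>No subpath can be shorter than its parameter length: the ends are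
        \<open>L1 + L2\<close> apart and the two outer parts are bounded by
        \<open>lo\<close>.\<close>
      have dd: "d (\<gamma> s) (\<gamma> t) = \<bar>s - t\<bar>" if st: "s \<in> {0..L1 + L2}" "t \<in> {0..L1 + L2}" "s \<le> t" for s t
      proof (rule antisym[OF lo[OF st]])
        have "L1 + L2 \<le> d x (\<gamma> s) + d (\<gamma> s) (\<gamma> t) + d (\<gamma> t) y"
          using d_triangle[OF inX(1) gX[OF st(1)] inX(2)] d_triangle[OF gX[OF st(1)] gX[OF st(2)] inX(2)] dxy by simp
        moreover have "d x (\<gamma> s) \<le> s" using lo[of 0 s] ends st by auto
        moreover have "d (\<gamma> t) y \<le> L1 + L2 - t" using lo[of t "L1 + L2"] ends st by auto
        ultimately show "\<bar>s - t\<bar> \<le> d (\<gamma> s) (\<gamma> t)" using st(3) by simp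
      qed
      have dist\<gamma>: "d (\<gamma> s) (\<gamma> t) = \<bar>s - t\<bar>" if "s \<in> {0..L1 + L2}" "t \<in> {0..L1 + L2}" for s t
        using dd[OF that] dd[OF that(2,1)] d_commute[of "\<gamma> s" "\<gamma> t"] by (cases "s \<le> t") auto
      have conv: "convex_on {0..L1 + L2} (\<lambda>t. (d r (\<gamma> t))\<^sup>2 - t\<^sup>2)" if r: "r \<in> X" for r
      proof (rule convex_on_join)
        have "convex_on {0..L1} (\<lambda>t. (d r (\<gamma>1 t))\<^sup>2 - t\<^sup>2)" by (rule g1'(4)[OF r])
        moreover have "\<forall>t\<in>{0..L1}. (d r (\<gamma> t))\<^sup>2 - t\<^sup>2 = (d r (\<gamma>1 t))\<^sup>2 - t\<^sup>2" using gL by auto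
        ultimately show "convex_on {0..L1} (\<lambda>t. (d r (\<gamma> t))\<^sup>2 - t\<^sup>2)" by (rule convex_on_eq)
        have "convex_on {L1..L1 + L2} (\<lambda>t. (d r (\<gamma>2 t))\<^sup>2 - t\<^sup>2)" by (rule segment_convex[OF QP(2) inP r aff dist])
        moreover have "\<forall>t\<in>{L1..L1 + L2}. (d r (\<gamma> t))\<^sup>2 - t\<^sup>2 = (d r (\<gamma>2 t))\<^sup>2 - t\<^sup>2" using gR by auto
        ultimately show "convex_on {L1..L1 + L2} (\<lambda>t. (d r (\<gamma> t))\<^sup>2 - t\<^sup>2)" by (rule convex_on_eq)
        show "0 \<le> L1" "L1 \<le> L1 + L2" using L by auto
        fix e assume e: "0 < e" "e < L1 - 0" "e < L1 + L2 - L1"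
        let ?z1 = "\<gamma> (L1 - e)" and ?z2 = "\<gamma> (L1 + e)"
        have z1: "?z1 = \<gamma>1 (L1 - e)" using gL e by simp
        have z2: "?z2 = \<gamma>2 (L1 + e)" using gR e by simp
        have z2P: "?z2 \<in> P" unfolding z2 by (rule inP) (use e in auto)
        have z1U: "?z1 \<in> \<Union>(set (Ps' @ [Q]))" unfolding z1 by (rule g1U) (use e in auto)
        have z1A: "?z1 \<in> \<Union>A" using z1U sub by blast
        have "d r a \<le> (d r ?z1 + d r ?z2) / 2"
        proof (rule joint_convex[OF snoc(3,6) _ snoc(5) z1A z2P _ _ _ _ _ r])
          show "Q \<in> A" using snoc(4) by auto
          show "a \<in> Q \<inter> P" using a(1) by (simp add: G_def)
          show "d ?z1 a = e" unfolding z1 using g1'(2) g1'(3)[of "L1 - e" L1] e L by auto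
          show "norm (a - ?z2) = e" using dist[of L1 "L1 + e"] g2a e unfolding z2 by auto
          show "2 * e \<le> d ?z1 b + norm (b - ?z2)" if b: "b \<in> Q \<inter> P" for b
          proof -
            have bX: "b \<in> X" using b QP by auto
            have zX: "?z1 \<in> X" "?z2 \<in> X" using z1A z2P QP snoc(3) by auto
            have "2 * e = d ?z1 ?z2" using dist\<gamma>[of "L1 - e" "L1 + e"] e by auto
            also have "\<dots> \<le> d ?z1 b + d b ?z2" by (rule d_triangle[OF zX(1) bX zX(2)])
            also have "d b ?z2 = norm (b - ?z2)" using d_piece[OF QP(2)] b z2P by auto
            finally show ?thesis .
          qed
          show "\<exists>\<gamma>. convex_geodesic ?z1 c \<gamma>" if "c \<in> Q \<inter> P" for c using IH[OF z1U, of c] that by blast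
        qed
        moreover have "\<gamma> L1 = a" using gL g1' by simp
        moreover have "0 \<le> d r a" using d_nonneg[OF r aX] .
        ultimately have "(d r (\<gamma> L1))\<^sup>2 \<le> ((d r ?z1 + d r ?z2) / 2)\<^sup>2" by (intro power_mono) auto
        also have "\<dots> \<le> ((d r ?z1)\<^sup>2 + (d r ?z2)\<^sup>2) / 2"
          using sum_squares_bound[of "d r ?z1" "d r ?z2"] by (simp add: power2_eq_square field_simps)
        \<comment> \<open>The mean of the squares of \<open>L1 - e\<close> and \<open>L1 + e\<close>
          exceeds the square of L1 by that of \<open>e\<close>; this is the error allowed in
          \<open>convex_on_join\<close>.\<close>
        finally show "(d r (\<gamma> L1))\<^sup>2 - L1\<^sup>2 \<le> ((d r ?z1)\<^sup>2 - (L1 - e)\<^sup>2 + ((d r ?z2)\<^sup>2 - (L1 + e)\<^sup>2)) / 2 + e\<^sup>2"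
          by (simp add: power2_eq_square field_simps)
      qed
      have "convex_geodesic x y \<gamma>" unfolding convex_geodesic_def dxy using ends gX dist\<gamma> conv by blast
      moreover have "\<gamma> t \<in> \<Union>(set Ps)" if "t \<in> {0..d x y}" for t
        using g1U[of t] inP[of t] that snoc(1) by (cases "t \<le> L1") (auto simp: \<gamma>_def dxy)
      ultimately show ?thesis by blast
    qed
  qed
qed

lemma convex_geodesic_exists: "x \<in> X \<Longrightarrow> y \<in> X \<Longrightarrow> \<exists>\<gamma>. convex_geodesic x y \<gamma>"
  using galleries geodesic_in_gallery by (metis UnionE)

end


section \<open>CAT(0) realizations\<close>

text \<open>The CAT(0) inequality speaks of arbitrary geodesics, the hypothesis of one distinguished
  geodesic \<gamma>. Inserting for \<open>r\<close> the point of \<open>c\<close> itself makes the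
  right side vanish, so both geodesics agree at each parameter.\<close>

lemma geodesic_two_convex:
  assumes c: "geodesic_path Y c x y" and xy: "x \<in> mspace Y" "y \<in> mspace Y"
    and \<gamma>: "geodesic_path Y \<gamma> x y"
    and conv: "\<And>r. r \<in> mspace Y \<Longrightarrow> convex_on {0..mdist Y x y} (\<lambda>t. (mdist Y r (\<gamma> t))\<^sup>2 - t\<^sup>2)"
    and s: "0 \<le> s" "s \<le> 1" and r: "r \<in> mspace Y"
  shows "(mdist Y r (c (s * mdist Y x y)))\<^sup>2
    \<le> (1 - s) * (mdist Y r x)\<^sup>2 + s * (mdist Y r y)\<^sup>2 - s * (1 - s) * (mdist Y x y)\<^sup>2"
proof -
  let ?L = "mdist Y x y"
  have L: "0 \<le> ?L" by simp
  have t: "s * ?L \<in> {0..?L}" using s L by (simp add: mult_left_le_one_le)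
  have ends: "\<gamma> 0 = x" "\<gamma> ?L = y" "c 0 = x" "c ?L = y" using c \<gamma> by (auto simp: geodesic_path_def)
  have bound: "(mdist Y r (\<gamma> (s * ?L)))\<^sup>2
    \<le> (1 - s) * (mdist Y r x)\<^sup>2 + s * (mdist Y r y)\<^sup>2 - s * (1 - s) * ?L\<^sup>2" if r: "r \<in> mspace Y" for r
    using convex_onD[OF conv[OF r], of s 0 ?L] s L ends
    by (simp add: power2_eq_square algebra_simps)
  have cX: "c (s * ?L) \<in> mspace Y" "\<gamma> (s * ?L) \<in> mspace Y"
    using c \<gamma> t unfolding geodesic_path_def by blast+
  have dc: "mdist Y (c (s * ?L)) x = s * ?L" "mdist Y (c (s * ?L)) y = (1 - s) * ?L"
  proof -
    have D: "\<forall>u\<in>{0..?L}. \<forall>v\<in>{0..?L}. mdist Y (c u) (c v) = \<bar>u - v\<bar>" using c by (auto simp: geodesic_path_def)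
    have "mdist Y (c (s * ?L)) (c 0) = \<bar>s * ?L - 0\<bar>" "mdist Y (c (s * ?L)) (c ?L) = \<bar>s * ?L - ?L\<bar>"
      using D t L by auto
    moreover have "\<bar>s * ?L - ?L\<bar> = (1 - s) * ?L" using t by (simp add: algebra_simps)
    moreover have "\<bar>s * ?L\<bar> = s * ?L" using t by simp
    ultimately show "mdist Y (c (s * ?L)) x = s * ?L" "mdist Y (c (s * ?L)) y = (1 - s) * ?L" by (simp_all add: ends)
  qed
  have "(mdist Y (c (s * ?L)) (\<gamma> (s * ?L)))\<^sup>2 \<le> 0"
    using bound[OF cX(1)] unfolding dc by (simp add: power2_eq_square algebra_simps)
  then have "mdist Y (c (s * ?L)) (\<gamma> (s * ?L)) = 0" by simp
  then have "c (s * ?L) = \<gamma> (s * ?L)" using cX by simp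
  then show ?thesis using bound[OF r] by simp
qed

text \<open>The distance from the first vertex determines the position on the side and on its
  comparison side alike, so one ratio \<open>s\<close> serves both. On a degenerate side both
  lengths are 0 and any \<open>s\<close> fits.\<close>

lemma comparison_side_param:
  assumes cs: "comparison_on_side Y p A p' q' x x'" and seg: "geodesic_segment Y p q A"
    and pq: "p \<in> mspace Y" "q \<in> mspace Y" and pq': "dist p' q' = mdist Y p q"
    and geo: "\<And>x y. x \<in> mspace Y \<Longrightarrow> y \<in> mspace Y \<Longrightarrow> \<exists>\<gamma>. geodesic_path Y \<gamma> x y \<and>
       (\<forall>r\<in>mspace Y. convex_on {0..mdist Y x y} (\<lambda>t. (mdist Y r (\<gamma> t))\<^sup>2 - t\<^sup>2))"
  shows "\<exists>s. 0 \<le> s \<and> s \<le> 1 \<and> x \<in> mspace Y \<and> x' = (1 - s) *\<^sub>R p' + s *\<^sub>R q' \<and>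
    (\<forall>r\<in>mspace Y. (mdist Y r x)\<^sup>2 \<le> (1 - s) * (mdist Y r p)\<^sup>2 + s * (mdist Y r q)\<^sup>2 - s * (1 - s) * (mdist Y p q)\<^sup>2)"
proof -
  let ?L = "mdist Y p q"
  from seg obtain c where c: "geodesic_path Y c p q" "A = c ` {0..?L}" by (auto simp: geodesic_segment_def)
  obtain t where t: "t \<in> {0..?L}" "x = c t" using cs c by (auto simp: comparison_on_side_def)
  have xX: "x \<in> mspace Y" using c t by (auto simp: geodesic_path_def)
  obtain s where s: "0 \<le> s" "s \<le> 1" "x' = (1 - s) *\<^sub>R p' + s *\<^sub>R q'"
    using cs by (auto simp: comparison_on_side_def closed_segment_def)
  have "dist p' x' = s * ?L"
  proof -
    have "p' - x' = s *\<^sub>R (p' - q')" using s(3) by (simp add: algebra_simps)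
    then show ?thesis using s pq' by (simp add: dist_norm)
  qed
  moreover have "mdist Y p x = t"
  proof -
    have "mdist Y (c 0) (c t) = \<bar>0 - t\<bar>" using c t unfolding geodesic_path_def by auto
    then show ?thesis using c t by (simp add: geodesic_path_def)
  qed
  ultimately have ts: "t = s * ?L" using cs by (simp add: comparison_on_side_def)
  obtain \<gamma> where "geodesic_path Y \<gamma> p q"
    "\<And>r. r \<in> mspace Y \<Longrightarrow> convex_on {0..mdist Y p q} (\<lambda>t. (mdist Y r (\<gamma> t))\<^sup>2 - t\<^sup>2)"
    using geo[OF pq] by blast
  from geodesic_two_convex[OF c(1) pq this s(1,2)] show ?thesis
    using s xX unfolding t(2) ts by blast
qed

text \<open>The CN inequality is applied twice, first seen from a vertex to the point
  \<open>x\<close> and then seen from \<open>x\<close> to \<open>y\<close>. In the plane the same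
  combination is an equality by Stewart's theorem.\<close>

lemma CAT0_spaceI:
  assumes ne: "mspace Y \<noteq> {}"
    and geo: "\<And>x y. x \<in> mspace Y \<Longrightarrow> y \<in> mspace Y \<Longrightarrow> \<exists>\<gamma>. geodesic_path Y \<gamma> x y \<and>
       (\<forall>r\<in>mspace Y. convex_on {0..mdist Y x y} (\<lambda>t. (mdist Y r (\<gamma> t))\<^sup>2 - t\<^sup>2))"
  shows "CAT0_space Y"
  unfolding CAT0_space_def
proof (intro conjI ballI allI impI)
  show "mspace Y \<noteq> {}" by (rule ne)
  show "geodesic_space Y" using geo unfolding geodesic_space_def by blast
  fix p q r A B C
  assume v: "p \<in> mspace Y" "q \<in> mspace Y" "r \<in> mspace Y"
    and seg: "geodesic_segment Y p q A \<and> geodesic_segment Y q r B \<and> geodesic_segment Y r p C"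
  show "CAT0_inequality Y (p, q, r) (A, B, C)"
    unfolding CAT0_inequality_def prod.case
  proof (intro allI impI)
    fix p' q' r' x y x' y'
    assume D: "dist p' q' = mdist Y p q \<and> dist q' r' = mdist Y q r \<and> dist r' p' = mdist Y r p"
      and xy: "comparison_point Y (p, q, r) (A, B, C) (p', q', r') x x' \<and>
        comparison_point Y (p, q, r) (A, B, C) (p', q', r') y y'"
    define V where "V = {(p, p'), (q, q'), (r, r')}"
    have VV: "mdist Y a b = dist a' b'" if "(a, a') \<in> V" "(b, b') \<in> V" for a a' b b'
      using that D v mdist_commute[of Y] by (auto simp: V_def dist_commute)
    have VX: "a \<in> mspace Y" if "(a, a') \<in> V" for a a' using that v by (auto simp: V_def)
    \<comment> \<open>Forgets on which side a point lies and keeps only its two weighted vertices,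
      which treats all pairs of sides at once, including equal ones.\<close>
    define good where "good z z' \<longleftrightarrow> z \<in> mspace Y \<and> (\<exists>a a' b b' s. (a, a') \<in> V \<and> (b, b') \<in> V \<and> 0 \<le> s \<and> s \<le> 1
      \<and> z' = (1 - s) *\<^sub>R a' + s *\<^sub>R b' \<and> (\<forall>w\<in>mspace Y. (mdist Y w z)\<^sup>2
        \<le> (1 - s) * (mdist Y w a)\<^sup>2 + s * (mdist Y w b)\<^sup>2 - s * (1 - s) * (mdist Y a b)\<^sup>2))" for z z'
    have good: "good z z'" if "comparison_point Y (p, q, r) (A, B, C) (p', q', r') z z'" for z z'
    proof -
      from that have cases: "comparison_on_side Y p A p' q' z z' \<or> comparison_on_side Y q B q' r' z z'
        \<or> comparison_on_side Y r C r' p' z z'" unfolding comparison_point_def prod.case .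
      consider "comparison_on_side Y p A p' q' z z'" | "comparison_on_side Y q B q' r' z z'"
        | "comparison_on_side Y r C r' p' z z'" using cases by blast
      then show ?thesis
      proof cases
        case 1
        with comparison_side_param[OF this _ v(1,2) _ geo] seg D show ?thesis unfolding good_def V_def by blast
      next
        case 2
        with comparison_side_param[OF this _ v(2,3) _ geo] seg D show ?thesis unfolding good_def V_def by blast
      next
        case 3
        with comparison_side_param[OF this _ v(3,1) _ geo] seg D show ?thesis unfolding good_def V_def by blast
      qed
    qed
    have step: "mdist Y w z \<le> dist w' z'"
      if w: "w \<in> mspace Y" and g: "good z z'" and le: "\<And>a a'. (a, a') \<in> V \<Longrightarrow> mdist Y w a \<le> dist w' a'" for w w' z z'
    proof -
      obtain a a' b b' s where ab: "(a, a') \<in> V" "(b, b') \<in> V" and s: "0 \<le> s" "s \<le> 1"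
        and z': "z' = (1 - s) *\<^sub>R a' + s *\<^sub>R b'" and ineq: "(mdist Y w z)\<^sup>2
        \<le> (1 - s) * (mdist Y w a)\<^sup>2 + s * (mdist Y w b)\<^sup>2 - s * (1 - s) * (mdist Y a b)\<^sup>2"
        using g w unfolding good_def by blast
      note ineq
      also have "(1 - s) * (mdist Y w a)\<^sup>2 + s * (mdist Y w b)\<^sup>2 - s * (1 - s) * (mdist Y a b)\<^sup>2
        \<le> (1 - s) * (dist w' a')\<^sup>2 + s * (dist w' b')\<^sup>2 - s * (1 - s) * (dist a' b')\<^sup>2"
        unfolding VV[OF ab] using le[OF ab(1)] le[OF ab(2)] s
        by (intro diff_right_mono add_mono mult_left_mono power_mono) auto
      also have "\<dots> = (dist w' z')\<^sup>2" unfolding z' dist_norm norm_combination_sq ..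
      finally show ?thesis by (rule power2_le_imp_le) simp
    qed
    have gx: "good x x'" and gy: "good y y'" using good xy by auto
    have "mdist Y x a \<le> dist x' a'" if a: "(a, a') \<in> V" for a a'
    proof -
      have "mdist Y a x \<le> dist a' x'"
        by (rule step[OF VX[OF a] gx]) (use VV[OF a] in auto)
      then show ?thesis by (simp add: mdist_commute dist_commute)
    qed
    then show "mdist Y x y \<le> dist x' y'"
      using step[OF _ gy, of x x'] gx unfolding good_def by blast
  qed
qed

section \<open>Completeness of the chain metric\<close>

locale separated_tree_of_pieces = tree_of_pieces \<P> for \<P> :: "'w::real_inner set set" +
  fixes \<V> :: "'w set set"
  assumes vertex_pieces: "\<V> \<subseteq> \<P>"
    and separated: "E \<in> \<V> \<Longrightarrow> E' \<in> \<V> \<Longrightarrow> E \<noteq> E' \<Longrightarrow> x \<in> E \<Longrightarrow> y \<in> E' \<Longrightarrow> 1 \<le> norm (x - y)"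
    and meet: "P \<in> \<P> \<Longrightarrow> Q \<in> \<P> \<Longrightarrow> P \<noteq> Q \<Longrightarrow> P \<inter> Q \<subseteq> \<Union>\<V>"
begin

text \<open>A change of piece happens at a common point of two different pieces, and
  \<open>meet\<close> puts such a point into a vertex piece.\<close>

lemma path_via_vertex:
  "piecewise_path \<P> x z l \<Longrightarrow> (\<exists>P\<in>\<P>. x \<in> P \<and> z \<in> P) \<or> (\<exists>v\<in>\<Union>\<V>. d x v + d v z \<le> l)"
proof (induction rule: piecewise_path.induct)
  case (step P x y z l)
  from step.IH show ?case
  proof
    assume "\<exists>Q\<in>\<P>. y \<in> Q \<and> z \<in> Q"
    then obtain Q where Q: "Q \<in> \<P>" "y \<in> Q" "z \<in> Q" by blast
    show ?thesis
    proof (cases "Q = P")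
      case True
      then show ?thesis using step Q by blast
    next
      case False
      then have "y \<in> \<Union>\<V>" using meet[of P Q] step Q by blast
      moreover have "d x y + d y z \<le> norm (x - y) + l" using d_piece[of P x y] d_le[OF step.hyps(4)] step by simp
      ultimately show ?thesis by blast
    qed
  next
    assume "\<exists>v\<in>\<Union>\<V>. d y v + d v z \<le> l"
    then obtain v where v: "v \<in> \<Union>\<V>" "d y v + d v z \<le> l" by blast
    have "v \<in> X" "x \<in> X" "y \<in> X" using v vertex_pieces step by auto
    then have "d x v \<le> norm (x - y) + d y v" using d_triangle[of x y v] d_piece[of P x y] step by simp
    then show ?thesis using v by (intro disjI2 bexI[of _ v]) auto
  qed
qed blast

text \<open>Nearby points of \<open>P\<close> form a bounded sequence in one piece, where the chain
  metric is the norm and bounded parts are compact.\<close>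

lemma cauchy_near_piece_converges:
  fixes \<sigma> :: "nat \<Rightarrow> 'w"
  assumes P: "P \<in> \<P>" and \<sigma>: "range \<sigma> \<subseteq> X"
    and cau: "\<And>e. e > 0 \<Longrightarrow> \<exists>N. \<forall>n\<ge>N. \<forall>m\<ge>N. d (\<sigma> n) (\<sigma> m) < e"
    and near: "\<And>e N. e > 0 \<Longrightarrow> \<exists>n\<ge>N. \<exists>y\<in>P. d (\<sigma> n) y < e"
  shows "\<exists>l\<in>X. \<forall>e>0. \<exists>N. \<forall>n\<ge>N. d (\<sigma> n) l < e"
proof -
  have \<sigma>X: "\<sigma> n \<in> X" for n using \<sigma> by auto
  have PX: "P \<subseteq> X" using P by auto
  have "\<forall>k. \<exists>n y. k \<le> n \<and> y \<in> P \<and> d (\<sigma> n) y < inverse (real (Suc k))"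
  proof
    fix k
    have "0 < inverse (real (Suc k))" by simp
    from near[OF this, of k] show "\<exists>n y. k \<le> n \<and> y \<in> P \<and> d (\<sigma> n) y < inverse (real (Suc k))" by blast
  qed
  then obtain nn y where ny: "\<And>k::nat. k \<le> nn k" "\<And>k::nat. y k \<in> P" "\<And>k::nat. d (\<sigma> (nn k)) (y k) < inverse (real (Suc k))"
    by metis
  obtain N0 where N0: "\<And>n m. n \<ge> N0 \<Longrightarrow> m \<ge> N0 \<Longrightarrow> d (\<sigma> n) (\<sigma> m) < 1" using cau[of 1] by auto
  define y0 where "y0 = y N0"
  have yX: "y k \<in> X" for k using ny(2) PX by auto
  have ball: "y k \<in> P \<inter> cball y0 3" if "k \<ge> N0" for k
  proof -
    \<comment> \<open>The radius 3 is the sum of three steps of length at most 1: to the sequence,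
      along it, and back to \<open>P\<close>.\<close>
    have inv1: "inverse (real (Suc k)) \<le> 1" for k by (simp add: inverse_le_1_iff)
    have "d (y k) y0 \<le> d (y k) (\<sigma> (nn k)) + d (\<sigma> (nn k)) (\<sigma> (nn N0)) + d (\<sigma> (nn N0)) y0"
      using d_triangle[OF yX[of k] \<sigma>X[of "nn k"] yX[of N0]] d_triangle[OF \<sigma>X[of "nn k"] \<sigma>X[of "nn N0"] yX[of N0]]
      unfolding y0_def by linarith
    also have "\<dots> \<le> 1 + 1 + 1"
    proof (intro add_mono)
      show "d (y k) (\<sigma> (nn k)) \<le> 1" using ny(3)[of k] inv1[of k] d_commute[of "y k"] by simp
      have "nn k \<ge> N0" "nn N0 \<ge> N0" using that ny(1)[of k] ny(1)[of N0] by auto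
      then show "d (\<sigma> (nn k)) (\<sigma> (nn N0)) \<le> 1" using N0 by (simp add: less_imp_le)
      show "d (\<sigma> (nn N0)) y0 \<le> 1" using ny(3)[of N0] inv1[of N0] unfolding y0_def by linarith
    qed
    finally have "d (y k) y0 \<le> 3" by simp
    then have "norm (y k - y0) \<le> 3" using d_piece[OF P ny(2) ny(2), of k N0] by (simp add: y0_def)
    then show ?thesis using ny(2) by (simp add: dist_norm norm_minus_commute)
  qed
  have "\<forall>k. y (k + N0) \<in> P \<inter> cball y0 3" using ball by simp
  then obtain l f where l: "l \<in> P \<inter> cball y0 3" "strict_mono f"
    "((\<lambda>k. y (k + N0)) \<circ> f) \<longlonglongrightarrow> l"
    using compact_piece[OF P, of y0 3, unfolded compact_def, rule_format, of "\<lambda>k. y (k + N0)"] by blast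
  have lP: "l \<in> P" and lX: "l \<in> X" using l(1) PX by auto
  show ?thesis
  proof (intro bexI[OF _ lX] allI impI)
    fix e :: real assume e: "e > 0"
    obtain N where N: "\<And>n m. n \<ge> N \<Longrightarrow> m \<ge> N \<Longrightarrow> d (\<sigma> n) (\<sigma> m) < e / 3" using cau[of "e / 3"] e by auto
    have "0 < e / 3" using e by simp
    from LIMSEQ_D[OF l(3) this] obtain K where K: "\<And>k. k \<ge> K \<Longrightarrow> norm (y (f k + N0) - l) < e / 3"
      unfolding comp_def by blast
    obtain M :: nat where M: "inverse (real (Suc M)) < e / 3"
      using reals_Archimedean[of "e / 3"] e by auto
    define k where "k = max K (max N M)"
    define j where "j = f k + N0"
    have "k \<le> f k" by (rule strict_mono_imp_increasing[OF l(2)])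
    then have j: "j \<ge> N" "j \<ge> M" by (auto simp: j_def k_def)
    have nj: "nn j \<ge> N" using ny(1)[of j] j by simp
    have 1: "d (\<sigma> (nn j)) (y j) < e / 3"
    proof -
      have "inverse (real (Suc j)) \<le> inverse (real (Suc M))" using j by (simp add: le_imp_inverse_le)
      then show ?thesis using ny(3)[of j] M by linarith
    qed
    have 2: "d (y j) l < e / 3" using K[of k] d_piece[OF P ny(2) lP, of j] by (simp add: k_def j_def)
    have "d (\<sigma> n) l < e" if n: "n \<ge> N" for n
      using N[OF n nj] 1 2 d_triangle[OF \<sigma>X \<sigma>X lX, of n "nn j"] d_triangle[OF \<sigma>X yX lX, of "nn j" j] by linarith
    then show "\<exists>N. \<forall>n\<ge>N. d (\<sigma> n) l < e" by blast
  qed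
qed

text \<open>A Cauchy sequence without limit stays away from every single piece, so it keeps changing
  pieces and comes arbitrarily close to vertex pieces. As distinct vertex pieces are at distance 1
  or more, it ends up close to one of them, a contradiction.\<close>

lemma cauchy_converges:
  fixes \<sigma> :: "nat \<Rightarrow> 'w"
  assumes \<sigma>: "range \<sigma> \<subseteq> X"
    and cau: "\<And>e. e > 0 \<Longrightarrow> \<exists>N. \<forall>n\<ge>N. \<forall>m\<ge>N. d (\<sigma> n) (\<sigma> m) < e"
  shows "\<exists>l\<in>X. \<forall>e>0. \<exists>N. \<forall>n\<ge>N. d (\<sigma> n) l < e"
proof (rule ccontr)
  assume n: "\<not> ?thesis"
  have far: "\<exists>e>0. \<exists>N. \<forall>n\<ge>N. \<forall>y\<in>P. e \<le> d (\<sigma> n) y" if P: "P \<in> \<P>" for P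
  proof (rule ccontr)
    assume c: "\<not> ?thesis"
    have "\<exists>n\<ge>N. \<exists>y\<in>P. d (\<sigma> n) y < e" if "e > 0" for e N
      using c that by (simp add: not_le)
    then show False using cauchy_near_piece_converges[OF P \<sigma> cau] n by blast
  qed
  have \<sigma>X: "\<sigma> n \<in> X" for n using \<sigma> by auto
  have VX: "v \<in> X" if "v \<in> \<Union>\<V>" for v using that vertex_pieces by auto
  have same: "v' \<in> E" if E: "E \<in> \<V>" "v \<in> E" and v': "v' \<in> \<Union>\<V>" and "d v v' < 1" for E v v'
  proof (rule ccontr)
    assume "v' \<notin> E"
    then obtain E' where "E' \<in> \<V>" "v' \<in> E'" "E \<noteq> E'" using v' by blast
    then have "1 \<le> norm (v - v')" using separated E by blast
    moreover have "norm (v - v') \<le> d v v'" using norm_le_d VX E v' by blast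
    ultimately show False using that by simp
  qed
  \<comment> \<open>A later member lies off the piece of \<sigma> n, so a short chain between the
    two has to visit a vertex piece.\<close>
  have close: "\<exists>N. \<forall>n\<ge>N. \<exists>v\<in>\<Union>\<V>. d (\<sigma> n) v < e" if e: "e > 0" for e
  proof -
    obtain N where N: "\<And>n m. n \<ge> N \<Longrightarrow> m \<ge> N \<Longrightarrow> d (\<sigma> n) (\<sigma> m) < e" using cau[OF e] by auto
    have "\<exists>v\<in>\<Union>\<V>. d (\<sigma> n) v < e" if n: "n \<ge> N" for n
    proof (cases "\<sigma> n \<in> \<Union>\<V>")
      case True
      then show ?thesis using d_piece[of _ "\<sigma> n" "\<sigma> n"] \<sigma>X[of n] e by (intro bexI[of _ "\<sigma> n"]) auto
    next
      case False
      obtain P where P: "P \<in> \<P>" "\<sigma> n \<in> P" using \<sigma>X by blast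
      obtain e' N' where e': "e' > 0" "\<And>m y. m \<ge> N' \<Longrightarrow> y \<in> P \<Longrightarrow> e' \<le> d (\<sigma> m) y" using far[OF P(1)] by blast
      define m where "m = max N N'"
      have mP: "\<sigma> m \<notin> P"
      proof
        assume "\<sigma> m \<in> P"
        then have "e' \<le> d (\<sigma> m) (\<sigma> m)" using e'(2)[of m] by (simp add: m_def)
        then show False using d_piece[OF P(1) \<open>\<sigma> m \<in> P\<close> \<open>\<sigma> m \<in> P\<close>] e'(1) by simp
      qed
      have "d (\<sigma> n) (\<sigma> m) < e" using N n by (simp add: m_def)
      then obtain l where l: "piecewise_path \<P> (\<sigma> n) (\<sigma> m) l" "l < e"
        using d_approx[OF \<sigma>X \<sigma>X, of "e - d (\<sigma> n) (\<sigma> m)" n m] by auto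
      have "\<not> (\<exists>P\<in>\<P>. \<sigma> n \<in> P \<and> \<sigma> m \<in> P)"
      proof
        assume "\<exists>P\<in>\<P>. \<sigma> n \<in> P \<and> \<sigma> m \<in> P"
        then obtain Q where "Q \<in> \<P>" "\<sigma> n \<in> Q" "\<sigma> m \<in> Q" by blast
        then show False using meet[of P Q] P mP False by blast
      qed
      then obtain v where v: "v \<in> \<Union>\<V>" "d (\<sigma> n) v + d v (\<sigma> m) \<le> l" using path_via_vertex[OF l(1)] by blast
      have "0 \<le> d v (\<sigma> m)" by (rule d_nonneg[OF VX[OF v(1)] \<sigma>X])
      then show ?thesis using v l by (intro bexI[of _ v]) auto
    qed
    then show ?thesis by blast
  qed
  \<comment> \<open>Three distances below or equal to 1/4 add up to less than the gap 1, so both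
    nearby vertex points lie in the same vertex piece.\<close>
  obtain N1 where N1: "\<And>n m. n \<ge> N1 \<Longrightarrow> m \<ge> N1 \<Longrightarrow> d (\<sigma> n) (\<sigma> m) < 1/4" using cau[of "1/4"] by auto
  obtain N2 where N2: "\<And>n. n \<ge> N2 \<Longrightarrow> \<exists>v\<in>\<Union>\<V>. d (\<sigma> n) v < 1/4" using close[of "1/4"] by auto
  define N where "N = max N1 N2"
  obtain v where v: "v \<in> \<Union>\<V>" "d (\<sigma> N) v < 1/4" using N2[of N] by (auto simp: N_def)
  obtain E where E: "E \<in> \<V>" "v \<in> E" using v by blast
  obtain e' N' where e': "e' > 0" "\<And>m y. m \<ge> N' \<Longrightarrow> y \<in> E \<Longrightarrow> e' \<le> d (\<sigma> m) y"
    using far[of E] E vertex_pieces by blast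
  define e where "e = min e' (1/4)"
  have e: "e > 0" "e \<le> e'" "e \<le> 1/4" using e' by (auto simp: e_def)
  obtain N3 where N3: "\<And>n. n \<ge> N3 \<Longrightarrow> \<exists>v\<in>\<Union>\<V>. d (\<sigma> n) v < e" using close[OF e(1)] by auto
  define n where "n = max N3 (max N N')"
  obtain w where w: "w \<in> \<Union>\<V>" "d (\<sigma> n) w < e" using N3[of n] by (auto simp: n_def)
  have "d (\<sigma> N) (\<sigma> n) < 1/4" using N1[of N n] by (simp add: N_def n_def)
  moreover have "d v w \<le> d v (\<sigma> N) + d (\<sigma> N) (\<sigma> n) + d (\<sigma> n) w"
    using d_triangle[OF VX[OF v(1)] \<sigma>X VX[OF w(1)], of N] d_triangle[OF \<sigma>X \<sigma>X VX[OF w(1)], of N n] by simp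
  ultimately have "d v w < 1" using v w e d_commute[of v "\<sigma> N"] by simp
  then have "w \<in> E" using same[OF E w(1)] by simp
  then have "e' \<le> d (\<sigma> n) w" using e'(2)[of n w] by (simp add: n_def)
  then show False using w e by simp
qed

section \<open>Transport of the chain metric along an injection\<close>

lemma metric_realization:
  assumes inj: "inj_on R X"
  obtains Y :: "'x metric" where "mspace Y = R ` X" "\<And>x y. x \<in> X \<Longrightarrow> y \<in> X \<Longrightarrow> mdist Y (R x) (R y) = d x y"
proof -
  interpret M: Metric_space X "\<lambda>x y. if x \<in> X \<and> y \<in> X then d x y else 0" by (rule Metric_space_d)
  define d' where "d' u v = (if u \<in> R ` X \<and> v \<in> R ` X then d (inv_into X R u) (inv_into X R v) else 0)" for u v
  have inv: "inv_into X R (R x) = x" if "x \<in> X" for x using inv_into_f_f[OF inj that] .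
  have iX: "inv_into X R u \<in> X" if "u \<in> R ` X" for u using that by (rule inv_into_into)
  have d'_eq: "d' u v = d (inv_into X R u) (inv_into X R v)" if "u \<in> R ` X" "v \<in> R ` X" for u v
    unfolding d'_def using that by (simp only: simp_thms if_True)
  have "Metric_space (R ` X) d'"
  proof
    fix u v
    show "0 \<le> d' u v"
    proof (cases "u \<in> R ` X \<and> v \<in> R ` X")
      case True
      then show ?thesis using d'_eq d_nonneg[OF iX iX] by metis
    next
      case False
      then show ?thesis unfolding d'_def by (simp only: if_False)
    qed
    show "d' u v = d' v u" unfolding d'_def using d_commute by metis
    assume "u \<in> R ` X" "v \<in> R ` X"
    then obtain x y where xy: "x \<in> X" "u = R x" "y \<in> X" "v = R y" by blast
    then have "d' u v = d x y" using inv d'_eq by (metis imageI)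
    moreover have "d x y = 0 \<longleftrightarrow> x = y" using M.zero[OF xy(1,3)] xy(1,3) by simp
    ultimately show "d' u v = 0 \<longleftrightarrow> u = v" using xy inj_on_eq_iff[OF inj xy(1,3)] by simp
  next
    fix u v w assume uvw: "u \<in> R ` X" "v \<in> R ` X" "w \<in> R ` X"
    show "d' u w \<le> d' u v + d' v w"
      unfolding d'_eq[OF uvw(1,3)] d'_eq[OF uvw(1,2)] d'_eq[OF uvw(2,3)]
      by (rule d_triangle) (rule iX uvw)+
  qed
  then interpret N: Metric_space "R ` X" d' .
  show ?thesis
  proof (rule that)
    show "mspace (metric (R ` X, d')) = R ` X" by simp
    fix x y assume "x \<in> X" "y \<in> X"
    then show "mdist (metric (R ` X, d')) (R x) (R y) = d x y"
      using inv d'_eq[OF imageI imageI] N.mdist_metric by metis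
  qed
qed

context
  fixes Y :: "'x metric" and R
  assumes inj: "inj_on R X" and space: "mspace Y = R ` X"
    and dist: "\<And>x y. x \<in> X \<Longrightarrow> y \<in> X \<Longrightarrow> mdist Y (R x) (R y) = d x y"
begin

lemma CAT0_realization: "CAT0_space Y"
proof (rule CAT0_spaceI)
  show "mspace Y \<noteq> {}" using nonempty space by auto
  fix u v assume "u \<in> mspace Y" "v \<in> mspace Y"
  then obtain x y where xy: "x \<in> X" "y \<in> X" "u = R x" "v = R y" using space by auto
  obtain \<gamma> where \<gamma>: "convex_geodesic x y \<gamma>" using convex_geodesic_exists xy by blast
  have uv: "mdist Y u v = d x y" using dist xy by simp
  have \<gamma>X: "\<gamma> t \<in> X" if "t \<in> {0..d x y}" for t using \<gamma> that unfolding convex_geodesic_def by blast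
  show "\<exists>\<gamma>. geodesic_path Y \<gamma> u v \<and>
       (\<forall>r\<in>mspace Y. convex_on {0..mdist Y u v} (\<lambda>t. (mdist Y r (\<gamma> t))\<^sup>2 - t\<^sup>2))"
  proof (intro exI conjI ballI)
    show "geodesic_path Y (R \<circ> \<gamma>) u v"
      unfolding geodesic_path_def uv
      using \<gamma> \<gamma>X xy space dist[OF \<gamma>X \<gamma>X] unfolding convex_geodesic_def by auto
    fix r assume "r \<in> mspace Y"
    then obtain w where w: "w \<in> X" "r = R w" using space by auto
    have "convex_on {0..d x y} (\<lambda>t. (d w (\<gamma> t))\<^sup>2 - t\<^sup>2)" using \<gamma> w unfolding convex_geodesic_def by auto
    moreover have "\<forall>t\<in>{0..d x y}. (mdist Y r ((R \<circ> \<gamma>) t))\<^sup>2 - t\<^sup>2 = (d w (\<gamma> t))\<^sup>2 - t\<^sup>2"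
      using dist[OF w(1) \<gamma>X] w by simp
    ultimately show "convex_on {0..mdist Y u v} (\<lambda>t. (mdist Y r ((R \<circ> \<gamma>) t))\<^sup>2 - t\<^sup>2)"
      unfolding uv by (rule convex_on_eq)
  qed
qed

lemma complete_realization: "mcomplete_of Y"
  unfolding mcomplete_of_def
proof -
  interpret N: Metric_space "mspace Y" "mdist Y" by blast
  show "N.mcomplete"
    unfolding N.mcomplete_def
  proof (intro allI impI)
    fix \<tau> assume "N.MCauchy \<tau>"
    then have mc: "range \<tau> \<subseteq> mspace Y \<and> (\<forall>e>0. \<exists>N. \<forall>n m. N \<le> n \<longrightarrow> N \<le> m \<longrightarrow> mdist Y (\<tau> n) (\<tau> m) < e)"
      unfolding N.MCauchy_def .
    then have \<tau>: "range \<tau> \<subseteq> R ` X" "\<forall>e>0. \<exists>N. \<forall>n m. N \<le> n \<longrightarrow> N \<le> m \<longrightarrow> mdist Y (\<tau> n) (\<tau> m) < e"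
      using space by simp_all
    then have "\<forall>n. \<exists>x\<in>X. \<tau> n = R x" by blast
    then obtain \<sigma> where \<sigma>: "\<And>n. \<sigma> n \<in> X" "\<And>n. \<tau> n = R (\<sigma> n)" by metis
    have "\<exists>l\<in>X. \<forall>e>0. \<exists>N. \<forall>n\<ge>N. d (\<sigma> n) l < e"
    proof (rule cauchy_converges)
      show "range \<sigma> \<subseteq> X" using \<sigma>(1) by blast
      fix e :: real assume "e > 0"
      then show "\<exists>N. \<forall>n\<ge>N. \<forall>m\<ge>N. d (\<sigma> n) (\<sigma> m) < e"
        using \<tau>(2) unfolding \<sigma>(2) dist[OF \<sigma>(1) \<sigma>(1)] by blast
    qed
    then obtain l where l: "l \<in> X" "\<And>e. e > 0 \<Longrightarrow> \<exists>N. \<forall>n\<ge>N. d (\<sigma> n) l < e" by blast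
    have "limitin N.mtopology \<tau> (R l) sequentially"
      unfolding N.limitin_metric
      using l \<sigma> dist space by (auto simp: eventually_sequentially)
    then show "\<exists>x. limitin N.mtopology \<tau> x sequentially" by blast
  qed
qed

text \<open>Within one piece the chain metric is the norm, so convergent subsequences of the inner
  product space stay convergent after transport.\<close>

lemma compactin_realization:
  assumes P: "P \<in> \<P>" and K: "K \<subseteq> P" "compact K"
  shows "compactin (mtopology_of Y) (R ` K)"
proof -
  interpret N: Metric_space "mspace Y" "mdist Y" by blast
  have KX: "K \<subseteq> X" using P K by auto
  show ?thesis
    unfolding mtopology_of_def N.compactin_sequentially
  proof (intro conjI allI impI)
    show "R ` K \<subseteq> mspace Y" using KX space by auto
    fix \<tau> :: "nat \<Rightarrow> 'x" assume "range \<tau> \<subseteq> R ` K"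
    then have "\<forall>n. \<exists>x\<in>K. \<tau> n = R x" by blast
    then obtain \<sigma> where \<sigma>: "\<And>n. \<sigma> n \<in> K" "\<And>n. \<tau> n = R (\<sigma> n)" by metis
    then obtain l f where l: "l \<in> K" "strict_mono f" "(\<sigma> \<circ> f) \<longlonglongrightarrow> l"
      using K(2) unfolding compact_def by blast
    have "limitin N.mtopology (\<tau> \<circ> f) (R l) sequentially"
      unfolding N.limitin_metric
    proof (intro conjI allI impI)
      show "R l \<in> mspace Y" using l KX space by auto
      fix e :: real assume "e > 0"
      then have "\<forall>\<^sub>F n in sequentially. norm ((\<sigma> \<circ> f) n - l) < e"
        using l(3) unfolding tendsto_iff dist_norm by blast
      then show "\<forall>\<^sub>F n in sequentially. (\<tau> \<circ> f) n \<in> mspace Y \<and> mdist Y ((\<tau> \<circ> f) n) (R l) < e"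
      proof (rule eventually_mono)
        fix n assume n: "norm ((\<sigma> \<circ> f) n - l) < e"
        have "\<sigma> (f n) \<in> P" "l \<in> P" using \<sigma> l K by auto
        moreover from this have "\<sigma> (f n) \<in> X" "l \<in> X" using P by blast+
        ultimately show "(\<tau> \<circ> f) n \<in> mspace Y \<and> mdist Y ((\<tau> \<circ> f) n) (R l) < e"
          using n d_piece[OF P, of "\<sigma> (f n)" l] dist[of "\<sigma> (f n)" l] space \<sigma>(2) by (simp del: Union_iff)
      qed
    qed
    then show "\<exists>l r. l \<in> R ` K \<and> strict_mono r \<and> limitin N.mtopology (\<tau> \<circ> r) l sequentially"
      using l by blast
  qed
qed

end

end


section \<open>Finitely supported functions\<close>

text \<open>The index set will contain all cosets of the vertex and edge groups. Finite support
  makes the inner product a finite sum whatever the size of the index set.\<close>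

typedef 'i fsupp = "{f :: 'i \<Rightarrow> real. finite {i. f i \<noteq> 0}}"
  morphisms coord Abs_fsupp
  by (rule exI[of _ "\<lambda>_. 0"]) simp

lemma finite_support: "finite {i. coord x i \<noteq> 0}"
  using coord[of x] by simp

lemma fsupp_eqI: "(\<And>i. coord x i = coord y i) \<Longrightarrow> x = y"
  by (simp add: coord_inject[symmetric] fun_eq_iff)

lemma coord_Abs: "finite {i. f i \<noteq> 0} \<Longrightarrow> coord (Abs_fsupp f) = f"
  by (simp add: Abs_fsupp_inverse)

instantiation fsupp :: (type) real_vector
begin

definition "0 = Abs_fsupp (\<lambda>_. 0)"
definition "x + y = Abs_fsupp (\<lambda>i. coord x i + coord y i)"
definition "- x = Abs_fsupp (\<lambda>i. - coord x i)"
definition "x - y = Abs_fsupp (\<lambda>i. coord x i - coord y i)"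
definition "scaleR r x = Abs_fsupp (\<lambda>i. r * coord x i)"

lemma coord_zero [simp]: "coord 0 i = 0"
  unfolding zero_fsupp_def by (subst coord_Abs) auto

lemma coord_add [simp]: "coord (x + y) i = coord x i + coord y i"
  unfolding plus_fsupp_def
  by (subst coord_Abs) (auto intro: finite_subset[OF _ finite_UnI[OF finite_support[of x] finite_support[of y]]])

lemma coord_uminus [simp]: "coord (- x) i = - coord x i"
  unfolding uminus_fsupp_def by (subst coord_Abs) (auto intro: finite_subset[OF _ finite_support[of x]])

lemma coord_diff [simp]: "coord (x - y) i = coord x i - coord y i"
  unfolding minus_fsupp_def
  by (subst coord_Abs) (auto intro: finite_subset[OF _ finite_UnI[OF finite_support[of x] finite_support[of y]]])

lemma coord_scaleR [simp]: "coord (scaleR r x) i = r * coord x i"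
  unfolding scaleR_fsupp_def by (subst coord_Abs) (auto intro: finite_subset[OF _ finite_support[of x]])

instance
  by standard (rule fsupp_eqI; simp add: algebra_simps)+

end

instantiation fsupp :: (type) real_inner
begin

definition inner_fsupp :: "'a fsupp \<Rightarrow> 'a fsupp \<Rightarrow> real" where
  "inner_fsupp x y = (\<Sum>i\<in>{i. coord x i \<noteq> 0}. coord x i * coord y i)"
definition norm_fsupp :: "'a fsupp \<Rightarrow> real" where "norm_fsupp x = sqrt (inner x x)"
definition dist_fsupp :: "'a fsupp \<Rightarrow> 'a fsupp \<Rightarrow> real" where "dist_fsupp x y = norm (x - y)"
definition sgn_fsupp :: "'a fsupp \<Rightarrow> 'a fsupp" where "sgn_fsupp x = x /\<^sub>R norm x"
definition uniformity_fsupp :: "('a fsupp \<times> 'a fsupp) filter" where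
  "uniformity_fsupp = (INF e\<in>{0<..}. principal {(x, y). dist x y < e})"
definition open_fsupp :: "'a fsupp set \<Rightarrow> bool" where
  "open_fsupp U \<longleftrightarrow> (\<forall>x\<in>U. eventually (\<lambda>(x', y). x' = x \<longrightarrow> y \<in> U) uniformity)"

lemma inner_fsupp_on:
  assumes "finite S" "\<And>i. i \<notin> S \<Longrightarrow> coord x i = 0 \<or> coord y i = 0"
  shows "inner x y = (\<Sum>i\<in>S. coord x i * coord y i)"
proof -
  have "inner x y = (\<Sum>i\<in>S \<union> {i. coord x i \<noteq> 0}. coord x i * coord y i)"
    unfolding inner_fsupp_def by (rule sum.mono_neutral_left) (use assms finite_support in auto)
  also have "\<dots> = (\<Sum>i\<in>S. coord x i * coord y i)"
    by (rule sum.mono_neutral_right) (use assms finite_support in auto)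
  finally show ?thesis .
qed

instance
proof
  fix x y z :: "'a fsupp" and r :: real
  let ?S = "{i. coord x i \<noteq> 0} \<union> {i. coord y i \<noteq> 0}"
  have S: "finite ?S" using finite_support by blast
  show "dist x y = norm (x - y)" by (rule dist_fsupp_def)
  show "sgn x = x /\<^sub>R norm x" by (rule sgn_fsupp_def)
  show "uniformity = (INF e\<in>{0<..}. principal {(x, y :: 'a fsupp). dist x y < e})" by (rule uniformity_fsupp_def)
  show "open U \<longleftrightarrow> (\<forall>x\<in>U. eventually (\<lambda>(x', y). x' = x \<longrightarrow> y \<in> U) uniformity)" for U :: "'a fsupp set"
    by (rule open_fsupp_def)
  have "inner x y = (\<Sum>i\<in>?S. coord x i * coord y i)" "inner y x = (\<Sum>i\<in>?S. coord y i * coord x i)"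
    by (rule inner_fsupp_on[OF S], blast)+
  then show "inner x y = inner y x" by (simp add: mult.commute)
  have "inner (x + y) z = (\<Sum>i\<in>?S. coord (x + y) i * coord z i)" "inner x z = (\<Sum>i\<in>?S. coord x i * coord z i)"
    "inner y z = (\<Sum>i\<in>?S. coord y i * coord z i)"
    by (rule inner_fsupp_on[OF S], simp)+
  then show "inner (x + y) z = inner x z + inner y z" by (simp add: sum.distrib algebra_simps)
  have "inner (r *\<^sub>R x) y = (\<Sum>i\<in>?S. coord (r *\<^sub>R x) i * coord y i)" "inner x y = (\<Sum>i\<in>?S. coord x i * coord y i)"
    by (rule inner_fsupp_on[OF S], simp)+
  then show "inner (r *\<^sub>R x) y = r * inner x y" by (simp add: sum_distrib_left algebra_simps)
  show "0 \<le> inner x x" unfolding inner_fsupp_def by (intro sum_nonneg) simp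
  show "inner x x = 0 \<longleftrightarrow> x = 0"
  proof
    assume "inner x x = 0"
    then have "\<forall>i\<in>{i. coord x i \<noteq> 0}. coord x i * coord x i = 0"
      unfolding inner_fsupp_def by (subst (asm) sum_nonneg_eq_0_iff) (use finite_support in auto)
    then show "x = 0" by (intro fsupp_eqI) auto
  next
    assume "x = 0"
    then show "inner x x = 0" by (simp add: inner_fsupp_def)
  qed
  show "norm x = sqrt (inner x x)" by (rule norm_fsupp_def)
qed

end

lemma coord_le_norm: "\<bar>coord x i\<bar> \<le> norm x"
proof -
  have "(coord x i)\<^sup>2 \<le> inner x x"
  proof -
    have "inner x x = (\<Sum>j\<in>insert i {i. coord x i \<noteq> 0}. coord x j * coord x j)"
      by (rule inner_fsupp_on) (use finite_support in auto)
    also have "\<dots> \<ge> coord x i * coord x i"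
      by (rule member_le_sum) (use finite_support in auto)
    finally show ?thesis by (simp add: power2_eq_square)
  qed
  then show ?thesis unfolding norm_eq_sqrt_inner by (intro real_le_rsqrt) simp
qed

definition unit :: "'i \<Rightarrow> 'i fsupp" where
  "unit i = Abs_fsupp (\<lambda>j. if j = i then 1 else 0)"

lemma coord_unit: "coord (unit i) j = (if j = i then 1 else 0)"
  unfolding unit_def by (subst coord_Abs) auto

section \<open>Heine-Borel for finitely many free coordinates\<close>

lemma compact_coordinate_box:
  assumes "finite J" shows "compact {x :: 'i fsupp. (\<forall>i. i \<notin> J \<longrightarrow> coord x i = 0) \<and> (\<forall>i. \<bar>coord x i\<bar> \<le> B)}"
  using assms
proof (induction J rule: finite_induct)
  case empty
  have "{x :: 'i fsupp. (\<forall>i. i \<notin> {} \<longrightarrow> coord x i = 0) \<and> (\<forall>i. \<bar>coord x i\<bar> \<le> B)} \<subseteq> {0}"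
    by (auto intro: fsupp_eqI)
  then show ?case using finite_imp_compact finite_subset by blast
next
  case (insert j J)
  let ?K = "{x :: 'i fsupp. (\<forall>i. i \<notin> J \<longrightarrow> coord x i = 0) \<and> (\<forall>i. \<bar>coord x i\<bar> \<le> B)}"
  have "compact ((\<lambda>(x, t). x + t *\<^sub>R unit j) ` (?K \<times> {-B..B}))"
    by (intro compact_continuous_image compact_Times insert.IH compact_Icc)
       (auto simp: case_prod_unfold intro!: continuous_intros)
  also have "(\<lambda>(x, t). x + t *\<^sub>R unit j) ` (?K \<times> {-B..B})
    = {x :: 'i fsupp. (\<forall>i. i \<notin> insert j J \<longrightarrow> coord x i = 0) \<and> (\<forall>i. \<bar>coord x i\<bar> \<le> B)}" (is "?L = ?R")
  proof
    show "?L \<subseteq> ?R" using insert.hyps by (auto simp: coord_unit)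
    show "?R \<subseteq> ?L"
    proof
      fix x assume x: "x \<in> ?R"
      have "\<bar>coord x j\<bar> \<le> B" using x by simp
      then have B: "0 \<le> B" by linarith
      define y where "y = x - coord x j *\<^sub>R unit j"
      have "y \<in> ?K" using x B by (auto simp: y_def coord_unit)
      moreover have "coord x j \<in> {-B..B}" using x by (auto simp: abs_le_iff minus_le_iff)
      moreover have "x = y + coord x j *\<^sub>R unit j" by (simp add: y_def)
      ultimately show "x \<in> ?L" by (intro image_eqI[of _ _ "(y, coord x j)"]) auto
    qed
  qed
  finally show ?case .
qed

lemma continuous_on_coord: "continuous_on S (\<lambda>x :: 'i fsupp. coord x i)"
proof (rule lipschitz_on_continuous_on)
  show "1-lipschitz_on S (\<lambda>x :: 'i fsupp. coord x i)"
    using coord_le_norm[of "_ - _" i] by (intro lipschitz_onI) (auto simp: dist_norm)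
qed

lemma closed_coordinate_condition: "closed {x :: 'i fsupp. coord x i = c}"
  by (intro closed_Collect_eq continuous_on_coord continuous_on_const)

lemma compact_closed_finite_coordinates:
  fixes P :: "'i fsupp set"
  assumes P: "closed P" and J: "finite J" and p: "\<And>x i. x \<in> P \<Longrightarrow> i \<notin> J \<Longrightarrow> coord x i = coord p i"
  shows "compact (P \<inter> cball z r)"
proof -
  define B where "B = norm z + r + norm p"
  let ?K = "{x :: 'i fsupp. (\<forall>i. i \<notin> J \<longrightarrow> coord x i = 0) \<and> (\<forall>i. \<bar>coord x i\<bar> \<le> B)}"
  have "compact ((\<lambda>x. x + p) ` ?K)"
    by (intro compact_continuous_image compact_coordinate_box[OF J] continuous_intros)
  moreover have "P \<inter> cball z r \<subseteq> (\<lambda>x. x + p) ` ?K"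
  proof
    fix x assume x: "x \<in> P \<inter> cball z r"
    have "norm (x - p) \<le> B"
      using x norm_triangle_ineq4[of x p] norm_triangle_sub[of x z]
      by (simp add: B_def dist_norm norm_minus_commute)
    then have "\<bar>coord (x - p) i\<bar> \<le> B" for i using coord_le_norm[of "x - p" i] by linarith
    then have "x - p \<in> ?K" using p[of x] x by auto
    then show "x \<in> (\<lambda>x. x + p) ` ?K" by (intro image_eqI[of _ _ "x - p"]) auto
  qed
  moreover have "closed (P \<inter> cball z r)" using P by (intro closed_Int closed_cball)
  ultimately have "compact ((\<lambda>x. x + p) ` ?K \<inter> (P \<inter> cball z r))" by (intro compact_Int_closed)
  then show ?thesis using \<open>P \<inter> cball z r \<subseteq> _\<close> by (simp add: Int_absorb1)
qed


section \<open>Trees of vertex pieces and strips\<close>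

text \<open>Whenever the next point already occurs, the path is cut back to that occurrence.\<close>

lemma rtrancl_distinct_path:
  assumes "(x, y) \<in> r\<^sup>*"
  shows "\<exists>xs. xs \<noteq> [] \<and> hd xs = x \<and> last xs = y \<and> distinct xs \<and> successively (\<lambda>a b. (a, b) \<in> r) xs"
  using assms
proof (induction rule: rtrancl_induct)
  case base
  show ?case by (intro exI[of _ "[x]"]) simp
next
  case (step y z)
  then obtain xs where xs: "xs \<noteq> []" "hd xs = x" "last xs = y" "distinct xs" "successively (\<lambda>a b. (a, b) \<in> r) xs" by blast
  show ?case
  proof (cases "z \<in> set xs")
    case True
    then obtain us vs where uv: "xs = us @ z # vs" by (meson split_list)
    have "successively (\<lambda>a b. (a, b) \<in> r) (us @ [z])"
      using xs(5) unfolding uv successively_append_iff by auto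
    moreover have "hd (us @ [z]) = x" using xs(2) uv by (cases us) auto
    ultimately show ?thesis using xs(4) uv by (intro exI[of _ "us @ [z]"]) auto
  next
    case False
    have "successively (\<lambda>a b. (a, b) \<in> r) (xs @ [z])"
      using xs step(2) by (auto simp: successively_append_iff)
    then show ?thesis using xs False by (intro exI[of _ "xs @ [z]"]) auto
  qed
qed

definition incident :: "'w set set \<Rightarrow> ('w set \<Rightarrow> 'w set) \<Rightarrow> ('w set \<Rightarrow> 'w set) \<Rightarrow> ('w set \<times> 'w set) set" where
  "incident \<S> lower upper = {(P, Q). (Q \<in> \<S> \<and> (P = lower Q \<or> P = upper Q)) \<or> (P \<in> \<S> \<and> (Q = lower P \<or> Q = upper P))}"

text \<open>
  The strip \<open>S\<close> joins the vertex pieces \<open>lower S\<close> and \<open>upper S\<close>; the height \<open>h S\<close> varies only along \<open>S\<close>,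
  so its level sets yield the walls.
\<close>

locale strip_tree =
  fixes \<V> \<S> :: "'w::real_inner set set" and h :: "'w set \<Rightarrow> 'w \<Rightarrow> real" and k :: "'w set \<Rightarrow> real"
    and lower upper :: "'w set \<Rightarrow> 'w set"
  assumes convex: "P \<in> \<V> \<union> \<S> \<Longrightarrow> convex P"
    and compact: "P \<in> \<V> \<union> \<S> \<Longrightarrow> compact (P \<inter> cball x r)"
    and vertices: "\<V> \<noteq> {}" "{} \<notin> \<V>" "\<V> \<inter> \<S> = {}"
    and ends: "S \<in> \<S> \<Longrightarrow> lower S \<in> \<V>" "S \<in> \<S> \<Longrightarrow> upper S \<in> \<V>"
    and height_strip: "S \<in> \<S> \<Longrightarrow> x \<in> S \<Longrightarrow> k S \<le> h S x \<and> h S x \<le> k S + 1"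
    and height_lower: "S \<in> \<S> \<Longrightarrow> x \<in> lower S \<Longrightarrow> h S x = k S"
    and height_upper: "S \<in> \<S> \<Longrightarrow> x \<in> upper S \<Longrightarrow> h S x = k S + 1"
    and height_const: "S \<in> \<S> \<Longrightarrow> P \<in> \<V> \<union> \<S> \<Longrightarrow> P \<noteq> S \<Longrightarrow> x \<in> P \<Longrightarrow> y \<in> P \<Longrightarrow> h S x = h S y"
    and bottom: "S \<in> \<S> \<Longrightarrow> x \<in> S \<Longrightarrow> h S x = k S \<Longrightarrow> x \<in> lower S"
    and top: "S \<in> \<S> \<Longrightarrow> x \<in> S \<Longrightarrow> h S x = k S + 1 \<Longrightarrow> x \<in> upper S"
    and meets: "S \<in> \<S> \<Longrightarrow> S \<inter> lower S \<noteq> {}" "S \<in> \<S> \<Longrightarrow> S \<inter> upper S \<noteq> {}"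
    and lipschitz: "S \<in> \<S> \<Longrightarrow> \<bar>h S x - h S y\<bar> \<le> norm (x - y)"
    and connected: "E \<in> \<V> \<Longrightarrow> E' \<in> \<V> \<Longrightarrow> (E, E') \<in> (incident \<S> lower upper)\<^sup>*"
begin

abbreviation pieces :: "'w set set" where "pieces \<equiv> \<V> \<union> \<S>"

abbreviation inc :: "('w set \<times> 'w set) set" where "inc \<equiv> incident \<S> lower upper"

lemma inc_pieces: "(P, Q) \<in> inc \<Longrightarrow> P \<in> pieces \<and> Q \<in> pieces \<and> P \<inter> Q \<noteq> {}"
  using ends meets unfolding incident_def by blast

lemma connected_pieces:
  assumes "P \<in> pieces" "Q \<in> pieces" shows "(P, Q) \<in> inc\<^sup>*"
proof -
  have to: "\<exists>E\<in>\<V>. (R, E) \<in> inc\<^sup>* \<and> (E, R) \<in> inc\<^sup>*" if "R \<in> pieces" for R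
  proof (cases "R \<in> \<V>")
    case False
    then have "R \<in> \<S>" using that by blast
    then have "(R, lower R) \<in> inc" "(lower R, R) \<in> inc" by (auto simp: incident_def)
    then show ?thesis using ends(1)[OF \<open>R \<in> \<S>\<close>] by blast
  qed blast
  obtain E E' where "E \<in> \<V>" "(P, E) \<in> inc\<^sup>*" "E' \<in> \<V>" "(E', Q) \<in> inc\<^sup>*" using to assms by blast
  then show ?thesis using connected[of E E'] by (meson rtrancl_trans)
qed

text \<open>The height is constant on each piece other than \<open>S\<close>, and consecutive pieces
  share a point.\<close>

lemma height_along:
  assumes S: "S \<in> \<S>" and path: "successively (\<lambda>a b. (a, b) \<in> inc) Ps" "S \<notin> set Ps" "set Ps \<subseteq> pieces"
    and P: "P \<in> set Ps" "x \<in> P" "Q \<in> set Ps" "y \<in> Q"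
  shows "h S x = h S y"
proof -
  have hd: "h S x = h S y" if "successively (\<lambda>a b. (a, b) \<in> inc) Ps" "S \<notin> set Ps" "set Ps \<subseteq> pieces"
    "x \<in> hd Ps" "P \<in> set Ps" "y \<in> P" for Ps x P y
    using that
  proof (induction Ps arbitrary: x)
    case (Cons R Ps)
    show ?case
    proof (cases "P = R")
      case True
      then show ?thesis using height_const[OF S] Cons.prems by auto
    next
      case False
      then have P: "P \<in> set Ps" using Cons.prems by auto
      then have ne: "Ps \<noteq> []" by auto
      have "(R, hd Ps) \<in> inc" using Cons.prems(1) ne by (cases Ps) auto
      then obtain z where z: "z \<in> R" "z \<in> hd Ps" using inc_pieces by blast
      have "h S x = h S z" using height_const[OF S, of R x z] Cons.prems z by auto
      also have "h S z = h S y"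
        by (rule Cons.IH) (use Cons.prems z P ne in \<open>auto simp: successively_Cons\<close>)
      finally show ?thesis .
    qed
  qed simp
  have ne: "Ps \<noteq> []" using P by auto
  then have "hd Ps \<in> pieces" using path(3) hd_in_set by blast
  then have "\<exists>z. z \<in> hd Ps"
    using vertices(2) meets by (metis Int_emptyI UnE all_not_in_conv)
  then obtain z where "z \<in> hd Ps" by blast
  then show ?thesis using hd[OF path _ P(1,2), of z] hd[OF path _ P(3,4), of z] by simp
qed

text \<open>Of two incident pieces exactly one is a strip, and its height provides the wall for this
  step of the gallery.\<close>

lemma path_gallery:
  assumes "successively (\<lambda>a b. (a, b) \<in> inc) Ps" "distinct Ps" "Ps \<noteq> []" "set Ps \<subseteq> pieces"
  shows "gallery pieces Ps"
  using assms
proof (induction Ps rule: rev_induct)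
  case (snoc P Ps)
  show ?case
  proof (cases Ps rule: rev_cases)
    case Nil
    then show ?thesis using snoc by (auto intro: gallery.single)
  next
    case (snoc Ps' Q)
    have path: "successively (\<lambda>a b. (a, b) \<in> inc) (Ps' @ [Q])" and QP: "(Q, P) \<in> inc"
      using snoc.prems(1) snoc by (auto simp: successively_append_iff)
    have sub: "set (Ps' @ [Q]) \<subseteq> pieces" "P \<in> pieces" "P \<notin> set (Ps' @ [Q])"
      using snoc.prems snoc by auto
    have g: "gallery pieces (Ps' @ [Q])" using snoc.IH snoc.prems snoc path by auto
    have ne: "Q \<inter> P \<noteq> {}" using inc_pieces[OF QP] by blast
    have "\<exists>A B. pieces = A \<union> B \<and> set (Ps' @ [Q]) \<subseteq> A \<and> P \<in> B \<and> \<Union>A \<inter> \<Union>B \<subseteq> Q \<inter> P"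
    proof -
      obtain S N c where S: "S \<in> \<S>" and SN: "(S = P \<and> N = Q) \<or> (S = Q \<and> N = P)"
        and N: "N = lower S \<and> c = k S \<or> N = upper S \<and> c = k S + 1"
        using QP unfolding incident_def by blast
      have NV: "N \<in> \<V>" using N ends[OF S] by blast
      have hN: "h S x = c" if "x \<in> N" for x using N that height_lower[OF S] height_upper[OF S] by blast
      have inN: "x \<in> N" if "x \<in> S" "h S x = c" for x using N that bottom[OF S] top[OF S] by blast
      \<comment> \<open>The pieces beyond the end \<open>N\<close> of the strip: all those whose
        height is the end value \<open>c\<close>. A piece outside \<open>L\<close> that reaches
        height \<open>c\<close> can only be \<open>S\<close>.\<close>
      define L where "L = {R \<in> pieces. R \<noteq> S \<and> (\<forall>x\<in>R. h S x = c)}"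
      have wall: "\<Union>L \<inter> \<Union>(pieces - L) \<subseteq> S \<inter> N"
      proof
        fix x assume "x \<in> \<Union>L \<inter> \<Union>(pieces - L)"
        then obtain R R' where R: "R \<in> L" "x \<in> R" "R' \<in> pieces" "R' \<notin> L" "x \<in> R'" by blast
        have hx: "h S x = c" using R by (auto simp: L_def)
        have "R' = S"
        proof (rule ccontr)
          assume n: "R' \<noteq> S"
          then have "\<forall>y\<in>R'. h S y = c" using height_const[OF S R(3) n _ R(5)] hx by simp
          then show False using R n by (auto simp: L_def)
        qed
        then show "x \<in> S \<inter> N" using R hx inN by blast
      qed
      have NS: "N \<noteq> S" using NV S vertices(3) by blast
      have NL: "N \<in> L" using NV NS hN by (auto simp: L_def)
      from SN show ?thesis
      proof
        assume SP: "S = P \<and> N = Q"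
        have "R \<in> L" if "R \<in> set (Ps' @ [Q])" for R
        proof -
          obtain y where y: "y \<in> Q" using ne by blast
          have "h S x = c" if x: "x \<in> R" for x
            using height_along[OF S path _ sub(1) \<open>R \<in> set (Ps' @ [Q])\<close> x, of Q y] sub(3) SP y hN by auto
          moreover have "R \<noteq> S" "R \<in> pieces" using that sub SP by blast+
          ultimately show ?thesis by (simp add: L_def)
        qed
        then show ?thesis using wall SP S NL L_def
          by (intro exI[of _ L] exI[of _ "pieces - L"]) (auto simp: L_def)
      next
        assume SQ: "S = Q \<and> N = P"
        \<comment> \<open>The path entered the strip through its other end N', so all earlier pieces
          have the other end value and lie outside \<open>L\<close>.\<close>
        have "R \<notin> L" if R: "R \<in> set (Ps' @ [Q])" for R
        proof
          assume RL: "R \<in> L"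
          then have RQ: "R \<noteq> Q" using SQ by (simp add: L_def)
          then have R': "R \<in> set Ps'" using R by simp
          then have ne': "Ps' \<noteq> []" by auto
          define N' where "N' = last Ps'"
          have N'Q: "(N', Q) \<in> inc" using path ne' by (auto simp: successively_append_iff N'_def)
          have N's: "N' \<in> set Ps'" using ne' by (simp add: N'_def)
          have "N' \<noteq> P" using N's sub(3) by auto
          then have N'e: "(N' = lower S \<or> N' = upper S) \<and> N' \<noteq> N"
            using N'Q SQ S ends vertices(3) unfolding incident_def by blast
          then obtain c' where c': "c' \<noteq> c" "\<And>x. x \<in> N' \<Longrightarrow> h S x = c'"
            using N height_lower[OF S] height_upper[OF S]
            by (metis add_cancel_left_right zero_neq_one)
          have p': "successively (\<lambda>a b. (a, b) \<in> inc) Ps'" using path by (auto simp: successively_append_iff)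
          have Q': "S \<notin> set Ps'" using snoc.prems(2) snoc SQ by auto
          have s': "set Ps' \<subseteq> pieces" using sub by auto
          have "\<exists>y. y \<in> N'" using inc_pieces[OF N'Q] by blast
          then obtain y where y: "y \<in> N'" by blast
          have "\<exists>x. x \<in> R"
            using R' s' vertices(2) meets by (metis Int_emptyI UnE all_not_in_conv subsetD)
          then obtain x where x: "x \<in> R" by blast
          have "h S x = h S y" by (rule height_along[OF S p' Q' s' R' x N's y])
          then show False using RL x y c' by (simp add: L_def)
        qed
        then have "set (Ps' @ [Q]) \<subseteq> pieces - L" using sub by blast
        then show ?thesis using wall SQ NL by (intro exI[of _ "pieces - L"] exI[of _ L]) (auto simp: L_def)
      qed
    qed
    then obtain A B where "pieces = A \<union> B" "set (Ps' @ [Q]) \<subseteq> A" "P \<in> B" "\<Union>A \<inter> \<Union>B \<subseteq> Q \<inter> P" by blast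
    from gallery.snoc[OF g this ne] show ?thesis using snoc by simp
  qed
qed simp

lemma distinct_path:
  assumes "P \<in> pieces" "Q \<in> pieces"
  shows "\<exists>Ps. Ps \<noteq> [] \<and> hd Ps = P \<and> last Ps = Q \<and> distinct Ps \<and> successively (\<lambda>a b. (a, b) \<in> inc) Ps \<and> set Ps \<subseteq> pieces"
proof -
  obtain Ps where Ps: "Ps \<noteq> []" "hd Ps = P" "last Ps = Q" "distinct Ps" "successively (\<lambda>a b. (a, b) \<in> inc) Ps"
    using rtrancl_distinct_path[OF connected_pieces[OF assms]] by blast
  have "set Ps \<subseteq> pieces"
    using Ps(1,5) assms(1) Ps(2)
  proof (induction Ps arbitrary: P)
    case (Cons R Ps)
    show ?case
    proof (cases Ps)
      case (Cons R' Ps')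
      then have "R' \<in> pieces" using Cons.prems inc_pieces by auto
      then show ?thesis using Cons.IH[of R'] Cons.prems Cons by auto
    qed (use Cons.prems in auto)
  qed simp
  then show ?thesis using Ps by blast
qed

text \<open>A path without repetition that leaves \<open>S\<close> starts in one of its two ends and
  never returns, so the height stays at that end value.\<close>

lemma height_end:
  assumes S: "S \<in> \<S>" and P: "P \<in> pieces" "P \<noteq> S" "x \<in> P"
  shows "h S x = k S \<or> h S x = k S + 1"
proof -
  have "S \<in> pieces" using S by blast
  from distinct_path[OF this P(1)] obtain Ps where Ps: "Ps \<noteq> []" "hd Ps = S" "last Ps = P" "distinct Ps"
    "successively (\<lambda>a b. (a, b) \<in> inc) Ps" "set Ps \<subseteq> pieces" by blast
  obtain Qs where Qs: "Ps = S # Qs" using Ps(1,2) by (cases Ps) auto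
  then have ne: "Qs \<noteq> []" using Ps(3) P(2) by auto
  have inc: "(S, hd Qs) \<in> inc" using Ps(5) Qs ne by (cases Qs) auto
  then obtain y where y: "y \<in> hd Qs" using inc_pieces by blast
  have hd: "hd Qs = lower S \<or> hd Qs = upper S"
    using inc S ends vertices(3) unfolding incident_def by blast
  have "h S x = h S y"
    by (rule height_along[OF S, of Qs P x "hd Qs" y])
       (use Ps Qs ne P y in \<open>auto simp: successively_Cons\<close>)
  then show ?thesis using hd y height_lower[OF S] height_upper[OF S] by metis
qed

sublocale separated_tree_of_pieces pieces \<V>
proof
  show "convex P" "compact (P \<inter> cball x r)" if "P \<in> pieces" for P x r using convex[OF that] compact[OF that] .
  show "pieces \<noteq> {}" using vertices(1) by blast
  show "{} \<notin> pieces" using vertices(2) meets by blast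
  show "\<exists>Ps. gallery pieces Ps \<and> hd Ps = P \<and> last Ps = Q" if "P \<in> pieces" "Q \<in> pieces" for P Q
    using distinct_path[OF that] path_gallery by blast
  show "\<V> \<subseteq> pieces" by blast
  show "P \<inter> Q \<subseteq> \<Union>\<V>" if PQ: "P \<in> pieces" "Q \<in> pieces" "P \<noteq> Q" for P Q
  proof
    fix x assume x: "x \<in> P \<inter> Q"
    show "x \<in> \<Union>\<V>"
    proof (cases "P \<in> \<V>")
      case False
      then have P: "P \<in> \<S>" using PQ by blast
      \<comment> \<open>A point of a strip that lies in a second piece has an end height, so it
        belongs to a vertex piece.\<close>
      have "h P x = k P \<or> h P x = k P + 1" using height_end[OF P PQ(2)] PQ(3) x by blast
      then show ?thesis using bottom[OF P] top[OF P] ends[OF P] x by blast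
    qed (use x in blast)
  qed
  fix E E' x y assume E: "E \<in> \<V>" "E' \<in> \<V>" "E \<noteq> E'" "x \<in> E" "y \<in> E'"
  have "E \<in> pieces" "E' \<in> pieces" using E by auto
  \<comment> \<open>The path from E to E' crosses a first strip. Its height differs by 1 between the
    two ends, and height is 1-Lipschitz; this is the gap between vertex pieces.\<close>
  from distinct_path[OF this] obtain Ps where Ps: "Ps \<noteq> []" "hd Ps = E" "last Ps = E'" "distinct Ps"
    "successively (\<lambda>a b. (a, b) \<in> inc) Ps" "set Ps \<subseteq> pieces" by blast
  obtain Qs where Qs: "Ps = E # Qs" using Ps(1,2) by (cases Ps) auto
  then obtain S Rs where Rs: "Qs = S # Rs" using Ps(3) E(3) by (cases Qs) auto
  have i1: "(E, S) \<in> inc" using Ps(5) Qs Rs by simp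
  then have S: "S \<in> \<S>" and e1: "E = lower S \<or> E = upper S" using E(1) vertices(3) unfolding incident_def by blast+
  have "S \<noteq> E'" using S E(2) vertices(3) by blast
  then have ne: "Rs \<noteq> []" using Ps(3) Qs Rs by auto
  have i2: "(S, hd Rs) \<in> inc" using Ps(5) Qs Rs ne by (cases Rs) auto
  then have e2: "hd Rs = lower S \<or> hd Rs = upper S" using S ends vertices(3) unfolding incident_def by blast
  have "hd Rs \<noteq> E" using Ps(4) Qs Rs ne by (metis distinct.simps(2) hd_in_set list.set_intros(2))
  then have opp: "(E = lower S \<and> hd Rs = upper S) \<or> (E = upper S \<and> hd Rs = lower S)" using e1 e2 by blast
  obtain z where z: "z \<in> hd Rs" using inc_pieces[OF i2] by blast
  have "last Rs = E'" using Ps(3) Qs Rs ne by simp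
  then have "E' \<in> set Rs" using ne last_in_set by blast
  have "h S y = h S z"
    by (rule height_along[OF S, of Rs E' y "hd Rs" z])
       (use Ps Qs Rs ne E z \<open>E' \<in> set Rs\<close> in \<open>auto simp: successively_Cons\<close>)
  moreover have "\<bar>h S x - h S z\<bar> = 1"
    using opp height_lower[OF S] height_upper[OF S] E(4) z by auto
  ultimately show "1 \<le> norm (x - y)" using lipschitz[OF S, of x y] by simp
qed

end


section \<open>The tree of pieces of a splitting\<close>

definition reindex :: "('i \<Rightarrow> 'i) \<Rightarrow> 'i fsupp \<Rightarrow> 'i fsupp" where
  "reindex \<sigma> x = Abs_fsupp (\<lambda>i. coord x (\<sigma> i))"

lemma coord_reindex: "bij \<sigma> \<Longrightarrow> coord (reindex \<sigma> x) i = coord x (\<sigma> i)"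
  unfolding reindex_def
  by (subst coord_Abs)
     (use finite_vimageI[OF finite_support[of x], of \<sigma>] in \<open>auto simp: bij_def vimage_def\<close>)

lemma reindex_linear: "bij \<sigma> \<Longrightarrow> linear (reindex \<sigma>)"
  by (rule linearI) (auto intro!: fsupp_eqI simp: coord_reindex)

lemma norm_reindex: "bij \<sigma> \<Longrightarrow> norm (reindex \<sigma> x) = norm x"
proof -
  assume \<sigma>: "bij \<sigma>"
  let ?S = "{i. coord x i \<noteq> 0}"
  have "inner (reindex \<sigma> x) (reindex \<sigma> x) = (\<Sum>i\<in>\<sigma> -` ?S. coord x (\<sigma> i) * coord x (\<sigma> i))"
    by (subst inner_fsupp_on[of "\<sigma> -` ?S"])
       (use \<sigma> finite_vimageI[OF finite_support[of x], of \<sigma>] in \<open>auto simp: coord_reindex bij_def\<close>)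
  also have "\<dots> = (\<Sum>i\<in>?S. coord x i * coord x i)"
    by (rule sum.reindex_bij_witness[of _ "inv_into UNIV \<sigma>" \<sigma>]) (use \<sigma> in \<open>auto simp: bij_is_inj bij_is_surj surj_f_inv_f\<close>)
  finally show ?thesis by (simp add: norm_eq_sqrt_inner inner_fsupp_def)
qed

section \<open>Closed convex conditions on hulls\<close>

lemma closure_convex_hull_induct:
  assumes "x \<in> closure (convex hull S)" "closed C" "convex C" "S \<subseteq> C" shows "x \<in> C"
  using assms closure_minimal[of "convex hull S" C] hull_minimal[of S C convex] by blast

lemma infdist_almost_attained:
  assumes "C \<noteq> {}" "infdist x C < r" shows "\<exists>p\<in>C. dist x p < r"
proof (rule ccontr)
  assume "\<not> ?thesis"
  then have "r \<le> infdist x C"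
    unfolding infdist_notempty[OF assms(1)] by (intro cINF_greatest assms(1)) (simp add: not_less)
  then show False using assms(2) by simp
qed

text \<open>The distance to a convex set is a convex function and a coordinate is affine. Sets of
  this kind carry an estimate from the points of an orbit to its closed convex hull.\<close>

lemma convex_infdist_le:
  fixes C :: "'i fsupp set"
  assumes C: "convex C" "C \<noteq> {}" shows "convex {x. infdist x C \<le> a * coord x i - b}"
proof (rule convexI)
  fix x y u v assume x: "x \<in> {x. infdist x C \<le> a * coord x i - b}" and y: "y \<in> {x. infdist x C \<le> a * coord x i - b}"
    and uv: "0 \<le> u" "0 \<le> v" "u + v = (1::real)"
  have "infdist (u *\<^sub>R x + v *\<^sub>R y) C \<le> u * infdist x C + v * infdist y C + e" if e: "e > 0" for e
  proof -
    obtain p where p: "p \<in> C" "dist x p < infdist x C + e" using infdist_almost_attained[OF C(2), of x "infdist x C + e"] e by fastforce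
    obtain q where q: "q \<in> C" "dist y q < infdist y C + e" using infdist_almost_attained[OF C(2), of y "infdist y C + e"] e by fastforce
    have "u *\<^sub>R p + v *\<^sub>R q \<in> C" using convexD[OF C(1) p(1) q(1) uv] .
    then have "infdist (u *\<^sub>R x + v *\<^sub>R y) C \<le> dist (u *\<^sub>R x + v *\<^sub>R y) (u *\<^sub>R p + v *\<^sub>R q)" by (rule infdist_le)
    also have "\<dots> = norm (u *\<^sub>R (x - p) + v *\<^sub>R (y - q))" by (simp add: dist_norm algebra_simps)
    also have "\<dots> \<le> u * dist x p + v * dist y q"
      using norm_triangle_ineq[of "u *\<^sub>R (x - p)" "v *\<^sub>R (y - q)"] uv by (simp add: dist_norm)
    also have "\<dots> \<le> u * (infdist x C + e) + v * (infdist y C + e)"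
      using p q uv by (intro add_mono mult_left_mono) auto
    also have "\<dots> = u * infdist x C + v * infdist y C + (u + v) * e" by (simp add: algebra_simps)
    finally show ?thesis using uv by simp
  qed
  then have "infdist (u *\<^sub>R x + v *\<^sub>R y) C \<le> u * infdist x C + v * infdist y C" by (rule field_le_epsilon)
  also have "\<dots> \<le> u * (a * coord x i - b) + v * (a * coord y i - b)"
    using x y uv by (intro add_mono mult_left_mono) auto
  also have "\<dots> = a * coord (u *\<^sub>R x + v *\<^sub>R y) i - (u + v) * b" by (simp add: algebra_simps)
  finally show "u *\<^sub>R x + v *\<^sub>R y \<in> {x. infdist x C \<le> a * coord x i - b}" using uv by simp
qed

lemma closed_infdist_le:
  fixes C :: "'i fsupp set"
  assumes "C \<noteq> {}" shows "closed {x. infdist x C \<le> a * coord x i - b}"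
  by (intro closed_Collect_le continuous_intros continuous_on_coord)

lemma convex_coord_eq: "convex {x :: 'i fsupp. coord x i = c}"
  by (rule convexI) (auto simp: algebra_simps simp flip: distrib_right)

lemma closed_coord_le: "closed {x :: 'i fsupp. coord x i \<le> c}" "closed {x :: 'i fsupp. c \<le> coord x i}"
  by (intro closed_Collect_le continuous_on_coord continuous_on_const)+

lemma convex_coord_le: "convex {x :: 'i fsupp. coord x i \<le> c}" "convex {x :: 'i fsupp. c \<le> coord x i}"
proof -
  have "convex ((\<lambda>x. coord x i) -` {..c})" "convex ((\<lambda>x. coord x i) -` {c..})"
    by (intro convex_linear_vimage linearI convex_real_interval; simp)+
  then show "convex {x :: 'i fsupp. coord x i \<le> c}" "convex {x :: 'i fsupp. c \<le> coord x i}"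
    by (simp_all add: vimage_def)
qed

text \<open>Dictionary: \<pi> permutes coordinates and \<delta> is the translation cocycle of an
  affine action. \<open>J\<close> collects the finitely many character coordinates, and \<epsilon> e
  is the coordinate crossed by the edge \<open>e\<close>. \<open>V\<close>, \<open>E\<close>,
  \<open>src\<close>, \<open>tgt\<close> form the quotient graph, with vertex groups
  \<open>Pv\<close>, edge groups \<open>Pe\<close> and stable letters \<open>t\<close>. The base
  points are integral, \<open>vertex_stabilizer\<close> recovers \<open>Pv\<close> from the
  coordinates outside \<open>J\<close>, and \<open>finite_kernel\<close> controls what is invisible
  inside \<open>J\<close>.\<close>

locale tree_splitting = group G for G (structure) +
  fixes \<pi> :: "'a \<Rightarrow> 'i \<Rightarrow> 'i" and \<delta> :: "'a \<Rightarrow> 'i fsupp" and J :: "'i set"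
    and V :: "'v set" and E :: "'e set" and src tgt :: "'e \<Rightarrow> 'v"
    and Pv :: "'v \<Rightarrow> 'a set" and Pe :: "'e \<Rightarrow> 'a set" and t :: "'e \<Rightarrow> 'a"
    and pos :: "'v \<Rightarrow> 'i fsupp" and \<epsilon> :: "'e \<Rightarrow> 'i"
  assumes \<pi>_one: "\<pi> \<one> i = i"
    and \<pi>_mult: "g \<in> carrier G \<Longrightarrow> h \<in> carrier G \<Longrightarrow> \<pi> (g \<otimes> h) i = \<pi> g (\<pi> h i)"
    and \<pi>_J: "g \<in> carrier G \<Longrightarrow> \<pi> g i \<in> J \<longleftrightarrow> i \<in> J"
    and finite_J: "finite J"
    and \<delta>_mult: "g \<in> carrier G \<Longrightarrow> h \<in> carrier G \<Longrightarrow> \<delta> (g \<otimes> h) = reindex (\<pi> (inv g)) (\<delta> h) + \<delta> g"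
    and \<delta>_int: "g \<in> carrier G \<Longrightarrow> coord (\<delta> g) i \<in> \<int>"
    and pos_int: "v \<in> V \<Longrightarrow> coord (pos v) i \<in> \<int>"
    and V: "finite V" "V \<noteq> {}" and E: "finite E" "e \<in> E \<Longrightarrow> src e \<in> V" "e \<in> E \<Longrightarrow> tgt e \<in> V"
    and Pv: "v \<in> V \<Longrightarrow> subgroup (Pv v) G" and Pe: "e \<in> E \<Longrightarrow> subgroup (Pe e) G"
    and Pe_src: "e \<in> E \<Longrightarrow> Pe e \<subseteq> Pv (src e)"
    and t: "e \<in> E \<Longrightarrow> t e \<in> carrier G"
    and Pe_tgt: "e \<in> E \<Longrightarrow> p \<in> Pe e \<Longrightarrow> inv (t e) \<otimes> p \<otimes> t e \<in> Pv (tgt e)"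
    and generated: "subgroup H G \<Longrightarrow> (\<And>v. v \<in> V \<Longrightarrow> Pv v \<subseteq> H) \<Longrightarrow> (\<And>e. e \<in> E \<Longrightarrow> t e \<in> H) \<Longrightarrow> H = carrier G"
    and base_connected: "u \<in> V \<Longrightarrow> v \<in> V \<Longrightarrow>
       (u, v) \<in> ({(src e, tgt e) | e. e \<in> E \<and> t e = \<one>} \<union> {(tgt e, src e) | e. e \<in> E \<and> t e = \<one>})\<^sup>*"
    and vertex_stabilizer: "v \<in> V \<Longrightarrow> g \<in> carrier G \<Longrightarrow>
       (\<forall>i. i \<notin> J \<longrightarrow> coord (reindex (\<pi> (inv g)) (pos v) + \<delta> g) i = coord (pos v) i) \<longleftrightarrow> g \<in> Pv v"
    and \<epsilon>_J: "e \<in> E \<Longrightarrow> \<epsilon> e \<notin> J"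
    and edge_step: "e \<in> E \<Longrightarrow> coord (reindex (\<pi> (inv (t e))) (pos (tgt e)) + \<delta> (t e)) (\<epsilon> e) = coord (pos (src e)) (\<epsilon> e) + 1"
    and other_edge_step: "e \<in> E \<Longrightarrow> e' \<in> E \<Longrightarrow> g \<in> carrier G \<Longrightarrow> \<pi> g (\<epsilon> e') \<noteq> \<epsilon> e \<Longrightarrow>
       coord (reindex (\<pi> (inv (t e))) (pos (tgt e)) + \<delta> (t e)) (\<pi> g (\<epsilon> e')) = coord (pos (src e)) (\<pi> g (\<epsilon> e'))"
    and edge_stabilizer: "e \<in> E \<Longrightarrow> e' \<in> E \<Longrightarrow> g \<in> carrier G \<Longrightarrow> \<pi> g (\<epsilon> e) = \<epsilon> e' \<longleftrightarrow> e = e' \<and> g \<in> Pe e"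
    and finite_kernel: "v \<in> V \<Longrightarrow> finite {g \<in> Pv v. \<forall>j\<in>J. \<pi> g j = j \<and> coord (\<delta> g) j = 0}"
begin

text \<open>Coordinates are pulled back along the inverse, which makes this a left action.\<close>

definition act :: "'a \<Rightarrow> 'i fsupp \<Rightarrow> 'i fsupp" where
  "act g x = reindex (\<pi> (inv g)) x + \<delta> g"

lemma \<pi>_inv: "g \<in> carrier G \<Longrightarrow> \<pi> (inv g) (\<pi> g i) = i" "g \<in> carrier G \<Longrightarrow> \<pi> g (\<pi> (inv g) i) = i"
  using \<pi>_mult[of "inv g" g i] \<pi>_mult[of g "inv g" i] \<pi>_one by simp_all

lemma bij_\<pi>: "g \<in> carrier G \<Longrightarrow> bij (\<pi> g)"
  by (rule bij_betw_byWitness[of _ "\<pi> (inv g)"]) (simp_all add: \<pi>_inv)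

lemma coord_act: "g \<in> carrier G \<Longrightarrow> coord (act g x) i = coord x (\<pi> (inv g) i) + coord (\<delta> g) i"
  by (simp add: act_def coord_reindex bij_\<pi>)

lemma \<delta>_one: "\<delta> \<one> = 0"
proof (rule fsupp_eqI)
  fix i
  have "coord (\<delta> (\<one> \<otimes> \<one>)) i = coord (\<delta> \<one>) (\<pi> (inv \<one>) i) + coord (\<delta> \<one>) i"
    using \<delta>_mult[of \<one> \<one>] by (simp only: one_closed coord_add coord_reindex bij_\<pi> inv_closed)
  then show "coord (\<delta> \<one>) i = coord 0 i" by (simp add: \<pi>_one)
qed

lemma act_one: "act \<one> x = x"
  by (rule fsupp_eqI) (simp add: coord_act \<pi>_one \<delta>_one)

lemma act_mult: "g \<in> carrier G \<Longrightarrow> h \<in> carrier G \<Longrightarrow> act (g \<otimes> h) x = act g (act h x)"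
  by (rule fsupp_eqI) (simp add: coord_act \<delta>_mult coord_reindex bij_\<pi> inv_mult_group \<pi>_mult)

lemma act_inv: "g \<in> carrier G \<Longrightarrow> act (inv g) (act g x) = x" "g \<in> carrier G \<Longrightarrow> act g (act (inv g) x) = x"
  using act_mult[of "inv g" g x] act_mult[of g "inv g" x] act_one by simp_all

lemma act_diff: "g \<in> carrier G \<Longrightarrow> act g x - act g y = reindex (\<pi> (inv g)) (x - y)"
  by (rule fsupp_eqI) (simp add: coord_act coord_reindex bij_\<pi>)

lemma norm_act: "g \<in> carrier G \<Longrightarrow> norm (act g x - act g y) = norm (x - y)"
  by (simp add: act_diff norm_reindex bij_\<pi>)

lemma continuous_act: "g \<in> carrier G \<Longrightarrow> continuous_on S (act g)"
  by (rule lipschitz_on_continuous_on[of 1]) (auto intro!: lipschitz_onI simp: dist_norm norm_act)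

lemma act_convex_hull: "g \<in> carrier G \<Longrightarrow> act g ` (convex hull S) = convex hull (act g ` S)"
proof -
  assume g: "g \<in> carrier G"
  have "act g ` S = (\<lambda>x. \<delta> g + x) ` (reindex (\<pi> (inv g)) ` S)" for S
    by (auto simp: act_def image_image add.commute)
  then show ?thesis
    by (simp add: convex_hull_translation convex_hull_linear_image[OF reindex_linear[OF bij_\<pi>]] g)
qed

section \<open>Vertex pieces and strips as closed hulls of orbits\<close>

definition chull :: "'i fsupp set \<Rightarrow> 'i fsupp set" where
  "chull S = closure (convex hull S)"

lemma chull_convex: "convex (chull S)" and chull_closed: "closed (chull S)" and chull_superset: "S \<subseteq> chull S"
  using hull_subset[of S convex] closure_subset[of "convex hull S"] by (auto simp: chull_def convex_closure)

lemma chull_into: "x \<in> chull S \<Longrightarrow> closed C \<Longrightarrow> convex C \<Longrightarrow> S \<subseteq> C \<Longrightarrow> x \<in> C"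
  unfolding chull_def by (rule closure_convex_hull_induct)

lemma act_chull: assumes g: "g \<in> carrier G" shows "act g ` chull S = chull (act g ` S)"
proof -
  have sub: "act g ` chull S \<subseteq> chull (act g ` S)" if "g \<in> carrier G" for g S
    unfolding chull_def act_convex_hull[OF that, symmetric]
    by (rule image_closure_subset[OF continuous_act[OF that] closed_closure closure_subset])
  have "chull (act g ` S) = act g ` act (inv g) ` chull (act g ` S)"
    using act_inv(2)[OF g] by (simp add: image_image)
  also have "\<dots> \<subseteq> act g ` chull (act (inv g) ` act g ` S)" using sub[of "inv g" "act g ` S"] g by blast
  also have "act (inv g) ` act g ` S = S" using act_inv(1)[OF g] by (simp add: image_image)
  finally show ?thesis using sub[OF g] by blast
qed

definition vpiece :: "'a \<Rightarrow> 'v \<Rightarrow> 'i fsupp set" where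
  "vpiece g v = chull ((\<lambda>p. act (g \<otimes> p) (pos v)) ` Pv v)"

definition spiece :: "'a \<Rightarrow> 'e \<Rightarrow> 'i fsupp set" where
  "spiece g e = chull ((\<lambda>p. act (g \<otimes> p) (pos (src e))) ` Pe e \<union> (\<lambda>p. act (g \<otimes> p \<otimes> t e) (pos (tgt e))) ` Pe e)"

lemma PvG: "v \<in> V \<Longrightarrow> p \<in> Pv v \<Longrightarrow> p \<in> carrier G" and PeG: "e \<in> E \<Longrightarrow> p \<in> Pe e \<Longrightarrow> p \<in> carrier G"
  using Pv Pe subgroup.mem_carrier by metis+

lemma act_vpiece: "g \<in> carrier G \<Longrightarrow> h \<in> carrier G \<Longrightarrow> v \<in> V \<Longrightarrow> act g ` vpiece h v = vpiece (g \<otimes> h) v"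
  unfolding vpiece_def act_chull image_image
  by (rule arg_cong[of _ _ chull], rule image_cong) (auto simp: act_mult[symmetric] m_assoc PvG)

lemma act_spiece: "g \<in> carrier G \<Longrightarrow> h \<in> carrier G \<Longrightarrow> e \<in> E \<Longrightarrow> act g ` spiece h e = spiece (g \<otimes> h) e"
  unfolding spiece_def act_chull image_image image_Un
  by (rule arg_cong[of _ _ chull], rule arg_cong2[of _ _ _ _ "(\<union>)"]; rule image_cong)
     (auto simp: act_mult[symmetric] m_assoc PeG t)

lemma coset_image: "subgroup P G \<Longrightarrow> g \<in> carrier G \<Longrightarrow> q \<in> P \<Longrightarrow> (\<lambda>p. f (g \<otimes> q \<otimes> p)) ` P = (\<lambda>p. f (g \<otimes> p)) ` P"
proof -
  assume P: "subgroup P G" and g: "g \<in> carrier G" and q: "q \<in> P"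
  note cl = subgroup.mem_carrier[OF P]
  have "(\<lambda>p. q \<otimes> p) ` P = P"
  proof
    show "(\<lambda>p. q \<otimes> p) ` P \<subseteq> P" using q subgroup.m_closed[OF P] by auto
    show "P \<subseteq> (\<lambda>p. q \<otimes> p) ` P"
    proof
      fix p assume p: "p \<in> P"
      have "p = q \<otimes> (inv q \<otimes> p)" using cl[OF p] cl[OF q] by (simp add: m_assoc[symmetric])
      moreover have "inv q \<otimes> p \<in> P" using p q P by (simp add: subgroup.m_closed subgroup.m_inv_closed)
      ultimately show "p \<in> (\<lambda>p. q \<otimes> p) ` P" by blast
    qed
  qed
  then have "(\<lambda>p. f (g \<otimes> p)) ` P = (\<lambda>p. f (g \<otimes> (q \<otimes> p))) ` P" by (metis image_image)
  also have "\<dots> = (\<lambda>p. f (g \<otimes> q \<otimes> p)) ` P"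
    by (rule image_cong) (use g cl[OF q] cl in \<open>auto simp: m_assoc\<close>)
  finally show ?thesis ..
qed

lemma vpiece_coset: "v \<in> V \<Longrightarrow> g \<in> carrier G \<Longrightarrow> q \<in> Pv v \<Longrightarrow> vpiece (g \<otimes> q) v = vpiece g v"
  unfolding vpiece_def using coset_image[OF Pv, of v g q "\<lambda>p. act p (pos v)"] by simp

lemma spiece_coset: "e \<in> E \<Longrightarrow> g \<in> carrier G \<Longrightarrow> q \<in> Pe e \<Longrightarrow> spiece (g \<otimes> q) e = spiece g e"
  unfolding spiece_def
  using coset_image[OF Pe, of e g q "\<lambda>p. act p (pos (src e))"]
    coset_image[OF Pe, of e g q "\<lambda>p. act (p \<otimes> t e) (pos (tgt e))"] by simp

text \<open>Conjugation by the stable letter carries the edge group into the vertex group of the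
  target.\<close>

lemma upper_coset:
  assumes e: "e \<in> E" and g: "g \<in> carrier G" and q: "q \<in> Pe e"
  shows "vpiece (g \<otimes> q \<otimes> t e) (tgt e) = vpiece (g \<otimes> t e) (tgt e)"
proof -
  have G: "q \<in> carrier G" "t e \<in> carrier G" using PeG e q t by auto
  have "g \<otimes> q \<otimes> t e = (g \<otimes> t e) \<otimes> (inv (t e) \<otimes> q \<otimes> t e)"
    using G g by (simp add: m_assoc) (simp add: m_assoc[symmetric])
  then show ?thesis using vpiece_coset[OF E(3)[OF e] _ Pe_tgt[OF e q], of "g \<otimes> t e"] G g by simp
qed

lemma coord_vertex_orbit:
  assumes v: "v \<in> V" and g: "g \<in> carrier G" and p: "p \<in> Pv v" and i: "i \<notin> J"
  shows "coord (act (g \<otimes> p) (pos v)) i = coord (act g (pos v)) i"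
proof -
  have pG: "p \<in> carrier G" using PvG v p by blast
  have "\<pi> (inv g) i \<notin> J" using \<pi>_J g i by simp
  then have "coord (act p (pos v)) (\<pi> (inv g) i) = coord (pos v) (\<pi> (inv g) i)"
    using vertex_stabilizer[OF v pG] p unfolding act_def by blast
  then show ?thesis using g pG by (simp add: act_mult coord_act[OF g])
qed

text \<open>Outside \<open>J\<close> the orbit of a vertex group is a single value, and having that
  value is a closed convex condition. So a vertex piece is a flat in the finitely many directions of
  \<open>J\<close>.\<close>

lemma coord_vpiece:
  assumes v: "v \<in> V" and g: "g \<in> carrier G" and i: "i \<notin> J" and x: "x \<in> vpiece g v"
  shows "coord x i = coord (act g (pos v)) i"
proof -
  have "x \<in> {x. coord x i = coord (act g (pos v)) i}"
    using x unfolding vpiece_def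
    by (rule chull_into) (use coord_vertex_orbit[OF v g _ i] in \<open>auto simp: closed_coordinate_condition convex_coord_eq\<close>)
  then show ?thesis by simp
qed

lemma act_int: "v \<in> V \<Longrightarrow> g \<in> carrier G \<Longrightarrow> coord (act g (pos v)) i \<in> \<int>"
  using pos_int \<delta>_int by (simp add: coord_act)

lemma coord_upper_orbit:
  assumes e: "e \<in> E" and g: "g \<in> carrier G" and p: "p \<in> Pe e" and i: "i \<notin> J"
  shows "coord (act (g \<otimes> p \<otimes> t e) (pos (tgt e))) i = coord (act (g \<otimes> t e) (pos (tgt e))) i"
proof -
  have G: "p \<in> carrier G" "t e \<in> carrier G" using PeG e p t by auto
  have "g \<otimes> p \<otimes> t e = (g \<otimes> t e) \<otimes> (inv (t e) \<otimes> p \<otimes> t e)"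
    using G g by (simp add: m_assoc) (simp add: m_assoc[symmetric])
  then show ?thesis using coord_vertex_orbit[OF E(3)[OF e] _ Pe_tgt[OF e p] i, of "g \<otimes> t e"] G g by simp
qed

lemma lower_mem: "e \<in> E \<Longrightarrow> g \<in> carrier G \<Longrightarrow> act g (pos (src e)) \<in> spiece g e"
  and upper_mem: "e \<in> E \<Longrightarrow> g \<in> carrier G \<Longrightarrow> act (g \<otimes> t e) (pos (tgt e)) \<in> spiece g e"
proof -
  assume e: "e \<in> E" and g: "g \<in> carrier G"
  have "\<one> \<in> Pe e" using subgroup.one_closed[OF Pe[OF e]] .
  then show "act g (pos (src e)) \<in> spiece g e" "act (g \<otimes> t e) (pos (tgt e)) \<in> spiece g e"
    unfolding spiece_def using g by (auto intro!: subsetD[OF chull_superset] image_eqI[of _ _ \<one>])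
qed

lemma center_mem: "v \<in> V \<Longrightarrow> g \<in> carrier G \<Longrightarrow> act g (pos v) \<in> vpiece g v"
  unfolding vpiece_def using subgroup.one_closed[OF Pv, of v]
  by (auto intro!: subsetD[OF chull_superset] image_eqI[of _ _ \<one>])

text \<open>Both orbits that span the strip agree in every edge coordinate except its own, so these
  coordinates serve as heights for the other strips.\<close>

lemma coord_other_edge:
  assumes e: "e \<in> E" and e': "e' \<in> E" and g: "g \<in> carrier G" and g': "g' \<in> carrier G"
    and ne: "\<pi> g' (\<epsilon> e') \<noteq> \<pi> g (\<epsilon> e)" and x: "x \<in> spiece g e"
  shows "coord x (\<pi> g' (\<epsilon> e')) = coord (act g (pos (src e))) (\<pi> g' (\<epsilon> e'))"
proof -
  let ?i = "\<pi> g' (\<epsilon> e')"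
  have i: "?i \<notin> J" using \<pi>_J[OF g'] \<epsilon>_J[OF e'] by simp
  have gi: "\<pi> (inv g) ?i = \<pi> (inv g \<otimes> g') (\<epsilon> e')" using \<pi>_mult g g' by simp
  have "\<pi> (inv g) ?i \<noteq> \<epsilon> e" using ne \<pi>_inv(2)[OF g] by metis
  then have "coord (act (t e) (pos (tgt e))) (\<pi> (inv g) ?i) = coord (pos (src e)) (\<pi> (inv g) ?i)"
    using other_edge_step[OF e e', of "inv g \<otimes> g'"] g g' unfolding gi act_def by simp
  then have up: "coord (act (g \<otimes> t e) (pos (tgt e))) ?i = coord (act g (pos (src e))) ?i"
    using g t[OF e] by (simp add: act_mult coord_act[OF g])
  have "x \<in> {x. coord x ?i = coord (act g (pos (src e))) ?i}"
    using x unfolding spiece_def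
    by (rule chull_into)
       (use coord_vertex_orbit[OF E(2)[OF e] g subsetD[OF Pe_src[OF e]] i] coord_upper_orbit[OF e g _ i] up
         in \<open>auto simp: closed_coordinate_condition convex_coord_eq\<close>)
  then show ?thesis by simp
qed

lemma coord_edge_upper:
  assumes e: "e \<in> E" and g: "g \<in> carrier G"
  shows "coord (act (g \<otimes> t e) (pos (tgt e))) (\<pi> g (\<epsilon> e)) = coord (act g (pos (src e))) (\<pi> g (\<epsilon> e)) + 1"
  using edge_step[OF e] g t[OF e] by (simp add: act_mult coord_act[OF g] \<pi>_inv act_def[of "t e", symmetric])

lemma coord_edge_bounds:
  assumes e: "e \<in> E" and g: "g \<in> carrier G" and x: "x \<in> spiece g e"
  shows "coord (act g (pos (src e))) (\<pi> g (\<epsilon> e)) \<le> coord x (\<pi> g (\<epsilon> e))"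
    and "coord x (\<pi> g (\<epsilon> e)) \<le> coord (act g (pos (src e))) (\<pi> g (\<epsilon> e)) + 1"
proof -
  let ?i = "\<pi> g (\<epsilon> e)"
  have i: "?i \<notin> J" using \<pi>_J[OF g] \<epsilon>_J[OF e] by simp
  note lo = coord_vertex_orbit[OF E(2)[OF e] g subsetD[OF Pe_src[OF e]] i]
  note up = coord_upper_orbit[OF e g _ i, unfolded coord_edge_upper[OF e g]]
  have "x \<in> {x. coord (act g (pos (src e))) ?i \<le> coord x ?i}"
    using x unfolding spiece_def
    by (rule chull_into) (use lo up in \<open>auto simp: closed_coord_le convex_coord_le\<close>)
  moreover have "x \<in> {x. coord x ?i \<le> coord (act g (pos (src e))) ?i + 1}"
    using x unfolding spiece_def
    by (rule chull_into) (use lo up in \<open>auto simp: closed_coord_le convex_coord_le\<close>)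
  ultimately show "coord (act g (pos (src e))) ?i \<le> coord x ?i" "coord x ?i \<le> coord (act g (pos (src e))) ?i + 1"
    by auto
qed

lemma coord_spiece_const:
  assumes e: "e \<in> E" and g: "g \<in> carrier G" and i: "i \<notin> J" and x: "x \<in> spiece g e"
    and up: "coord (act (g \<otimes> t e) (pos (tgt e))) i = coord (act g (pos (src e))) i"
  shows "coord x i = coord (act g (pos (src e))) i"
proof -
  have "x \<in> {x. coord x i = coord (act g (pos (src e))) i}"
    using x unfolding spiece_def
    by (rule chull_into)
       (use coord_vertex_orbit[OF E(2)[OF e] g subsetD[OF Pe_src[OF e]] i] coord_upper_orbit[OF e g _ i] up
         in \<open>auto simp: closed_coordinate_condition convex_coord_eq\<close>)
  then show ?thesis by simp
qed

lemma dist_orbits: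
  assumes e: "e \<in> E" and g: "g \<in> carrier G" and p: "p \<in> Pe e"
  shows "norm (act (g \<otimes> p \<otimes> t e) (pos (tgt e)) - act (g \<otimes> p) (pos (src e))) = norm (act (t e) (pos (tgt e)) - pos (src e))"
  using g PeG[OF e p] t[OF e] by (simp add: act_mult[of "g \<otimes> p"] norm_act)

text \<open>In a closed hull a slice need not be the hull of the generators in it, so membership is
  obtained from a barrier: the distance to the vertex piece is at most \<open>D\<close> times the
  height above the bottom.\<close>

lemma bottom_slice:
  assumes e: "e \<in> E" and g: "g \<in> carrier G" and x: "x \<in> spiece g e"
    and k: "coord x (\<pi> g (\<epsilon> e)) = coord (act g (pos (src e))) (\<pi> g (\<epsilon> e))"
  shows "x \<in> vpiece g (src e)"
proof -
  let ?i = "\<pi> g (\<epsilon> e)" and ?C = "vpiece g (src e)"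
  have i: "?i \<notin> J" using \<pi>_J[OF g] \<epsilon>_J[OF e] by simp
  define c where "c = coord (act g (pos (src e))) ?i"
  \<comment> \<open>The distance between corresponding points of the two orbits, the same for all of
    them since the action is isometric.\<close>
  define D where "D = norm (act (t e) (pos (tgt e)) - pos (src e))"
  have C: "closed ?C" "convex ?C" "?C \<noteq> {}"
    using chull_closed chull_convex center_mem[OF E(2)[OF e] g] by (auto simp: vpiece_def)
  have low: "act (g \<otimes> p) (pos (src e)) \<in> ?C" if "p \<in> Pe e" for p
    unfolding vpiece_def using that Pe_src[OF e] by (intro subsetD[OF chull_superset]) auto
  \<comment> \<open>The barrier holds on the lower orbit with value 0 and on the upper orbit with
    value \<open>D\<close>. It is closed and convex, hence holds on the whole strip.\<close>
  have "x \<in> {x. infdist x ?C \<le> D * coord x ?i - D * c}"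
    using x unfolding spiece_def
  proof (rule chull_into)
    show "closed {x. infdist x ?C \<le> D * coord x ?i - D * c}" "convex {x. infdist x ?C \<le> D * coord x ?i - D * c}"
      by (rule closed_infdist_le[OF C(3)] convex_infdist_le[OF C(2,3)])+
    have "infdist y ?C \<le> D * coord y ?i - D * c"
      if "y \<in> (\<lambda>p. act (g \<otimes> p) (pos (src e))) ` Pe e" for y
      using that low coord_vertex_orbit[OF E(2)[OF e] g subsetD[OF Pe_src[OF e]] i] by (auto simp: c_def)
    moreover have "infdist y ?C \<le> D * coord y ?i - D * c"
      if yO: "y \<in> (\<lambda>p. act (g \<otimes> p \<otimes> t e) (pos (tgt e))) ` Pe e" for y
    proof -
      obtain p where p: "p \<in> Pe e" "y = act (g \<otimes> p \<otimes> t e) (pos (tgt e))" using yO by blast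
      have "infdist y ?C \<le> D"
        using infdist_le[OF low[OF p(1)], of y] dist_orbits[OF e g p(1)] by (simp add: dist_norm p(2) D_def)
      moreover have "coord y ?i = c + 1"
        using coord_upper_orbit[OF e g p(1) i] coord_edge_upper[OF e g] by (simp add: p(2) c_def)
      ultimately show ?thesis by (simp add: algebra_simps)
    qed
    ultimately show "(\<lambda>p. act (g \<otimes> p) (pos (src e))) ` Pe e \<union> (\<lambda>p. act (g \<otimes> p \<otimes> t e) (pos (tgt e))) ` Pe e
      \<subseteq> {x. infdist x ?C \<le> D * coord x ?i - D * c}" by blast
  qed
  then have "infdist x ?C = 0" using k infdist_nonneg[of x ?C] by (simp add: c_def)
  then show ?thesis using in_closed_iff_infdist_zero[OF C(1,3)] by blast
qed

text \<open>The same barrier, with the height measured downwards from the top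
  \<open>c + 1\<close>.\<close>

lemma top_slice:
  assumes e: "e \<in> E" and g: "g \<in> carrier G" and x: "x \<in> spiece g e"
    and k: "coord x (\<pi> g (\<epsilon> e)) = coord (act g (pos (src e))) (\<pi> g (\<epsilon> e)) + 1"
  shows "x \<in> vpiece (g \<otimes> t e) (tgt e)"
proof -
  let ?i = "\<pi> g (\<epsilon> e)" and ?C = "vpiece (g \<otimes> t e) (tgt e)"
  have i: "?i \<notin> J" using \<pi>_J[OF g] \<epsilon>_J[OF e] by simp
  define c where "c = coord (act g (pos (src e))) ?i"
  define D where "D = norm (act (t e) (pos (tgt e)) - pos (src e))"
  have gt: "g \<otimes> t e \<in> carrier G" using g t[OF e] by simp
  have C: "closed ?C" "convex ?C" "?C \<noteq> {}"
    using chull_closed chull_convex center_mem[OF E(3)[OF e] gt] by (auto simp: vpiece_def)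
  have up: "act (g \<otimes> p \<otimes> t e) (pos (tgt e)) \<in> ?C" if p: "p \<in> Pe e" for p
  proof -
    have G: "p \<in> carrier G" "t e \<in> carrier G" using PeG e p t by auto
    have "g \<otimes> p \<otimes> t e = (g \<otimes> t e) \<otimes> (inv (t e) \<otimes> p \<otimes> t e)"
      using G g by (simp add: m_assoc) (simp add: m_assoc[symmetric])
    then show ?thesis unfolding vpiece_def using Pe_tgt[OF e p] by (intro subsetD[OF chull_superset]) auto
  qed
  have "x \<in> {x. infdist x ?C \<le> (- D) * coord x ?i - (- D) * (c + 1)}"
    using x unfolding spiece_def
  proof (rule chull_into)
    show "closed {x. infdist x ?C \<le> (- D) * coord x ?i - (- D) * (c + 1)}"
      "convex {x. infdist x ?C \<le> (- D) * coord x ?i - (- D) * (c + 1)}"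
      by (rule closed_infdist_le[OF C(3)] convex_infdist_le[OF C(2,3)])+
    have "infdist y ?C \<le> (- D) * coord y ?i - (- D) * (c + 1)"
      if yO: "y \<in> (\<lambda>p. act (g \<otimes> p \<otimes> t e) (pos (tgt e))) ` Pe e" for y
    proof -
      obtain p where p: "p \<in> Pe e" "y = act (g \<otimes> p \<otimes> t e) (pos (tgt e))" using yO by blast
      have "coord y ?i = c + 1"
        using coord_upper_orbit[OF e g p(1) i] coord_edge_upper[OF e g] by (simp add: p(2) c_def)
      then show ?thesis using up[OF p(1)] p(2) by simp
    qed
    moreover have "infdist y ?C \<le> (- D) * coord y ?i - (- D) * (c + 1)"
      if yO: "y \<in> (\<lambda>p. act (g \<otimes> p) (pos (src e))) ` Pe e" for y
    proof -
      obtain p where p: "p \<in> Pe e" "y = act (g \<otimes> p) (pos (src e))" using yO by blast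
      have "infdist y ?C \<le> D"
        using infdist_le[OF up[OF p(1)], of y] dist_orbits[OF e g p(1)]
        by (simp add: dist_norm p(2) D_def norm_minus_commute)
      moreover have "coord y ?i = c"
        using coord_vertex_orbit[OF E(2)[OF e] g subsetD[OF Pe_src[OF e] p(1)] i] by (simp add: p(2) c_def)
      ultimately show ?thesis by (simp add: algebra_simps)
    qed
    ultimately show "(\<lambda>p. act (g \<otimes> p) (pos (src e))) ` Pe e \<union> (\<lambda>p. act (g \<otimes> p \<otimes> t e) (pos (tgt e))) ` Pe e
      \<subseteq> {x. infdist x ?C \<le> (- D) * coord x ?i - (- D) * (c + 1)}" by blast
  qed
  then have "infdist x ?C = 0" using k infdist_nonneg[of x ?C] by (simp add: c_def)
  then show ?thesis using in_closed_iff_infdist_zero[OF C(1,3)] by blast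
qed

lemma same_edge_index:
  assumes e: "e \<in> E" "e' \<in> E" and g: "g \<in> carrier G" "g' \<in> carrier G" and eq: "\<pi> g (\<epsilon> e) = \<pi> g' (\<epsilon> e')"
  shows "e' = e \<and> (\<exists>q\<in>Pe e. g' = g \<otimes> q)"
proof -
  have "\<pi> (inv g \<otimes> g') (\<epsilon> e') = \<epsilon> e" using \<pi>_mult[of "inv g" g'] g eq[symmetric] \<pi>_inv(1) by simp
  then have "e' = e \<and> inv g \<otimes> g' \<in> Pe e'" using edge_stabilizer[OF e(2,1), of "inv g \<otimes> g'"] g by blast
  moreover have "g' = g \<otimes> (inv g \<otimes> g')" using g by (simp add: m_assoc[symmetric])
  ultimately show ?thesis by metis
qed

text \<open>A strip is recognised by its own edge coordinate, which differs by 1 between its two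
  base points; a strip with another index is constant there.\<close>

lemma spiece_index:
  assumes e: "e \<in> E" "e' \<in> E" and g: "g \<in> carrier G" "g' \<in> carrier G" and eq: "spiece g e = spiece g' e'"
  shows "\<pi> g (\<epsilon> e) = \<pi> g' (\<epsilon> e')"
proof (rule ccontr)
  assume n: "\<pi> g (\<epsilon> e) \<noteq> \<pi> g' (\<epsilon> e')"
  note c = coord_other_edge[OF e(2,1) g(2,1) n, folded eq]
  show False using c[OF lower_mem[OF e(1) g(1)]] c[OF upper_mem[OF e(1) g(1)]] coord_edge_upper[OF e(1) g(1)] by simp
qed

lemma spiece_eqD:
  assumes e: "e \<in> E" "e' \<in> E" and g: "g \<in> carrier G" "g' \<in> carrier G" and eq: "spiece g e = spiece g' e'"
  shows "\<exists>q\<in>Pe e. e' = e \<and> g' = g \<otimes> q"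
  using same_edge_index[OF e g spiece_index[OF e g eq]] by blast

definition vpieces :: "'i fsupp set set" where "vpieces = {vpiece g v | g v. g \<in> carrier G \<and> v \<in> V}"
definition spieces :: "'i fsupp set set" where "spieces = {spiece g e | g e. g \<in> carrier G \<and> e \<in> E}"
text \<open>The pieces are bare sets, so a coset representative is recovered by choice.
  \<open>spiece_data\<close> shows that the derived ends and heights do not depend on it.\<close>

definition label :: "'i fsupp set \<Rightarrow> 'a \<times> 'e" where
  "label S = (SOME (g, e). g \<in> carrier G \<and> e \<in> E \<and> S = spiece g e)"
definition lower :: "'i fsupp set \<Rightarrow> 'i fsupp set" where
  "lower S = (case label S of (g, e) \<Rightarrow> vpiece g (src e))"
definition upper :: "'i fsupp set \<Rightarrow> 'i fsupp set" where
  "upper S = (case label S of (g, e) \<Rightarrow> vpiece (g \<otimes> t e) (tgt e))"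
definition edge_index :: "'i fsupp set \<Rightarrow> 'i" where
  "edge_index S = (case label S of (g, e) \<Rightarrow> \<pi> g (\<epsilon> e))"
definition base_height :: "'i fsupp set \<Rightarrow> real" where
  "base_height S = (case label S of (g, e) \<Rightarrow> coord (act g (pos (src e))) (\<pi> g (\<epsilon> e)))"

lemma label:
  assumes "S \<in> spieces"
  obtains g e where "g \<in> carrier G" "e \<in> E" "S = spiece g e" "label S = (g, e)"
proof -
  obtain g e where ge: "g \<in> carrier G \<and> e \<in> E \<and> S = spiece g e" using assms by (auto simp: spieces_def)
  have "case label S of (g, e) \<Rightarrow> g \<in> carrier G \<and> e \<in> E \<and> S = spiece g e"
    unfolding label_def by (rule someI[of _ "(g, e)"]) (use ge in simp)
  then show ?thesis using that by (cases "label S") auto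
qed

lemma spiece_data:
  assumes e: "e \<in> E" and g: "g \<in> carrier G"
  shows "lower (spiece g e) = vpiece g (src e)" "upper (spiece g e) = vpiece (g \<otimes> t e) (tgt e)"
    "edge_index (spiece g e) = \<pi> g (\<epsilon> e)"
    "base_height (spiece g e) = coord (act g (pos (src e))) (\<pi> g (\<epsilon> e))"
proof -
  have "spiece g e \<in> spieces" using e g by (auto simp: spieces_def)
  then obtain g' e' where g': "g' \<in> carrier G" "e' \<in> E" "spiece g e = spiece g' e'" "label (spiece g e) = (g', e')"
    by (rule label)
  obtain q where q: "q \<in> Pe e" "e' = e" "g' = g \<otimes> q" using spiece_eqD[OF e g'(2) g g'(1) g'(3)] by blast
  have i: "\<pi> g (\<epsilon> e) = \<pi> g' (\<epsilon> e')" by (rule spiece_index[OF e g'(2) g g'(1) g'(3)])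
  have qv: "q \<in> Pv (src e)" using q Pe_src[OF e] by blast
  show "lower (spiece g e) = vpiece g (src e)"
    using vpiece_coset[OF E(2)[OF e] g qv] q by (simp add: lower_def g'(4))
  show "upper (spiece g e) = vpiece (g \<otimes> t e) (tgt e)"
    using upper_coset[OF e g q(1)] q by (simp add: upper_def g'(4))
  show "edge_index (spiece g e) = \<pi> g (\<epsilon> e)" using i by (simp add: edge_index_def g'(4))
  have "\<pi> g (\<epsilon> e) \<notin> J" using \<pi>_J[OF g] \<epsilon>_J[OF e] by simp
  then show "base_height (spiece g e) = coord (act g (pos (src e))) (\<pi> g (\<epsilon> e))"
    using coord_vertex_orbit[OF E(2)[OF e] g qv] i q by (simp add: base_height_def g'(4))
qed

section \<open>Incidence and connectedness of the pieces\<close>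

lemma act_incident:
  assumes k: "k \<in> carrier G" and PQ: "(P, Q) \<in> incident spieces lower upper"
  shows "(act k ` P, act k ` Q) \<in> incident spieces lower upper"
proof -
  have *: "act k ` S \<in> spieces \<and> act k ` lower S = lower (act k ` S) \<and> act k ` upper S = upper (act k ` S)"
    if S: "S \<in> spieces" for S
  proof -
    obtain g e where ge: "g \<in> carrier G" "e \<in> E" "S = spiece g e" using S by (auto simp: spieces_def)
    have kg: "k \<otimes> g \<in> carrier G" using k ge by simp
    have "act k ` S = spiece (k \<otimes> g) e" using act_spiece k ge by simp
    then show ?thesis
      using spiece_data[OF ge(2,1)] spiece_data[OF ge(2) kg] kg ge k act_vpiece[OF k _ E(2)[OF ge(2)]]
        act_vpiece[OF k _ E(3)[OF ge(2)], of "g \<otimes> t e"] t[OF ge(2)]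
      by (auto simp: spieces_def m_assoc)
  qed
  show ?thesis using PQ * unfolding incident_def by blast
qed

lemma act_incident_rtrancl:
  assumes k: "k \<in> carrier G" and PQ: "(P, Q) \<in> (incident spieces lower upper)\<^sup>*"
  shows "(act k ` P, act k ` Q) \<in> (incident spieces lower upper)\<^sup>*"
  using PQ by (induction rule: rtrancl_induct) (auto intro: rtrancl_into_rtrancl act_incident[OF k])

lemma incident_sym: "(P, Q) \<in> (incident \<S> l u)\<^sup>* \<Longrightarrow> (Q, P) \<in> (incident \<S> l u)\<^sup>*"
proof -
  have "sym (incident \<S> l u)" unfolding incident_def sym_def by blast
  then show "(P, Q) \<in> (incident \<S> l u)\<^sup>* \<Longrightarrow> (Q, P) \<in> (incident \<S> l u)\<^sup>*"
    using sym_rtrancl symD by metis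
qed

lemma edge_connects:
  assumes e: "e \<in> E" and g: "g \<in> carrier G"
  shows "(vpiece g (src e), vpiece (g \<otimes> t e) (tgt e)) \<in> (incident spieces lower upper)\<^sup>*"
proof -
  have S: "spiece g e \<in> spieces" using e g by (auto simp: spieces_def)
  have "(vpiece g (src e), spiece g e) \<in> incident spieces lower upper"
    "(spiece g e, vpiece (g \<otimes> t e) (tgt e)) \<in> incident spieces lower upper"
    using S spiece_data[OF e g] by (auto simp: incident_def)
  then show ?thesis by (meson rtrancl.simps)
qed

lemma base_pieces_connected:
  assumes "u \<in> V" "v \<in> V"
  shows "(vpiece \<one> u, vpiece \<one> v) \<in> (incident spieces lower upper)\<^sup>*"
  using base_connected[OF assms]
proof (induction rule: rtrancl_induct)
  case (step y z)
  then obtain e where e: "e \<in> E" "t e = \<one>" "(y = src e \<and> z = tgt e) \<or> (y = tgt e \<and> z = src e)" by blast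
  have 1: "(vpiece \<one> (src e), vpiece \<one> (tgt e)) \<in> (incident spieces lower upper)\<^sup>*"
    using edge_connects[OF e(1) one_closed] e(2) by simp
  have "(vpiece \<one> y, vpiece \<one> z) \<in> (incident spieces lower upper)\<^sup>*" using e(3) 1 incident_sym[OF 1] by blast
  then show ?case using step.IH by (meson rtrancl_trans)
qed simp

text \<open>The elements that move a base piece within its component form a subgroup. It contains
  each vertex group, whose elements preserve a piece joined to the base piece, and each stable
  letter, whose strip joins the two relevant translates; by \<open>generated\<close> it is
  everything.\<close>

lemma vpieces_connected:
  assumes "P \<in> vpieces" "Q \<in> vpieces"
  shows "(P, Q) \<in> (incident spieces lower upper)\<^sup>*"
proof -
  let ?R = "(incident spieces lower upper)\<^sup>*"
  obtain v0 where v0: "v0 \<in> V" using V(2) by blast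
  define H where "H = {g \<in> carrier G. (vpiece \<one> v0, vpiece g v0) \<in> ?R}"
  have tr: "(vpiece (k \<otimes> g) u, vpiece (k \<otimes> h) v) \<in> ?R"
    if "k \<in> carrier G" "g \<in> carrier G" "h \<in> carrier G" "u \<in> V" "v \<in> V" "(vpiece g u, vpiece h v) \<in> ?R" for k g h u v
    using act_incident_rtrancl[OF that(1,6)] act_vpiece that by simp
  have "H = carrier G"
  proof (rule generated)
    show "subgroup H G"
    proof
      show "H \<subseteq> carrier G" by (auto simp: H_def)
      show "\<one> \<in> H" by (simp add: H_def)
      fix g assume g: "g \<in> H"
      then have "(vpiece (inv g \<otimes> \<one>) v0, vpiece (inv g \<otimes> g) v0) \<in> ?R" by (intro tr) (use v0 in \<open>auto simp: H_def\<close>)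
      then show "inv g \<in> H" using incident_sym g by (simp add: H_def)
      fix h assume h: "h \<in> H"
      then have "(vpiece (g \<otimes> \<one>) v0, vpiece (g \<otimes> h) v0) \<in> ?R" by (intro tr) (use v0 g in \<open>auto simp: H_def\<close>)
      then show "g \<otimes> h \<in> H" using g h rtrancl_trans by (fastforce simp: H_def)
    qed
    show "Pv v \<subseteq> H" if v: "v \<in> V" for v
    proof
      fix p assume p: "p \<in> Pv v"
      have pG: "p \<in> carrier G" by (rule PvG[OF v p])
      have "(vpiece (p \<otimes> \<one>) v, vpiece (p \<otimes> \<one>) v0) \<in> ?R"
        by (rule tr[OF pG _ _ v v0]) (use base_pieces_connected v v0 in simp_all)
      moreover have "vpiece (p \<otimes> \<one>) v = vpiece \<one> v" using vpiece_coset[OF v one_closed p] pG by simp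
      ultimately have "(vpiece \<one> v, vpiece p v0) \<in> ?R" using pG by simp
      then show "p \<in> H" using base_pieces_connected[OF v0 v] pG rtrancl_trans by (fastforce simp: H_def)
    qed
    show "t e \<in> H" if e: "e \<in> E" for e
    proof -
      have 1: "(vpiece \<one> v0, vpiece \<one> (src e)) \<in> ?R" using base_pieces_connected v0 E(2)[OF e] by blast
      have 2: "(vpiece \<one> (src e), vpiece (t e) (tgt e)) \<in> ?R" using edge_connects[OF e one_closed] t[OF e] by simp
      have "(vpiece (t e \<otimes> \<one>) (tgt e), vpiece (t e \<otimes> \<one>) v0) \<in> ?R"
        by (rule tr[OF t[OF e] _ _ E(3)[OF e] v0]) (use base_pieces_connected E(3)[OF e] v0 in simp_all)
      then have 3: "(vpiece (t e) (tgt e), vpiece (t e) v0) \<in> ?R" using t[OF e] by simp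
      show ?thesis using rtrancl_trans[OF rtrancl_trans[OF 1 2] 3] t[OF e] by (simp add: H_def)
    qed
  qed
  then have all: "(vpiece \<one> v0, vpiece g v0) \<in> ?R" if "g \<in> carrier G" for g using that by (auto simp: H_def)
  have to: "(vpiece \<one> v0, vpiece g v) \<in> ?R" if "g \<in> carrier G" "v \<in> V" for g v
  proof -
    have "(vpiece (g \<otimes> \<one>) v0, vpiece (g \<otimes> \<one>) v) \<in> ?R"
      by (rule tr[OF that(1) _ _ v0 that(2)]) (use base_pieces_connected v0 that in simp_all)
    then have "(vpiece g v0, vpiece g v) \<in> ?R" using that by simp
    then show ?thesis using rtrancl_trans[OF all[OF that(1)]] by blast
  qed
  obtain g u h v where "g \<in> carrier G" "u \<in> V" "P = vpiece g u" "h \<in> carrier G" "v \<in> V" "Q = vpiece h v"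
    using assms by (auto simp: vpieces_def)
  then show ?thesis using rtrancl_trans[OF incident_sym[OF to[of g u]] to[of h v]] by blast
qed

lemma piece_cases:
  assumes "P \<in> vpieces \<union> spieces"
  obtains (vertex) g v where "g \<in> carrier G" "v \<in> V" "P = vpiece g v"
    | (strip) g e where "g \<in> carrier G" "e \<in> E" "P = spiece g e"
  using assms by (auto simp: vpieces_def spieces_def)

sublocale strip_tree vpieces spieces "\<lambda>S x. coord x (edge_index S)" base_height lower upper
proof
  fix P assume P: "P \<in> vpieces \<union> spieces"
  show "convex P" using P by (cases rule: piece_cases) (auto simp: vpiece_def spiece_def chull_convex)
  show "compact (P \<inter> cball x r)" for x r
    using P
  proof (cases rule: piece_cases)
    case (vertex g v)
    show ?thesis
      by (rule compact_closed_finite_coordinates[OF _ finite_J, of _ "act g (pos v)"])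
         (use vertex coord_vpiece chull_closed in \<open>auto simp: vpiece_def[of g v]\<close>)
  next
    case (strip g e)
    \<comment> \<open>A strip varies only in \<open>J\<close> and in the finitely many coordinates
      in which its two base points differ.\<close>
    let ?D = "{i. coord (act (g \<otimes> t e) (pos (tgt e)) - act g (pos (src e))) i \<noteq> 0}"
    show ?thesis
    proof (rule compact_closed_finite_coordinates)
      show "closed P" using strip chull_closed by (simp add: spiece_def)
      show "finite (J \<union> ?D)" using finite_J finite_support by blast
      show "coord x i = coord (act g (pos (src e))) i" if "x \<in> P" "i \<notin> J \<union> ?D" for x i
        using coord_spiece_const[OF strip(2,1), of i x] that strip(3) by simp
    qed
  qed
next
  show "vpieces \<noteq> {}" using V(2) one_closed by (auto simp: vpieces_def)
  show "{} \<notin> vpieces" using center_mem by (auto simp: vpieces_def)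
  show "vpieces \<inter> spieces = {}"
  proof (rule ccontr)
    assume "vpieces \<inter> spieces \<noteq> {}"
    then obtain g v h e where gv: "g \<in> carrier G" "v \<in> V" and he: "h \<in> carrier G" "e \<in> E" and eq: "vpiece g v = spiece h e"
      by (auto simp: vpieces_def spieces_def)
    \<comment> \<open>A vertex piece is constant in the edge coordinate that the strip
      crosses.\<close>
    have i: "\<pi> h (\<epsilon> e) \<notin> J" using \<pi>_J[OF he(1)] \<epsilon>_J[OF he(2)] by simp
    note c = coord_vpiece[OF gv(2,1) i, unfolded eq]
    show False using c[OF lower_mem[OF he(2,1)]] c[OF upper_mem[OF he(2,1)]] coord_edge_upper[OF he(2,1)] by simp
  qed
  show "(P, Q) \<in> (incident spieces lower upper)\<^sup>*" if "P \<in> vpieces" "Q \<in> vpieces" for P Q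
    by (rule vpieces_connected[OF that])
next
  fix S assume "S \<in> spieces"
  then obtain g e where ge: "g \<in> carrier G" "e \<in> E" and S: "S = spiece g e" by (auto simp: spieces_def)
  note data = spiece_data[OF ge(2,1), folded S]
  have gt: "g \<otimes> t e \<in> carrier G" using ge t by simp
  have i: "\<pi> g (\<epsilon> e) \<notin> J" using \<pi>_J[OF ge(1)] \<epsilon>_J[OF ge(2)] by simp
  show "lower S \<in> vpieces" "upper S \<in> vpieces"
    unfolding data vpieces_def using ge(1) gt E(2,3)[OF ge(2)] by blast+
  show "S \<inter> lower S \<noteq> {}" using lower_mem[OF ge(2,1)] center_mem[OF E(2)[OF ge(2)] ge(1)] data S by auto
  show "S \<inter> upper S \<noteq> {}" using upper_mem[OF ge(2,1)] center_mem[OF E(3)[OF ge(2)] gt] data S by auto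
  show "\<bar>coord x (edge_index S) - coord y (edge_index S)\<bar> \<le> norm (x - y)" for x y
    using coord_le_norm[of "x - y" "edge_index S"] by simp
  fix x
  show "base_height S \<le> coord x (edge_index S) \<and> coord x (edge_index S) \<le> base_height S + 1" if "x \<in> S"
    using coord_edge_bounds[OF ge(2,1)] that data S by simp
  show "coord x (edge_index S) = base_height S" if "x \<in> lower S"
    using coord_vpiece[OF E(2)[OF ge(2)] ge(1) i] that data by simp
  show "coord x (edge_index S) = base_height S + 1" if "x \<in> upper S"
    using coord_vpiece[OF E(3)[OF ge(2)] gt i] coord_edge_upper[OF ge(2,1)] that data by simp
  show "x \<in> lower S" if "x \<in> S" "coord x (edge_index S) = base_height S"
    using bottom_slice[OF ge(2,1)] that data S by simp
  show "x \<in> upper S" if "x \<in> S" "coord x (edge_index S) = base_height S + 1"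
    using top_slice[OF ge(2,1)] that data S by simp
  fix P y assume P: "P \<in> vpieces \<union> spieces" "P \<noteq> S" "x \<in> P" "y \<in> P"
  from P(1) show "coord x (edge_index S) = coord y (edge_index S)"
  proof (cases rule: piece_cases)
    case (vertex h v)
    then show ?thesis using coord_vpiece[OF vertex(2,1) i] P data by simp
  next
    case (strip h f)
    have "\<pi> g (\<epsilon> e) \<noteq> \<pi> h (\<epsilon> f)"
    proof
      assume "\<pi> g (\<epsilon> e) = \<pi> h (\<epsilon> f)"
      then obtain q where "f = e" "q \<in> Pe e" "h = g \<otimes> q" using same_edge_index[OF ge(2) strip(2) ge(1) strip(1)] by blast
      then have "P = S" using spiece_coset[OF ge(2,1)] strip S by simp
      then show False using P(2) by simp
    qed
    then show ?thesis using coord_other_edge[OF strip(2) ge(2) strip(1) ge(1)] P data strip(3) by simp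
  qed
qed

end

section \<open>Coarse density of orbits in their hulls\<close>

lemma coord_sum: "coord (sum f A) i = (\<Sum>a\<in>A. coord (f a) i)"
  by (induction A rule: infinite_finite_induct) auto

lemma fsupp_expansion:
  assumes "finite J" "\<And>i. i \<notin> J \<Longrightarrow> coord a i = 0" shows "a = (\<Sum>j\<in>J. coord a j *\<^sub>R unit j)"
proof (rule fsupp_eqI)
  fix i
  have "(\<Sum>j\<in>J. coord (coord a j *\<^sub>R unit j) i) = (\<Sum>j\<in>J. if i = j then coord a i else 0)"
    by (rule sum.cong) (auto simp: coord_unit)
  then show "coord a i = coord (\<Sum>j\<in>J. coord a j *\<^sub>R unit j) i"
    unfolding coord_sum using assms by (simp add: sum.delta)
qed

context tree_splitting
begin

text \<open>Up to finitely many cosets \<open>P\<close> acts on the orbit by translations. The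
  translation vectors form an additive group \<Lambda> inside the finite-dimensional space of
  \<open>J\<close>, and every point of the hull is a point of a fixed compact hull plus a vector of
  the span of \<Lambda>, which can be rounded to \<Lambda>.\<close>

lemma coarse_orbit:
  assumes P: "subgroup P G" and fix_off: "\<And>p i. p \<in> P \<Longrightarrow> i \<notin> J \<Longrightarrow> coord (act p y) i = coord y i"
  shows "\<exists>R. \<forall>x\<in>convex hull ((\<lambda>p. act p y) ` P). \<exists>p\<in>P. norm (x - act p y) \<le> R"
proof -
  note PG = subgroup.mem_carrier[OF P]
  define \<rho> where "\<rho> p = restrict (\<pi> p) J" for p
  have "\<rho> ` P \<subseteq> J \<rightarrow>\<^sub>E J" using \<pi>_J PG by (auto simp: \<rho>_def)
  then have fin\<rho>: "finite (\<rho> ` P)" using finite_PiE[OF finite_J] finite_J finite_subset by metis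
  have "\<forall>c\<in>\<rho> ` P. \<exists>p\<in>P. \<rho> p = c" by blast
  then obtain rep where rep: "\<And>c. c \<in> \<rho> ` P \<Longrightarrow> rep c \<in> P" "\<And>c. c \<in> \<rho> ` P \<Longrightarrow> \<rho> (rep c) = c" by metis
  define F where "F = (\<lambda>c. act (rep c) y) ` \<rho> ` P"
  have finF: "finite F" using fin\<rho> by (simp add: F_def)
  \<comment> \<open>These elements fix every index in \<open>J\<close>, and all of \<open>P\<close>
    fixes the coordinates outside \<open>J\<close> along the orbit; hence
    \<open>translate\<close>.\<close>
  define N where "N = {n \<in> P. \<forall>j\<in>J. \<pi> n j = j}"
  define \<tau> where "\<tau> n = act n y - y" for n
  have translate: "act n (act q y) = act q y + \<tau> n" if n: "n \<in> N" and q: "q \<in> P" for n q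
  proof (rule fsupp_eqI)
    fix i
    have nP: "n \<in> P" and nG: "n \<in> carrier G" and qG: "q \<in> carrier G" using n q PG by (auto simp: N_def)
    show "coord (act n (act q y)) i = coord (act q y + \<tau> n) i"
    proof (cases "i \<in> J")
      case True
      have "\<pi> (inv n) i = i" using \<pi>_inv(1)[OF nG, of i] n True by (simp add: N_def)
      then show ?thesis by (simp add: \<tau>_def coord_act[OF nG])
    next
      case False
      have "coord (act n (act q y)) i = coord y i"
        using fix_off[OF subgroup.m_closed[OF P nP q] False] act_mult[OF nG qG] by simp
      then show ?thesis using fix_off[OF q False] fix_off[OF nP False] by (simp add: \<tau>_def)
    qed
  qed
  have one: "\<one> \<in> P" "\<one> \<in> N" using subgroup.one_closed[OF P] \<pi>_one by (auto simp: N_def)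
  have N_mult: "n \<otimes> m \<in> N" if "n \<in> N" "m \<in> N" for n m
    using that subgroup.m_closed[OF P] \<pi>_mult PG by (auto simp: N_def)
  have N_inv: "inv n \<in> N" if n: "n \<in> N" for n
  proof -
    have nG: "n \<in> carrier G" using n PG by (auto simp: N_def)
    have "\<pi> (inv n) j = j" if "j \<in> J" for j using \<pi>_inv(1)[OF nG, of j] n that by (simp add: N_def)
    then show ?thesis using n subgroup.m_inv_closed[OF P] by (simp add: N_def)
  qed
  have NG: "n \<in> carrier G" if "n \<in> N" for n using that PG by (simp add: N_def)
  have NP: "n \<in> P" if "n \<in> N" for n using that by (simp add: N_def)
  have \<tau>_mult: "\<tau> (n \<otimes> m) = \<tau> n + \<tau> m" if "n \<in> N" "m \<in> N" for n m
    using translate[OF that(1) NP[OF that(2)]] act_mult[OF NG NG, OF that] by (simp add: \<tau>_def)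
  define \<Lambda> where "\<Lambda> = \<tau> ` N"
  have \<tau>_one: "\<tau> \<one> = 0" by (simp add: \<tau>_def act_one)
  have \<Lambda>0: "0 \<in> \<Lambda>" unfolding \<Lambda>_def by (rule image_eqI[of _ _ \<one>]) (use one \<tau>_one in simp_all)
  have \<Lambda>_add: "a + b \<in> \<Lambda>" if "a \<in> \<Lambda>" "b \<in> \<Lambda>" for a b
  proof -
    obtain n m where "n \<in> N" "m \<in> N" "a = \<tau> n" "b = \<tau> m" using \<open>a \<in> \<Lambda>\<close> \<open>b \<in> \<Lambda>\<close> unfolding \<Lambda>_def by blast
    then show ?thesis using \<tau>_mult[of n m] N_mult[of n m] unfolding \<Lambda>_def by (metis imageI)
  qed
  have \<Lambda>_neg: "- a \<in> \<Lambda>" if aL: "a \<in> \<Lambda>" for a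
  proof -
    obtain n where n: "n \<in> N" "a = \<tau> n" using aL unfolding \<Lambda>_def by blast
    have "\<tau> (n \<otimes> inv n) = \<tau> n + \<tau> (inv n)" by (rule \<tau>_mult[OF n(1) N_inv[OF n(1)]])
    then have "\<tau> n + \<tau> (inv n) = 0" using r_inv[OF NG[OF n(1)]] \<tau>_one by simp
    then have "- a = \<tau> (inv n)" unfolding n(2) by (rule minus_unique)
    then show ?thesis using N_inv[OF n(1)] by (simp add: \<Lambda>_def)
  qed
  have \<Lambda>_int: "of_int k *\<^sub>R a \<in> \<Lambda>" if a: "a \<in> \<Lambda>" for k a
  proof -
    have nat: "of_nat n *\<^sub>R a \<in> \<Lambda>" for n
    proof (induction n)
      case (Suc n)
      have "of_nat (Suc n) *\<^sub>R a = a + of_nat n *\<^sub>R a" by (simp add: scaleR_add_left)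
      then show ?case using \<Lambda>_add[OF a Suc] by simp
    qed (simp add: \<Lambda>0)
    show ?thesis
    proof (cases k rule: int_cases2)
      case (nonneg n) then show ?thesis using nat[of n] by simp
    next
      case (nonpos n) then show ?thesis using \<Lambda>_neg[OF nat[of n]] by simp
    qed
  qed
  have \<Lambda>_sum: "sum f B \<in> \<Lambda>" if "finite B" "\<And>b. b \<in> B \<Longrightarrow> f b \<in> \<Lambda>" for f and B :: "'i fsupp set"
    using that by (induction B rule: finite_induct) (auto intro: \<Lambda>0 \<Lambda>_add)
  \<comment> \<open>A basis of the span chosen inside \<Lambda>, so that integer combinations of it
    stay in \<Lambda>.\<close>
  obtain B where B: "B \<subseteq> \<Lambda>" "independent B" "\<Lambda> \<subseteq> span B" using maximal_independent_subset[of \<Lambda>] by blast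
  have "\<Lambda> \<subseteq> span (unit ` J)"
  proof
    fix a assume "a \<in> \<Lambda>"
    then obtain n where n: "n \<in> N" "a = \<tau> n" unfolding \<Lambda>_def by blast
    have off: "coord a i = 0" if "i \<notin> J" for i using fix_off[OF NP[OF n(1)] that] n by (simp add: \<tau>_def)
    have "a = (\<Sum>j\<in>J. coord a j *\<^sub>R unit j)" by (rule fsupp_expansion[OF finite_J off])
    also have "\<dots> \<in> span (unit ` J)" by (intro span_sum span_scale span_base) auto
    finally show "a \<in> span (unit ` J)" .
  qed
  then have "B \<subseteq> span (unit ` J)" using B(1) by blast
  then have finB: "finite B" using independent_span_bound[OF finite_imageI[OF finite_J] B(2)] by blast
  obtain D where "\<forall>f\<in>F. dist y f \<le> D" using finite_imp_bounded[OF finF] unfolding bounded_any_center[where a = y] by blast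
  then have D: "F \<subseteq> cball y D" by auto
  then have FD: "convex hull F \<subseteq> cball y D" by (intro hull_minimal) auto
  define R where "R = D + (\<Sum>b\<in>B. norm b)"
  show ?thesis
  proof (intro exI[of _ R] ballI)
    fix x assume x: "x \<in> convex hull ((\<lambda>p. act p y) ` P)"
    \<comment> \<open>Each orbit point is a representative of its coset followed by a translation.
      The right side is a sum of convex sets, so the hull of the orbit stays in it.\<close>
    have "convex hull ((\<lambda>p. act p y) ` P) \<subseteq> (\<Union>f\<in>convex hull F. \<Union>l\<in>span B. {f + l})"
    proof (rule hull_minimal)
      show "convex (\<Union>f\<in>convex hull F. \<Union>l\<in>span B. {f + l})"
        by (intro convex_sums convex_convex_hull subspace_imp_convex subspace_span)
      show "(\<lambda>p. act p y) ` P \<subseteq> (\<Union>f\<in>convex hull F. \<Union>l\<in>span B. {f + l})"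
      proof
        fix z assume "z \<in> (\<lambda>p. act p y) ` P"
        then obtain p where p: "p \<in> P" "z = act p y" by blast
        define q where "q = rep (\<rho> p)"
        have q: "q \<in> P" "\<rho> q = \<rho> p" using rep p by (auto simp: q_def)
        define n where "n = p \<otimes> inv q"
        have "\<pi> n j = j" if j: "j \<in> J" for j
        proof -
          have j': "\<pi> (inv q) j \<in> J" using \<pi>_J j PG[OF q(1)] by simp
          have "\<pi> n j = \<pi> p (\<pi> (inv q) j)" using \<pi>_mult PG p q by (simp add: n_def)
          also have "\<dots> = \<pi> q (\<pi> (inv q) j)" using fun_cong[OF q(2), of "\<pi> (inv q) j"] j' by (simp add: \<rho>_def)
          finally show ?thesis using \<pi>_inv(2) PG q by simp
        qed
        then have n: "n \<in> N" using p q P by (simp add: N_def n_def subgroup.m_closed subgroup.m_inv_closed)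
        have "n \<otimes> q = p" using PG p q by (simp add: n_def m_assoc)
        then have "z = act q y + \<tau> n" using translate[OF n q(1)] act_mult[OF NG[OF n] PG[OF q(1)]] p by metis
        moreover have "act q y \<in> convex hull F" using p by (intro hull_inc) (auto simp: F_def q_def)
        moreover have "\<tau> n \<in> span B" using B(3) n by (auto simp: \<Lambda>_def)
        ultimately show "z \<in> (\<Union>f\<in>convex hull F. \<Union>l\<in>span B. {f + l})" by blast
      qed
    qed
    then obtain f l where fl: "f \<in> convex hull F" "l \<in> span B" "x = f + l" using x by blast
    obtain c where c: "l = (\<Sum>b\<in>B. c b *\<^sub>R b)" using fl(2) unfolding span_finite[OF finB] by blast
    \<comment> \<open>Rounding each coefficient down costs at most the norm of each basis vector;
      their sum is the second part of \<open>R\<close>.\<close>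
    define l0 where "l0 = (\<Sum>b\<in>B. of_int \<lfloor>c b\<rfloor> *\<^sub>R b)"
    have "l0 \<in> \<Lambda>" unfolding l0_def by (rule \<Lambda>_sum[OF finB]) (use B(1) \<Lambda>_int in blast)
    then obtain n where n: "n \<in> N" "l0 = \<tau> n" by (auto simp: \<Lambda>_def)
    have "l - l0 = (\<Sum>b\<in>B. (c b - of_int \<lfloor>c b\<rfloor>) *\<^sub>R b)"
      unfolding c l0_def by (simp add: sum_subtractf scaleR_diff_left)
    then have "norm (l - l0) \<le> (\<Sum>b\<in>B. norm ((c b - of_int \<lfloor>c b\<rfloor>) *\<^sub>R b))" by (simp only: norm_sum)
    also have "\<dots> \<le> (\<Sum>b\<in>B. norm b)"
    proof (rule sum_mono)
      fix b
      have "\<bar>c b - of_int \<lfloor>c b\<rfloor>\<bar> \<le> 1" by linarith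
      then show "norm ((c b - of_int \<lfloor>c b\<rfloor>) *\<^sub>R b) \<le> norm b" by (simp add: mult_left_le_one_le)
    qed
    finally have ll: "norm (l - l0) \<le> (\<Sum>b\<in>B. norm b)" .
    have fy: "norm (f - y) \<le> D" using FD fl(1) by (auto simp: dist_norm norm_minus_commute)
    have "x - act n y = (f - y) + (l - l0)" using n fl by (simp add: \<tau>_def)
    then have "norm (x - act n y) \<le> R" using norm_triangle_ineq[of "f - y" "l - l0"] ll fy by (simp add: R_def)
    then show "\<exists>p\<in>P. norm (x - act p y) \<le> R" using NP[OF n(1)] by blast
  qed
qed

section \<open>Properness of the affine action\<close>

lemma finite_small_displacement:
  assumes v: "v \<in> V" shows "finite {p \<in> Pv v. norm (act p x - x) \<le> r}"
proof -
  let ?A = "{p \<in> Pv v. norm (act p x - x) \<le> r}"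
  \<comment> \<open>The finite shadow of an element on the character coordinates. Its fibres lie in
    cosets of the kernel that \<open>finite_kernel\<close> declares finite.\<close>
  define \<theta> where "\<theta> p = (restrict (\<pi> p) J, restrict (coord (\<delta> p)) J)" for p
  \<comment> \<open>A coordinate of \<delta> p is a coordinate of the displacement plus a difference
    of two coordinates of \<open>x\<close>; integrality leaves finitely many values below this
    bound.\<close>
  define M where "M = r + 2 * norm x"
  define Z where "Z = real_of_int ` {\<lceil>- M\<rceil>..\<lfloor>M\<rfloor>}"
  have "\<theta> p \<in> (J \<rightarrow>\<^sub>E J) \<times> (J \<rightarrow>\<^sub>E Z)" if p: "p \<in> ?A" for p
  proof -
    have pG: "p \<in> carrier G" using PvG v p by blast
    have "coord (\<delta> p) j \<in> Z" for j
    proof -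
      have "norm (act p x - x) \<le> r" using p by blast
      then have "\<bar>coord (act p x - x) j\<bar> \<le> r" using coord_le_norm[of "act p x - x" j] by linarith
      moreover have "coord (act p x - x) j = coord x (\<pi> (inv p) j) + coord (\<delta> p) j - coord x j"
        using coord_act[OF pG] by simp
      ultimately have M: "\<bar>coord (\<delta> p) j\<bar> \<le> M"
        using coord_le_norm[of x j] coord_le_norm[of x "\<pi> (inv p) j"] unfolding M_def by linarith
      obtain k where k: "coord (\<delta> p) j = of_int k" using \<delta>_int[OF pG] by (auto elim: Ints_cases)
      have "- M \<le> of_int k" "of_int k \<le> M" using M unfolding k by linarith+
      then have "k \<in> {\<lceil>- M\<rceil>..\<lfloor>M\<rfloor>}" by (simp add: ceiling_le_iff le_floor_iff)
      then show ?thesis unfolding Z_def k by (rule imageI)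
    qed
    then show ?thesis using \<pi>_J[OF pG] by (auto simp: \<theta>_def)
  qed
  then have "\<theta> ` ?A \<subseteq> (J \<rightarrow>\<^sub>E J) \<times> (J \<rightarrow>\<^sub>E Z)" by blast
  moreover have "finite ((J \<rightarrow>\<^sub>E J) \<times> (J \<rightarrow>\<^sub>E Z))" using finite_J by (intro finite_cartesian_product finite_PiE) (auto simp: Z_def)
  ultimately have fin: "finite (\<theta> ` ?A)" by (rule finite_subset)
  have "finite {p \<in> ?A. \<theta> p = c}" if c: "c \<in> \<theta> ` ?A" for c
  proof -
    obtain q where q: "q \<in> Pv v" "\<theta> q = c" using c by blast
    have qG: "q \<in> carrier G" using PvG v q by blast
    \<comment> \<open>Two elements with equal shadow differ by one that fixes all of
      \<open>J\<close> and translates by 0 there.\<close>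
    have "{p \<in> ?A. \<theta> p = c} \<subseteq> (\<lambda>k. q \<otimes> k) ` {g \<in> Pv v. \<forall>j\<in>J. \<pi> g j = j \<and> coord (\<delta> g) j = 0}"
    proof
      fix p assume "p \<in> {p \<in> ?A. \<theta> p = c}"
      then have p: "p \<in> Pv v" "\<theta> p = \<theta> q" using q by auto
      have pG: "p \<in> carrier G" using PvG v p by blast
      define k where "k = inv q \<otimes> p"
      have r: "restrict (\<pi> p) J = restrict (\<pi> q) J" "restrict (coord (\<delta> p)) J = restrict (coord (\<delta> q)) J"
        using p(2) by (simp_all add: \<theta>_def)
      have eq: "\<pi> p j = \<pi> q j" "coord (\<delta> p) j = coord (\<delta> q) j" if "j \<in> J" for j
        using fun_cong[OF r(1), of j] fun_cong[OF r(2), of j] that by simp_all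
      have "\<pi> k j = j \<and> coord (\<delta> k) j = 0" if j: "j \<in> J" for j
      proof
        show "\<pi> k j = j" using \<pi>_mult[of "inv q" p] qG pG eq(1)[OF j] \<pi>_inv(1)[OF qG] by (simp add: k_def)
        have qj: "\<pi> q j \<in> J" using \<pi>_J qG j by simp
        have "coord (\<delta> (inv q \<otimes> q)) j = coord (\<delta> q) (\<pi> q j) + coord (\<delta> (inv q)) j"
          using \<delta>_mult[of "inv q" q] qG by (simp add: coord_reindex bij_\<pi> del: l_inv)
        moreover have "coord (\<delta> k) j = coord (\<delta> p) (\<pi> q j) + coord (\<delta> (inv q)) j"
          using \<delta>_mult[of "inv q" p] qG pG by (simp add: coord_reindex bij_\<pi> k_def)
        ultimately show "coord (\<delta> k) j = 0" using eq(2)[OF qj] l_inv[OF qG] \<delta>_one by simp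
      qed
      moreover have "k \<in> Pv v" unfolding k_def
        by (rule subgroup.m_closed[OF Pv[OF v] subgroup.m_inv_closed[OF Pv[OF v] q(1)] p(1)])
      moreover have "p = q \<otimes> k" using qG pG by (simp add: k_def m_assoc[symmetric])
      ultimately show "p \<in> (\<lambda>k. q \<otimes> k) ` {g \<in> Pv v. \<forall>j\<in>J. \<pi> g j = j \<and> coord (\<delta> g) j = 0}" by (intro image_eqI[of _ _ k]) auto
    qed
    then show ?thesis by (rule finite_subset) (intro finite_imageI finite_kernel[OF v])
  qed
  then have "finite (\<Union>c\<in>\<theta> ` ?A. {p \<in> ?A. \<theta> p = c})" by (intro finite_UN_I fin)
  moreover have "?A = (\<Union>c\<in>\<theta> ` ?A. {p \<in> ?A. \<theta> p = c})" by auto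
  ultimately show ?thesis by simp
qed

text \<open>Moving the base point by \<open>inv g\<close> turns displacements of elements of a
  conjugate into displacements of elements of the vertex group.\<close>

lemma finite_conjugate_displacement:
  assumes v: "v \<in> V" and g: "g \<in> carrier G"
    and H: "\<And>h. h \<in> H \<Longrightarrow> h \<in> carrier G \<and> norm (act h x - x) \<le> r \<and> inv g \<otimes> h \<otimes> g \<in> Pv v"
  shows "finite H"
proof -
  let ?x = "act (inv g) x"
  have "H \<subseteq> (\<lambda>p. g \<otimes> p \<otimes> inv g) ` {p \<in> Pv v. norm (act p ?x - ?x) \<le> r}"
  proof
    fix h assume h: "h \<in> H"
    have hG: "h \<in> carrier G" using H[OF h] by blast
    let ?p = "inv g \<otimes> h \<otimes> g"
    have "act ?p ?x = act (inv g) (act h x)" using g hG by (simp add: act_mult act_inv)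
    then have "norm (act ?p ?x - ?x) \<le> r" using H[OF h] norm_act[of "inv g"] g by simp
    then have "?p \<in> {p \<in> Pv v. norm (act p ?x - ?x) \<le> r}" using H[OF h] by blast
    moreover have "g \<otimes> ?p \<otimes> inv g = h"
    proof -
      have "g \<otimes> ?p = h \<otimes> g" using g hG by (simp add: m_assoc[symmetric])
      then show ?thesis using g hG by (simp add: m_assoc)
    qed
    ultimately show "h \<in> (\<lambda>p. g \<otimes> p \<otimes> inv g) ` {p \<in> Pv v. norm (act p ?x - ?x) \<le> r}"
      by (intro image_eqI[of _ _ ?p]) simp_all
  qed
  then show ?thesis by (rule finite_subset) (intro finite_imageI finite_small_displacement[OF v])
qed

lemma integer_close: "a \<in> \<int> \<Longrightarrow> b \<in> \<int> \<Longrightarrow> \<bar>a - b\<bar> \<le> 1 / 2 \<Longrightarrow> a = (b :: real)"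
proof -
  assume "a \<in> \<int>" "b \<in> \<int>" and ab: "\<bar>a - b\<bar> \<le> 1 / 2"
  then obtain m n where mn: "a = of_int m" "b = of_int n" by (auto elim!: Ints_cases)
  have "real_of_int \<bar>m - n\<bar> < real_of_int 1" using ab unfolding mn by simp
  then have "m = n" unfolding of_int_less_iff by simp
  then show ?thesis using mn by simp
qed

text \<open>A small displacement cannot change the piece of \<open>x\<close>: in a vertex piece the
  coordinates outside \<open>J\<close> are integers, and in the interior of a strip the edge
  coordinate lies strictly between two consecutive ones.\<close>

lemma proper_at:
  assumes x: "x \<in> X" shows "\<exists>r>0. finite {h \<in> carrier G. norm (act h x - x) \<le> r}"
proof -
  have vert: "\<exists>r>0. finite {h \<in> carrier G. norm (act h x - x) \<le> r}"
    if gv: "g \<in> carrier G" "v \<in> V" and xv: "x \<in> vpiece g v" for g v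
  proof -
    \<comment> \<open>Integers at distance at most 1/2 are equal, so \<open>h\<close> keeps all
      coordinates outside \<open>J\<close> and lies in the conjugate of the vertex group.\<close>
    have "finite {h \<in> carrier G. norm (act h x - x) \<le> 1 / 2}"
    proof (rule finite_conjugate_displacement[OF gv(2,1)])
      fix h assume "h \<in> {h \<in> carrier G. norm (act h x - x) \<le> 1 / 2}"
      then have h: "h \<in> carrier G" "norm (act h x - x) \<le> 1 / 2" by auto
      have hg: "h \<otimes> g \<in> carrier G" using h gv by simp
      have hx: "act h x \<in> vpiece (h \<otimes> g) v" using act_vpiece[OF h(1) gv] xv by blast
      have same: "coord (act (h \<otimes> g) (pos v)) i = coord (act g (pos v)) i" if i: "i \<notin> J" for i
      proof (rule integer_close[OF act_int[OF gv(2) hg] act_int[OF gv(2,1)]])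
        have "\<bar>coord (act h x - x) i\<bar> \<le> 1 / 2" using coord_le_norm[of "act h x - x" i] h(2) by linarith
        then show "\<bar>coord (act (h \<otimes> g) (pos v)) i - coord (act g (pos v)) i\<bar> \<le> 1 / 2"
          using coord_vpiece[OF gv(2) hg i hx] coord_vpiece[OF gv(2,1) i xv] by simp
      qed
      let ?p = "inv g \<otimes> h \<otimes> g"
      have pG: "?p \<in> carrier G" using h gv by simp
      have "coord (act ?p (pos v)) i = coord (pos v) i" if i: "i \<notin> J" for i
      proof -
        have gi: "\<pi> g i \<notin> J" using \<pi>_J gv i by simp
        have "act ?p (pos v) = act (inv g) (act (h \<otimes> g) (pos v))"
          using act_mult[of "inv g" "h \<otimes> g"] h gv by (simp add: m_assoc)
        then have "coord (act ?p (pos v)) i = coord (act (inv g) (act g (pos v))) i"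
          using same[OF gi] gv by (simp add: coord_act[of "inv g"])
        then show ?thesis using act_inv(1) gv by simp
      qed
      then have "?p \<in> Pv v" using vertex_stabilizer[OF gv(2) pG] unfolding act_def by blast
      then show "h \<in> carrier G \<and> norm (act h x - x) \<le> 1 / 2 \<and> ?p \<in> Pv v" using h by blast
    qed
    then show ?thesis by (intro exI[of _ "1/2"]) simp
  qed
  obtain P where P: "P \<in> vpieces \<union> spieces" "x \<in> P" using x by blast
  from P(1) show ?thesis
  proof (cases rule: piece_cases)
    case (vertex g v)
    then show ?thesis using vert P(2) by simp
  next
    case (strip g e)
    have xs: "x \<in> spiece g e" using P(2) strip by simp
    let ?i = "\<pi> g (\<epsilon> e)"
    define c where "c = coord (act g (pos (src e))) ?i"
    have b: "c \<le> coord x ?i" "coord x ?i \<le> c + 1" using coord_edge_bounds[OF strip(2,1) xs] by (auto simp: c_def)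
    show ?thesis
    proof (cases "coord x ?i = c \<or> coord x ?i = c + 1")
      case True
      then show ?thesis
      proof
        assume "coord x ?i = c"
        then have "x \<in> vpiece g (src e)" using bottom_slice[OF strip(2,1) xs] by (simp add: c_def)
        then show ?thesis using vert[OF strip(1) E(2)[OF strip(2)]] by blast
      next
        assume "coord x ?i = c + 1"
        then have "x \<in> vpiece (g \<otimes> t e) (tgt e)" using top_slice[OF strip(2,1) xs] by (simp add: c_def)
        then show ?thesis using vert[OF _ E(3)[OF strip(2)], of "g \<otimes> t e"] strip t by simp
      qed
    next
      case False
      \<comment> \<open>Half the distance to the nearer end of the strip, so that the edge
        coordinate cannot reach an integer.\<close>
      define r where "r = min (coord x ?i - c) (c + 1 - coord x ?i) / 2"
      have r: "0 < r" "r < coord x ?i - c" "r < c + 1 - coord x ?i" using b False by (auto simp: r_def min_def)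
      have "finite {h \<in> carrier G. norm (act h x - x) \<le> r}"
      proof (rule finite_conjugate_displacement[OF E(2)[OF strip(2)] strip(1)])
        fix h assume "h \<in> {h \<in> carrier G. norm (act h x - x) \<le> r}"
        then have h: "h \<in> carrier G" "norm (act h x - x) \<le> r" by auto
        have hg: "h \<otimes> g \<in> carrier G" using h strip by simp
        have hx: "act h x \<in> spiece (h \<otimes> g) e" using act_spiece[OF h(1) strip(1,2)] xs by blast
        \<comment> \<open>Were the translated strip a different one, it would be constant in this
          coordinate with an integer value, which would then lie strictly between \<open>c\<close>
          and \<open>c + 1\<close>.\<close>
        have "?i = \<pi> (h \<otimes> g) (\<epsilon> e)"
        proof (rule ccontr)
          assume n: "?i \<noteq> \<pi> (h \<otimes> g) (\<epsilon> e)"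
          have "coord (act h x) ?i \<in> \<int>"
            unfolding coord_other_edge[OF strip(2,2) hg strip(1) n hx] by (rule act_int[OF E(2)[OF strip(2)] hg])
          moreover have "c \<in> \<int>" unfolding c_def by (rule act_int[OF E(2)[OF strip(2)] strip(1)])
          moreover have "\<bar>coord (act h x) ?i - coord x ?i\<bar> \<le> r"
            using coord_le_norm[of "act h x - x" ?i] h(2) by simp
          then have "c < coord (act h x) ?i" "coord (act h x) ?i < c + 1" using r by auto
          ultimately show False by (elim Ints_cases) auto
        qed
        then obtain q where q: "q \<in> Pe e" "h \<otimes> g = g \<otimes> q"
          using same_edge_index[OF strip(2,2,1) hg] by blast
        have "inv g \<otimes> h \<otimes> g = inv g \<otimes> (g \<otimes> q)" using q(2) h strip by (simp add: m_assoc)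
        then have "inv g \<otimes> h \<otimes> g = q" using strip PeG[OF strip(2) q(1)] by (simp add: m_assoc[symmetric])
        then show "h \<in> carrier G \<and> norm (act h x - x) \<le> r \<and> inv g \<otimes> h \<otimes> g \<in> Pv (src e)"
          using h q Pe_src[OF strip(2)] by auto
      qed
      then show ?thesis using r by blast
    qed
  qed
qed

section \<open>Invariance of the chain metric, and cocompactness on each type of piece\<close>

lemma act_piece: "g \<in> carrier G \<Longrightarrow> P \<in> vpieces \<union> spieces \<Longrightarrow> act g ` P \<in> vpieces \<union> spieces"
proof -
  assume g: "g \<in> carrier G" and P: "P \<in> vpieces \<union> spieces"
  from P show ?thesis
  proof (cases rule: piece_cases)
    case (vertex h v)
    then show ?thesis using act_vpiece[OF g] g by (auto simp: vpieces_def)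
  next
    case (strip h e)
    have "act g ` P = spiece (g \<otimes> h) e" unfolding strip(3) by (rule act_spiece[OF g strip(1,2)])
    moreover have "g \<otimes> h \<in> carrier G" using g strip(1) by simp
    ultimately show ?thesis using strip(2) unfolding spieces_def by blast
  qed
qed

lemma act_X: "g \<in> carrier G \<Longrightarrow> x \<in> X \<Longrightarrow> act g x \<in> X"
  using act_piece by blast

lemma path_act:
  assumes g: "g \<in> carrier G" and p: "piecewise_path pieces x y l" shows "piecewise_path pieces (act g x) (act g y) l"
  using p
proof (induction rule: piecewise_path.induct)
  case (refl x)
  then show ?case using act_X[OF g] by (intro piecewise_path.refl) blast
next
  case (step P x y z l)
  have "piecewise_path pieces (act g x) (act g z) (norm (act g x - act g y) + l)"
    by (rule piecewise_path.step[OF act_piece[OF g step(1)]]) (use step in auto)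
  then show ?case by (simp add: norm_act g)
qed

lemma d_act: assumes g: "g \<in> carrier G" shows "d (act g x) (act g y) = d x y"
proof -
  have "piecewise_path pieces (act g x) (act g y) l \<longleftrightarrow> piecewise_path pieces x y l" for l
    using path_act[OF g, of x y l] path_act[of "inv g" "act g x" "act g y" l] act_inv(1)[OF g] g by auto
  then show ?thesis by (simp add: chain_dist_def)
qed

lemma vpiece_cocompact:
  assumes v: "v \<in> V"
  shows "\<exists>r. \<forall>g\<in>carrier G. \<forall>x\<in>vpiece g v. \<exists>h\<in>carrier G. \<exists>y\<in>vpiece \<one> v \<inter> cball (pos v) r. x = act h y"
proof -
  have "\<exists>R. \<forall>x\<in>convex hull ((\<lambda>p. act p (pos v)) ` Pv v). \<exists>p\<in>Pv v. norm (x - act p (pos v)) \<le> R"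
    by (rule coarse_orbit[OF Pv[OF v]])
       (use coord_vertex_orbit[OF v one_closed] PvG[OF v] act_one in auto)
  then obtain R where R: "\<And>x. x \<in> convex hull ((\<lambda>p. act p (pos v)) ` Pv v) \<Longrightarrow> \<exists>p\<in>Pv v. norm (x - act p (pos v)) \<le> R"
    by blast
  have base: "vpiece \<one> v = closure (convex hull ((\<lambda>p. act p (pos v)) ` Pv v))"
  proof -
    have "(\<lambda>p. act (\<one> \<otimes> p) (pos v)) ` Pv v = (\<lambda>p. act p (pos v)) ` Pv v" using PvG[OF v] by (intro image_cong) auto
    then show ?thesis by (simp add: vpiece_def chull_def)
  qed
  show ?thesis
  proof (intro exI[of _ "R + 1"] ballI)
    fix g x assume g: "g \<in> carrier G" and x: "x \<in> vpiece g v"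
    define z where "z = act (inv g) x"
    have "act (inv g) ` vpiece g v = vpiece \<one> v" using act_vpiece[of "inv g" g v] g v by simp
    then have z: "z \<in> vpiece \<one> v" using x by (auto simp: z_def)
    \<comment> \<open>The convex hull is only dense in the closed piece; this costs the extra 1 in
      the radius.\<close>
    then obtain z' where z': "z' \<in> convex hull ((\<lambda>p. act p (pos v)) ` Pv v)" "dist z' z < 1"
      unfolding base by (meson closure_approachable zero_less_one)
    obtain p where p: "p \<in> Pv v" "norm (z' - act p (pos v)) \<le> R" using R[OF z'(1)] by blast
    have pG: "p \<in> carrier G" by (rule PvG[OF v p(1)])
    define y where "y = act (inv p) z"
    have "act (inv p) ` vpiece \<one> v = vpiece (inv p) v" using act_vpiece[of "inv p" \<one> v] pG v by simp
    also have "\<dots> = vpiece \<one> v"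
      using vpiece_coset[OF v one_closed, of "inv p"] p(1) pG subgroup.m_inv_closed[OF Pv[OF v]] by simp
    finally have "y \<in> vpiece \<one> v" using z by (auto simp: y_def)
    moreover have "norm (y - pos v) \<le> R + 1"
    proof -
      have "norm (y - pos v) = norm (act (inv p) z - act (inv p) (act p (pos v)))" using act_inv(1)[OF pG] by (simp add: y_def)
      also have "\<dots> = norm (z - act p (pos v))" using norm_act pG by simp
      also have "\<dots> \<le> norm (z - z') + norm (z' - act p (pos v))" using norm_triangle_ineq[of "z - z'" "z' - act p (pos v)"] by simp
      finally show ?thesis using p(2) z'(2) by (simp add: dist_norm norm_minus_commute)
    qed
    moreover have "x = act (g \<otimes> p) y" using act_mult[OF g pG] act_inv(2)[OF pG] act_inv(2)[OF g] by (simp add: y_def z_def)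
    ultimately show "\<exists>h\<in>carrier G. \<exists>y\<in>vpiece \<one> v \<inter> cball (pos v) (R + 1). x = act h y"
      using g pG by (intro bexI[of _ "g \<otimes> p"] bexI[of _ y]) (auto simp: dist_norm norm_minus_commute)
  qed
qed

text \<open>The whole strip lies within \<open>D\<close> of the hull of its lower orbit, where
  \<open>coarse_orbit\<close> applies to the edge group.\<close>

lemma spiece_cocompact:
  assumes e: "e \<in> E"
  shows "\<exists>r. \<forall>g\<in>carrier G. \<forall>x\<in>spiece g e. \<exists>h\<in>carrier G. \<exists>y\<in>spiece \<one> e \<inter> cball (pos (src e)) r. x = act h y"
proof -
  let ?y = "pos (src e)" let ?C = "convex hull ((\<lambda>p. act p (pos (src e))) ` Pe e)"
  have "\<exists>R. \<forall>x\<in>?C. \<exists>p\<in>Pe e. norm (x - act p ?y) \<le> R"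
    by (rule coarse_orbit[OF Pe[OF e]])
       (use coord_vertex_orbit[OF E(2)[OF e] one_closed subsetD[OF Pe_src[OF e]]] PeG[OF e] act_one in auto)
  then obtain R where R: "\<And>x. x \<in> ?C \<Longrightarrow> \<exists>p\<in>Pe e. norm (x - act p ?y) \<le> R" by blast
  define D where "D = norm (act (t e) (pos (tgt e)) - pos (src e))"
  have one: "\<one> \<in> Pe e" by (rule subgroup.one_closed[OF Pe[OF e]])
  then have ne: "?C \<noteq> {}" by auto
  have pC: "act p ?y \<in> ?C" if "p \<in> Pe e" for p using that by (intro hull_inc) blast
  have near: "infdist z ?C \<le> D" if z: "z \<in> spiece \<one> e" for z
  proof -
    \<comment> \<open>The barrier sets with slope 0 are metric neighbourhoods of the hull; the
      factor 0 makes the choice of the coordinate arbitrary.\<close>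
    have "z \<in> {x. infdist x ?C \<le> 0 * coord x undefined - (- D)}"
      using z unfolding spiece_def
    proof (rule chull_into)
      show "closed {x. infdist x ?C \<le> 0 * coord x undefined - (- D)}" "convex {x. infdist x ?C \<le> 0 * coord x undefined - (- D)}"
        by (rule closed_infdist_le[OF ne] convex_infdist_le[OF convex_convex_hull ne])+
      have 1: "infdist (act p ?y) ?C \<le> D" if "p \<in> Pe e" for p using pC[OF that] by (simp add: D_def)
      have 2: "infdist (act (p \<otimes> t e) (pos (tgt e))) ?C \<le> D" if p: "p \<in> Pe e" for p
        using infdist_le[OF pC[OF p], of "act (p \<otimes> t e) (pos (tgt e))"] dist_orbits[OF e one_closed p] PeG[OF e p]
        by (simp add: dist_norm D_def)
      show "(\<lambda>p. act (\<one> \<otimes> p) (pos (src e))) ` Pe e \<union> (\<lambda>p. act (\<one> \<otimes> p \<otimes> t e) (pos (tgt e))) ` Pe e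
        \<subseteq> {x. infdist x ?C \<le> 0 * coord x undefined - (- D)}"
        using 1 2 PeG[OF e] by auto
    qed
    then show ?thesis by simp
  qed
  show ?thesis
  proof (intro exI[of _ "R + D + 1"] ballI)
    fix g x assume g: "g \<in> carrier G" and x: "x \<in> spiece g e"
    define z where "z = act (inv g) x"
    have "act (inv g) ` spiece g e = spiece \<one> e" using act_spiece[of "inv g" g e] g e by simp
    then have z: "z \<in> spiece \<one> e" using x by (auto simp: z_def)
    obtain z' where z': "z' \<in> ?C" "dist z z' < D + 1"
      using infdist_almost_attained[OF ne, of z "D + 1"] near[OF z] by auto
    obtain p where p: "p \<in> Pe e" "norm (z' - act p ?y) \<le> R" using R[OF z'(1)] by blast
    have pG: "p \<in> carrier G" by (rule PeG[OF e p(1)])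
    define y where "y = act (inv p) z"
    have "act (inv p) ` spiece \<one> e = spiece (inv p) e" using act_spiece[of "inv p" \<one> e] pG e by simp
    also have "\<dots> = spiece \<one> e"
      using spiece_coset[OF e one_closed, of "inv p"] p(1) pG subgroup.m_inv_closed[OF Pe[OF e]] by simp
    finally have "y \<in> spiece \<one> e" using z by (auto simp: y_def)
    moreover have "norm (y - ?y) \<le> R + D + 1"
    proof -
      have "norm (y - ?y) = norm (act (inv p) z - act (inv p) (act p ?y))" using act_inv(1)[OF pG] by (simp add: y_def)
      also have "\<dots> = norm (z - act p ?y)" using norm_act pG by simp
      also have "\<dots> \<le> norm (z - z') + norm (z' - act p ?y)" using norm_triangle_ineq[of "z - z'" "z' - act p ?y"] by simp
      finally show ?thesis using p(2) z'(2) by (simp add: dist_norm)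
    qed
    moreover have "x = act (g \<otimes> p) y" using act_mult[OF g pG] act_inv(2)[OF pG] act_inv(2)[OF g] by (simp add: y_def z_def)
    ultimately show "\<exists>h\<in>carrier G. \<exists>y\<in>spiece \<one> e \<inter> cball ?y (R + D + 1). x = act h y"
      using g pG by (intro bexI[of _ "g \<otimes> p"] bexI[of _ y]) (auto simp: dist_norm norm_minus_commute)
  qed
qed

theorem geometric_action:
  fixes R :: "'i fsupp \<Rightarrow> 'x"
  assumes inj: "inj_on R X"
  shows "\<exists>(Y :: 'x metric) \<phi>. CAT0_space Y \<and> mcomplete_of Y \<and>
    isometric_action G Y \<phi> \<and> proper_action G Y \<phi> \<and> cocompact_action G Y \<phi>"
proof -
  obtain Y :: "'x metric" where Y: "mspace Y = R ` X" "\<And>x y. x \<in> X \<Longrightarrow> y \<in> X \<Longrightarrow> mdist Y (R x) (R y) = d x y"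
    using metric_realization[OF inj] by blast
  \<comment> \<open>The restriction is required because the elements of \<open>BijGroup\<close> are
    extensional functions.\<close>
  define \<phi> where "\<phi> g = restrict (\<lambda>u. R (act g (inv_into X R u))) (R ` X)" for g
  have \<phi>: "\<phi> g (R x) = R (act g x)" if "x \<in> X" for g x
    using that inv_into_f_f[OF inj that] by (simp add: \<phi>_def del: Union_iff Union_Un_distrib)
  have bij: "\<phi> g \<in> carrier (BijGroup (R ` X))" if g: "g \<in> carrier G" for g
  proof -
    have "bij_betw (\<phi> g) (R ` X) (R ` X)"
    proof (rule bij_betw_byWitness[of _ "\<phi> (inv g)"])
      have RX: "\<phi> h (R x) \<in> R ` X" if "h \<in> carrier G" "x \<in> X" for h x
        unfolding \<phi>[OF that(2)] using act_X[OF that] by (rule imageI)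
      show "\<forall>u\<in>R ` X. \<phi> (inv g) (\<phi> g u) = u"
      proof
        fix u assume "u \<in> R ` X"
        then obtain x where x: "x \<in> X" "u = R x" by blast
        then show "\<phi> (inv g) (\<phi> g u) = u" using \<phi>[OF x(1), of g] \<phi>[OF act_X[OF g x(1)], of "inv g"] act_inv(1)[OF g] by simp
      qed
      show "\<forall>u\<in>R ` X. \<phi> g (\<phi> (inv g) u) = u"
      proof
        fix u assume "u \<in> R ` X"
        then obtain x where x: "x \<in> X" "u = R x" by blast
        then show "\<phi> g (\<phi> (inv g) u) = u"
          using \<phi>[OF x(1), of "inv g"] \<phi>[OF act_X[OF inv_closed[OF g] x(1)], of g] act_inv(2)[OF g] by simp
      qed
      show "\<phi> g ` R ` X \<subseteq> R ` X" using RX[OF g] by blast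
      show "\<phi> (inv g) ` R ` X \<subseteq> R ` X" using RX[OF inv_closed[OF g]] by blast
    qed
    then show ?thesis by (simp add: BijGroup_def Bij_def \<phi>_def)
  qed
  have "group_action G (mspace Y) \<phi>"
    unfolding group_action_def Y(1)
  proof (intro group_hom.intro group_hom_axioms.intro)
    show "group G" by (rule group_axioms)
    show "group (BijGroup (R ` X))" by (rule group_BijGroup)
    show "\<phi> \<in> hom G (BijGroup (R ` X))"
    proof (rule homI)
      fix g h assume gh: "g \<in> carrier G" "h \<in> carrier G"
      have "\<phi> (g \<otimes> h) = compose (R ` X) (\<phi> g) (\<phi> h)"
      proof (rule extensionalityI)
        show "\<phi> (g \<otimes> h) \<in> extensional (R ` X)" by (simp add: \<phi>_def)
        show "compose (R ` X) (\<phi> g) (\<phi> h) \<in> extensional (R ` X)" by (simp add: compose_def)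
        fix u assume u: "u \<in> R ` X"
        then obtain x where x: "x \<in> X" "u = R x" by blast
        show "\<phi> (g \<otimes> h) u = compose (R ` X) (\<phi> g) (\<phi> h) u"
          unfolding compose_eq[OF u] using \<phi>[OF x(1)] \<phi>[OF act_X[OF gh(2) x(1)]] act_mult[OF gh] x(2) by simp
      qed
      then show "\<phi> (g \<otimes> h) = \<phi> g \<otimes>\<^bsub>BijGroup (R ` X)\<^esub> \<phi> h"
        using bij[OF gh(1)] bij[OF gh(2)] by (simp add: BijGroup_def)
    qed (rule bij)
  qed
  then have "isometric_action G Y \<phi>"
    unfolding isometric_action_def Y(1)
  proof (intro conjI ballI)
    fix g u w assume g: "g \<in> carrier G" and "u \<in> R ` X" "w \<in> R ` X"
    then obtain x y where "x \<in> X" "u = R x" "y \<in> X" "w = R y" by blast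
    then show "mdist Y (\<phi> g u) (\<phi> g w) = mdist Y u w"
      using \<phi> Y(2) act_X[OF g] d_act[OF g] by metis
  qed
  moreover have "proper_action G Y \<phi>"
    unfolding proper_action_def Y(1)
  proof
    fix u assume "u \<in> R ` X"
    then obtain x where x: "x \<in> X" "u = R x" by blast
    obtain r where r: "r > 0" "finite {h \<in> carrier G. norm (act h x - x) \<le> r}" using proper_at[OF x(1)] by blast
    \<comment> \<open>The chain metric dominates the norm, so its balls are smaller and inherit
      finiteness.\<close>
    have "{h \<in> carrier G. mdist Y (\<phi> h u) u \<le> r} \<subseteq> {h \<in> carrier G. norm (act h x - x) \<le> r}"
    proof
      fix h assume "h \<in> {h \<in> carrier G. mdist Y (\<phi> h u) u \<le> r}"
      then have h: "h \<in> carrier G" "mdist Y (\<phi> h u) u \<le> r" by auto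
      have "mdist Y (\<phi> h u) u = d (act h x) x" unfolding x(2) \<phi>[OF x(1)] by (rule Y(2)[OF act_X[OF h(1) x(1)] x(1)])
      then show "h \<in> {h \<in> carrier G. norm (act h x - x) \<le> r}" using norm_le_d[OF act_X[OF h(1) x(1)] x(1)] h by simp
    qed
    then show "\<exists>r>0. finite {h \<in> carrier G. mdist Y (\<phi> h u) u \<le> r}" using r finite_subset by blast
  qed
  moreover have "cocompact_action G Y \<phi>"
  proof -
    obtain rv where rv: "\<And>v g x. v \<in> V \<Longrightarrow> g \<in> carrier G \<Longrightarrow> x \<in> vpiece g v \<Longrightarrow>
        \<exists>h\<in>carrier G. \<exists>y\<in>vpiece \<one> v \<inter> cball (pos v) (rv v). x = act h y"
      using vpiece_cocompact by metis
    obtain re where re: "\<And>e g x. e \<in> E \<Longrightarrow> g \<in> carrier G \<Longrightarrow> x \<in> spiece g e \<Longrightarrow>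
        \<exists>h\<in>carrier G. \<exists>y\<in>spiece \<one> e \<inter> cball (pos (src e)) (re e). x = act h y"
      using spiece_cocompact by metis
    \<comment> \<open>One bounded part for each vertex and each edge of the finite quotient graph;
      their union is the compact fundamental set.\<close>
    define \<K> where "\<K> = (\<lambda>v. vpiece \<one> v \<inter> cball (pos v) (rv v)) ` V \<union> (\<lambda>e. spiece \<one> e \<inter> cball (pos (src e)) (re e)) ` E"
    have K: "\<exists>P\<in>pieces. K \<subseteq> P \<and> compact K" if K: "K \<in> \<K>" for K
    proof -
      have "\<exists>P\<in>pieces. \<exists>x r. K = P \<inter> cball x r"
        using K one_closed unfolding \<K>_def vpieces_def spieces_def by blast
      then show ?thesis using compact_piece by blast
    qed
    define C where "C = (\<Union>K\<in>\<K>. R ` K)"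
    have "compactin (mtopology_of Y) C"
      unfolding C_def
    proof (rule compactin_Union)
      show "finite ((`) R ` \<K>)" using V(1) E(1) by (simp add: \<K>_def)
      show "compactin (mtopology_of Y) S" if "S \<in> (`) R ` \<K>" for S
        using that K compactin_realization[OF inj Y] by blast
    qed
    moreover have "mspace Y = (\<Union>g\<in>carrier G. \<phi> g ` C)"
    proof
      have KX: "K \<subseteq> X" if "K \<in> \<K>" for K using K[OF that] by blast
      show "(\<Union>g\<in>carrier G. \<phi> g ` C) \<subseteq> mspace Y"
      proof
        fix u assume "u \<in> (\<Union>g\<in>carrier G. \<phi> g ` C)"
        then obtain g K x where gK: "g \<in> carrier G" "K \<in> \<K>" "x \<in> K" "u = \<phi> g (R x)" unfolding C_def by blast
        have x: "x \<in> X" by (rule subsetD[OF KX[OF gK(2)] gK(3)])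
        have "R (act g x) \<in> R ` X" by (rule imageI[OF act_X[OF gK(1) x]])
        then show "u \<in> mspace Y" unfolding gK(4) \<phi>[OF x] Y(1) .
      qed
      show "mspace Y \<subseteq> (\<Union>g\<in>carrier G. \<phi> g ` C)"
      proof
        fix u assume "u \<in> mspace Y"
        then obtain x where x: "x \<in> X" "u = R x" using Y(1) by blast
        from x(1) obtain P where P: "P \<in> vpieces \<union> spieces" "x \<in> P" by (rule UnionE)
        have "\<exists>h\<in>carrier G. \<exists>K\<in>\<K>. \<exists>y\<in>K. x = act h y"
          using P(1)
        proof (cases rule: piece_cases)
          case (vertex g v)
          then obtain h y where hy: "h \<in> carrier G" "y \<in> vpiece \<one> v \<inter> cball (pos v) (rv v)" "x = act h y"
            using rv[OF vertex(2,1)] P(2) by blast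
          have "vpiece \<one> v \<inter> cball (pos v) (rv v) \<in> \<K>" unfolding \<K>_def by (intro UnI1 imageI vertex(2))
          then show ?thesis using hy by blast
        next
          case (strip g e)
          then obtain h y where hy: "h \<in> carrier G" "y \<in> spiece \<one> e \<inter> cball (pos (src e)) (re e)" "x = act h y"
            using re[OF strip(2,1)] P(2) by blast
          have "spiece \<one> e \<inter> cball (pos (src e)) (re e) \<in> \<K>" unfolding \<K>_def by (intro UnI2 imageI strip(2))
          then show ?thesis using hy by blast
        qed
        then obtain h K y where h: "h \<in> carrier G" "K \<in> \<K>" "y \<in> K" "x = act h y" by blast
        have "u = \<phi> h (R y)" unfolding x(2) h(4) by (rule \<phi>[OF subsetD[OF KX[OF h(2)] h(3)], symmetric])
        moreover have "R y \<in> C" unfolding C_def using h(2,3) by (intro UN_I imageI)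
        ultimately show "u \<in> (\<Union>g\<in>carrier G. \<phi> g ` C)" using h(1) by (intro UN_I image_eqI)
      qed
    qed
    ultimately show ?thesis unfolding cocompact_action_def by (intro exI conjI)
  qed
  moreover have "CAT0_space Y" by (rule CAT0_realization[OF inj Y])
  moreover have "mcomplete_of Y" by (rule complete_realization[OF inj Y])
  ultimately show ?thesis by (intro exI conjI)
qed

end


section \<open>Virtual characters\<close>

text \<open>A homomorphism to the integers from a finite-index subgroup. The domain is carried along
  in the pair because functions are total.\<close>

definition virtual_character :: "('a, 'm) monoid_scheme \<Rightarrow> 'a set \<times> ('a \<Rightarrow> int) \<Rightarrow> bool" where
  "virtual_character G \<kappa> \<longleftrightarrow> finite_index G (fst \<kappa>) \<and>
     (\<forall>x\<in>fst \<kappa>. \<forall>y\<in>fst \<kappa>. snd \<kappa> (x \<otimes>\<^bsub>G\<^esub> y) = snd \<kappa> x + snd \<kappa> y)"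

definition joint_kernel :: "('a set \<times> ('a \<Rightarrow> int)) set \<Rightarrow> 'a set \<Rightarrow> 'a set" where
  "joint_kernel \<Phi> A = {a\<in>A. \<forall>\<kappa>\<in>\<Phi>. a \<in> fst \<kappa> \<and> snd \<kappa> a = 0}"

definition almost_separated :: "('a, 'm) monoid_scheme \<Rightarrow> 'a set \<Rightarrow> bool" where
  "almost_separated G A \<longleftrightarrow>
     (\<exists>\<Phi>. finite \<Phi> \<and> (\<forall>\<kappa>\<in>\<Phi>. virtual_character G \<kappa>) \<and> finite (joint_kernel \<Phi> A))"

section \<open>Arithmetic of virtual characters and their kernels\<close>

context group
begin

lemma int_pow_commutes:
  assumes xy: "x \<otimes> y = y \<otimes> x" "x \<in> carrier G" "y \<in> carrier G"
  shows "x [^] (k::int) \<otimes> y = y \<otimes> x [^] k"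
proof (cases k rule: int_cases)
  case (nonneg n)
  then show ?thesis using group_commutes_pow[OF xy] by (simp add: int_pow_int)
next
  case (neg n)
  define w where "w = x [^] Suc n"
  have w: "w \<in> carrier G" "w \<otimes> y = y \<otimes> w" using group_commutes_pow[OF xy, of "Suc n"] xy by (auto simp: w_def)
  have "inv w \<otimes> y = inv w \<otimes> (y \<otimes> w) \<otimes> inv w" using w xy by (simp add: m_assoc)
  also have "\<dots> = y \<otimes> inv w" using w xy by (simp add: w(2)[symmetric] m_assoc[symmetric])
  finally show ?thesis using neg int_pow_neg_int[OF xy(2), of "Suc n"] by (simp add: w_def)
qed

lemma virtual_character_subgroup: "virtual_character G \<kappa> \<Longrightarrow> subgroup (fst \<kappa>) G"
  by (simp add: virtual_character_def finite_index_def)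

lemma virtual_character_add:
  "virtual_character G \<kappa> \<Longrightarrow> x \<in> fst \<kappa> \<Longrightarrow> y \<in> fst \<kappa> \<Longrightarrow> snd \<kappa> (x \<otimes> y) = snd \<kappa> x + snd \<kappa> y"
  unfolding virtual_character_def by blast

lemma virtual_character_one:
  assumes "virtual_character G \<kappa>" shows "snd \<kappa> \<one> = 0"
proof -
  note one = subgroup.one_closed[OF virtual_character_subgroup[OF assms]]
  show ?thesis using virtual_character_add[OF assms one one] by simp
qed

lemma virtual_character_inv:
  assumes "virtual_character G \<kappa>" "x \<in> fst \<kappa>" shows "snd \<kappa> (inv x) = - snd \<kappa> x"
proof -
  note S = virtual_character_subgroup[OF assms(1)]
  have "x \<in> carrier G" by (rule subgroup.mem_carrier[OF S assms(2)])
  then show ?thesis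
    using virtual_character_add[OF assms subgroup.m_inv_closed[OF S assms(2)]] virtual_character_one[OF assms(1)] by simp
qed

lemma virtual_character_nat_pow:
  assumes "virtual_character G \<kappa>" "x \<in> fst \<kappa>"
  shows "x [^] (n::nat) \<in> fst \<kappa> \<and> snd \<kappa> (x [^] n) = int n * snd \<kappa> x"
proof (induction n)
  case 0
  show ?case using virtual_character_one[OF assms(1)] subgroup.one_closed[OF virtual_character_subgroup[OF assms(1)]]
    by simp
next
  case (Suc n)
  then show ?case
    using virtual_character_add[OF assms(1) _ assms(2), of "x [^] n"]
      subgroup.m_closed[OF virtual_character_subgroup[OF assms(1)] _ assms(2), of "x [^] n"]
    by (simp add: algebra_simps)
qed

lemma virtual_character_int_pow:
  assumes "virtual_character G \<kappa>" "x \<in> fst \<kappa>"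
  shows "snd \<kappa> (x [^] (k::int)) = k * snd \<kappa> x"
proof (cases k rule: int_cases)
  case (nonneg n)
  then show ?thesis using virtual_character_nat_pow[OF assms, of n] by (simp add: int_pow_int)
next
  case (neg n)
  have "x \<in> carrier G" by (rule subgroup.mem_carrier[OF virtual_character_subgroup[OF assms(1)] assms(2)])
  then have "x [^] k = inv (x [^] Suc n)" unfolding neg by (rule int_pow_neg_int)
  moreover have "snd \<kappa> (inv (x [^] Suc n)) = - (int (Suc n) * snd \<kappa> x)"
    using virtual_character_nat_pow[OF assms, of "Suc n"] virtual_character_inv[OF assms(1), of "x [^] Suc n"]
    by metis
  ultimately show ?thesis using neg by (simp only: mult_minus_left)
qed

lemma joint_kernel_subgroup:
  assumes \<Phi>: "\<forall>\<kappa>\<in>\<Phi>. virtual_character G \<kappa>" and A: "subgroup A G"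
  shows "subgroup (joint_kernel \<Phi> A) G"
proof
  show "joint_kernel \<Phi> A \<subseteq> carrier G" using subgroup.subset[OF A] by (auto simp: joint_kernel_def)
  have K: "virtual_character G \<kappa>" "subgroup (fst \<kappa>) G" if "\<kappa> \<in> \<Phi>" for \<kappa>
    using that \<Phi> virtual_character_subgroup by auto
  show "\<one> \<in> joint_kernel \<Phi> A"
    using subgroup.one_closed[OF A] virtual_character_one[OF K(1)] subgroup.one_closed[OF K(2)]
    by (simp add: joint_kernel_def)
  fix x assume x: "x \<in> joint_kernel \<Phi> A"
  then show "inv x \<in> joint_kernel \<Phi> A"
    using subgroup.m_inv_closed[OF A] virtual_character_inv[OF K(1)] subgroup.m_inv_closed[OF K(2)]
    by (simp add: joint_kernel_def)
  fix y assume y: "y \<in> joint_kernel \<Phi> A"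
  with x show "x \<otimes> y \<in> joint_kernel \<Phi> A"
    using subgroup.m_closed[OF A] virtual_character_add[OF K(1)] subgroup.m_closed[OF K(2)]
    by (simp add: joint_kernel_def)
qed

text \<open>This is where (VRC) enters. A retraction onto the infinite cyclic group of
  \<open>a\<close>, followed by its identification with the integers, is a virtual character with
  value 1 at \<open>a\<close>.\<close>

lemma virtual_retract_character:
  assumes vrc: "property_VRC G" and a: "a \<in> carrier G" and ord: "ord a = 0"
  shows "\<exists>\<kappa>. virtual_character G \<kappa> \<and> a \<in> fst \<kappa> \<and> snd \<kappa> a = 1"
proof -
  define H where "H = generate G {a}"
  have H_eq: "H = range (\<lambda>k::int. a [^] k)" unfolding H_def generate_pow[OF a] by auto
  have H: "subgroup H G" unfolding H_def by (rule generate_is_subgroup) (use a in simp)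
  have aH: "a \<in> H" unfolding H_def by (rule generate.incl) simp
  have "G\<lparr>carrier := H\<rparr> = subgroup_generated G {a}" using a by (simp add: subgroup_generated_def H_def)
  then have "cyclic_group (G\<lparr>carrier := H\<rparr>)" using cyclic_group_generated by simp
  then have "virtual_retract G H" using vrc H unfolding property_VRC_def by blast
  then obtain K \<rho> where K: "finite_index G K" "H \<subseteq> K" and \<rho>: "\<rho> \<in> hom (G\<lparr>carrier := K\<rparr>) (G\<lparr>carrier := H\<rparr>)"
    "\<forall>h\<in>H. \<rho> h = h" unfolding virtual_retract_def by blast
  have inj: "k = l" if "a [^] (k::int) = a [^] (l::int)" for k l
    using that int_pow_eq[OF a, of k l] ord by simp
  \<comment> \<open>The exponent of the retracted element, well defined because \<open>a\<close> has
    infinite order.\<close>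
  define f where "f x = (THE k::int. \<rho> x = a [^] k)" for x
  have f: "\<rho> x = a [^] f x" if "x \<in> K" for x
  proof -
    have "\<rho> x \<in> H" using \<rho>(1) that by (auto simp: hom_def)
    then obtain k :: int where k: "\<rho> x = a [^] k" unfolding H_eq by blast
    show ?thesis unfolding f_def by (rule theI[of _ k]) (use k inj in auto)
  qed
  have KG: "subgroup K G" using K by (simp add: finite_index_def)
  have "f (x \<otimes> y) = f x + f y" if "x \<in> K" "y \<in> K" for x y
  proof (rule inj)
    have "a [^] f (x \<otimes> y) = \<rho> (x \<otimes> y)" using f subgroup.m_closed[OF KG that] by simp
    also have "\<dots> = \<rho> x \<otimes> \<rho> y" using \<rho>(1) that by (auto simp: hom_def)
    also have "\<dots> = a [^] (f x + f y)" using f that a by (simp add: int_pow_mult)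
    finally show "a [^] f (x \<otimes> y) = a [^] (f x + f y)" .
  qed
  moreover have "f a = 1"
  proof (rule inj)
    have "a [^] f a = \<rho> a" using f aH K by auto
    then show "a [^] f a = a [^] (1::int)" using \<rho>(2) aH a by simp
  qed
  ultimately show ?thesis using K aH
    by (intro exI[of _ "(K, f)"]) (auto simp: virtual_character_def)
qed

text \<open>Each coset of \<open>B\<close> meets \<open>Z\<close> in at most one coset of \<open>Z \<inter> B\<close>.\<close>

lemma finite_subgroup_by_cosets:
  assumes Z: "subgroup Z G" and B: "subgroup B G" and fin: "finite (Z \<inter> B)"
    and F: "finite F" "F \<subseteq> carrier G" and cover: "Z \<subseteq> (\<Union>t\<in>F. B #> t)"
  shows "finite Z"
proof -
  have "finite (Z \<inter> (B #> t))" if t: "t \<in> F" for t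
  proof (cases "Z \<inter> (B #> t) = {}")
    case False
    then obtain b0 where b0: "b0 \<in> B" "b0 \<otimes> t \<in> Z" by (auto simp: r_coset_def)
    have tG: "t \<in> carrier G" using t F by auto
    note cl = subgroup.mem_carrier[OF B] subgroup.mem_carrier[OF Z]
    have "Z \<inter> (B #> t) \<subseteq> (\<lambda>w. w \<otimes> (b0 \<otimes> t)) ` (Z \<inter> B)"
    proof
      fix z assume "z \<in> Z \<inter> (B #> t)"
      then obtain b where b: "b \<in> B" "z = b \<otimes> t" "z \<in> Z" by (auto simp: r_coset_def)
      have bG: "b \<in> carrier G" "b0 \<in> carrier G" "z \<in> carrier G"
        using b(1) b0(1) b(3) cl by auto
      have "z \<otimes> inv (b0 \<otimes> t) = b \<otimes> (t \<otimes> inv t) \<otimes> inv b0"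
        using bG tG unfolding b(2) by (simp only: inv_mult_group m_assoc m_closed inv_closed)
      then have eq: "z \<otimes> inv (b0 \<otimes> t) = b \<otimes> inv b0" using bG tG by simp
      have "z \<otimes> inv (b0 \<otimes> t) \<in> Z" using b b0 Z by (simp add: subgroup.m_closed subgroup.m_inv_closed)
      moreover have "b \<otimes> inv b0 \<in> B" using b b0 B by (simp add: subgroup.m_closed subgroup.m_inv_closed)
      moreover have "z = z \<otimes> inv (b0 \<otimes> t) \<otimes> (b0 \<otimes> t)"
        using bG tG by (simp add: m_assoc)
      ultimately show "z \<in> (\<lambda>w. w \<otimes> (b0 \<otimes> t)) ` (Z \<inter> B)" using eq by (metis IntI image_eqI)
    qed
    then show ?thesis using fin by (meson finite_imageI finite_subset)
  qed simp
  then have "finite (\<Union>t\<in>F. Z \<inter> (B #> t))" using F by blast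
  moreover have "Z \<subseteq> (\<Union>t\<in>F. Z \<inter> (B #> t))" using cover by blast
  ultimately show ?thesis by (rule rev_finite_subset)
qed

lemma almost_separated_finite_index:
  assumes A: "almost_separated G A" "subgroup A G" and P: "subgroup P G"
    and F: "finite F" "F \<subseteq> carrier G" and cover: "P \<subseteq> (\<Union>t\<in>F. A #> t)"
  shows "almost_separated G P"
proof -
  obtain \<Phi> where \<Phi>: "finite \<Phi>" "\<forall>\<kappa>\<in>\<Phi>. virtual_character G \<kappa>" "finite (joint_kernel \<Phi> A)"
    using A(1) unfolding almost_separated_def by blast
  have "finite (joint_kernel \<Phi> P)"
  proof (rule finite_subgroup_by_cosets[OF joint_kernel_subgroup[OF \<Phi>(2) P] A(2) _ F])
    have "joint_kernel \<Phi> P \<inter> A \<subseteq> joint_kernel \<Phi> A" by (auto simp: joint_kernel_def)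
    then show "finite (joint_kernel \<Phi> P \<inter> A)" using \<Phi>(3) finite_subset by blast
    show "joint_kernel \<Phi> P \<subseteq> (\<Union>t\<in>F. A #> t)" using cover by (auto simp: joint_kernel_def)
  qed
  then show ?thesis using \<Phi> unfolding almost_separated_def by blast
qed

section \<open>Separating finitely generated virtually abelian subgroups\<close>

lemma generate_insert_central:
  assumes S: "S \<subseteq> carrier G" "s \<in> carrier G"
    and comm: "\<And>x. x \<in> generate G (insert s S) \<Longrightarrow> x \<otimes> s = s \<otimes> x"
    and x: "x \<in> generate G (insert s S)"
  shows "\<exists>b\<in>generate G S. \<exists>k::int. x = b \<otimes> s [^] k"
  using x
proof (induction rule: generate.induct)
  case one
  show ?case by (intro bexI[of _ \<one>] exI[of _ 0]) (auto intro: generate.one)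
next
  case (incl h)
  show ?case
  proof (cases "h = s")
    case True
    then show ?thesis using S by (intro bexI[of _ \<one>] exI[of _ 1]) (auto intro: generate.one)
  next
    case False
    then show ?thesis using S incl by (intro bexI[of _ h] exI[of _ 0]) (auto intro: generate.incl)
  qed
next
  case (inv h)
  show ?case
  proof (cases "h = s")
    case True
    then show ?thesis using S int_pow_neg[of s 1] by (intro bexI[of _ \<one>] exI[of _ "-1"]) (auto intro: generate.one)
  next
    case False
    then show ?thesis using S inv by (intro bexI[of _ "inv h"] exI[of _ 0]) (auto intro: generate.inv)
  qed
next
  case (eng x y)
  then obtain b k c l where bc: "b \<in> generate G S" "c \<in> generate G S" "x = b \<otimes> s [^] (k::int)" "y = c \<otimes> s [^] (l::int)"
    by blast
  have sub: "generate G S \<subseteq> generate G (insert s S)" by (rule mono_generate) auto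
  have G: "b \<in> carrier G" "c \<in> carrier G" using bc generate_in_carrier[OF S(1)] by auto
  have "c \<otimes> s = s \<otimes> c" using comm bc sub by blast
  then have sc: "s [^] k \<otimes> c = c \<otimes> s [^] k" by (intro int_pow_commutes) (simp_all add: G S)
  have "x \<otimes> y = b \<otimes> (s [^] k \<otimes> c) \<otimes> s [^] l" using G S unfolding bc by (simp add: m_assoc)
  also have "\<dots> = (b \<otimes> c) \<otimes> s [^] (k + l)" unfolding sc using G S by (simp add: m_assoc int_pow_mult)
  finally have "x \<otimes> y = (b \<otimes> c) \<otimes> s [^] (k + l)" .
  then show ?case using generate.eng[OF bc(1,2)] by blast
qed

lemma ord_nonzero_of_finite_subgroup:
  assumes H: "subgroup H G" "finite H" and w: "w \<in> H"
  shows "ord w \<noteq> 0"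
proof
  assume z: "ord w = 0"
  have wG: "w \<in> carrier G" by (rule subgroup.mem_carrier[OF H(1) w])
  have "inj (\<lambda>k::int. w [^] k)" using int_pow_eq[OF wG] z by (simp add: inj_on_def)
  moreover have "range (\<lambda>k::int. w [^] k) \<subseteq> H" using subgroup_int_pow_closed[OF H(1) w] by auto
  ultimately have "finite (UNIV :: int set)" using H(2) finite_subset finite_imageD by blast
  then show False by simp
qed

text \<open>One further generator raises the rank of the joint kernel \<open>Z\<close> by at most 1.
  If \<open>Z\<close> has an element of infinite order, a character nontrivial on it is added;
  otherwise \<open>Z\<close> is torsion and turns out to be finite.\<close>

lemma almost_separated_step:
  assumes vrc: "property_VRC G" and S: "S \<subseteq> carrier G" "s \<in> carrier G"
    and comm: "\<And>x y. x \<in> generate G (insert s S) \<Longrightarrow> y \<in> generate G (insert s S) \<Longrightarrow> x \<otimes> y = y \<otimes> x"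
    and IH: "almost_separated G (generate G S)"
  shows "almost_separated G (generate G (insert s S))"
proof -
  let ?A = "generate G (insert s S)" and ?B = "generate G S"
  have A: "subgroup ?A G" and B: "subgroup ?B G" using S by (auto intro!: generate_is_subgroup)
  have BA: "?B \<subseteq> ?A" by (rule mono_generate) auto
  have sA: "s \<in> ?A" by (rule generate.incl) simp
  have AG: "x \<in> carrier G" if "x \<in> ?A" for x using subgroup.mem_carrier[OF A that] .
  have BG: "x \<in> carrier G" if "x \<in> ?B" for x using subgroup.mem_carrier[OF B that] .
  obtain \<Phi> where \<Phi>: "finite \<Phi>" "\<forall>\<kappa>\<in>\<Phi>. virtual_character G \<kappa>" "finite (joint_kernel \<Phi> ?B)"
    using IH unfolding almost_separated_def by blast
  define Z where "Z = joint_kernel \<Phi> ?A"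
  have Z: "subgroup Z G" unfolding Z_def by (rule joint_kernel_subgroup[OF \<Phi>(2) A])
  have ZA: "Z \<subseteq> ?A" by (auto simp: Z_def joint_kernel_def)
  have ZB: "Z \<inter> ?B = joint_kernel \<Phi> ?B" using BA by (auto simp: Z_def joint_kernel_def)
  have ZBs: "subgroup (Z \<inter> ?B) G" by (rule subgroups_Inter_pair[OF Z B])
  have dec: "\<exists>b\<in>?B. \<exists>k::int. x = b \<otimes> s [^] k" if "x \<in> ?A" for x
    by (rule generate_insert_central[OF S _ that]) (use comm sA in blast)
  have pow: "(b \<otimes> s [^] (k::int)) [^] (n::int) = b [^] n \<otimes> s [^] (k * n)" if b: "b \<in> ?B" for b k n
  proof -
    have "b \<otimes> s [^] k = s [^] k \<otimes> b"
      by (rule comm) (use b BA sA subgroup_int_pow_closed[OF A] in auto)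
    then show ?thesis using int_pow_mult_distrib[of b "s [^] k" n] BG[OF b] S by (simp add: int_pow_pow)
  qed
  show ?thesis
  proof (cases "\<exists>a\<in>Z. ord a = 0")
    case True
    then obtain a where a: "a \<in> Z" "ord a = 0" by blast
    have aG: "a \<in> carrier G" using a ZA AG by blast
    obtain \<kappa> where \<kappa>: "virtual_character G \<kappa>" "a \<in> fst \<kappa>" "snd \<kappa> a = 1"
      using virtual_retract_character[OF vrc aG a(2)] by blast
    obtain b k where b: "b \<in> ?B" "a = b \<otimes> s [^] (k::int)" using dec a(1) ZA by blast
    have "joint_kernel (insert \<kappa> \<Phi>) ?A \<subseteq> joint_kernel \<Phi> ?B"
    proof
      fix z assume "z \<in> joint_kernel (insert \<kappa> \<Phi>) ?A"
      then have z: "z \<in> Z" "z \<in> fst \<kappa>" "snd \<kappa> z = 0" by (auto simp: Z_def joint_kernel_def)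
      have zG: "z \<in> carrier G" using z ZA AG by blast
      obtain c l where c: "c \<in> ?B" "z = c \<otimes> s [^] (l::int)" using dec z(1) ZA by blast
      have zk: "z [^] k = c [^] k \<otimes> s [^] (l * k)" unfolding c(2) by (rule pow[OF c(1)])
      have al: "a [^] l = b [^] l \<otimes> s [^] (l * k)" unfolding b(2) using pow[OF b(1), of k l] by (simp add: mult.commute)
      \<comment> \<open>The powers of \<open>s\<close> cancel, so \<open>w\<close> lies in the
        finite intersection of \<open>Z\<close> with the old subgroup and has finite order.\<close>
      define w where "w = z [^] k \<otimes> inv (a [^] l)"
      have w_eq: "w = c [^] k \<otimes> inv (b [^] l)"
        unfolding w_def zk al using BG[OF b(1)] BG[OF c(1)] S
        by (simp add: inv_mult_group m_assoc) (simp add: m_assoc[symmetric])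
      have "w \<in> Z" unfolding w_def using z a Z
        by (simp add: subgroup.m_closed subgroup.m_inv_closed subgroup_int_pow_closed)
      moreover have "w \<in> ?B" unfolding w_eq using b c B
        by (simp add: subgroup.m_closed subgroup.m_inv_closed subgroup_int_pow_closed)
      ultimately have ow: "ord w \<noteq> 0"
        using ord_nonzero_of_finite_subgroup[OF ZBs] \<Phi>(3) ZB by (metis IntI)
      have wG: "w \<in> carrier G" unfolding w_def using zG aG by simp
      have "z [^] k = w \<otimes> a [^] l" unfolding w_def using zG aG by (simp add: m_assoc)
      moreover have "w \<otimes> a [^] l = a [^] l \<otimes> w"
        by (rule comm) (use \<open>w \<in> Z\<close> a ZA subgroup_int_pow_closed[OF A] in auto)
      ultimately have "(z [^] k) [^] int (ord w) = w [^] int (ord w) \<otimes> (a [^] l) [^] int (ord w)"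
        using int_pow_mult_distrib[of w "a [^] l" "int (ord w)"] wG aG by simp
      also have "w [^] int (ord w) = \<one>" using pow_ord_eq_1[OF wG] by (simp add: int_pow_int)
      finally have "z [^] (k * int (ord w)) = a [^] (l * int (ord w))" using zG aG by (simp add: int_pow_pow)
      \<comment> \<open>\<kappa> vanishes on z and is 1 on \<open>a\<close>, which forces the
        exponent \<open>l\<close> of \<open>s\<close> in z to be 0.\<close>
      then have "snd \<kappa> (z [^] (k * int (ord w))) = snd \<kappa> (a [^] (l * int (ord w)))" by simp
      then have "l * int (ord w) = 0"
        using virtual_character_int_pow[OF \<kappa>(1) z(2)] virtual_character_int_pow[OF \<kappa>(1,2)] z(3) \<kappa>(3) by simp
      then have "z = c" using ow c BG[OF c(1)] by simp
      then show "z \<in> joint_kernel \<Phi> ?B" using c(1) z(1) ZB by blast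
    qed
    then have "finite (joint_kernel (insert \<kappa> \<Phi>) ?A)" using \<Phi>(3) finite_subset by blast
    then show ?thesis unfolding almost_separated_def using \<Phi> \<kappa>
      by (intro exI[of _ "insert \<kappa> \<Phi>"]) auto
  next
    case False
    \<comment> \<open>Every element of \<open>Z\<close> is now torsion. Either a positive power of
      \<open>s\<close> lies in the old subgroup, which then has finitely many cosets, or torsion
      forces the exponent of \<open>s\<close> to vanish.\<close>
    have "finite Z"
    proof (cases "\<exists>m::int. 0 < m \<and> s [^] m \<in> ?B")
      case True
      then obtain m :: int where m: "0 < m" "s [^] m \<in> ?B" by blast
      show ?thesis
      proof (rule finite_subgroup_by_cosets[OF Z B])
        show "finite (Z \<inter> ?B)" using \<Phi>(3) ZB by simp
        show "finite ((\<lambda>l. s [^] l) ` {0..<m})" "(\<lambda>l. s [^] l) ` {0..<m} \<subseteq> carrier G" using S by auto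
        show "Z \<subseteq> (\<Union>t\<in>(\<lambda>l. s [^] l) ` {0..<m}. ?B #> t)"
        proof
          fix z assume "z \<in> Z"
          then obtain c l where c: "c \<in> ?B" "z = c \<otimes> s [^] (l::int)" using dec ZA by blast
          have "s [^] l = (s [^] m) [^] (l div m) \<otimes> s [^] (l mod m)"
            using S by (simp add: int_pow_pow int_pow_mult[symmetric])
          then have "z = (c \<otimes> (s [^] m) [^] (l div m)) \<otimes> s [^] (l mod m)"
            using c BG S by (simp add: m_assoc)
          moreover have "c \<otimes> (s [^] m) [^] (l div m) \<in> ?B"
            using c m B by (simp add: subgroup.m_closed subgroup_int_pow_closed)
          ultimately have "z \<in> ?B #> s [^] (l mod m)" by (auto simp: r_coset_def)
          moreover have "l mod m \<in> {0..<m}" using m by simp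
          ultimately show "z \<in> (\<Union>t\<in>(\<lambda>l. s [^] l) ` {0..<m}. ?B #> t)" by blast
        qed
      qed
    next
      case no: False
      have "Z \<subseteq> joint_kernel \<Phi> ?B"
      proof
        fix z assume z: "z \<in> Z"
        then obtain c l where c: "c \<in> ?B" "z = c \<otimes> s [^] (l::int)" using dec ZA by blast
        have zG: "z \<in> carrier G" using z ZA AG by blast
        define M where "M = int (ord z)"
        have M: "M > 0" using False z by (auto simp: M_def)
        have "\<one> = z [^] M" using pow_ord_eq_1[OF zG] by (simp add: M_def int_pow_int)
        also have "\<dots> = c [^] M \<otimes> s [^] (l * M)" unfolding c(2) by (rule pow[OF c(1)])
        finally have "s [^] (l * M) = inv (c [^] M)"
          using BG[OF c(1)] S by (metis inv_equality int_pow_closed inv_inv)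
        then have in1: "s [^] (l * M) \<in> ?B" using c B by (simp add: subgroup.m_inv_closed subgroup_int_pow_closed)
        then have in2: "s [^] (- (l * M)) \<in> ?B" using B S by (simp add: int_pow_neg subgroup.m_inv_closed)
        have "\<not> 0 < l * M" "\<not> 0 < - (l * M)" using no in1 in2 by blast+
        then have "l = 0" using M by (simp add: zero_less_mult_iff not_less mult_le_0_iff zero_le_mult_iff)
        then have "z = c" using c BG by simp
        then show "z \<in> joint_kernel \<Phi> ?B" using c(1) z ZB by blast
      qed
      then show ?thesis using \<Phi>(3) finite_subset by blast
    qed
    then show ?thesis unfolding almost_separated_def Z_def using \<Phi> by blast
  qed
qed

lemma almost_separated_abelian:
  assumes vrc: "property_VRC G" and S: "finite S" "S \<subseteq> carrier G"
    and comm: "\<And>x y. x \<in> generate G S \<Longrightarrow> y \<in> generate G S \<Longrightarrow> x \<otimes> y = y \<otimes> x"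
  shows "almost_separated G (generate G S)"
  using S comm
proof (induction S rule: finite_induct)
  case empty
  have "finite (joint_kernel {} (generate G {}))" by (simp add: generate_empty joint_kernel_def)
  then show ?case unfolding almost_separated_def by (intro exI[of _ "{}"]) simp
next
  case (insert s S)
  have "generate G S \<subseteq> generate G (insert s S)" by (rule mono_generate) auto
  then have "almost_separated G (generate G S)" using insert by blast
  then show ?case using insert by (intro almost_separated_step[OF vrc]) auto
qed

text \<open>Schreier's argument: rewriting a word one letter at a time keeps the prefix in the form
  of a product of Schreier generators and a coset representative.\<close>

lemma finite_index_finitely_generated:
  assumes S: "finite S" "S \<subseteq> carrier G" and A: "subgroup A G" "A \<subseteq> generate G S"
    and F: "finite F" "F \<subseteq> generate G S" and cover: "generate G S \<subseteq> (\<Union>t\<in>F. A #> t)"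
  shows "\<exists>S'. finite S' \<and> S' \<subseteq> carrier G \<and> generate G S' = A"
proof -
  let ?P = "generate G S"
  have P: "subgroup ?P G" using S by (intro generate_is_subgroup)
  note PG = subgroup.mem_carrier[OF P]
  have "\<forall>p\<in>?P. \<exists>t\<in>F. p \<otimes> inv t \<in> A"
  proof
    fix p assume "p \<in> ?P"
    then obtain t a where t: "t \<in> F" "a \<in> A" "p = a \<otimes> t" using cover by (auto simp: r_coset_def)
    have "a \<otimes> t \<otimes> inv t = a" using subgroup.mem_carrier[OF A(1) t(2)] PG t(1) F by (simp add: m_assoc subset_iff)
    then show "\<exists>t\<in>F. p \<otimes> inv t \<in> A" using t by (intro bexI[of _ t]) simp_all
  qed
  then obtain \<tau> where \<tau>: "\<And>p. p \<in> ?P \<Longrightarrow> \<tau> p \<in> F" "\<And>p. p \<in> ?P \<Longrightarrow> p \<otimes> inv (\<tau> p) \<in> A" by metis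
  define F' where "F' = insert \<one> F"
  have F': "finite F'" "F' \<subseteq> ?P" using F by (auto simp: F'_def generate.one)
  define S1 where "S1 = S \<union> m_inv G ` S"
  have S1: "finite S1" "S1 \<subseteq> ?P" using S by (auto simp: S1_def intro: generate.incl generate.inv)
  define k where "k t s = t \<otimes> s \<otimes> inv (\<tau> (t \<otimes> s))" for t s
  \<comment> \<open>The representative of the trivial coset need not be 1, so the representatives
    that lie in \<open>A\<close> are adjoined as generators.\<close>
  define S' where "S' = (\<lambda>(t, s). k t s) ` (F' \<times> S1) \<union> (F' \<inter> A)"
  have kA: "k t s \<in> A" if "t \<in> F'" "s \<in> S1" for t s
    unfolding k_def by (rule \<tau>(2)) (use that F' S1 in \<open>auto intro: generate.eng\<close>)
  have S'A: "S' \<subseteq> A" using kA by (auto simp: S'_def)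
  let ?H = "generate G S'"
  have S'G: "S' \<subseteq> carrier G" using S'A subgroup.subset[OF A(1)] by blast
  have H: "subgroup ?H G" by (rule generate_is_subgroup[OF S'G])
  have HA: "?H \<subseteq> A" by (rule generate_subgroup_incl[OF S'A A(1)])
  note HG = subgroup.mem_carrier[OF H]
  define U where "U = {h \<otimes> t | h t. h \<in> ?H \<and> t \<in> F'}"
  have step: "u \<otimes> s \<in> U" if u: "u \<in> U" and s: "s \<in> S1" for u s
  proof -
    obtain h t where ht: "h \<in> ?H" "t \<in> F'" "u = h \<otimes> t" using u by (auto simp: U_def)
    have ts: "t \<otimes> s \<in> ?P" by (rule generate.eng[OF subsetD[OF F'(2) ht(2)] subsetD[OF S1(2) s]])
    have \<tau>F: "\<tau> (t \<otimes> s) \<in> F'" using \<tau>(1)[OF ts] by (simp add: F'_def)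
    have G: "h \<in> carrier G" "t \<in> carrier G" "s \<in> carrier G" "\<tau> (t \<otimes> s) \<in> carrier G"
      using HG[OF ht(1)] PG[OF subsetD[OF F'(2) ht(2)]] PG[OF subsetD[OF S1(2) s]] PG[OF subsetD[OF F'(2) \<tau>F]] .
    have "u \<otimes> s = h \<otimes> k t s \<otimes> \<tau> (t \<otimes> s)"
      unfolding ht(3) k_def using G by (simp add: m_assoc)
    moreover have "k t s \<in> ?H" by (rule generate.incl) (use ht s in \<open>auto simp: S'_def\<close>)
    ultimately have "h \<otimes> k t s \<in> ?H" using ht(1) by (intro generate.eng)
    then show ?thesis using \<tau>F \<open>u \<otimes> s = h \<otimes> k t s \<otimes> \<tau> (t \<otimes> s)\<close> unfolding U_def by blast
  qed
  have UG: "U \<subseteq> carrier G" using HG F' PG by (auto simp: U_def)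
  have steps: "\<forall>u\<in>U. u \<otimes> p \<in> U" if "p \<in> ?P" for p
    using that
  proof (induction rule: generate.induct)
    case one
    then show ?case using UG by auto
  next
    case (incl h)
    then show ?case using step by (auto simp: S1_def)
  next
    case (inv h)
    then show ?case using step by (auto simp: S1_def)
  next
    case (eng p q)
    show ?case
    proof
      fix u assume u: "u \<in> U"
      then have "(u \<otimes> p) \<otimes> q \<in> U" using eng by blast
      moreover have "u \<in> carrier G" "p \<in> carrier G" "q \<in> carrier G" using u UG eng PG by auto
      ultimately show "u \<otimes> (p \<otimes> q) \<in> U" by (simp add: m_assoc)
    qed
  qed
  have "A \<subseteq> ?H"
  proof
    fix a assume a: "a \<in> A"
    have "\<one> \<otimes> \<one> \<in> U" unfolding U_def F'_def using generate.one by blast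
    then have "\<one> \<in> U" by simp
    then have "\<one> \<otimes> a \<in> U" using steps a A(2) by blast
    then have "a \<in> U" using subgroup.mem_carrier[OF A(1) a] by simp
    then obtain h t where ht: "h \<in> ?H" "t \<in> F'" "a = h \<otimes> t" by (auto simp: U_def)
    have G: "h \<in> carrier G" "t \<in> carrier G" using ht HG F' PG by auto
    have "t = inv h \<otimes> a" unfolding ht(3) using G by (simp add: m_assoc[symmetric])
    moreover have "h \<in> A" using ht HA by blast
    ultimately have "t \<in> A" using a A(1) by (simp add: subgroup.m_closed subgroup.m_inv_closed)
    then have "t \<in> ?H" using ht by (intro generate.incl) (simp add: S'_def)
    then show "a \<in> ?H" using generate.eng[OF ht(1)] ht(3) by simp
  qed
  moreover have "finite S'" using F' S1 by (simp add: S'_def)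
  ultimately show ?thesis using HA S'G by (intro exI[of _ S'] conjI antisym)
qed

lemma almost_separated_virtually_abelian:
  assumes vrc: "property_VRC G" and S: "finite S" "S \<subseteq> carrier G" and A: "subgroup A G" "A \<subseteq> generate G S"
    and comm: "\<And>x y. x \<in> A \<Longrightarrow> y \<in> A \<Longrightarrow> x \<otimes> y = y \<otimes> x"
    and F: "finite F" "F \<subseteq> generate G S" and cover: "generate G S \<subseteq> (\<Union>t\<in>F. A #> t)"
  shows "almost_separated G (generate G S)"
proof -
  have P: "subgroup (generate G S) G" using S by (intro generate_is_subgroup)
  obtain S' where S': "finite S'" "S' \<subseteq> carrier G" "generate G S' = A"
    using finite_index_finitely_generated[OF S A F cover] by blast
  have "almost_separated G (generate G S')"
    by (rule almost_separated_abelian[OF vrc S'(1,2)]) (simp only: S'(3) comm)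
  then show ?thesis unfolding S'(3)
    by (rule almost_separated_finite_index[OF _ A(1) P F(1) subset_trans[OF F(2) subgroup.subset[OF P]] cover])
qed

end


section \<open>Maximal trees\<close>

lemma (in pre_digraph) cas_iff_nth:
  "cas u p v \<longleftrightarrow> (if p = [] then u = v else tail G (hd p) = u \<and> head G (last p) = v \<and>
     (\<forall>i. Suc i < length p \<longrightarrow> head G (p ! i) = tail G (p ! Suc i)))"
proof (induction p arbitrary: u)
  case (Cons e p)
  show ?case
  proof (cases p)
    case Nil
    then show ?thesis by auto
  next
    case (Cons e' q)
    have "(\<forall>i. Suc i < length (e # p) \<longrightarrow> head G ((e # p) ! i) = tail G ((e # p) ! Suc i))
      \<longleftrightarrow> head G e = tail G e' \<and> (\<forall>i. Suc i < length p \<longrightarrow> head G (p ! i) = tail G (p ! Suc i))"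
    proof -
      have *: "(\<forall>i. Q i) \<longleftrightarrow> Q 0 \<and> (\<forall>i. Q (Suc i))" for Q :: "nat \<Rightarrow> bool"
        by (metis not0_implies_Suc)
      show ?thesis unfolding Cons by (subst *) simp
    qed
    then show ?thesis using Cons.IH Cons by auto
  qed
qed simp

text \<open>In this form a cycle mentions only arcs, incidence maps and positions, so it passes
  between digraphs with the same incidence maps, and backtracking can be read off at a
  position.\<close>

lemma (in pre_digraph) cycle_iff_nth:
  assumes "wf_digraph G"
  shows "cycle p \<longleftrightarrow> p \<noteq> [] \<and> set p \<subseteq> arcs G \<and> tail G (hd p) = head G (last p) \<and>
     (\<forall>i. Suc i < length p \<longrightarrow> head G (p ! i) = tail G (p ! Suc i)) \<and> distinct (map (head G) p)"
proof -
  interpret wf_digraph G by fact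
  have "cycle p \<longleftrightarrow> p \<noteq> [] \<and> (\<exists>u. awalk u p u \<and> distinct (map (head G) p))"
    unfolding cycle_def by (metis awalk_verts_conv' awalkE list.sel(3))
  also have "\<dots> \<longleftrightarrow> p \<noteq> [] \<and> set p \<subseteq> arcs G \<and> tail G (hd p) = head G (last p) \<and>
     (\<forall>i. Suc i < length p \<longrightarrow> head G (p ! i) = tail G (p ! Suc i)) \<and> distinct (map (head G) p)"
  proof (cases "p = []")
    case False
    have "tail G (hd p) \<in> verts G" if "set p \<subseteq> arcs G" using that False wellformed(1) hd_in_set by blast
    then show ?thesis using False unfolding awalk_def cas_iff_nth by (simp add: conj_commute) metis
  qed simp
  finally show ?thesis .
qed

text \<open>With opposite arcs present, the symmetric closure used by
  \<open>Digraph_Component.connected\<close> adds no adjacency.\<close>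

lemma connected_iff_reachable:
  assumes "wf_digraph H" and sym: "\<And>e. e \<in> arcs H \<Longrightarrow> \<exists>e'\<in>arcs H. tail H e' = head H e \<and> head H e' = tail H e"
  shows "Digraph_Component.connected H \<longleftrightarrow> verts H \<noteq> {} \<and> (\<forall>u\<in>verts H. \<forall>v\<in>verts H. u \<rightarrow>\<^sup>*\<^bsub>H\<^esub> v)"
proof -
  interpret wf_digraph H by fact
  have "symmetric H"
    unfolding symmetric_def arcs_ends_conv by (rule symI) (use sym in force)
  then show ?thesis
    unfolding Digraph_Component.connected_def strongly_connected_def by (simp add: reachable_mk_symmetric_eq)
qed

context finite_graph_of_groups
begin

section \<open>Subtrees: attaching a leaf and removing an edge\<close>

context
  fixes T assumes T: "subgraph T \<Gamma>" "serre_tree erev T"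
begin

lemma subtree_facts:
  shows "wf_digraph T" "tail T = tail \<Gamma>" "head T = head \<Gamma>" "arcs T \<subseteq> arcs \<Gamma>" "verts T \<subseteq> verts \<Gamma>"
    and "\<And>e. e \<in> arcs T \<Longrightarrow> erev e \<in> arcs T"
    and "\<And>e. e \<in> arcs T \<Longrightarrow> tail \<Gamma> (erev e) = head \<Gamma> e \<and> head \<Gamma> (erev e) = tail \<Gamma> e"
    and "\<nexists>p. circuit T erev p"
proof -
  show *: "wf_digraph T" "tail T = tail \<Gamma>" "head T = head \<Gamma>" "arcs T \<subseteq> arcs \<Gamma>" "verts T \<subseteq> verts \<Gamma>"
    using T(1) by (auto simp: subgraph_def compatible_def)
  show "\<And>e. e \<in> arcs T \<Longrightarrow> erev e \<in> arcs T" "\<nexists>p. circuit T erev p" using T(2) by (auto simp: serre_tree_def)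
  show "tail \<Gamma> (erev e) = head \<Gamma> e \<and> head \<Gamma> (erev e) = tail \<Gamma> e" if "e \<in> arcs T" for e
    using that *(4) by (simp add: subset_iff)
qed

lemma subtree_reachable:
  "verts T \<noteq> {}" "u \<in> verts T \<Longrightarrow> v \<in> verts T \<Longrightarrow> u \<rightarrow>\<^sup>*\<^bsub>T\<^esub> v"
proof -
  have "Digraph_Component.connected T" using T(2) by (simp add: serre_tree_def)
  moreover have "\<exists>e'\<in>arcs T. tail T e' = head T e \<and> head T e' = tail T e" if "e \<in> arcs T" for e
    using subtree_facts(6,7)[OF that] subtree_facts(2,3) by auto
  ultimately show "verts T \<noteq> {}" "u \<in> verts T \<Longrightarrow> v \<in> verts T \<Longrightarrow> u \<rightarrow>\<^sup>*\<^bsub>T\<^esub> v"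
    using connected_iff_reachable[OF subtree_facts(1)] by blast+
qed

text \<open>The only arcs at the new vertex are \<open>e\<close> and its reverse, so a closed walk
  through it would backtrack there. A circuit in the larger graph therefore already lies in
  \<open>T\<close>.\<close>

lemma leaf_extension:
  assumes e: "e \<in> arcs \<Gamma>" "tail \<Gamma> e \<in> verts T" "head \<Gamma> e \<notin> verts T"
  defines "T' \<equiv> \<lparr>verts = insert (head \<Gamma> e) (verts T), arcs = arcs T \<union> {e, erev e}, tail = tail \<Gamma>, head = head \<Gamma>\<rparr>"
  shows "subgraph T' \<Gamma>" "subgraph T T'" "T' \<noteq> T" "serre_tree erev T'"
proof -
  note F = subtree_facts
  interpret T: wf_digraph T by (rule F(1))
  let ?w = "head \<Gamma> e"
  have er: "erev e \<in> arcs \<Gamma>" "tail \<Gamma> (erev e) = ?w" "head \<Gamma> (erev e) = tail \<Gamma> e" "erev (erev e) = e" "erev e \<noteq> e"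
    using e(1) arev_neq by auto
  have sel: "verts T' = insert ?w (verts T)" "arcs T' = arcs T \<union> {e, erev e}" "tail T' = tail \<Gamma>" "head T' = head \<Gamma>"
    by (simp_all add: T'_def)
  have TT: "tail \<Gamma> a \<in> verts T" "head \<Gamma> a \<in> verts T" if "a \<in> arcs T" for a
    using T.wellformed[OF that] F(2,3) by auto
  have wf: "wf_digraph T'" by unfold_locales (use TT e er sel in auto)
  interpret T': wf_digraph T' by (rule wf)
  show "subgraph T' \<Gamma>"
    using wf F(4,5) e er head_in_verts[OF e(1)] wf_digraph_axioms
    by (auto simp: subgraph_def compatible_def sel)
  show sub: "subgraph T T'" using wf F(1-3) by (auto simp: subgraph_def compatible_def sel)
  show "T' \<noteq> T" using e(3) sel(1) by auto
  have rev: "erev a \<in> arcs T'" if "a \<in> arcs T'" for a using that F(6) er sel by auto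
  have symm: "\<exists>a'\<in>arcs T'. tail T' a' = head T' a \<and> head T' a' = tail T' a" if a: "a \<in> arcs T'" for a
  proof -
    have "a \<in> arcs \<Gamma>" using a sel F(4) e er by auto
    then show ?thesis using rev[OF a] sel by (intro bexI[of _ "erev a"]) auto
  qed
  show "serre_tree erev T'"
    unfolding serre_tree_def
  proof (intro conjI ballI notI)
    show "erev a \<in> arcs T'" if "a \<in> arcs T'" for a by (rule rev[OF that])
    let ?t = "tail \<Gamma> e"
    have 1: "u \<rightarrow>\<^sup>*\<^bsub>T'\<^esub> v" if "u \<in> verts T" "v \<in> verts T" for u v
      using pre_digraph.reachable_mono[OF subtree_reachable(2)[OF that] sub] .
    have 2: "?t \<rightarrow>\<^bsub>T'\<^esub> ?w" "?w \<rightarrow>\<^bsub>T'\<^esub> ?t"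
    proof -
      have "(?t, ?w) = (tail T' e, head T' e)" "(?w, ?t) = (tail T' (erev e), head T' (erev e))"
        using er sel(3,4) by simp_all
      moreover have "e \<in> arcs T'" "erev e \<in> arcs T'" using sel(2) by simp_all
      ultimately show "?t \<rightarrow>\<^bsub>T'\<^esub> ?w" "?w \<rightarrow>\<^bsub>T'\<^esub> ?t" unfolding arcs_ends_conv by blast+
    qed
    have "u \<rightarrow>\<^sup>*\<^bsub>T'\<^esub> ?t \<and> ?t \<rightarrow>\<^sup>*\<^bsub>T'\<^esub> u" if u: "u \<in> verts T'" for u
    proof (cases "u = ?w")
      case True
      then show ?thesis using 2 T'.reachable_adjI by blast
    next
      case False
      then have "u \<in> verts T" using u sel(1) by blast
      then show ?thesis using 1 e(2) by blast
    qed
    then have "\<forall>u\<in>verts T'. \<forall>v\<in>verts T'. u \<rightarrow>\<^sup>*\<^bsub>T'\<^esub> v" using T'.reachable_trans by blast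
    then show "Digraph_Component.connected T'"
      using connected_iff_reachable[OF wf symm] sel by auto
    assume "\<exists>p. circuit T' erev p"
    then obtain p where p: "T'.cycle p" "\<And>i. Suc i < length p \<Longrightarrow> p ! Suc i \<noteq> erev (p ! i)"
      unfolding circuit_def by blast
    have c: "p \<noteq> []" "set p \<subseteq> arcs T'" "tail \<Gamma> (hd p) = head \<Gamma> (last p)"
      "\<And>i. Suc i < length p \<Longrightarrow> head \<Gamma> (p ! i) = tail \<Gamma> (p ! Suc i)" "distinct (map (head \<Gamma>) p)"
      using p(1) unfolding T'.cycle_iff_nth[OF wf] sel by auto
    have out: "a = erev e" if "a \<in> arcs T'" "tail \<Gamma> a = ?w" for a
      using that sel TT[of a] e er by auto
    have into: "a = e" if "a \<in> arcs T'" "head \<Gamma> a = ?w" for a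
      using that sel TT[of a] e er by auto
    have no_e: "e \<notin> set p"
    proof
      assume "e \<in> set p"
      then obtain i where i: "i < length p" "p ! i = e" by (auto simp: in_set_conv_nth)
      \<comment> \<open>Only the reverse of \<open>e\<close> leaves the new vertex, so an arc
        following \<open>e\<close> would backtrack.\<close>
      have "Suc i = length p"
      proof (rule ccontr)
        assume "Suc i \<noteq> length p"
        then have s: "Suc i < length p" using i by simp
        have "p ! Suc i = erev e" by (rule out) (use c(2) c(4)[OF s] i s in auto)
        then show False using p(2)[OF s] i by simp
      qed
      then have "length p - 1 = i" by simp
      then have last: "last p = e" using i c(1) by (simp add: last_conv_nth)
      \<comment> \<open>Backtracking at the closing point is not excluded by the definition of a
        circuit, so this case needs the distinctness of the heads.\<close>
      have hd: "hd p = erev e" by (rule out) (use c(1-3) last in auto)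
      then have "length p \<noteq> 1" using last er(5) by (cases p) auto
      then have len: "length p \<ge> 2" using c(1) by (cases p) (auto simp: Suc_le_eq)
      have p0: "p ! 0 = erev e" using hd c(1) by (simp add: hd_conv_nth)
      have pl: "p ! (length p - 1) = e" using last c(1) by (simp add: last_conv_nth)
      show False
      proof (cases "length p = 2")
        case True
        then show False using p(2)[of 0] p0 pl er(4) by simp
      next
        case False
        \<comment> \<open>The position before the last arc: that arc and the first one both end at
          the tail of \<open>e\<close>.\<close>
        define j where "j = length p - 2"
        have j: "0 < j" "j < length p" "Suc j < length p" "Suc j = length p - 1" using False len by (auto simp: j_def)
        have "head \<Gamma> (p ! j) = head \<Gamma> (p ! 0)" using c(4)[OF j(3)] pl j(4) p0 er(3) by simp
        then have "map (head \<Gamma>) p ! j = map (head \<Gamma>) p ! 0" using j(1,2) len by (subst (1 2) nth_map) auto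
        moreover have "j < length (map (head \<Gamma>) p)" "0 < length (map (head \<Gamma>) p)" using j(2) c(1) by simp_all
        ultimately have "j = 0" using nth_eq_iff_index_eq[OF c(5)] by blast
        then show False using j(1) by simp
      qed
    qed
    have no_r: "erev e \<notin> set p"
    proof
      assume "erev e \<in> set p"
      then obtain i where i: "i < length p" "p ! i = erev e" by (auto simp: in_set_conv_nth)
      show False
      proof (cases i)
        case 0
        then have "head \<Gamma> (last p) = ?w" using c(1,3) i er(2) by (simp add: hd_conv_nth)
        then have "last p = e" using into c(1,2) last_in_set by blast
        then show False using no_e c(1) last_in_set by metis
      next
        case (Suc j)
        then have "head \<Gamma> (p ! j) = ?w" using c(4)[of j] i er(2) by simp
        moreover have "p ! j \<in> set p" using Suc i by simp
        ultimately show False using into[of "p ! j"] c(2) no_e by blast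
      qed
    qed
    have "set p \<subseteq> arcs T" using c(2) no_e no_r sel by auto
    then have "T.cycle p" unfolding T.cycle_iff_nth[OF F(1)] F(2,3) using c by auto
    then have "circuit T erev p" using p(2) unfolding circuit_def by blast
    then show False using F(8) by blast
  qed
qed

text \<open>A simple path back from the head to the tail of \<open>f\<close> that avoids
  \<open>f\<close> and its reverse would close up with \<open>f\<close> to a circuit.\<close>

lemma tree_edge_separates:
  assumes f: "f \<in> arcs T"
  shows "(head \<Gamma> f, tail \<Gamma> f) \<notin> {(tail \<Gamma> a, head \<Gamma> a) | a. a \<in> arcs T - {f, erev f}}\<^sup>*"
proof
  note F = subtree_facts
  interpret T: wf_digraph T by (rule F(1))
  assume path: "(head \<Gamma> f, tail \<Gamma> f) \<in> {(tail \<Gamma> a, head \<Gamma> a) | a. a \<in> arcs T - {f, erev f}}\<^sup>*"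
  define H where "H = \<lparr>verts = verts T, arcs = arcs T - {f, erev f}, tail = tail \<Gamma>, head = head \<Gamma>\<rparr>"
  have sel: "verts H = verts T" "arcs H = arcs T - {f, erev f}" "tail H = tail \<Gamma>" "head H = head \<Gamma>"
    by (simp_all add: H_def)
  have "wf_digraph H"
    by unfold_locales (use T.wellformed F(2,3) sel in auto)
  then interpret H: wf_digraph H .
  have hf: "head \<Gamma> f \<in> verts T" using T.wellformed[OF f] F(3) by auto
  have "head \<Gamma> f \<rightarrow>\<^sup>*\<^bsub>H\<^esub> tail \<Gamma> f"
    using path
  proof (induction rule: rtrancl_induct)
    case base
    show ?case using hf sel by (simp add: H.reachable_refl)
  next
    case (step y z)
    then obtain a where a: "a \<in> arcs H" "y = tail \<Gamma> a" "z = head \<Gamma> a" using sel by auto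
    then have "y \<rightarrow>\<^bsub>H\<^esub> z" unfolding arcs_ends_conv using sel by force
    then show ?case using step.IH H.reachable_adj_trans by blast
  qed
  then obtain q where q: "H.apath (head \<Gamma> f) q (tail \<Gamma> f)" using H.reachable_apath by blast
  then have q: "H.awalk (head \<Gamma> f) q (tail \<Gamma> f)" "distinct (H.awalk_verts (head \<Gamma> f) q)"
    by (auto simp: H.apath_def)
  define p where "p = f # q"
  have qa: "set q \<subseteq> arcs T - {f, erev f}" and cas: "H.cas (head \<Gamma> f) q (tail \<Gamma> f)"
    using q(1) by (auto simp: H.awalk_def sel)
  have vq: "H.awalk_verts (head \<Gamma> f) q = head \<Gamma> f # map (head \<Gamma>) q"
  proof (cases "q = []")
    case False
    then have "H.awalk_verts (head \<Gamma> f) q = tail \<Gamma> (hd q) # map (head \<Gamma>) q"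
      using H.awalk_verts_conv'[OF cas] sel by simp
    moreover have "tail \<Gamma> (hd q) = head \<Gamma> f" using cas False unfolding H.cas_iff_nth sel by simp
    ultimately show ?thesis by simp
  qed simp
  have dist: "distinct (map (head \<Gamma>) p)" using q(2) unfolding vq p_def by simp
  have chain: "head \<Gamma> (p ! i) = tail \<Gamma> (p ! Suc i)" if "Suc i < length p" for i
  proof (cases i)
    case 0
    then show ?thesis using cas that unfolding H.cas_iff_nth sel p_def by (cases q) auto
  next
    case (Suc j)
    then show ?thesis using cas that unfolding H.cas_iff_nth sel p_def by (cases q) auto
  qed
  have lst: "tail \<Gamma> (hd p) = head \<Gamma> (last p)"
    using cas unfolding H.cas_iff_nth sel p_def by (cases "q = []") auto
  have "T.cycle p"
    unfolding T.cycle_iff_nth[OF F(1)] F(2,3)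
    using dist chain lst qa f by (auto simp: p_def)
  moreover have "p ! Suc i \<noteq> erev (p ! i)" if i: "Suc i < length p" for i
  proof
    assume eq: "p ! Suc i = erev (p ! i)"
    have "p ! i \<in> set p" using i by (intro nth_mem) simp
    then have arc: "p ! i \<in> arcs T" using qa f by (auto simp: p_def)
    show False
    proof (cases i)
      case 0
      then have "q ! 0 = erev f" "0 < length q" using eq i by (auto simp: p_def)
      then have "erev f \<in> set q" using nth_mem[of 0 q] by simp
      then show False using qa by blast
    next
      \<comment> \<open>Reversing the arc at position \<open>i\<close> would return to the head of
        the arc before it, against simplicity of the path.\<close>
      case (Suc j)
      have "head \<Gamma> (p ! Suc i) = tail \<Gamma> (p ! i)" using eq F(7)[OF arc] by simp
      also have "\<dots> = head \<Gamma> (p ! j)" using chain[of j] Suc i by simp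
      finally have "map (head \<Gamma>) p ! Suc i = map (head \<Gamma>) p ! j" using i Suc by simp
      then show False using nth_eq_iff_index_eq[OF dist, of "Suc i" j] i Suc by simp
    qed
  qed
  ultimately have "circuit T erev p" unfolding circuit_def by blast
  then show False using F(8) by blast
qed

end

text \<open>If a vertex were missed, connectedness would give an arc that leaves the tree, and
  attaching it as a leaf would contradict maximality.\<close>

lemma maximal_tree_spans:
  assumes "maximal_tree \<Gamma> erev T" shows "verts T = verts \<Gamma>"
proof (rule ccontr)
  have T: "subgraph T \<Gamma>" "serre_tree erev T"
    and max: "\<And>H. H \<noteq> T \<Longrightarrow> subgraph T H \<Longrightarrow> \<not> (subgraph H \<Gamma> \<and> serre_tree erev H)"
    using assms unfolding maximal_tree_def pre_digraph.max_subgraph_def by blast+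
  assume "verts T \<noteq> verts \<Gamma>"
  then obtain v where v: "v \<in> verts \<Gamma>" "v \<notin> verts T" using subtree_facts(5)[OF T] by blast
  obtain u where u: "u \<in> verts T" using subtree_reachable(1)[OF T] by blast
  have symm: "\<exists>a'\<in>arcs \<Gamma>. tail \<Gamma> a' = head \<Gamma> a \<and> head \<Gamma> a' = tail \<Gamma> a" if "a \<in> arcs \<Gamma>" for a
    using that by (intro bexI[of _ "erev a"]) auto
  have "u \<rightarrow>\<^sup>*\<^bsub>\<Gamma>\<^esub> v"
    using connected_graph u v subtree_facts(5)[OF T] connected_iff_reachable[OF wf_digraph_axioms symm] by blast
  then have "v \<notin> verts T \<longrightarrow> (\<exists>e\<in>arcs \<Gamma>. tail \<Gamma> e \<in> verts T \<and> head \<Gamma> e \<notin> verts T)"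
    unfolding reachable_def
  proof (induction rule: rtrancl_on_induct)
    case (step y z)
    then show ?case unfolding arcs_ends_conv by force
  qed (use u in auto)
  then obtain e where "e \<in> arcs \<Gamma>" "tail \<Gamma> e \<in> verts T" "head \<Gamma> e \<notin> verts T" using v by blast
  from leaf_extension[OF T this] max show False by blast
qed

end


section \<open>Presentations and cocycles\<close>

text \<open>Lets \<open>G\<close> be handled through words instead of equivalence classes; a marking
  is an isomorphism composed with the passage to classes.\<close>

lemma presented_group_marking:
  assumes G: "group G" and iso: "G \<cong> presented_group X R"
  obtains \<psi> where "\<And>w. w \<in> words X \<Longrightarrow> \<psi> w \<in> carrier G"
    "\<And>u v. u \<in> words X \<Longrightarrow> v \<in> words X \<Longrightarrow> \<psi> (u @ v) = \<psi> u \<otimes>\<^bsub>G\<^esub> \<psi> v"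
    "\<And>g. g \<in> carrier G \<Longrightarrow> \<exists>w\<in>words X. \<psi> w = g"
    "\<And>u v. u \<in> words X \<Longrightarrow> v \<in> words X \<Longrightarrow> \<psi> u = \<psi> v \<longleftrightarrow> pres_eq X R u v"
proof -
  obtain h where h: "h \<in> iso (presented_group X R) G"
    using group.iso_sym[OF G iso] unfolding is_iso_def by blast
  define cl where "cl w = {u. pres_eq X R w u}" for w
  define \<psi> where "\<psi> w = h (cl w)" for w
  have carr: "carrier (presented_group X R) = cl ` words X"
    unfolding cl_def using presented_group_carrier[of _ X R] by blast
  have bij: "bij_betw h (cl ` words X) (carrier G)" using h by (simp add: iso_def carr)
  show thesis
  proof (rule that[of \<psi>])
    fix u assume u: "u \<in> words X"
    then show "\<psi> u \<in> carrier G" unfolding \<psi>_def using bij_betwE[OF bij] by blast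
    fix v assume v: "v \<in> words X"
    have "cl u \<otimes>\<^bsub>presented_group X R\<^esub> cl v = cl (u @ v)" unfolding cl_def by (rule presented_group_mult[OF u v])
    then show "\<psi> (u @ v) = \<psi> u \<otimes>\<^bsub>G\<^esub> \<psi> v"
      unfolding \<psi>_def using hom_mult[of h "presented_group X R" G "cl u" "cl v"] h u v by (simp add: iso_def carr)
    have "\<psi> u = \<psi> v \<longleftrightarrow> cl u = cl v"
      unfolding \<psi>_def using bij_betw_imp_inj_on[OF bij] u v by (auto simp: inj_on_eq_iff)
    also have "\<dots> \<longleftrightarrow> pres_eq X R u v"
      unfolding cl_def using pres_eq.refl[OF v, of R] pres_eq.sym[of X R] pres_eq.trans[of X R] by blast
    finally show "\<psi> u = \<psi> v \<longleftrightarrow> pres_eq X R u v" .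
  next
    fix g assume "g \<in> carrier G"
    then show "\<exists>w\<in>words X. \<psi> w = g" unfolding \<psi>_def using bij_betw_imp_surj_on[OF bij] by force
  qed
qed

text \<open>Inverse letters act through \<open>inv_into UNIV\<close>, a two-sided inverse as soon as
  the generators act by bijections.\<close>

definition word_action :: "('x \<Rightarrow> 'y \<Rightarrow> 'y) \<Rightarrow> 'x word \<Rightarrow> 'y \<Rightarrow> 'y" where
  "word_action \<beta> w = foldr (\<lambda>(x, b). (\<circ>) (if b then \<beta> x else inv_into UNIV (\<beta> x))) w id"

lemma word_action_simps [simp]:
  "word_action \<beta> [] = id"
  "word_action \<beta> ((x, b) # w) = (if b then \<beta> x else inv_into UNIV (\<beta> x)) \<circ> word_action \<beta> w"
  by (simp_all add: word_action_def)

lemma word_action_append: "word_action \<beta> (u @ v) = word_action \<beta> u \<circ> word_action \<beta> v"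
  by (induction u) (auto simp: comp_assoc)

text \<open>Von Dyck's principle: bijections that satisfy the relators define an action of the
  presented group.\<close>

lemma word_action_pres_eq:
  assumes "pres_eq X R u v" and bij: "\<And>x. x \<in> X \<Longrightarrow> bij (\<beta> x)" and rel: "\<And>r. r \<in> R \<Longrightarrow> r \<in> words X \<Longrightarrow> word_action \<beta> r = id"
  shows "word_action \<beta> u = word_action \<beta> v"
  using assms(1)
proof (induction rule: pres_eq.induct)
  case (cancel u v x b)
  have "\<beta> x \<circ> inv_into UNIV (\<beta> x) = id" "inv_into UNIV (\<beta> x) \<circ> \<beta> x = id"
    using bij[OF cancel(3)] by (simp_all add: bij_is_inj bij_is_surj surj_iff[symmetric])
  then have "word_action \<beta> [(x, b), (x, \<not> b)] = id" by simp
  then show ?case unfolding word_action_append by simp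
next
  case (relator u v r)
  then show ?case using rel by (simp add: word_action_append)
qed simp_all

locale marked_group = group G for G (structure) +
  fixes X :: "'x set" and R :: "'x word set" and \<psi> :: "'x word \<Rightarrow> 'a"
  assumes marking_closed: "w \<in> words X \<Longrightarrow> \<psi> w \<in> carrier G"
    and marking_append: "u \<in> words X \<Longrightarrow> v \<in> words X \<Longrightarrow> \<psi> (u @ v) = \<psi> u \<otimes> \<psi> v"
    and marking_onto: "g \<in> carrier G \<Longrightarrow> \<exists>w\<in>words X. \<psi> w = g"
    and marking_eq: "u \<in> words X \<Longrightarrow> v \<in> words X \<Longrightarrow> \<psi> u = \<psi> v \<longleftrightarrow> pres_eq X R u v"
begin

lemma marking_letter: "x \<in> X \<Longrightarrow> \<psi> [(x, b)] \<in> carrier G"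
  using marking_closed[of "[(x, b)]"] by simp

lemma marking_nil: "\<psi> [] = \<one>"
  using marking_append[of "[]" "[]"] marking_closed[of "[]"] by (simp add: l_cancel_one')

lemma marking_Cons: "x \<in> X \<Longrightarrow> w \<in> words X \<Longrightarrow> \<psi> ((x, b) # w) = \<psi> [(x, b)] \<otimes> \<psi> w"
  using marking_append[of "[(x, b)]" w] by simp

lemma marking_inv: assumes x: "x \<in> X" shows "\<psi> [(x, False)] = inv (\<psi> [(x, True)])"
proof -
  have "\<psi> [(x, False), (x, True)] = \<psi> []"
    using marking_eq[of "[(x, False), (x, True)]" "[]"] pres_eq.cancel[of "[]" X "[]" x R False] x by simp
  then have "\<psi> [(x, False)] \<otimes> \<psi> [(x, True)] = \<one>" using marking_Cons[of x "[(x, True)]" False] x marking_nil by simp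
  then show ?thesis using inv_equality[OF _ marking_letter[OF x] marking_letter[OF x], of False True] by simp
qed

lemma marking_relator: "r \<in> R \<Longrightarrow> r \<in> words X \<Longrightarrow> \<psi> r = \<one>"
  using marking_eq[of r "[]"] pres_eq.relator[of "[]" X "[]" r R] marking_nil by simp

lemma marking_generated:
  assumes H: "subgroup H G" and X: "\<And>x. x \<in> X \<Longrightarrow> \<psi> [(x, True)] \<in> H" shows "H = carrier G"
proof -
  have "\<psi> w \<in> H" if "w \<in> words X" for w
    using that
  proof (induction w)
    case Nil
    show ?case using subgroup.one_closed[OF H] by (simp add: marking_nil)
  next
    case (Cons a w)
    obtain x b where a: "a = (x, b)" by (cases a)
    have x: "x \<in> X" and w: "w \<in> words X" using Cons.prems a by auto
    have "\<psi> [(x, b)] \<in> H"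
    proof (cases b)
      case True
      then show ?thesis using X[OF x] by simp
    next
      case False
      then show ?thesis using subgroup.m_inv_closed[OF H X[OF x]] marking_inv[OF x] by simp
    qed
    then show ?case unfolding a marking_Cons[OF x w] by (rule subgroup.m_closed[OF H _ Cons.IH[OF w]])
  qed
  then show ?thesis using marking_onto subgroup.subset[OF H] by blast
qed

end

section \<open>Affine cocycles over a permutation of the coordinates\<close>

locale index_action = group G for G (structure) +
  fixes \<pi> :: "'a \<Rightarrow> 'i \<Rightarrow> 'i"
  assumes \<pi>_one: "\<pi> \<one> i = i"
    and \<pi>_mult: "g \<in> carrier G \<Longrightarrow> h \<in> carrier G \<Longrightarrow> \<pi> (g \<otimes> h) i = \<pi> g (\<pi> h i)"
begin

definition permute :: "'a \<Rightarrow> 'i fsupp \<Rightarrow> 'i fsupp" where "permute g = reindex (\<pi> (inv g))"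

lemma \<pi>_inv: "g \<in> carrier G \<Longrightarrow> \<pi> (inv g) (\<pi> g i) = i" "g \<in> carrier G \<Longrightarrow> \<pi> g (\<pi> (inv g) i) = i"
  using \<pi>_mult[of "inv g" g i] \<pi>_mult[of g "inv g" i] \<pi>_one by simp_all

lemma coord_permute: "g \<in> carrier G \<Longrightarrow> coord (permute g x) i = coord x (\<pi> (inv g) i)"
  unfolding permute_def
  by (rule coord_reindex, rule bij_betw_byWitness[of _ "\<pi> g"]) (simp_all add: \<pi>_inv)

lemma permute_one: "permute \<one> x = x"
  by (rule fsupp_eqI) (simp add: coord_permute \<pi>_one)

lemma permute_mult: "g \<in> carrier G \<Longrightarrow> h \<in> carrier G \<Longrightarrow> permute (g \<otimes> h) x = permute g (permute h x)"
  by (rule fsupp_eqI) (simp add: coord_permute inv_mult_group \<pi>_mult)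

lemma permute_add: "g \<in> carrier G \<Longrightarrow> permute g (x + y) = permute g x + permute g y"
  and permute_diff: "g \<in> carrier G \<Longrightarrow> permute g (x - y) = permute g x - permute g y"
  and permute_zero: "g \<in> carrier G \<Longrightarrow> permute g 0 = 0"
  by (rule fsupp_eqI; simp add: coord_permute)+

lemma permute_inv: "g \<in> carrier G \<Longrightarrow> permute (inv g) (permute g x) = x" "g \<in> carrier G \<Longrightarrow> permute g (permute (inv g) x) = x"
  by (simp_all add: permute_mult[symmetric] permute_one)

lemma permute_unit: "g \<in> carrier G \<Longrightarrow> permute g (unit i) = unit (\<pi> g i)"
  by (rule fsupp_eqI) (auto simp: coord_permute coord_unit \<pi>_inv)

lemma bij_affine: assumes g: "g \<in> carrier G" shows "bij (\<lambda>y. permute g y + c)"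
  by (rule bij_betw_byWitness[of _ "\<lambda>z. permute (inv g) (z - c)"]) (simp_all add: permute_inv g)

text \<open>The affine maps attached to the generators satisfy the relators, so they extend to an
  affine action of \<open>G\<close>, and its translation part is the cocycle. \<open>Q\<close> is an
  invariant additive group of vectors; it transfers integrality and support conditions from the
  generators to all of \<open>G\<close>.\<close>

lemma cocycle_from_presentation:
  assumes "marked_group G X R \<psi>"
    and rel: "\<And>r. r \<in> R \<Longrightarrow> r \<in> words X \<Longrightarrow> word_action (\<lambda>x y. permute (\<psi> [(x, True)]) y + c x) r = id"
    and Q: "0 \<in> Q" "\<And>x y. x \<in> Q \<Longrightarrow> y \<in> Q \<Longrightarrow> x + y \<in> Q" "\<And>x. x \<in> Q \<Longrightarrow> - x \<in> Q"
      "\<And>g x. g \<in> carrier G \<Longrightarrow> x \<in> Q \<Longrightarrow> permute g x \<in> Q" "\<And>x. x \<in> X \<Longrightarrow> c x \<in> Q"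
  obtains \<delta> where "\<And>g h. g \<in> carrier G \<Longrightarrow> h \<in> carrier G \<Longrightarrow> \<delta> (g \<otimes> h) = permute g (\<delta> h) + \<delta> g"
    "\<And>x. x \<in> X \<Longrightarrow> \<delta> (\<psi> [(x, True)]) = c x" "\<And>g. g \<in> carrier G \<Longrightarrow> \<delta> g \<in> Q"
proof -
  interpret marked_group G X R \<psi> by fact
  define \<beta> where "\<beta> x y = permute (\<psi> [(x, True)]) y + c x" for x y
  define ev where "ev = word_action \<beta>"
  \<comment> \<open>The translation part is the image of the origin; \<open>\<delta>_ev\<close>
    shows that the chosen word does not matter.\<close>
  define \<delta> where "\<delta> g = ev (SOME w. w \<in> words X \<and> \<psi> w = g) 0" for g
  note \<psi>x = marking_letter
  have \<beta>_inv: "inv_into UNIV (\<beta> x) y = permute (\<psi> [(x, False)]) (y - c x)" and \<beta>_bij: "bij (\<beta> x)" if x: "x \<in> X" for x y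
  proof -
    have 1: "permute (\<psi> [(x, False)]) (\<beta> x z - c x) = z" and 2: "\<beta> x (permute (\<psi> [(x, False)]) (z - c x)) = z" for z
      by (simp_all add: \<beta>_def marking_inv[OF x] permute_inv \<psi>x[OF x])
    show b: "bij (\<beta> x)" by (rule bij_betw_byWitness[of _ "\<lambda>z. permute (\<psi> [(x, False)]) (z - c x)"]) (simp_all add: 1 2)
    show "inv_into UNIV (\<beta> x) y = permute (\<psi> [(x, False)]) (y - c x)"
      by (rule inv_f_eq[OF bij_is_inj[OF b] 2])
  qed
  have ev_affine: "ev w y = permute (\<psi> w) y + ev w 0 \<and> ev w 0 \<in> Q" if "w \<in> words X" for w y
    using that
  proof (induction w arbitrary: y)
    case Nil
    show ?case by (simp add: ev_def marking_nil permute_one Q)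
  next
    case (Cons a w)
    obtain x b where a: "a = (x, b)" by (cases a)
    have x: "x \<in> X" and w: "w \<in> words X" using Cons.prems a by auto
    have \<psi>w: "\<psi> (a # w) = \<psi> [(x, b)] \<otimes> \<psi> w" unfolding a by (rule marking_Cons[OF x w])
    define s where "s = (if b then c x else - permute (\<psi> [(x, False)]) (c x))"
    have step: "ev (a # w) z = permute (\<psi> [(x, b)]) (ev w z) + s" for z
      using \<beta>_inv[OF x] \<psi>x[OF x] by (simp add: a ev_def s_def \<beta>_def permute_diff)
    have sQ: "s \<in> Q" using Q x \<psi>x[OF x] by (simp add: s_def)
    have IH: "ev w y = permute (\<psi> w) y + ev w 0" and Qw: "ev w 0 \<in> Q" using Cons.IH[OF w] by blast+
    have "ev (a # w) y = permute (\<psi> [(x, b)]) (permute (\<psi> w) y + ev w 0) + s" unfolding step IH ..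
    also have "\<dots> = permute (\<psi> (a # w)) y + ev (a # w) 0"
      unfolding step[of 0] \<psi>w permute_mult[OF \<psi>x[OF x] marking_closed[OF w]] permute_add[OF \<psi>x[OF x]] by (rule add.assoc)
    finally have "ev (a # w) y = permute (\<psi> (a # w)) y + ev (a # w) 0" .
    moreover have "ev (a # w) 0 \<in> Q" unfolding step by (rule Q(2)[OF Q(4)[OF \<psi>x[OF x] Qw] sQ])
    ultimately show ?case ..
  qed
  have \<delta>_ev: "\<delta> (\<psi> w) = ev w 0" if w: "w \<in> words X" for w
  proof -
    define u where "u = (SOME u. u \<in> words X \<and> \<psi> u = \<psi> w)"
    have u: "u \<in> words X \<and> \<psi> u = \<psi> w" unfolding u_def by (rule someI[of _ w]) (simp add: w)
    then have "pres_eq X R u w" using marking_eq[of u w] w by simp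
    then have "ev u = ev w" unfolding ev_def
      by (rule word_action_pres_eq) (use \<beta>_bij rel in \<open>auto simp: \<beta>_def[abs_def]\<close>)
    then show ?thesis by (simp add: \<delta>_def u_def)
  qed
  show thesis
  proof (rule that[of \<delta>])
    fix g h assume "g \<in> carrier G" "h \<in> carrier G"
    then obtain u v where uv: "u \<in> words X" "\<psi> u = g" "v \<in> words X" "\<psi> v = h" using marking_onto by blast
    have "\<delta> (g \<otimes> h) = ev (u @ v) 0" using \<delta>_ev[of "u @ v"] marking_append uv by simp
    also have "\<dots> = ev u (ev v 0)" by (simp add: ev_def word_action_append)
    also have "\<dots> = permute (\<psi> u) (ev v 0) + ev u 0" using ev_affine[OF uv(1)] by blast
    finally show "\<delta> (g \<otimes> h) = permute g (\<delta> h) + \<delta> g" using \<delta>_ev[OF uv(1)] \<delta>_ev[OF uv(3)] uv by simp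
  next
    fix x assume x: "x \<in> X"
    show "\<delta> (\<psi> [(x, True)]) = c x"
      using \<delta>_ev[of "[(x, True)]"] x \<psi>x[OF x] by (simp add: ev_def \<beta>_def permute_zero)
  next
    fix g assume "g \<in> carrier G"
    then obtain w where w: "w \<in> words X" "\<psi> w = g" using marking_onto by blast
    have "ev w 0 \<in> Q" using ev_affine[OF w(1)] by blast
    then show "\<delta> g \<in> Q" using \<delta>_ev[OF w(1)] w(2) by simp
  qed
qed

end


section \<open>Permuting cosets\<close>

text \<open>
  \<open>EdgeI\<close> and \<open>VertI\<close> carry left cosets of edge and vertex groups, permuted by left translation. \<open>CharI \<kappa>\<close>
  carries right cosets of the domain of the character \<open>\<kappa>\<close>, on which \<open>g\<close> acts through right
  multiplication by \<open>g\<inverse>\<close>; these are the coordinates of the induced representation.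
\<close>

datatype ('a, 'v, 'e) index = EdgeI 'e "'a set" | VertI 'v "'a set" | CharI "'a set \<times> ('a \<Rightarrow> int)" "'a set"

context group
begin

text \<open>The guard makes this an action on all sets, as the index type also contains sets outside
  the carrier, where the multiplication obeys no laws.\<close>

definition translate :: "'a \<Rightarrow> 'a set \<Rightarrow> 'a set" where
  "translate g C = (if C \<subseteq> carrier G then g <# C else C)"

definition translate_right :: "'a \<Rightarrow> 'a set \<Rightarrow> 'a set" where
  "translate_right g C = (if C \<subseteq> carrier G then C #> inv g else C)"

lemma translate_one: "translate \<one> C = C" "translate_right \<one> C = C"
  by (simp_all add: translate_def translate_right_def lcos_mult_one)

lemma translate_mult:
  assumes "g \<in> carrier G" "h \<in> carrier G"
  shows "translate (g \<otimes> h) C = translate g (translate h C)"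
    "translate_right (g \<otimes> h) C = translate_right g (translate_right h C)"
  using assms
  by (simp_all add: translate_def translate_right_def lcos_m_assoc l_coset_subset_G r_coset_subset_G
      coset_mult_assoc inv_mult_group)

primrec index_perm :: "'a \<Rightarrow> ('a, 'v, 'e) index \<Rightarrow> ('a, 'v, 'e) index" where
  "index_perm g (EdgeI e C) = EdgeI e (translate g C)"
| "index_perm g (VertI v C) = VertI v (translate g C)"
| "index_perm g (CharI \<kappa> C) = CharI \<kappa> (translate_right g C)"

sublocale index_action G "index_perm :: 'a \<Rightarrow> ('a, 'v, 'e) index \<Rightarrow> ('a, 'v, 'e) index"
proof
  show "index_perm \<one> i = i" for i :: "('a, 'v, 'e) index" by (cases i) (simp_all add: translate_one)
  show "index_perm (g \<otimes> h) i = index_perm g (index_perm h i)" if "g \<in> carrier G" "h \<in> carrier G"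
    for g h and i :: "('a, 'v, 'e) index"
    using that by (cases i) (simp_all add: translate_mult)
qed

lemma l_coset_absorb: assumes H: "subgroup H G" and g: "g \<in> carrier G" shows "g <# H = H \<longleftrightarrow> g \<in> H"
proof
  assume "g <# H = H"
  moreover have "g \<otimes> \<one> \<in> g <# H" unfolding l_coset_def using subgroup.one_closed[OF H] by blast
  ultimately show "g \<in> H" using g by simp
next
  assume gH: "g \<in> H"
  show "g <# H = H"
  proof
    show "g <# H \<subseteq> H" unfolding l_coset_def using subgroup.m_closed[OF H gH] by blast
    show "H \<subseteq> g <# H"
    proof
      fix x assume x: "x \<in> H"
      have "x = g \<otimes> (inv g \<otimes> x)" using g subgroup.mem_carrier[OF H x] by (simp add: m_assoc[symmetric])
      moreover have "inv g \<otimes> x \<in> H" by (rule subgroup.m_closed[OF H subgroup.m_inv_closed[OF H gH] x])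
      ultimately show "x \<in> g <# H" unfolding l_coset_def by blast
    qed
  qed
qed

lemma translate_stabilizer:
  assumes H: "subgroup H G" and g: "g \<in> carrier G"
  shows "translate g H = H \<longleftrightarrow> g \<in> H" "translate_right g H = H \<longleftrightarrow> g \<in> H"
proof -
  show "translate g H = H \<longleftrightarrow> g \<in> H" using l_coset_absorb[OF H g] subgroup.subset[OF H] by (simp add: translate_def)
  have "H #> inv g = H \<longleftrightarrow> g \<in> H"
  proof
    assume "H #> inv g = H"
    then have "inv g \<in> H" using rcos_self[OF inv_closed[OF g] H] by simp
    then show "g \<in> H" using subgroup.m_inv_closed[OF H, of "inv g"] g by simp
  next
    assume "g \<in> H"
    then show "H #> inv g = H" by (rule coset_join2[OF inv_closed[OF g] H subgroup.m_inv_closed[OF H]])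
  qed
  then show "translate_right g H = H \<longleftrightarrow> g \<in> H" using subgroup.subset[OF H] by (simp add: translate_right_def)
qed

text \<open>The cocycle of the representation induced from the domain of \<kappa>, in the manner of
  Shapiro's lemma: \<open>g\<close> carries the representative of \<open>C\<close> to that of
  \<open>C #> g\<close> up to an element of the domain, and \<kappa> is evaluated on that
  element.\<close>

definition char_value :: "'a set \<times> ('a \<Rightarrow> int) \<Rightarrow> 'a \<Rightarrow> 'a set \<Rightarrow> int" where
  "char_value \<kappa> g C = snd \<kappa> ((SOME x. x \<in> C) \<otimes> g \<otimes> inv (SOME x. x \<in> C #> g))"

lemma rcoset_rep:
  assumes H: "subgroup H G" and C: "C \<in> rcosets H"
  shows "(SOME x. x \<in> C) \<in> carrier G" "C = H #> (SOME x. x \<in> C)"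
proof -
  obtain a where a: "a \<in> carrier G" "C = H #> a" using C unfolding RCOSETS_def by blast
  have "a \<in> C" unfolding a(2) by (rule rcos_self[OF a(1) H])
  then have x: "(SOME x. x \<in> C) \<in> C" by (rule someI)
  then show "(SOME x. x \<in> C) \<in> carrier G" using r_coset_subset_G[OF subgroup.subset[OF H] a(1)] a(2) by blast
  show "C = H #> (SOME x. x \<in> C)" using repr_independence[OF _ a(1) H, of "SOME x. x \<in> C"] x a(2) by blast
qed

lemma rcosets_translate:
  assumes H: "subgroup H G" and C: "C \<in> rcosets H" and g: "g \<in> carrier G" shows "C #> g \<in> rcosets H"
proof -
  obtain a where a: "a \<in> carrier G" "C = H #> a" using C unfolding RCOSETS_def by blast
  have "C #> g = H #> (a \<otimes> g)" unfolding a(2) by (rule coset_mult_assoc[OF subgroup.subset[OF H] a(1) g])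
  then show ?thesis using a(1) g unfolding RCOSETS_def by blast
qed

lemma rcosets_subset: "subgroup H G \<Longrightarrow> C \<in> rcosets H \<Longrightarrow> C \<subseteq> carrier G"
  unfolding RCOSETS_def using r_coset_subset_G[OF subgroup.subset] by blast

lemma rcosets_translate_right:
  assumes H: "subgroup H G" and g: "g \<in> carrier G" shows "translate_right g C \<in> rcosets H \<longleftrightarrow> C \<in> rcosets H"
proof -
  have *: "translate_right h D \<in> rcosets H" if "h \<in> carrier G" "D \<in> rcosets H" for h D
    using rcosets_translate[OF H that(2) inv_closed[OF that(1)]] rcosets_subset[OF H that(2)]
    by (simp add: translate_right_def)
  have "translate_right (inv g) (translate_right g C) = C"
    using translate_mult(2)[OF inv_closed[OF g] g, of C] g by (simp add: translate_one)
  then show ?thesis using *[OF g, of C] *[OF inv_closed[OF g], of "translate_right g C"] by auto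
qed

lemma char_value_mem:
  assumes H: "subgroup H G" and C: "C \<in> rcosets H" and g: "g \<in> carrier G"
  shows "(SOME x. x \<in> C) \<otimes> g \<otimes> inv (SOME x. x \<in> C #> g) \<in> H"
proof -
  let ?x = "SOME x. x \<in> C" and ?y = "SOME x. x \<in> C #> g"
  have x: "?x \<in> carrier G" "C = H #> ?x" using rcoset_rep[OF H C] by blast+
  have y: "?y \<in> carrier G" "C #> g = H #> ?y" using rcoset_rep[OF H rcosets_translate[OF H C g]] by blast+
  have "H #> (?x \<otimes> g) = C #> g"
    using coset_mult_assoc[OF subgroup.subset[OF H] x(1) g] x(2) by simp
  then have "?x \<otimes> g \<in> H #> ?y" using rcos_self[of "?x \<otimes> g" H] x(1) g H y(2) by simp
  then obtain h where h: "h \<in> H" "?x \<otimes> g = h \<otimes> ?y" unfolding r_coset_def by blast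
  have "?x \<otimes> g \<otimes> inv ?y = h" unfolding h(2) using y(1) subgroup.mem_carrier[OF H h(1)] by (simp add: m_assoc)
  then show ?thesis using h(1) by simp
qed

lemma char_value_mult:
  assumes \<kappa>: "virtual_character G \<kappa>" and C: "C \<in> rcosets (fst \<kappa>)" and g: "g \<in> carrier G" and h: "h \<in> carrier G"
  shows "char_value \<kappa> (g \<otimes> h) C = char_value \<kappa> g C + char_value \<kappa> h (C #> g)"
proof -
  note H = virtual_character_subgroup[OF \<kappa>]
  note D = rcosets_translate[OF H C g]
  define x y z where "x = (SOME x. x \<in> C)" and "y = (SOME x. x \<in> C #> g)" and "z = (SOME x. x \<in> C #> g #> h)"
  have xyz: "x \<in> carrier G" "y \<in> carrier G" "z \<in> carrier G"
    unfolding x_def y_def z_def using rcoset_rep(1)[OF H] C D rcosets_translate[OF H D h] by blast+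
  have gh: "C #> (g \<otimes> h) = C #> g #> h" by (rule coset_mult_assoc[OF rcosets_subset[OF H C] g h, symmetric])
  have "snd \<kappa> ((x \<otimes> g \<otimes> inv y) \<otimes> (y \<otimes> h \<otimes> inv z)) = snd \<kappa> (x \<otimes> g \<otimes> inv y) + snd \<kappa> (y \<otimes> h \<otimes> inv z)"
    unfolding x_def y_def z_def by (rule virtual_character_add[OF \<kappa> char_value_mem[OF H C g] char_value_mem[OF H D h]])
  \<comment> \<open>The intermediate representative \<open>y\<close> telescopes.\<close>
  moreover have "(x \<otimes> g \<otimes> inv y) \<otimes> (y \<otimes> h \<otimes> inv z) = x \<otimes> (g \<otimes> h) \<otimes> inv z"
  proof -
    have "inv y \<otimes> (y \<otimes> h \<otimes> inv z) = h \<otimes> inv z" using xyz g h by (simp add: m_assoc[symmetric])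
    then show ?thesis using xyz g h by (simp add: m_assoc)
  qed
  ultimately show ?thesis unfolding char_value_def gh x_def[symmetric] y_def[symmetric] z_def[symmetric] by simp
qed

text \<open>The chosen representative of the trivial coset conjugates \<open>g\<close>, which does
  not change the value of a homomorphism to an abelian group.\<close>

lemma char_value_self:
  assumes \<kappa>: "virtual_character G \<kappa>" and g: "g \<in> fst \<kappa>" shows "char_value \<kappa> g (fst \<kappa>) = snd \<kappa> g"
proof -
  note H = virtual_character_subgroup[OF \<kappa>]
  note gG = subgroup.mem_carrier[OF H g]
  have "fst \<kappa> #> g = fst \<kappa>" by (rule coset_join2[OF gG H g])
  define x where "x = (SOME x. x \<in> fst \<kappa>)"
  have x: "x \<in> fst \<kappa>" unfolding x_def by (rule someI[of _ g], rule g)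
  have "snd \<kappa> (x \<otimes> g \<otimes> inv x) = snd \<kappa> (x \<otimes> g) + snd \<kappa> (inv x)"
    by (rule virtual_character_add[OF \<kappa> subgroup.m_closed[OF H x g] subgroup.m_inv_closed[OF H x]])
  also have "\<dots> = snd \<kappa> g" using virtual_character_add[OF \<kappa> x g] virtual_character_inv[OF \<kappa> x] by simp
  finally show ?thesis unfolding char_value_def \<open>fst \<kappa> #> g = fst \<kappa>\<close> x_def .
qed

definition char_indices :: "('a set \<times> ('a \<Rightarrow> int)) set \<Rightarrow> ('a, 'v, 'e) index set" where
  "char_indices \<Phi> = (\<Union>\<kappa>\<in>\<Phi>. CharI \<kappa> ` (rcosets (fst \<kappa>)))"

lemma char_indices_iff [simp]:
  "EdgeI e C \<notin> char_indices \<Phi>" "VertI v C \<notin> char_indices \<Phi>"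
  "CharI \<kappa> C \<in> char_indices \<Phi> \<longleftrightarrow> \<kappa> \<in> \<Phi> \<and> C \<in> rcosets (fst \<kappa>)"
  by (auto simp: char_indices_def)

definition char_vec :: "('a set \<times> ('a \<Rightarrow> int)) set \<Rightarrow> 'a \<Rightarrow> ('a, 'v, 'e) index fsupp" where
  "char_vec \<Phi> g = Abs_fsupp (\<lambda>i. if i \<in> char_indices \<Phi> then
     (case i of CharI \<kappa> C \<Rightarrow> of_int (char_value \<kappa> g C) | _ \<Rightarrow> 0) else 0)"

context
  fixes \<Phi> assumes \<Phi>: "finite \<Phi>" "\<And>\<kappa>. \<kappa> \<in> \<Phi> \<Longrightarrow> virtual_character G \<kappa>"
begin

lemma finite_char_indices: "finite (char_indices \<Phi>)"
  unfolding char_indices_def using \<Phi> by (auto simp: virtual_character_def finite_index_def)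

lemma coord_char_vec: "coord (char_vec \<Phi> g) i = (if i \<in> char_indices \<Phi> then
    (case i of CharI \<kappa> C \<Rightarrow> of_int (char_value \<kappa> g C) | _ \<Rightarrow> 0) else 0)"
  unfolding char_vec_def by (subst coord_Abs) (auto intro: finite_subset[OF _ finite_char_indices])

lemma index_perm_char_indices: "g \<in> carrier G \<Longrightarrow> index_perm g i \<in> char_indices \<Phi> \<longleftrightarrow> i \<in> char_indices \<Phi>"
  using rcosets_translate_right[OF virtual_character_subgroup[OF \<Phi>(2)]] by (cases i) auto

lemma coord_char_vec_int: "coord (char_vec \<Phi> g) i \<in> \<int>"
  by (cases i) (simp_all add: coord_char_vec)

lemma char_vec_mult:
  assumes g: "g \<in> carrier G" and h: "h \<in> carrier G"
  shows "char_vec \<Phi> (g \<otimes> h) = permute g (char_vec \<Phi> h) + (char_vec \<Phi> g :: ('a, 'v, 'e) index fsupp)"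
proof (rule fsupp_eqI)
  fix i :: "('a, 'v, 'e) index"
  have iff: "index_perm (inv g) i \<in> char_indices \<Phi> \<longleftrightarrow> i \<in> char_indices \<Phi>"
    by (rule index_perm_char_indices[OF inv_closed[OF g]])
  show "coord (char_vec \<Phi> (g \<otimes> h)) i = coord (permute g (char_vec \<Phi> h) + char_vec \<Phi> g) i"
  proof (cases "i \<in> char_indices \<Phi>")
    case True
    then obtain \<kappa> C where i: "i = CharI \<kappa> C" and C: "\<kappa> \<in> \<Phi>" "C \<in> rcosets (fst \<kappa>)" by (cases i) auto
    note H = virtual_character_subgroup[OF \<Phi>(2)[OF C(1)]]
    have "translate_right (inv g) C = C #> g" using rcosets_subset[OF H C(2)] g by (simp add: translate_right_def)
    then show ?thesis
      using iff True char_value_mult[OF \<Phi>(2)[OF C(1)] C(2) g h] g by (simp add: coord_permute coord_char_vec i)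
  next
    case False
    then show ?thesis using iff g by (simp add: coord_permute coord_char_vec)
  qed
qed

text \<open>Evaluate at the trivial coset: fixing it means lying in the domain of \<kappa>, and the
  coordinate there is the value of \<kappa>.\<close>

lemma char_vec_kernel:
  assumes g: "g \<in> carrier G"
    and fixed: "\<And>j :: ('a, 'v, 'e) index. j \<in> char_indices \<Phi> \<Longrightarrow> index_perm g j = j \<and> coord (char_vec \<Phi> g) j = 0"
    and \<kappa>: "\<kappa> \<in> \<Phi>"
  shows "g \<in> fst \<kappa> \<and> snd \<kappa> g = 0"
proof -
  note H = virtual_character_subgroup[OF \<Phi>(2)[OF \<kappa>]]
  have "fst \<kappa> #> \<one> = fst \<kappa>" by (rule coset_mult_one[OF subgroup.subset[OF H]])
  then have "fst \<kappa> \<in> rcosets (fst \<kappa>)" unfolding RCOSETS_def by blast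
  then have j: "(CharI \<kappa> (fst \<kappa>) :: ('a, 'v, 'e) index) \<in> char_indices \<Phi>" using \<kappa> by simp
  have "translate_right g (fst \<kappa>) = fst \<kappa>" using fixed[OF j] by simp
  then have gk: "g \<in> fst \<kappa>" using translate_stabilizer(2)[OF H g] by simp
  have "char_value \<kappa> g (fst \<kappa>) = 0" using fixed[OF j] j by (simp add: coord_char_vec)
  then show ?thesis using gk char_value_self[OF \<Phi>(2)[OF \<kappa>] gk] by simp
qed

end

end


section \<open>Fundamental groups of graphs of groups\<close>

lemma (in tree_splitting) coord_zero_X:
  assumes i: "\<And>v g. v \<in> V \<Longrightarrow> g \<in> carrier G \<Longrightarrow> coord (act g (pos v)) i = 0" and x: "x \<in> X"
  shows "coord x i = 0"
proof -
  have hull: "x \<in> chull S \<Longrightarrow> S \<subseteq> {y. coord y i = 0} \<Longrightarrow> coord x i = 0" for S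
  proof -
    assume S: "x \<in> chull S" "S \<subseteq> {y. coord y i = 0}"
    have "closed {y :: 'i fsupp. coord y i = 0}" by (rule closed_coordinate_condition)
    then have "x \<in> {y. coord y i = 0}" by (rule chull_into[OF S(1) _ convex_coord_eq S(2)])
    then show "coord x i = 0" by simp
  qed
  from x obtain P where P: "P \<in> vpieces \<union> spieces" "x \<in> P" by (rule UnionE)
  from P(1) show ?thesis
  proof (cases rule: piece_cases)
    case (vertex g v)
    show ?thesis
    proof (rule hull)
      show "x \<in> chull ((\<lambda>p. act (g \<otimes> p) (pos v)) ` Pv v)" using P(2) unfolding vertex(3) vpiece_def .
      show "(\<lambda>p. act (g \<otimes> p) (pos v)) ` Pv v \<subseteq> {y. coord y i = 0}"
        using i[OF vertex(2) m_closed[OF vertex(1) PvG[OF vertex(2)]]] by (intro image_subsetI CollectI)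
    qed
  next
    case (strip g e)
    show ?thesis
    proof (rule hull)
      show "x \<in> chull ((\<lambda>p. act (g \<otimes> p) (pos (src e))) ` Pe e \<union> (\<lambda>p. act (g \<otimes> p \<otimes> t e) (pos (tgt e))) ` Pe e)"
        using P(2) unfolding strip(3) spiece_def .
      show "(\<lambda>p. act (g \<otimes> p) (pos (src e))) ` Pe e \<union> (\<lambda>p. act (g \<otimes> p \<otimes> t e) (pos (tgt e))) ` Pe e \<subseteq> {y. coord y i = 0}"
        using i[OF E(2)[OF strip(2)] m_closed[OF strip(1) PeG[OF strip(2)]]]
          i[OF E(3)[OF strip(2)] m_closed[OF m_closed[OF strip(1) PeG[OF strip(2)]] t[OF strip(2)]]]
        by (intro Un_least image_subsetI CollectI)
    qed
  qed
qed

text \<open>Only countably many coordinates occur in the pieces, and reading them off embeds the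
  space into the real sequences.\<close>

lemma (in tree_splitting) inj_on_sequences:
  assumes I: "countable I" and off: "\<And>v g i. v \<in> V \<Longrightarrow> g \<in> carrier G \<Longrightarrow> i \<notin> I \<Longrightarrow> coord (act g (pos v)) i = 0"
  shows "inj_on (\<lambda>x n. coord x (from_nat_into I n)) X"
proof (rule inj_onI, rule fsupp_eqI)
  fix x y i assume xy: "x \<in> X" "y \<in> X" and eq: "(\<lambda>n. coord x (from_nat_into I n)) = (\<lambda>n. coord y (from_nat_into I n))"
  show "coord x i = coord y i"
  proof (cases "i \<in> I")
    case True
    then obtain n where "i = from_nat_into I n" using from_nat_into_surj[OF I] by metis
    then show ?thesis using fun_cong[OF eq, of n] by simp
  next
    case False
    then show ?thesis using coord_zero_X[OF off xy(1)] coord_zero_X[OF off xy(2)] by simp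
  qed
qed

lemma (in group) countable_generate:
  assumes S: "countable S" "S \<subseteq> carrier G" shows "countable (generate G S)"
proof -
  let ?L = "lists (S \<union> m_inv G ` S)" let ?f = "\<lambda>w. foldr (\<otimes>) w \<one>"
  have L: "S \<union> m_inv G ` S \<subseteq> carrier G" using S by auto
  have closed: "?f w \<in> carrier G" if "w \<in> ?L" for w using that by (induction w) (use L in auto)
  have app: "?f (u @ w) = ?f u \<otimes> ?f w" if "u \<in> ?L" "w \<in> ?L" for u w
    using that(1)
  proof (induction u rule: list.induct)
    case Nil
    show ?case using closed[OF that(2)] by simp
  next
    case (Cons a u)
    then have a: "a \<in> carrier G" and u: "u \<in> ?L" using L by auto
    have "?f ((a # u) @ w) = a \<otimes> (?f u \<otimes> ?f w)" using Cons.IH[OF u] by (simp only: append_Cons foldr.simps comp_apply)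
    also have "\<dots> = ?f (a # u) \<otimes> ?f w" using m_assoc[OF a closed[OF u] closed[OF that(2)]] by (simp only: foldr.simps comp_apply)
    finally show ?case .
  qed
  have "g \<in> ?f ` ?L" if "g \<in> generate G S" for g
    using that
  proof (induction rule: generate.induct)
    case one
    show ?case by (rule image_eqI[of _ _ "[]"]) auto
  next
    case (incl h)
    then show ?case using S by (intro image_eqI[of _ _ "[h]"]) auto
  next
    case (inv h)
    then show ?case using S by (intro image_eqI[of _ _ "[inv h]"]) auto
  next
    case (eng h1 h2)
    then obtain u w where "u \<in> ?L" "h1 = ?f u" "w \<in> ?L" "h2 = ?f w" by blast
    then show ?case using app[of u w] by (intro image_eqI[of _ _ "u @ w"]) (simp_all del: foldr_append)
  qed
  then have "generate G S \<subseteq> ?f ` ?L" by blast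
  moreover have "countable (?f ` ?L)" using S(1) by (intro countable_image countable_lists countable_Un)
  ultimately show ?thesis by (rule countable_subset)
qed

locale marked_graph_of_groups = marked_group G "gog_generators \<Gamma> Gv Ep" "gog_relators \<Gamma> erev Gv Ge \<alpha> T Ep" \<psi> +
    finite_graph_of_groups \<Gamma> erev Gv Ge \<alpha>
  for G :: "('a, 'm) monoid_scheme" (structure) and \<Gamma> :: "('v, 'e) pre_digraph" and erev and Gv :: "'v \<Rightarrow> 'c monoid"
    and Ge :: "'e \<Rightarrow> 'd monoid" and \<alpha> T Ep \<psi> +
  assumes max_tree: "maximal_tree \<Gamma> erev T" and oriented: "orientation \<Gamma> erev Ep"
begin

definition vertex_emb :: "'v \<Rightarrow> 'c \<Rightarrow> 'a" where "vertex_emb v c = \<psi> [(VGen v c, True)]"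
definition stable :: "'e \<Rightarrow> 'a" where "stable e = \<psi> [(EGen e, True)]"
text \<open>Vertex and edge groups enter through their images in \<open>G\<close>; the conditions on
  the vertex groups pass to these images.\<close>

definition vgroup :: "'v \<Rightarrow> 'a set" where "vgroup v = vertex_emb v ` carrier (Gv v)"
definition egroup :: "'e \<Rightarrow> 'a set" where
  "egroup e = (\<lambda>a. vertex_emb (tail \<Gamma> e) (\<alpha> e a)) ` carrier (Ge e)"

lemma generators [simp]:
  "VGen v c \<in> gog_generators \<Gamma> Gv Ep \<longleftrightarrow> v \<in> verts \<Gamma> \<and> c \<in> carrier (Gv v)"
  "EGen e \<in> gog_generators \<Gamma> Gv Ep \<longleftrightarrow> e \<in> Ep"
  by (auto simp: gog_generators_def)

lemma Ep_arcs: "Ep \<subseteq> arcs \<Gamma>" and Ep_rev: "e \<in> Ep \<Longrightarrow> erev e \<notin> Ep"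
  using oriented unfolding orientation_def by blast+

lemma arc_ends: "e \<in> arcs \<Gamma> \<Longrightarrow> erev e \<in> arcs \<Gamma> \<and> tail \<Gamma> (erev e) = head \<Gamma> e \<and> head \<Gamma> (erev e) = tail \<Gamma> e"
  by simp

lemma edge_hom: assumes e: "e \<in> arcs \<Gamma>"
  shows "\<alpha> e \<in> hom (Ge e) (Gv (tail \<Gamma> e))" "\<alpha> (erev e) \<in> hom (Ge e) (Gv (head \<Gamma> e))"
proof -
  show "\<alpha> e \<in> hom (Ge e) (Gv (tail \<Gamma> e))" using edge_mono[OF e] by (simp add: mon_def)
  show "\<alpha> (erev e) \<in> hom (Ge e) (Gv (head \<Gamma> e))"
    using edge_mono[of "erev e"] arc_ends[OF e] edge_group_rev[OF e] by (simp add: mon_def)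
qed

lemma edge_closed: assumes "e \<in> arcs \<Gamma>" "a \<in> carrier (Ge e)"
  shows "\<alpha> e a \<in> carrier (Gv (tail \<Gamma> e))" "\<alpha> (erev e) a \<in> carrier (Gv (head \<Gamma> e))"
  using edge_hom[OF assms(1)] assms(2) hom_in_carrier by metis+

lemma vertex_emb_closed: "v \<in> verts \<Gamma> \<Longrightarrow> c \<in> carrier (Gv v) \<Longrightarrow> vertex_emb v c \<in> carrier G"
  unfolding vertex_emb_def by (rule marking_letter) simp

lemma stable_closed: "e \<in> Ep \<Longrightarrow> stable e \<in> carrier G"
  unfolding stable_def by (rule marking_letter) simp

lemma vertex_relator:
  assumes "v \<in> verts \<Gamma>" "g \<in> carrier (Gv v)" "h \<in> carrier (Gv v)"
  shows "vertex_emb v (g \<otimes>\<^bsub>Gv v\<^esub> h) = vertex_emb v g \<otimes> vertex_emb v h"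
proof -
  let ?gh = "g \<otimes>\<^bsub>Gv v\<^esub> h"
  have gh: "?gh \<in> carrier (Gv v)" using vertex_group[OF assms(1)] assms(2,3) by (simp add: group.is_monoid monoid.m_closed)
  have r: "[(VGen v g, True), (VGen v h, True), (VGen v ?gh, False)] \<in> gog_relators \<Gamma> erev Gv Ge \<alpha> T Ep"
    using assms unfolding gog_relators_def by blast
  have "vertex_emb v g \<otimes> (vertex_emb v h \<otimes> inv (vertex_emb v ?gh)) = \<one>"
    using marking_relator[OF r] marking_Cons[of "VGen v g" "[(VGen v h, True), (VGen v ?gh, False)]" True]
      marking_Cons[of "VGen v h" "[(VGen v ?gh, False)]" True] marking_inv[of "VGen v ?gh"] assms gh
    by (simp add: vertex_emb_def)
  then have "(vertex_emb v g \<otimes> vertex_emb v h) \<otimes> inv (vertex_emb v ?gh) = \<one>"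
    using vertex_emb_closed assms gh by (simp add: m_assoc)
  then show ?thesis
    using inv_equality[of "vertex_emb v g \<otimes> vertex_emb v h" "inv (vertex_emb v ?gh)"] vertex_emb_closed assms gh by simp
qed

lemma edge_relator:
  assumes e: "e \<in> Ep" and a: "a \<in> carrier (Ge e)"
  shows "stable e \<otimes> vertex_emb (head \<Gamma> e) (\<alpha> (erev e) a) = vertex_emb (tail \<Gamma> e) (\<alpha> e a) \<otimes> stable e"
proof -
  have eA: "e \<in> arcs \<Gamma>" using e Ep_arcs by blast
  note V = head_in_verts[OF eA] tail_in_verts[OF eA] edge_closed[OF eA a]
  let ?w = "vertex_emb (head \<Gamma> e) (\<alpha> (erev e) a)" and ?u = "vertex_emb (tail \<Gamma> e) (\<alpha> e a)" and ?t = "stable e"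
  have r: "[(EGen e, True), (VGen (head \<Gamma> e) (\<alpha> (erev e) a), True), (EGen e, False), (VGen (tail \<Gamma> e) (\<alpha> e a), False)]
    \<in> gog_relators \<Gamma> erev Gv Ge \<alpha> T Ep"
    using e a unfolding gog_relators_def by blast
  have c: "?w \<in> carrier G" "?u \<in> carrier G" "?t \<in> carrier G" using vertex_emb_closed V stable_closed[OF e] by auto
  have "?t \<otimes> (?w \<otimes> (inv ?t \<otimes> inv ?u)) = \<one>"
    using marking_relator[OF r] e V marking_inv[of "EGen e"] marking_inv[of "VGen (tail \<Gamma> e) (\<alpha> e a)"]
      marking_Cons[of "EGen e" "[(VGen (head \<Gamma> e) (\<alpha> (erev e) a), True), (EGen e, False), (VGen (tail \<Gamma> e) (\<alpha> e a), False)]" True]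
      marking_Cons[of "VGen (head \<Gamma> e) (\<alpha> (erev e) a)" "[(EGen e, False), (VGen (tail \<Gamma> e) (\<alpha> e a), False)]" True]
      marking_Cons[of "EGen e" "[(VGen (tail \<Gamma> e) (\<alpha> e a), False)]" False]
    by (simp add: vertex_emb_def stable_def)
  then have "(?t \<otimes> ?w) \<otimes> inv (?u \<otimes> ?t) = \<one>" using c by (simp add: m_assoc inv_mult_group)
  then show ?thesis using inv_equality[of "?t \<otimes> ?w" "inv (?u \<otimes> ?t)"] c by simp
qed

lemma tree_relator: assumes "f \<in> arcs T" "f \<in> Ep" shows "stable f = \<one>"
proof -
  have "[(EGen f, True)] \<in> gog_relators \<Gamma> erev Gv Ge \<alpha> T Ep" using assms unfolding gog_relators_def by blast
  then show ?thesis using marking_relator[of "[(EGen f, True)]"] assms by (simp add: stable_def)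
qed

lemma vertex_emb_hom: "v \<in> verts \<Gamma> \<Longrightarrow> vertex_emb v \<in> hom (Gv v) G"
  using vertex_emb_closed vertex_relator by (intro homI) auto

lemma vertex_group_hom: "v \<in> verts \<Gamma> \<Longrightarrow> group_hom (Gv v) G (vertex_emb v)"
  using vertex_group vertex_emb_hom group_axioms by (simp add: group_hom_def group_hom_axioms_def)

lemma vgroup_subgroup: "v \<in> verts \<Gamma> \<Longrightarrow> subgroup (vgroup v) G"
  unfolding vgroup_def by (rule group_hom.img_is_subgroup[OF vertex_group_hom])

lemma egroup_subgroup: assumes e: "e \<in> arcs \<Gamma>" shows "subgroup (egroup e) G"
proof -
  have "(\<lambda>a. vertex_emb (tail \<Gamma> e) (\<alpha> e a)) \<in> hom (Ge e) G"
    using hom_mult[OF edge_hom(1)[OF e]] vertex_emb_closed[OF tail_in_verts[OF e] edge_closed(1)[OF e]]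
      vertex_relator[OF tail_in_verts[OF e] edge_closed(1)[OF e] edge_closed(1)[OF e]]
    by (intro homI) simp_all
  then have "group_hom (Ge e) G (\<lambda>a. vertex_emb (tail \<Gamma> e) (\<alpha> e a))"
    using edge_group[OF e] group_axioms by (simp add: group_hom_def group_hom_axioms_def)
  then show ?thesis unfolding egroup_def by (rule group_hom.img_is_subgroup)
qed

lemma egroup_src: "e \<in> arcs \<Gamma> \<Longrightarrow> egroup e \<subseteq> vgroup (tail \<Gamma> e)"
  unfolding egroup_def vgroup_def using edge_closed(1) by blast

lemma egroup_tgt:
  assumes e: "e \<in> Ep" and p: "p \<in> egroup e" shows "inv (stable e) \<otimes> p \<otimes> stable e \<in> vgroup (head \<Gamma> e)"
proof -
  have eA: "e \<in> arcs \<Gamma>" using e Ep_arcs by blast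
  obtain a where a: "a \<in> carrier (Ge e)" "p = vertex_emb (tail \<Gamma> e) (\<alpha> e a)" using p unfolding egroup_def by blast
  let ?w = "vertex_emb (head \<Gamma> e) (\<alpha> (erev e) a)"
  have c: "?w \<in> carrier G" "p \<in> carrier G" "stable e \<in> carrier G"
    using vertex_emb_closed head_in_verts[OF eA] tail_in_verts[OF eA] edge_closed[OF eA a(1)] stable_closed[OF e] a(2) by auto
  have "inv (stable e) \<otimes> p \<otimes> stable e = inv (stable e) \<otimes> (stable e \<otimes> ?w)"
    unfolding edge_relator[OF e a(1)] a(2)[symmetric] using c by (simp add: m_assoc)
  also have "\<dots> = ?w" using c by (simp add: m_assoc[symmetric])
  finally show ?thesis using edge_closed(2)[OF eA a(1)] unfolding vgroup_def by simp
qed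

lemma vertices_stables_generate:
  assumes H: "subgroup H G" "\<And>v. v \<in> verts \<Gamma> \<Longrightarrow> vgroup v \<subseteq> H" "\<And>e. e \<in> Ep \<Longrightarrow> stable e \<in> H"
  shows "H = carrier G"
proof (rule marking_generated[OF H(1)])
  fix x assume "x \<in> gog_generators \<Gamma> Gv Ep"
  then show "\<psi> [(x, True)] \<in> H"
    using H(2,3) by (cases x) (auto simp: vgroup_def vertex_emb_def stable_def)
qed

lemma tree: "subgraph T \<Gamma>" "serre_tree erev T" "verts T = verts \<Gamma>"
  using max_tree maximal_tree_spans[OF max_tree] unfolding maximal_tree_def pre_digraph.max_subgraph_def by auto

lemma tree_arcs:
  assumes "a \<in> arcs T" shows "a \<in> arcs \<Gamma>" "erev a \<in> arcs T" "a \<in> Ep \<or> erev a \<in> Ep"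
proof -
  show "a \<in> arcs \<Gamma>" "erev a \<in> arcs T" using subtree_facts[OF tree(1,2)] assms by blast+
  then show "a \<in> Ep \<or> erev a \<in> Ep" using oriented unfolding orientation_def by (metis UnE arev_arev imageE)
qed

lemma tree_connected:
  assumes "u \<in> verts \<Gamma>" "v \<in> verts \<Gamma>"
  shows "(u, v) \<in> ({(tail \<Gamma> e, head \<Gamma> e) | e. e \<in> Ep \<and> stable e = \<one>} \<union> {(head \<Gamma> e, tail \<Gamma> e) | e. e \<in> Ep \<and> stable e = \<one>})\<^sup>*"
    (is "_ \<in> ?R\<^sup>*")
proof -
  interpret T: wf_digraph T by (rule subtree_facts(1)[OF tree(1,2)])
  have "u \<rightarrow>\<^sup>*\<^bsub>T\<^esub> v" using subtree_reachable(2)[OF tree(1,2)] assms tree(3) by simp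
  then show ?thesis
  proof (induction rule: T.reachable_induct)
    case base
    show ?case by simp
  next
    case (step x y)
    obtain a where a: "a \<in> arcs T" "tail \<Gamma> a = x" "head \<Gamma> a = y"
      using step(2) subtree_facts(2,3)[OF tree(1,2)] by (auto simp: arcs_ends_conv)
    have "(x, y) \<in> ?R"
    proof (cases "a \<in> Ep")
      case True
      then show ?thesis using a tree_relator by blast
    next
      case False
      then have "erev a \<in> Ep" "erev a \<in> arcs T" using tree_arcs[OF a(1)] by blast+
      then show ?thesis using tree_relator arc_ends[OF tree_arcs(1)[OF a(1)]] a(2,3) by (intro UnI2) force
    qed
    then show ?case using step(3) by (meson rtrancl.rtrancl_into_rtrancl)
  qed
qed

text \<open>Reachability in the tree with the edge \<open>f\<close> removed, that is, lying in the
  same one of its two components.\<close>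

definition side :: "'e \<Rightarrow> ('v \<times> 'v) set" where
  "side f = {(tail \<Gamma> a, head \<Gamma> a) | a. a \<in> arcs T - {f, erev f}}\<^sup>*"

text \<open>
  The height of \<open>v\<close> over a tree edge \<open>f\<close> is \<open>1\<close> or \<open>0\<close>, according to the component of \<open>T - f\<close>
  that contains \<open>v\<close>.
\<close>

definition tree_pos :: "'v \<Rightarrow> ('a, 'v, 'e) index fsupp" where
  "tree_pos v = (\<Sum>f\<in>arcs T \<inter> Ep. of_bool ((head \<Gamma> f, v) \<in> side f) *\<^sub>R unit (EdgeI f (egroup f)))"

lemma finite_tree_edges: "finite (arcs T \<inter> Ep)"
  using finite_arcs Ep_arcs finite_subset by blast

lemma coord_tree_pos_int: "coord (tree_pos v) i \<in> \<int>"
  unfolding tree_pos_def coord_sum by (intro Ints_sum) (simp add: coord_unit)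

lemma coord_tree_pos_zero: "(\<And>f. f \<in> Ep \<Longrightarrow> i \<noteq> EdgeI f (egroup f)) \<Longrightarrow> coord (tree_pos v) i = 0"
  unfolding tree_pos_def coord_sum by (intro sum.neutral) (simp add: coord_unit)

text \<open>Crossing the tree edge \<open>f\<close> changes the component only of
  \<open>T - f\<close>; this is what makes the stable letters of tree edges act trivially.\<close>

lemma tree_pos_step:
  assumes f: "f \<in> arcs T" "f \<in> Ep"
  shows "tree_pos (head \<Gamma> f) = tree_pos (tail \<Gamma> f) + unit (EdgeI f (egroup f))"
proof -
  \<comment> \<open>For \<open>k\<close> different from \<open>f\<close> both directions of
    \<open>f\<close> survive in \<open>T - k\<close>, so the ends of \<open>f\<close> lie on the
    same side.\<close>
  have height: "of_bool ((head \<Gamma> k, head \<Gamma> f) \<in> side k) = of_bool ((head \<Gamma> k, tail \<Gamma> f) \<in> side k) + (if k = f then 1 else (0 :: real))"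
    if k: "k \<in> arcs T \<inter> Ep" for k
  proof (cases "k = f")
    case True
    have "(head \<Gamma> f, tail \<Gamma> f) \<notin> side f" unfolding side_def by (rule tree_edge_separates[OF tree(1,2) f(1)])
    moreover have "(head \<Gamma> f, head \<Gamma> f) \<in> side f" unfolding side_def by simp
    ultimately show ?thesis using True by simp
  next
    case False
    have fk: "f \<noteq> erev k" using Ep_rev k f by blast
    then have "erev f \<noteq> k" by auto
    moreover have "erev f \<noteq> erev k" using False by (simp add: arev_eq_iff)
    ultimately have rev: "erev f \<in> arcs T - {k, erev k}" using tree_arcs(2)[OF f(1)] by simp
    have "(tail \<Gamma> f, head \<Gamma> f) \<in> side k" unfolding side_def using f(1) False fk by (intro r_into_rtrancl) blast
    moreover have "(tail \<Gamma> (erev f), head \<Gamma> (erev f)) \<in> side k"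
      unfolding side_def using rev by (intro r_into_rtrancl) blast
    then have "(head \<Gamma> f, tail \<Gamma> f) \<in> side k" using arc_ends[OF tree_arcs(1)[OF f(1)]] by simp
    ultimately have "(head \<Gamma> k, head \<Gamma> f) \<in> side k \<longleftrightarrow> (head \<Gamma> k, tail \<Gamma> f) \<in> side k"
      unfolding side_def by (meson rtrancl_trans)
    then show ?thesis using False by simp
  qed
  have "tree_pos (head \<Gamma> f) = (\<Sum>k\<in>arcs T \<inter> Ep. of_bool ((head \<Gamma> k, tail \<Gamma> f) \<in> side k) *\<^sub>R unit (EdgeI k (egroup k))
      + (if k = f then unit (EdgeI f (egroup f)) else 0))"
    unfolding tree_pos_def
  proof (rule sum.cong[OF HOL.refl])
    fix k assume k: "k \<in> arcs T \<inter> Ep"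
    show "of_bool ((head \<Gamma> k, head \<Gamma> f) \<in> side k) *\<^sub>R unit (EdgeI k (egroup k)) =
      of_bool ((head \<Gamma> k, tail \<Gamma> f) \<in> side k) *\<^sub>R unit (EdgeI k (egroup k)) + (if k = f then unit (EdgeI f (egroup f)) else (0 :: ('a, 'v, 'e) index fsupp))"
      unfolding height[OF k] scaleR_add_left by simp
  qed
  then show ?thesis using f finite_tree_edges by (simp add: sum.distrib tree_pos_def sum.delta)
qed

text \<open>Solved from two demands: elements of a vertex group fix the position of their vertex,
  and a stable letter carries the position of the head to that of the tail, raised by 1 in the
  coordinate of its edge.\<close>

primrec displacement :: "('v, 'c, 'e) gog_gen \<Rightarrow> ('a, 'v, 'e) index fsupp" where
  "displacement (VGen v c) = tree_pos v - permute (vertex_emb v c) (tree_pos v)"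
| "displacement (EGen e) = tree_pos (tail \<Gamma> e) + unit (EdgeI e (egroup e)) - permute (stable e) (tree_pos (head \<Gamma> e))"

lemma permute_edge_unit:
  assumes e: "e \<in> arcs \<Gamma>" and p: "p \<in> egroup e"
  shows "permute p (unit (EdgeI e (egroup e))) = unit (EdgeI e (egroup e) :: ('a, 'v, 'e) index)"
proof -
  note H = egroup_subgroup[OF e]
  have pG: "p \<in> carrier G" by (rule subgroup.mem_carrier[OF H p])
  show ?thesis using translate_stabilizer(1)[OF H pG] p by (simp add: permute_unit pG)
qed

text \<open>Vertex relators hold because a vertex group acts linearly about the position of its
  vertex. The edge relators hold because the edge group fixes the unit vector of its own coset, and
  the tree relators by \<open>tree_pos_step\<close>.\<close>

lemma displacement_relators:
  assumes r: "r \<in> gog_relators \<Gamma> erev Gv Ge \<alpha> T Ep" and w: "r \<in> words (gog_generators \<Gamma> Gv Ep)"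
  shows "word_action (\<lambda>x y. permute (\<psi> [(x, True)]) y + displacement x) r = id"
proof -
  define \<beta> where "\<beta> x y = permute (\<psi> [(x, True)]) y + displacement x" for x y
  have bij: "bij (\<beta> x)" if "x \<in> gog_generators \<Gamma> Gv Ep" for x
    unfolding \<beta>_def[abs_def] by (rule bij_affine[OF marking_letter[OF that]])
  have inv: "\<beta> x \<circ> inv_into UNIV (\<beta> x) = id" if "x \<in> gog_generators \<Gamma> Gv Ep" for x
    using bij_is_surj[OF bij[OF that]] by (simp add: surj_iff)
  have V: "\<beta> (VGen v c) y = permute (vertex_emb v c) (y - tree_pos v) + tree_pos v" if "v \<in> verts \<Gamma>" "c \<in> carrier (Gv v)" for v c y
    using vertex_emb_closed[OF that] by (simp add: \<beta>_def vertex_emb_def permute_diff)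
  have S: "\<beta> (EGen e) y = permute (stable e) (y - tree_pos (head \<Gamma> e)) + tree_pos (tail \<Gamma> e) + unit (EdgeI e (egroup e))"
    if "e \<in> Ep" for e y
    using stable_closed[OF that] by (simp add: \<beta>_def stable_def permute_diff)
  consider (vertex) v g h where "v \<in> verts \<Gamma>" "g \<in> carrier (Gv v)" "h \<in> carrier (Gv v)"
      "r = [(VGen v g, True), (VGen v h, True), (VGen v (g \<otimes>\<^bsub>Gv v\<^esub> h), False)]"
    | (edge) e a where "e \<in> Ep" "a \<in> carrier (Ge e)"
      "r = [(EGen e, True), (VGen (head \<Gamma> e) (\<alpha> (erev e) a), True), (EGen e, False), (VGen (tail \<Gamma> e) (\<alpha> e a), False)]"
    | (tree) f where "f \<in> arcs T" "f \<in> Ep" "r = [(EGen f, True)]"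
    using r unfolding gog_relators_def by blast
  then have "word_action \<beta> r = id"
  proof cases
    case (vertex v g h)
    let ?gh = "g \<otimes>\<^bsub>Gv v\<^esub> h"
    have gh: "?gh \<in> carrier (Gv v)" using w vertex by simp
    note c = vertex_emb_closed[OF vertex(1)]
    have "\<beta> (VGen v g) \<circ> \<beta> (VGen v h) = \<beta> (VGen v ?gh)"
      using V[OF vertex(1)] vertex gh c by (simp add: fun_eq_iff vertex_relator permute_mult)
    then have "word_action \<beta> r = \<beta> (VGen v ?gh) \<circ> inv_into UNIV (\<beta> (VGen v ?gh))"
      unfolding vertex(4) by (simp add: comp_assoc[symmetric])
    then show ?thesis using inv[of "VGen v ?gh"] vertex gh by simp
  next
    case (edge e a)
    have eA: "e \<in> arcs \<Gamma>" using edge Ep_arcs by blast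
    note ends = head_in_verts[OF eA] tail_in_verts[OF eA]
    note \<alpha> = edge_closed[OF eA edge(2)]
    let ?w = "VGen (head \<Gamma> e) (\<alpha> (erev e) a)" and ?u = "VGen (tail \<Gamma> e) (\<alpha> e a)"
    let ?gw = "vertex_emb (head \<Gamma> e) (\<alpha> (erev e) a)" and ?gu = "vertex_emb (tail \<Gamma> e) (\<alpha> e a)"
    have c: "?gw \<in> carrier G" "?gu \<in> carrier G" "stable e \<in> carrier G"
      using vertex_emb_closed ends \<alpha> stable_closed[OF edge(1)] by auto
    have u: "permute ?gu (unit (EdgeI e (egroup e))) = unit (EdgeI e (egroup e) :: ('a, 'v, 'e) index)"
      by (rule permute_edge_unit[OF eA]) (use edge(2) in \<open>simp add: egroup_def\<close>)
    have comm: "permute (stable e) (permute ?gw z) = permute ?gu (permute (stable e) z)" for z :: "('a, 'v, 'e) index fsupp"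
      using edge_relator[OF edge(1,2)] permute_mult[OF c(3,1), of z] permute_mult[OF c(2,3), of z] by simp
    \<comment> \<open>The edge relation in the form \<open>t w = u t\<close>, which postpones
      inverses to the end.\<close>
    have eq: "\<beta> (EGen e) \<circ> \<beta> ?w = \<beta> ?u \<circ> \<beta> (EGen e)"
    proof
      fix y
      have "\<beta> (EGen e) (\<beta> ?w y) = permute (stable e) (permute ?gw (y - tree_pos (head \<Gamma> e))) + tree_pos (tail \<Gamma> e) + unit (EdgeI e (egroup e))"
        using V[OF ends(1) \<alpha>(2)] S[OF edge(1)] by simp
      also have "\<dots> = permute ?gu (permute (stable e) (y - tree_pos (head \<Gamma> e))) + permute ?gu (unit (EdgeI e (egroup e))) + tree_pos (tail \<Gamma> e)"
        unfolding comm u by simp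
      also have "\<dots> = \<beta> ?u (\<beta> (EGen e) y)"
        using V[OF ends(2) \<alpha>(1)] S[OF edge(1)] by (simp add: permute_add[OF c(2), symmetric])
      finally show "(\<beta> (EGen e) \<circ> \<beta> ?w) y = (\<beta> ?u \<circ> \<beta> (EGen e)) y" by simp
    qed
    have "word_action \<beta> r = (\<beta> (EGen e) \<circ> \<beta> ?w) \<circ> (inv_into UNIV (\<beta> (EGen e)) \<circ> inv_into UNIV (\<beta> ?u))"
      unfolding edge(3) by (simp add: comp_assoc)
    also have "\<dots> = \<beta> ?u \<circ> (\<beta> (EGen e) \<circ> inv_into UNIV (\<beta> (EGen e))) \<circ> inv_into UNIV (\<beta> ?u)"
      unfolding eq by (simp add: comp_assoc)
    finally show ?thesis using inv[of "EGen e"] inv[of ?u] edge(1) ends \<alpha> by simp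
  next
    case (tree f)
    have "\<beta> (EGen f) = id"
      using S[OF tree(2)] by (simp add: fun_eq_iff tree_relator[OF tree(1,2)] permute_one tree_pos_step[OF tree(1,2)])
    then show ?thesis unfolding tree(3) by simp
  qed
  then show ?thesis by (simp add: \<beta>_def[abs_def])
qed

definition edge_indices :: "('a, 'v, 'e) index set" where
  "edge_indices = {index_perm g (EdgeI e (egroup e)) | g e. g \<in> carrier G \<and> e \<in> Ep}"

lemma edge_displacement_cocycle:
  obtains \<delta> :: "'a \<Rightarrow> ('a, 'v, 'e) index fsupp"
  where "\<And>g h. g \<in> carrier G \<Longrightarrow> h \<in> carrier G \<Longrightarrow> \<delta> (g \<otimes> h) = permute g (\<delta> h) + \<delta> g"
    "\<And>v p. v \<in> verts \<Gamma> \<Longrightarrow> p \<in> vgroup v \<Longrightarrow> \<delta> p = tree_pos v - permute p (tree_pos v)"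
    "\<And>e. e \<in> Ep \<Longrightarrow> \<delta> (stable e) = tree_pos (tail \<Gamma> e) + unit (EdgeI e (egroup e)) - permute (stable e) (tree_pos (head \<Gamma> e))"
    "\<And>g i. g \<in> carrier G \<Longrightarrow> coord (\<delta> g) i \<in> \<int>"
    "\<And>g i. g \<in> carrier G \<Longrightarrow> i \<notin> edge_indices \<Longrightarrow> coord (\<delta> g) i = 0"
proof -
  \<comment> \<open>Integral vectors supported on the orbit of the edge coordinates; the
    displacements lie in \<open>Q\<close>, which is invariant.\<close>
  define Q where "Q = {x :: ('a, 'v, 'e) index fsupp. \<forall>i. coord x i \<in> \<int> \<and> (i \<notin> edge_indices \<longrightarrow> coord x i = 0)}"
  have perm: "index_perm g i \<in> edge_indices" if gi: "g \<in> carrier G" "i \<in> edge_indices" for g and i :: "('a, 'v, 'e) index"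
  proof -
    obtain h e where h: "h \<in> carrier G" "e \<in> Ep" "i = index_perm h (EdgeI e (egroup e))"
      using gi(2) unfolding edge_indices_def by blast
    have "index_perm g i = index_perm (g \<otimes> h) (EdgeI e (egroup e))" unfolding h(3) by (rule \<pi>_mult[OF gi(1) h(1), symmetric])
    then show ?thesis using gi(1) h unfolding edge_indices_def by blast
  qed
  have base: "EdgeI e (egroup e) \<in> edge_indices" if "e \<in> Ep" for e
    using that \<pi>_one[of "EdgeI e (egroup e)"] unfolding edge_indices_def by force
  have Q0: "0 \<in> Q" by (simp add: Q_def)
  have Qadd: "x + y \<in> Q" if "x \<in> Q" "y \<in> Q" for x y using that by (simp add: Q_def)
  have Qneg: "- x \<in> Q" if "x \<in> Q" for x using that by (simp add: Q_def)
  have Qperm: "permute g x \<in> Q" if g: "g \<in> carrier G" and x: "x \<in> Q" for g x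
  proof -
    have "index_perm (inv g) i \<notin> edge_indices" if "i \<notin> edge_indices" for i :: "('a, 'v, 'e) index"
      using perm[OF g, of "index_perm (inv g) i"] that \<pi>_inv(2)[OF g, of i] by auto
    then show ?thesis using x by (simp add: Q_def coord_permute[OF g])
  qed
  have Qtree: "tree_pos v \<in> Q" for v
  proof -
    have "coord (tree_pos v) i = 0" if i: "i \<notin> edge_indices" for i
    proof (rule coord_tree_pos_zero)
      show "i \<noteq> EdgeI f (egroup f)" if "f \<in> Ep" for f using base[OF that] i by auto
    qed
    then show ?thesis by (simp add: Q_def coord_tree_pos_int)
  qed
  have Qunit: "unit (EdgeI e (egroup e)) \<in> Q" if "e \<in> Ep" for e
    using base[OF that] by (auto simp: Q_def coord_unit)
  have Qdiff: "x - permute g y \<in> Q" if "g \<in> carrier G" "x \<in> Q" "y \<in> Q" for g x y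
    using Qadd[OF that(2) Qneg[OF Qperm[OF that(1,3)]]] by simp
  have Qc: "displacement x \<in> Q" if x: "x \<in> gog_generators \<Gamma> Gv Ep" for x
  proof (cases x)
    case (VGen v c)
    then show ?thesis using Qdiff[OF vertex_emb_closed Qtree Qtree] x by simp
  next
    case (EGen e)
    then show ?thesis using Qdiff[OF stable_closed Qadd[OF Qtree Qunit] Qtree] x by simp
  qed
  show thesis
  proof (rule cocycle_from_presentation[OF marked_group_axioms displacement_relators Q0 Qadd Qneg Qperm Qc])
    fix \<delta> assume \<delta>: "\<And>g h. g \<in> carrier G \<Longrightarrow> h \<in> carrier G \<Longrightarrow> \<delta> (g \<otimes> h) = permute g (\<delta> h) + \<delta> g"
      "\<And>x. x \<in> gog_generators \<Gamma> Gv Ep \<Longrightarrow> \<delta> (\<psi> [(x, True)]) = displacement x" "\<And>g. g \<in> carrier G \<Longrightarrow> \<delta> g \<in> Q"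
    show thesis
  proof (rule that[OF \<delta>(1)])
    fix v p assume v: "v \<in> verts \<Gamma>" and "p \<in> vgroup v"
    then obtain c where c: "c \<in> carrier (Gv v)" "p = vertex_emb v c" unfolding vgroup_def by blast
    show "\<delta> p = tree_pos v - permute p (tree_pos v)" using \<delta>(2)[of "VGen v c"] v c by (simp add: vertex_emb_def)
  next
    fix e assume "e \<in> Ep"
    then show "\<delta> (stable e) = tree_pos (tail \<Gamma> e) + unit (EdgeI e (egroup e)) - permute (stable e) (tree_pos (head \<Gamma> e))"
      using \<delta>(2)[of "EGen e"] by (simp add: stable_def)
  next
    fix g and i :: "('a, 'v, 'e) index" assume "g \<in> carrier G"
    then have "\<delta> g \<in> Q" by (rule \<delta>(3))
    then show "coord (\<delta> g) i \<in> \<int>" "i \<notin> edge_indices \<Longrightarrow> coord (\<delta> g) i = 0" by (simp_all add: Q_def)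
  qed
  qed
qed

text \<open>The affine action is the sum of two cocycles on disjoint sets of coordinates: the edge
  cocycle moves along the tree, the character cocycle within the flats.\<close>

theorem geometric_action_of_characters:
  assumes \<Phi>: "finite \<Phi>" "\<And>\<kappa>. \<kappa> \<in> \<Phi> \<Longrightarrow> virtual_character G \<kappa>"
    and sep: "\<And>v. v \<in> verts \<Gamma> \<Longrightarrow> finite (joint_kernel \<Phi> (vgroup v))"
    and count: "countable (carrier G)"
  shows "\<exists>(Y :: (nat \<Rightarrow> real) metric) \<phi>. CAT0_space Y \<and> mcomplete_of Y \<and>
    isometric_action G Y \<phi> \<and> proper_action G Y \<phi> \<and> cocompact_action G Y \<phi>"
proof (rule edge_displacement_cocycle)
  fix \<eta> :: "'a \<Rightarrow> ('a, 'v, 'e) index fsupp"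
  assume \<eta>_mult: "\<And>g h. g \<in> carrier G \<Longrightarrow> h \<in> carrier G \<Longrightarrow> \<eta> (g \<otimes> h) = permute g (\<eta> h) + \<eta> g"
    and \<eta>_vertex: "\<And>v p. v \<in> verts \<Gamma> \<Longrightarrow> p \<in> vgroup v \<Longrightarrow> \<eta> p = tree_pos v - permute p (tree_pos v)"
    and \<eta>_stable: "\<And>e. e \<in> Ep \<Longrightarrow> \<eta> (stable e) = tree_pos (tail \<Gamma> e) + unit (EdgeI e (egroup e)) - permute (stable e) (tree_pos (head \<Gamma> e))"
    and \<eta>_int: "\<And>g i. g \<in> carrier G \<Longrightarrow> coord (\<eta> g) i \<in> \<int>"
    and \<eta>_zero: "\<And>g i. g \<in> carrier G \<Longrightarrow> i \<notin> edge_indices \<Longrightarrow> coord (\<eta> g) i = 0"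
  define J where "J = (char_indices \<Phi> :: ('a, 'v, 'e) index set)"
  define \<delta> where "\<delta> g = \<eta> g + char_vec \<Phi> g" for g
  \<comment> \<open>The extra unit vector marks the coset of the vertex group, so that the
    stabilizer outside \<open>J\<close> is exactly that group.\<close>
  define pos where "pos v = tree_pos v + (unit (VertI v (vgroup v)) :: ('a, 'v, 'e) index fsupp)" for v
  have edge_only: "i \<notin> edge_indices" if "\<And>e C. i \<noteq> EdgeI e C" for i :: "('a, 'v, 'e) index"
    using that unfolding edge_indices_def by auto
  have off_J: "coord (char_vec \<Phi> g) i = 0" if "i \<notin> J" for g and i :: "('a, 'v, 'e) index"
    using that by (simp add: J_def coord_char_vec[OF \<Phi>])
  have J_no: "EdgeI e C \<notin> J" "VertI v C \<notin> J" for e v C by (simp_all add: J_def)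
  have J_edge: "j \<notin> edge_indices" if "j \<in> J" for j
    by (rule edge_only) (use that J_no in auto)
  have fix_vertex: "permute p (pos v) + \<delta> p = pos v + char_vec \<Phi> p" if v: "v \<in> verts \<Gamma>" and p: "p \<in> vgroup v" for v p
  proof -
    note H = vgroup_subgroup[OF v]
    have pG: "p \<in> carrier G" by (rule subgroup.mem_carrier[OF H p])
    have "permute p (unit (VertI v (vgroup v))) = (unit (VertI v (vgroup v)) :: ('a, 'v, 'e) index fsupp)"
      using translate_stabilizer(1)[OF H pG] p by (simp add: permute_unit pG)
    then show ?thesis using \<eta>_vertex[OF v p] by (simp add: pos_def \<delta>_def permute_add[OF pG])
  qed
  have move_stable: "permute (stable e) (pos (head \<Gamma> e)) + \<delta> (stable e) = tree_pos (tail \<Gamma> e) + unit (EdgeI e (egroup e))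
      + unit (VertI (head \<Gamma> e) (translate (stable e) (vgroup (head \<Gamma> e)))) + char_vec \<Phi> (stable e)" if e: "e \<in> Ep" for e
    using \<eta>_stable[OF e] by (simp add: pos_def \<delta>_def permute_add permute_unit stable_closed[OF e])
  interpret S: tree_splitting G "index_perm :: 'a \<Rightarrow> ('a, 'v, 'e) index \<Rightarrow> ('a, 'v, 'e) index" \<delta> J "verts \<Gamma>" Ep
    "tail \<Gamma>" "head \<Gamma>" vgroup egroup stable pos "\<lambda>e. EdgeI e (egroup e)"
  proof (intro tree_splitting.intro tree_splitting_axioms.intro group_axioms)
    show "index_perm \<one> i = i" for i :: "('a, 'v, 'e) index" by (rule \<pi>_one)
    show "index_perm (g \<otimes> h) i = index_perm g (index_perm h i)" if "g \<in> carrier G" "h \<in> carrier G"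
      for g h and i :: "('a, 'v, 'e) index" by (rule \<pi>_mult[OF that])
    show "index_perm g i \<in> J \<longleftrightarrow> i \<in> J" if "g \<in> carrier G" for g and i :: "('a, 'v, 'e) index"
      unfolding J_def by (rule index_perm_char_indices[OF \<Phi> that])
    show "finite J" unfolding J_def by (rule finite_char_indices[OF \<Phi>])
    show "\<delta> (g \<otimes> h) = reindex (index_perm (inv g)) (\<delta> h) + \<delta> g" if "g \<in> carrier G" "h \<in> carrier G" for g h
      using \<eta>_mult[OF that] char_vec_mult[OF \<Phi> that] permute_add[OF that(1), of "\<eta> h" "char_vec \<Phi> h"]
      by (simp add: \<delta>_def permute_def)
    show "coord (\<delta> g) i \<in> \<int>" if "g \<in> carrier G" for g i
      unfolding \<delta>_def coord_add by (rule Ints_add[OF \<eta>_int[OF that] coord_char_vec_int[OF \<Phi>]])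
    show "coord (pos v) i \<in> \<int>" for v i
      unfolding pos_def coord_add by (rule Ints_add[OF coord_tree_pos_int]) (simp add: coord_unit)
    show "finite (verts \<Gamma>)" by (rule finite_verts)
    show "verts \<Gamma> \<noteq> {}" using subtree_reachable(1)[OF tree(1,2)] tree(3) by simp
    show "finite Ep" using finite_arcs Ep_arcs finite_subset by blast
    show "tail \<Gamma> e \<in> verts \<Gamma>" "head \<Gamma> e \<in> verts \<Gamma>" "subgroup (egroup e) G" "egroup e \<subseteq> vgroup (tail \<Gamma> e)"
      "stable e \<in> carrier G" "EdgeI e (egroup e) \<notin> J" if "e \<in> Ep" for e
      using that Ep_arcs egroup_subgroup egroup_src stable_closed J_no by auto
    show "subgroup (vgroup v) G" if "v \<in> verts \<Gamma>" for v by (rule vgroup_subgroup[OF that])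
    show "inv (stable e) \<otimes> p \<otimes> stable e \<in> vgroup (head \<Gamma> e)" if "e \<in> Ep" "p \<in> egroup e" for e p
      by (rule egroup_tgt[OF that])
    show "H = carrier G" if "subgroup H G" "\<And>v. v \<in> verts \<Gamma> \<Longrightarrow> vgroup v \<subseteq> H" "\<And>e. e \<in> Ep \<Longrightarrow> stable e \<in> H" for H
      using that by (rule vertices_stables_generate)
    show "(u, v) \<in> ({(tail \<Gamma> e, head \<Gamma> e) | e. e \<in> Ep \<and> stable e = \<one>} \<union> {(head \<Gamma> e, tail \<Gamma> e) | e. e \<in> Ep \<and> stable e = \<one>})\<^sup>*"
      if "u \<in> verts \<Gamma>" "v \<in> verts \<Gamma>" for u v by (rule tree_connected[OF that])
    show "(\<forall>i. i \<notin> J \<longrightarrow> coord (reindex (index_perm (inv g)) (pos v) + \<delta> g) i = coord (pos v) i) \<longleftrightarrow> g \<in> vgroup v"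
      if v: "v \<in> verts \<Gamma>" and g: "g \<in> carrier G" for v g
    proof
      assume eq: "\<forall>i. i \<notin> J \<longrightarrow> coord (reindex (index_perm (inv g)) (pos v) + \<delta> g) i = coord (pos v) i"
      \<comment> \<open>Neither cocycle has a component at vertex coordinates, so \<open>g\<close>
        has to permute this coordinate to itself.\<close>
      let ?i = "VertI v (vgroup v) :: ('a, 'v, 'e) index"
      have z: "coord (tree_pos w) (VertI u C) = 0" for w u C by (rule coord_tree_pos_zero) simp
      have "coord (permute g (pos v) + \<delta> g) ?i = coord (pos v) ?i" using eq J_no(2) unfolding permute_def by blast
      then have "coord (pos v) (index_perm (inv g) ?i) + (coord (\<eta> g) ?i + coord (char_vec \<Phi> g) ?i) = coord (pos v) ?i"
        unfolding coord_add \<delta>_def coord_permute[OF g] .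
      then have "coord (unit ?i) (VertI v (translate (inv g) (vgroup v)) :: ('a, 'v, 'e) index) = 1"
        using \<eta>_zero[OF g edge_only[of ?i]] off_J[OF J_no(2)] z by (simp add: pos_def coord_unit)
      then have "translate (inv g) (vgroup v) = vgroup v" by (simp add: coord_unit split: if_splits)
      then have "inv g \<in> vgroup v" using translate_stabilizer(1)[OF vgroup_subgroup[OF v] inv_closed[OF g]] by simp
      then show "g \<in> vgroup v" using subgroup.m_inv_closed[OF vgroup_subgroup[OF v], of "inv g"] g by simp
    next
      assume "g \<in> vgroup v"
      then show "\<forall>i. i \<notin> J \<longrightarrow> coord (reindex (index_perm (inv g)) (pos v) + \<delta> g) i = coord (pos v) i"
        unfolding permute_def[symmetric] fix_vertex[OF v \<open>g \<in> vgroup v\<close>] using off_J by simp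
    qed
    show "coord (reindex (index_perm (inv (stable e))) (pos (head \<Gamma> e)) + \<delta> (stable e)) (EdgeI e (egroup e))
        = coord (pos (tail \<Gamma> e)) (EdgeI e (egroup e)) + 1" if "e \<in> Ep" for e
      unfolding permute_def[symmetric] move_stable[OF that] by (simp add: off_J J_no coord_unit pos_def)
    show "coord (reindex (index_perm (inv (stable e))) (pos (head \<Gamma> e)) + \<delta> (stable e)) (index_perm g (EdgeI e' (egroup e')))
        = coord (pos (tail \<Gamma> e)) (index_perm g (EdgeI e' (egroup e')))"
      if "e \<in> Ep" "e' \<in> Ep" "g \<in> carrier G" "index_perm g (EdgeI e' (egroup e')) \<noteq> EdgeI e (egroup e)" for e e' g
      unfolding permute_def[symmetric] move_stable[OF that(1)] using that(4) by (auto simp: off_J J_no coord_unit pos_def)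
    show "index_perm g (EdgeI e (egroup e)) = EdgeI e' (egroup e') \<longleftrightarrow> e = e' \<and> g \<in> egroup e"
      if "e \<in> Ep" "e' \<in> Ep" "g \<in> carrier G" for e e' g
      using translate_stabilizer(1)[OF egroup_subgroup that(3), of e] that(1) Ep_arcs by auto
    show "finite {g \<in> vgroup v. \<forall>j\<in>J. index_perm g j = j \<and> coord (\<delta> g) j = 0}" if v: "v \<in> verts \<Gamma>" for v
    proof (rule finite_subset[OF _ sep[OF v]], rule subsetI)
      fix g assume g: "g \<in> {g \<in> vgroup v. \<forall>j\<in>J. index_perm g j = j \<and> coord (\<delta> g) j = 0}"
      then have gG: "g \<in> carrier G" using subgroup.mem_carrier[OF vgroup_subgroup[OF v]] by blast
      have "index_perm g j = j \<and> coord (char_vec \<Phi> g) j = 0" if "j \<in> char_indices \<Phi>" for j :: "('a, 'v, 'e) index"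
        using g that \<eta>_zero[OF gG J_edge] by (auto simp: J_def \<delta>_def)
      then have "\<forall>\<kappa>\<in>\<Phi>. g \<in> fst \<kappa> \<and> snd \<kappa> g = 0" using char_vec_kernel[OF \<Phi> gG] by blast
      then show "g \<in> joint_kernel \<Phi> (vgroup v)" using g by (simp add: joint_kernel_def)
    qed
  qed
  \<comment> \<open>All coordinates that can be nonzero on a piece; countable because
    \<open>G\<close> is and the graph is finite.\<close>
  define I where "I = edge_indices \<union> J \<union> {index_perm g (VertI v (vgroup v)) | g v. g \<in> carrier G \<and> v \<in> verts \<Gamma>}"
  have "edge_indices = (\<lambda>(g, e). index_perm g (EdgeI e (egroup e))) ` (carrier G \<times> Ep)"
    by (auto simp: edge_indices_def)
  then have "countable edge_indices" using count S.E(1) by (simp add: countable_finite)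
  moreover have "{index_perm g (VertI v (vgroup v)) | g v. g \<in> carrier G \<and> v \<in> verts \<Gamma>}
      = (\<lambda>(g, v). index_perm g (VertI v (vgroup v)) :: ('a, 'v, 'e) index) ` (carrier G \<times> verts \<Gamma>)" by auto
  then have "countable {index_perm g (VertI v (vgroup v)) :: ('a, 'v, 'e) index | g v. g \<in> carrier G \<and> v \<in> verts \<Gamma>}"
    using count S.V(1) by (simp add: countable_finite)
  ultimately have I: "countable I" using S.finite_J by (simp add: I_def countable_finite)
  have "coord (S.act g (pos v)) i = 0" if v: "v \<in> verts \<Gamma>" and g: "g \<in> carrier G" and i: "i \<notin> I" for v g i
  proof -
    have iE: "i \<notin> edge_indices" and iJ: "i \<notin> J" using i by (auto simp: I_def)
    have "index_perm (inv g) i \<noteq> EdgeI e (egroup e)" if "e \<in> Ep" for e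
      using S.\<pi>_inv(2)[OF g, of i] iE g that unfolding edge_indices_def by (metis (mono_tags, lifting) mem_Collect_eq)
    then have "coord (tree_pos v) (index_perm (inv g) i) = 0" by (rule coord_tree_pos_zero)
    moreover have "index_perm (inv g) i \<noteq> VertI v (vgroup v)"
      using S.\<pi>_inv(2)[OF g, of i] i g v unfolding I_def by (metis (mono_tags, lifting) UnCI mem_Collect_eq)
    ultimately show ?thesis using \<eta>_zero[OF g iE] off_J[OF iJ]
      by (simp add: S.coord_act[OF g] pos_def \<delta>_def coord_unit)
  qed
  then show ?thesis by (rule S.geometric_action[OF S.inj_on_sequences[OF I]])
qed

text \<open>Generators, an abelian subgroup and its finitely many coset representatives are all
  carried to the image in \<open>G\<close>, where the characters live.\<close>

lemma vgroup_almost_separated: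
  assumes v: "v \<in> verts \<Gamma>" and fg: "finitely_generated_group (Gv v)" and va: "virtually_abelian (Gv v)"
    and vrc: "property_VRC G"
  shows "\<exists>S. finite S \<and> S \<subseteq> carrier G \<and> vgroup v = generate G S" "almost_separated G (vgroup v)"
proof -
  interpret h: group_hom "Gv v" G "vertex_emb v" by (rule vertex_group_hom[OF v])
  obtain S where S: "finite S" "S \<subseteq> carrier (Gv v)" "generate (Gv v) S = carrier (Gv v)"
    using fg unfolding finitely_generated_group_def by blast
  let ?S = "vertex_emb v ` S"
  have gen: "vgroup v = generate G ?S" unfolding vgroup_def using h.generate_img[OF S(2)] S(3) by simp
  have fS: "finite ?S" "?S \<subseteq> carrier G" using S(1,2) by auto
  then show "\<exists>S. finite S \<and> S \<subseteq> carrier G \<and> vgroup v = generate G S" using gen by blast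
  obtain A where A: "subgroup A (Gv v)" "finite (rcosets\<^bsub>Gv v\<^esub> A)" and comm: "comm_group (Gv v\<lparr>carrier := A\<rparr>)"
    using va unfolding virtually_abelian_def finite_index_def by blast
  note AG = subgroup.mem_carrier[OF A(1)]
  define F where "F = (\<lambda>C. SOME x. x \<in> C) ` (rcosets\<^bsub>Gv v\<^esub> A)"
  have rep: "(SOME x. x \<in> C) \<in> carrier (Gv v)" "C = A #>\<^bsub>Gv v\<^esub> (SOME x. x \<in> C)" if "C \<in> rcosets\<^bsub>Gv v\<^esub> A" for C
    using h.G.rcoset_rep[OF A(1) that] by blast+
  have "almost_separated G (generate G ?S)"
  proof (rule almost_separated_virtually_abelian[OF vrc fS])
    show "subgroup (vertex_emb v ` A) G" by (rule h.subgroup_img_is_subgroup[OF A(1)])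
    show "vertex_emb v ` A \<subseteq> generate G ?S" unfolding gen[symmetric] vgroup_def using AG by blast
    show "x \<otimes> y = y \<otimes> x" if xy: "x \<in> vertex_emb v ` A" "y \<in> vertex_emb v ` A" for x y
    proof -
      obtain a b where ab: "a \<in> A" "b \<in> A" "x = vertex_emb v a" "y = vertex_emb v b" using xy by blast
      have "a \<otimes>\<^bsub>Gv v\<^esub> b = b \<otimes>\<^bsub>Gv v\<^esub> a"
        using comm_monoid.m_comm[OF comm_group.axioms(1)[OF comm], of a b] ab(1,2) by simp
      then show ?thesis using vertex_relator[OF v AG AG] ab by metis
    qed
    show "finite (vertex_emb v ` F)" using A(2) by (simp add: F_def)
    show "vertex_emb v ` F \<subseteq> generate G ?S" unfolding gen[symmetric] vgroup_def F_def using rep(1) by blast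
    show "generate G ?S \<subseteq> (\<Union>t\<in>vertex_emb v ` F. vertex_emb v ` A #> t)"
    proof
      fix x assume "x \<in> generate G ?S"
      then obtain c where c: "c \<in> carrier (Gv v)" "x = vertex_emb v c" unfolding gen[symmetric] vgroup_def by blast
      let ?C = "A #>\<^bsub>Gv v\<^esub> c"
      have C: "?C \<in> rcosets\<^bsub>Gv v\<^esub> A" unfolding RCOSETS_def using c(1) by blast
      define t where "t = (SOME x. x \<in> ?C)"
      have "c \<in> ?C" by (rule h.G.rcos_self[OF c(1) A(1)])
      then have "c \<in> A #>\<^bsub>Gv v\<^esub> t" using rep(2)[OF C] unfolding t_def by simp
      then obtain a where a: "a \<in> A" "c = a \<otimes>\<^bsub>Gv v\<^esub> t" unfolding r_coset_def by blast
      have "t \<in> carrier (Gv v)" "t \<in> F" using rep(1)[OF C] C unfolding t_def F_def by blast+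
      then have "x = vertex_emb v a \<otimes> vertex_emb v t" "vertex_emb v t \<in> vertex_emb v ` F"
        unfolding c(2) a(2) using vertex_relator[OF v AG[OF a(1)]] by blast+
      then show "x \<in> (\<Union>t\<in>vertex_emb v ` F. vertex_emb v ` A #> t)" using a(1) unfolding r_coset_def by blast
    qed
  qed
  then show "almost_separated G (vgroup v)" using gen by simp
qed

text \<open>More characters only shrink the joint kernels, so the union over the finitely many
  vertices serves all vertex groups at once.\<close>

theorem geometric_action_VRC:
  assumes fg: "\<And>v. v \<in> verts \<Gamma> \<Longrightarrow> finitely_generated_group (Gv v)"
    and va: "\<And>v. v \<in> verts \<Gamma> \<Longrightarrow> virtually_abelian (Gv v)" and vrc: "property_VRC G"
  shows "\<exists>(Y :: (nat \<Rightarrow> real) metric) \<phi>. CAT0_space Y \<and> mcomplete_of Y \<and>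
    isometric_action G Y \<phi> \<and> proper_action G Y \<phi> \<and> cocompact_action G Y \<phi>"
proof -
  note vg = vgroup_almost_separated[OF _ fg va vrc]
  obtain S where S: "\<And>v. v \<in> verts \<Gamma> \<Longrightarrow> finite (S v) \<and> S v \<subseteq> carrier G \<and> vgroup v = generate G (S v)"
    using vg(1) by metis
  obtain \<Phi> where \<Phi>: "\<And>v. v \<in> verts \<Gamma> \<Longrightarrow> finite (\<Phi> v) \<and> (\<forall>\<kappa>\<in>\<Phi> v. virtual_character G \<kappa>) \<and> finite (joint_kernel (\<Phi> v) (vgroup v))"
    using vg(2) unfolding almost_separated_def by metis
  let ?S = "(\<Union>v\<in>verts \<Gamma>. S v) \<union> stable ` Ep"
  have fin: "finite Ep" using finite_arcs Ep_arcs finite_subset by blast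
  have SG: "?S \<subseteq> carrier G" using S stable_closed by blast
  have "generate G ?S = carrier G"
  proof (rule vertices_stables_generate[OF generate_is_subgroup[OF SG]])
    show "vgroup v \<subseteq> generate G ?S" if "v \<in> verts \<Gamma>" for v
      using S[OF that] mono_generate[of "S v" ?S] that by blast
    show "stable e \<in> generate G ?S" if "e \<in> Ep" for e using that by (intro generate.incl) blast
  qed
  moreover have "countable ?S" using S fin finite_verts by (intro countable_finite) auto
  ultimately have count: "countable (carrier G)" using countable_generate[OF _ SG] by simp
  show ?thesis
  proof (rule geometric_action_of_characters[OF _ _ _ count])
    show "finite (\<Union>v\<in>verts \<Gamma>. \<Phi> v)" using \<Phi> finite_verts by auto
    show "virtual_character G \<kappa>" if "\<kappa> \<in> (\<Union>v\<in>verts \<Gamma>. \<Phi> v)" for \<kappa> using \<Phi> that by blast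
    show "finite (joint_kernel (\<Union>v\<in>verts \<Gamma>. \<Phi> v) (vgroup v))" if v: "v \<in> verts \<Gamma>" for v
    proof (rule finite_subset)
      show "joint_kernel (\<Union>v\<in>verts \<Gamma>. \<Phi> v) (vgroup v) \<subseteq> joint_kernel (\<Phi> v) (vgroup v)"
        using v unfolding joint_kernel_def by blast
      show "finite (joint_kernel (\<Phi> v) (vgroup v))" using \<Phi>[OF v] by blast
    qed
  qed
qed

end

theorem proposition1p9:
  fixes G :: "('a, 'm) monoid_scheme"
    and \<Gamma> T :: "('v, 'e) pre_digraph"
    and erev :: "'e \<Rightarrow> 'e"
    and Gv :: "'v \<Rightarrow> 'c monoid"
    and Ge :: "'e \<Rightarrow> 'd monoid"
    and \<alpha> :: "'e \<Rightarrow> 'd \<Rightarrow> 'c"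
    and Ep :: "'e set"
  assumes "group G"
    and "finite_graph_of_groups \<Gamma> erev Gv Ge \<alpha>"
    and "maximal_tree \<Gamma> erev T"
    and "orientation \<Gamma> erev Ep"
    and "G \<cong> fundamental_group \<Gamma> erev Gv Ge \<alpha> T Ep"
    and "\<And>v. v \<in> verts \<Gamma> \<Longrightarrow> finitely_generated_group (Gv v)"
    and "\<And>v. v \<in> verts \<Gamma> \<Longrightarrow> virtually_abelian (Gv v)"
    and "property_VRC G"
  shows "\<exists>(X :: (nat \<Rightarrow> real) metric) \<phi>. CAT0_space X \<and> mcomplete_of X \<and>
           isometric_action G X \<phi> \<and> proper_action G X \<phi> \<and> cocompact_action G X \<phi>"
proof (rule presented_group_marking[OF assms(1) assms(5)[unfolded fundamental_group_def]])
  fix \<psi> assume \<psi>: "\<And>w. w \<in> words (gog_generators \<Gamma> Gv Ep) \<Longrightarrow> \<psi> w \<in> carrier G"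
    "\<And>u v. u \<in> words (gog_generators \<Gamma> Gv Ep) \<Longrightarrow> v \<in> words (gog_generators \<Gamma> Gv Ep) \<Longrightarrow> \<psi> (u @ v) = \<psi> u \<otimes>\<^bsub>G\<^esub> \<psi> v"
    "\<And>g. g \<in> carrier G \<Longrightarrow> \<exists>w\<in>words (gog_generators \<Gamma> Gv Ep). \<psi> w = g"
    "\<And>u v. u \<in> words (gog_generators \<Gamma> Gv Ep) \<Longrightarrow> v \<in> words (gog_generators \<Gamma> Gv Ep) \<Longrightarrow>
      \<psi> u = \<psi> v \<longleftrightarrow> pres_eq (gog_generators \<Gamma> Gv Ep) (gog_relators \<Gamma> erev Gv Ge \<alpha> T Ep) u v"
  have "marked_group G (gog_generators \<Gamma> Gv Ep) (gog_relators \<Gamma> erev Gv Ge \<alpha> T Ep) \<psi>"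
    using assms(1) \<psi> by (intro marked_group.intro marked_group_axioms.intro)
  then interpret marked_graph_of_groups G \<Gamma> erev Gv Ge \<alpha> T Ep \<psi>
    using assms(2,3,4) by (intro marked_graph_of_groups.intro marked_graph_of_groups_axioms.intro)
  show ?thesis by (rule geometric_action_VRC[OF assms(6-8)])
qed

end
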